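(* Let $(\mathscr E,t)=\{t_k\}_{k\in\mathbb Z}$ be an $\mathcal A$-Hilbert complex. The following statements are equivalent: (i) The complex $(\mathscr E,t)$ has weak Hodge decomposition. (ii) For every $k\in\mathbb Z$, the differential map $t_k$ is polar decomposable. (iii) For every $k\in\mathbb Z$, the $k$-th Laplace operator $\Delta_k^{(\mathscr E,t)}$ is polar decomposable. If $(\mathscr E,t)$ has finite length, the statements (i), (ii) and (iii) are furthermore equivalent to: (iv) The even Dirac operator $\mathcal D^+_t$ is polar decomposable.
   Context: $\mathcal A$ is a fixed complex C*-algebra. Hilbert $\mathcal A$-modules are right Hilbert C*-modules over $\mathcal A$; $\oplus$ is the orthogonal direct sum; $\mathcal L_{\mathcal A}(\mathscr E,\mathscr F)$ is the space of adjointable operators. A densely defined $\mathcal A$-linear operator $t\colon \mathrm{dom}(t)\subset \mathscr E\to\mathscr F$ is semi-regular if its adjoint $t^*$ is densely defined; a semi-regular $t$ is regular if it is closed and $1+t^*t$ has dense range. $\mathcal R_{\mathcal A}(\mathscr E,\mathscr F)$ denotes the set of regular operators. An $\mathcal A$-Hilbert complex $(\mathscr E,t)$ is a sequence of regular operators $t_k\in\mathcal R_{\mathcal A}(\mathscr E_k,\mathscr E_{k+1})$, $k\in\mathbb Z$ (its differential maps), between Hilbert $\mathcal A$-modules, with $\mathrm{ran}(t_k)\subset\ker(t_{k+1})$ for all $k$. It has finite length if $\mathscr E_k=0$ for $|k|$ large; it is then indexed so that $\mathscr E_k=0$ unless $0\le k\le N+1$, written $\{t_k\}_{k=0}^N$,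 and $t_k=0$ (everywhere defined) for $k<0$ or $k>N$. The complex has weak Hodge decomposition if for all $k\in\mathbb Z$, $\mathscr E_k=(\ker t_k\cap\ker t_{k-1}^* )\oplus\overline{\mathrm{ran}(t_k^* )}\oplus\overline{\mathrm{ran}(t_{k-1})}$. An adjointable $T\in\mathcal L_{\mathcal A}(\mathscr E,\mathscr F)$ is polar decomposable if $T=V|T|$ for a partial isometry $V\in\mathcal L_{\mathcal A}(\mathscr E,\mathscr F)$ with $\ker V=\ker T$, $\ker V^*=\ker T^*$, $\mathrm{ran}(V)=\overline{\mathrm{ran}(T)}$, $\mathrm{ran}(V^* )=\overline{\mathrm{ran}(|T|)}$. A regular operator $t$ is polar decomposable if its bounded transform $F_t=t(1+t^*t)^{-1/2}\in\mathcal L_{\mathcal A}(\mathscr E,\mathscr F)$ is. The $k$-th Laplace operator is $\Delta_k^{(\mathscr E,t)}=t_k^*t_k+t_{k-1}t_{k-1}^*$ on $\mathrm{dom}(t_k^*t_k)\cap\mathrm{dom}(t_{k-1}t_{k-1}^* )\subset\mathscr E_k$; it is regular and self-adjoint. For a finite-length complex put $\mathscr E_{\mathrm{ev}}=\bigoplus_k\mathscr E_{2k}$, $\mathscr E_{\mathrm{odd}}=\bigoplus_k\mathscr E_{2k+1}$. The even Dirac operator $\mathcal D^+_t\colon\mathrm{dom}(\mathcal D^+_t)\subset\mathscr E_{\mathrm{ev}}\to\mathscr E_{\mathrm{odd}}$ has domain $\bigoplus_k \mathrm{dom}(t_{2k})\cap\mathrm{dom}(t_{2k-1}^* )$ and is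 given by $\mathcal D^+_t(x_{2k})_k=(t_{2k}x_{2k}+t_{2k+1}^*x_{2k+2})_k$; it is regular. *)

theory Defs
  imports "HOL-Analysis.Analysis"
begin

section \<open>Complex C*-algebras, not necessarily unital\<close>

class cstar_algebra = real_normed_algebra + banach +
  fixes scaleC :: "complex \<Rightarrow> 'a \<Rightarrow> 'a" (infixr "*\<^sub>C" 75)
    and star :: "'a \<Rightarrow> 'a"
  assumes scaleR_scaleC: "r *\<^sub>R a = complex_of_real r *\<^sub>C a"
    and scaleC_add_right: "c *\<^sub>C (a + b) = c *\<^sub>C a + c *\<^sub>C b"
    and scaleC_add_left: "(c + d) *\<^sub>C a = c *\<^sub>C a + d *\<^sub>C a"
    and scaleC_scaleC: "c *\<^sub>C d *\<^sub>C a = (c * d) *\<^sub>C a"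
    and mult_scaleC_left: "(c *\<^sub>C a) * b = c *\<^sub>C (a * b)"
    and mult_scaleC_right: "a * (c *\<^sub>C b) = c *\<^sub>C (a * b)"
    and norm_scaleC: "norm (c *\<^sub>C a) = cmod c * norm a"
    and star_add: "star (a + b) = star a + star b"
    and star_scaleC: "star (c *\<^sub>C a) = cnj c *\<^sub>C star a"
    and star_mult: "star (a * b) = star b * star a"
    and star_star: "star (star a) = a"
    and norm_star_mult_self: "norm (star a * a) = (norm a)\<^sup>2"

definition cstar_positive :: "'a::cstar_algebra \<Rightarrow> bool" where
  "cstar_positive a \<longleftrightarrow> (\<exists>b. a = star b * b)"


section \<open>Hilbert modules\<close>

text \<open>
  The modules of a complex vary with an integer index, so a module is a record over a carrier set.
  The \<open>'a\<close>-valued inner product is linear in the second argument.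
\<close>

record ('a, 'e) hmodule =
  hcarrier :: "'e set"
  hzero :: 'e
  hadd :: "'e \<Rightarrow> 'e \<Rightarrow> 'e"
  hscale :: "complex \<Rightarrow> 'e \<Rightarrow> 'e"
  hact :: "'e \<Rightarrow> 'a \<Rightarrow> 'e"
  hinner :: "'e \<Rightarrow> 'e \<Rightarrow> 'a"

definition hnorm :: "('a::cstar_algebra, 'e) hmodule \<Rightarrow> 'e \<Rightarrow> real" where
  "hnorm M x = sqrt (norm (hinner M x x))"

text \<open>
  The value outside the carrier is irrelevant, but the library's locale of metric spaces
  demands a symmetric distance on the whole type.
\<close>

definition hdist :: "('a::cstar_algebra, 'e) hmodule \<Rightarrow> 'e \<Rightarrow> 'e \<Rightarrow> real" where
  "hdist M x y =
    (if x \<in> hcarrier M \<and> y \<in> hcarrier M then hnorm M (hadd M x (hscale M (- 1) y)) else 0)"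

definition htopology :: "('a::cstar_algebra, 'e) hmodule \<Rightarrow> 'e topology" where
  "htopology M = Metric_space.mtopology (hcarrier M) (hdist M)"

locale hilbert_module =
  fixes M :: "('a::cstar_algebra, 'e) hmodule"
  assumes zero_closed: "hzero M \<in> hcarrier M"
    and add_closed: "\<lbrakk>x \<in> hcarrier M; y \<in> hcarrier M\<rbrakk> \<Longrightarrow> hadd M x y \<in> hcarrier M"
    and scale_closed: "x \<in> hcarrier M \<Longrightarrow> hscale M c x \<in> hcarrier M"
    and act_closed: "x \<in> hcarrier M \<Longrightarrow> hact M x a \<in> hcarrier M"
    and add_assoc: "\<lbrakk>x \<in> hcarrier M; y \<in> hcarrier M; z \<in> hcarrier M\<rbrakk>
      \<Longrightarrow> hadd M (hadd M x y) z = hadd M x (hadd M y z)"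
    and add_commute: "\<lbrakk>x \<in> hcarrier M; y \<in> hcarrier M\<rbrakk> \<Longrightarrow> hadd M x y = hadd M y x"
    and add_zero: "x \<in> hcarrier M \<Longrightarrow> hadd M x (hzero M) = x"
    and add_inverse: "x \<in> hcarrier M \<Longrightarrow> \<exists>y\<in>hcarrier M. hadd M x y = hzero M"
    and scale_add_right: "\<lbrakk>x \<in> hcarrier M; y \<in> hcarrier M\<rbrakk>
      \<Longrightarrow> hscale M c (hadd M x y) = hadd M (hscale M c x) (hscale M c y)"
    and scale_add_left: "x \<in> hcarrier M
      \<Longrightarrow> hscale M (c + d) x = hadd M (hscale M c x) (hscale M d x)"
    and scale_scale: "x \<in> hcarrier M \<Longrightarrow> hscale M c (hscale M d x) = hscale M (c * d) x"
    and scale_one: "x \<in> hcarrier M \<Longrightarrow> hscale M 1 x = x"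
    and act_add_left: "\<lbrakk>x \<in> hcarrier M; y \<in> hcarrier M\<rbrakk>
      \<Longrightarrow> hact M (hadd M x y) a = hadd M (hact M x a) (hact M y a)"
    and act_add_right: "x \<in> hcarrier M \<Longrightarrow> hact M x (a + b) = hadd M (hact M x a) (hact M x b)"
    and act_act: "x \<in> hcarrier M \<Longrightarrow> hact M (hact M x a) b = hact M x (a * b)"
    and act_scale_left: "x \<in> hcarrier M \<Longrightarrow> hact M (hscale M c x) a = hscale M c (hact M x a)"
    and act_scale_right: "x \<in> hcarrier M \<Longrightarrow> hact M x (c *\<^sub>C a) = hscale M c (hact M x a)"
    and inner_add: "\<lbrakk>x \<in> hcarrier M; y \<in> hcarrier M; z \<in> hcarrier M\<rbrakk>
      \<Longrightarrow> hinner M x (hadd M y z) = hinner M x y + hinner M x z"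
    and inner_scale: "\<lbrakk>x \<in> hcarrier M; y \<in> hcarrier M\<rbrakk>
      \<Longrightarrow> hinner M x (hscale M c y) = c *\<^sub>C hinner M x y"
    and inner_act: "\<lbrakk>x \<in> hcarrier M; y \<in> hcarrier M\<rbrakk>
      \<Longrightarrow> hinner M x (hact M y a) = hinner M x y * a"
    and inner_star: "\<lbrakk>x \<in> hcarrier M; y \<in> hcarrier M\<rbrakk> \<Longrightarrow> hinner M y x = star (hinner M x y)"
    and inner_positive: "x \<in> hcarrier M \<Longrightarrow> cstar_positive (hinner M x x)"
    and inner_definite: "\<lbrakk>x \<in> hcarrier M; hinner M x x = 0\<rbrakk> \<Longrightarrow> x = hzero M"
    and complete: "Metric_space.mcomplete (hcarrier M) (hdist M)"

definition hclosure :: "('a::cstar_algebra, 'e) hmodule \<Rightarrow> 'e set \<Rightarrow> 'e set" where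
  "hclosure M S = htopology M closure_of S"

definition hdense :: "('a::cstar_algebra, 'e) hmodule \<Rightarrow> 'e set \<Rightarrow> bool" where
  "hdense M S \<longleftrightarrow> S \<subseteq> hcarrier M \<and> hclosure M S = hcarrier M"

definition hsubmodule :: "('a::cstar_algebra, 'e) hmodule \<Rightarrow> 'e set \<Rightarrow> bool" where
  "hsubmodule M S \<longleftrightarrow> S \<subseteq> hcarrier M \<and> hzero M \<in> S \<and>
    (\<forall>x\<in>S. \<forall>y\<in>S. hadd M x y \<in> S) \<and> (\<forall>x\<in>S. \<forall>c. hscale M c x \<in> S) \<and>
    (\<forall>x\<in>S. \<forall>a. hact M x a \<in> S)"

definition horthogonal :: "('a::cstar_algebra, 'e) hmodule \<Rightarrow> 'e set \<Rightarrow> 'e set \<Rightarrow> bool" where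
  "horthogonal M S T \<longleftrightarrow> (\<forall>x\<in>S. \<forall>y\<in>T. hinner M x y = 0)"

text \<open>Internal orthogonal direct sum \<open>M = U \<oplus> V \<oplus> W\<close>.\<close>

definition orthogonal_sum3 ::
  "('a::cstar_algebra, 'e) hmodule \<Rightarrow> 'e set \<Rightarrow> 'e set \<Rightarrow> 'e set \<Rightarrow> bool" where
  "orthogonal_sum3 M U V W \<longleftrightarrow>
    hsubmodule M U \<and> hsubmodule M V \<and> hsubmodule M W \<and>
    horthogonal M U V \<and> horthogonal M U W \<and> horthogonal M V W \<and>
    hcarrier M = {hadd M (hadd M u v) w | u v w. u \<in> U \<and> v \<in> V \<and> w \<in> W}"

text \<open>
  External orthogonal direct sum, with finitely supported families as elements. It is used only
  for families in which all but finitely many modules vanish.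
\<close>

definition hdirect_sum ::
  "('i \<Rightarrow> ('a::cstar_algebra, 'e) hmodule) \<Rightarrow> ('a, 'i \<Rightarrow> 'e) hmodule" where
  "hdirect_sum M =
    \<lparr>hcarrier = {x. (\<forall>i. x i \<in> hcarrier (M i)) \<and> finite {i. x i \<noteq> hzero (M i)}},
     hzero = (\<lambda>i. hzero (M i)),
     hadd = (\<lambda>x y i. hadd (M i) (x i) (y i)),
     hscale = (\<lambda>c x i. hscale (M i) c (x i)),
     hact = (\<lambda>x a i. hact (M i) (x i) a),
     hinner = (\<lambda>x y. \<Sum>i | x i \<noteq> hzero (M i). hinner (M i) (x i) (y i))\<rparr>"


section \<open>Operators\<close>

text \<open>
  A possibly unbounded operator is a partial function with \<open>dom\<close> and \<open>ran\<close> as its domain and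
  range. Thus \<open>\<circ>\<^sub>m\<close> is composition on the maximal domain, and equality includes equality of domains.
  Bounded operators are those whose domain is the whole carrier.
\<close>

definition module_operator ::
  "('a::cstar_algebra, 'e) hmodule \<Rightarrow> ('a, 'f) hmodule \<Rightarrow> ('e \<rightharpoonup> 'f) \<Rightarrow> bool" where
  "module_operator M N t \<longleftrightarrow> hsubmodule M (dom t) \<and> ran t \<subseteq> hcarrier N \<and>
    (\<forall>x\<in>dom t. \<forall>y\<in>dom t. t (hadd M x y) = Some (hadd N (the (t x)) (the (t y)))) \<and>
    (\<forall>x\<in>dom t. \<forall>c. t (hscale M c x) = Some (hscale N c (the (t x)))) \<and>
    (\<forall>x\<in>dom t. \<forall>a. t (hact M x a) = Some (hact N (the (t x)) a))"

definition op_ker :: "('a::cstar_algebra, 'f) hmodule \<Rightarrow> ('e \<rightharpoonup> 'f) \<Rightarrow> 'e set" where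
  "op_ker N t = {x. t x = Some (hzero N)}"

definition op_id :: "('a::cstar_algebra, 'e) hmodule \<Rightarrow> ('e \<rightharpoonup> 'e)" where
  "op_id M = Some |` hcarrier M"

definition op_add ::
  "('a::cstar_algebra, 'f) hmodule \<Rightarrow> ('e \<rightharpoonup> 'f) \<Rightarrow> ('e \<rightharpoonup> 'f) \<Rightarrow> ('e \<rightharpoonup> 'f)" where
  "op_add N s t =
    (\<lambda>x. if x \<in> dom s \<inter> dom t then Some (hadd N (the (s x)) (the (t x))) else None)"

definition op_inverse :: "('e \<rightharpoonup> 'f) \<Rightarrow> ('f \<rightharpoonup> 'e)" where
  "op_inverse t = (\<lambda>y. if y \<in> ran t then Some (THE x. t x = Some y) else None)"

text \<open>The adjoint is meaningful for densely defined \<open>t\<close>, where the \<open>z\<close> below is unique.\<close>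

definition op_adjoint ::
  "('a::cstar_algebra, 'e) hmodule \<Rightarrow> ('a, 'f) hmodule \<Rightarrow> ('e \<rightharpoonup> 'f) \<Rightarrow> ('f \<rightharpoonup> 'e)" where
  "op_adjoint M N t =
    (let P = (\<lambda>y z. z \<in> hcarrier M \<and> (\<forall>x\<in>dom t. hinner N (the (t x)) y = hinner M x z))
     in (\<lambda>y. if y \<in> hcarrier N \<and> (\<exists>z. P y z) then Some (THE z. P y z) else None))"

definition semi_regular ::
  "('a::cstar_algebra, 'e) hmodule \<Rightarrow> ('a, 'f) hmodule \<Rightarrow> ('e \<rightharpoonup> 'f) \<Rightarrow> bool" where
  "semi_regular M N t \<longleftrightarrow>
    module_operator M N t \<and> hdense M (dom t) \<and> hdense N (dom (op_adjoint M N t))"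

definition closed_operator ::
  "('a::cstar_algebra, 'e) hmodule \<Rightarrow> ('a, 'f) hmodule \<Rightarrow> ('e \<rightharpoonup> 'f) \<Rightarrow> bool" where
  "closed_operator M N t \<longleftrightarrow>
    closedin (prod_topology (htopology M) (htopology N)) (Map.graph t)"

definition one_plus_adjoint_self ::
  "('a::cstar_algebra, 'e) hmodule \<Rightarrow> ('a, 'f) hmodule \<Rightarrow> ('e \<rightharpoonup> 'f) \<Rightarrow> ('e \<rightharpoonup> 'e)" where
  "one_plus_adjoint_self M N t = op_add M (op_id M) (op_adjoint M N t \<circ>\<^sub>m t)"

definition regular_operator ::
  "('a::cstar_algebra, 'e) hmodule \<Rightarrow> ('a, 'f) hmodule \<Rightarrow> ('e \<rightharpoonup> 'f) \<Rightarrow> bool" where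
  "regular_operator M N t \<longleftrightarrow>
    semi_regular M N t \<and> closed_operator M N t \<and> hdense M (ran (one_plus_adjoint_self M N t))"


section \<open>Adjointable operators and polar decomposition\<close>

definition adjointable ::
  "('a::cstar_algebra, 'e) hmodule \<Rightarrow> ('a, 'f) hmodule \<Rightarrow> ('e \<rightharpoonup> 'f) \<Rightarrow> bool" where
  "adjointable M N T \<longleftrightarrow> dom T = hcarrier M \<and> ran T \<subseteq> hcarrier N \<and>
    (\<exists>S. dom S = hcarrier N \<and> ran S \<subseteq> hcarrier M \<and>
      (\<forall>x\<in>hcarrier M. \<forall>y\<in>hcarrier N. hinner N (the (T x)) y = hinner M x (the (S y))))"

text \<open>Positivity in the C*-algebra of adjointable operators on \<open>M\<close>.\<close>

definition op_positive :: "('a::cstar_algebra, 'e) hmodule \<Rightarrow> ('e \<rightharpoonup> 'e) \<Rightarrow> bool" where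
  "op_positive M T \<longleftrightarrow> (\<exists>S. adjointable M M S \<and> T = op_adjoint M M S \<circ>\<^sub>m S)"

text \<open>Meaningful for positive \<open>T\<close>, which have exactly one positive square root.\<close>

definition op_sqrt :: "('a::cstar_algebra, 'e) hmodule \<Rightarrow> ('e \<rightharpoonup> 'e) \<Rightarrow> ('e \<rightharpoonup> 'e)" where
  "op_sqrt M T = (THE S. op_positive M S \<and> S \<circ>\<^sub>m S = T)"

definition op_abs ::
  "('a::cstar_algebra, 'e) hmodule \<Rightarrow> ('a, 'f) hmodule \<Rightarrow> ('e \<rightharpoonup> 'f) \<Rightarrow> ('e \<rightharpoonup> 'e)" where
  "op_abs M N T = op_sqrt M (op_adjoint M N T \<circ>\<^sub>m T)"

definition partial_isometry ::
  "('a::cstar_algebra, 'e) hmodule \<Rightarrow> ('a, 'f) hmodule \<Rightarrow> ('e \<rightharpoonup> 'f) \<Rightarrow> bool" where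
  "partial_isometry M N V \<longleftrightarrow> adjointable M N V \<and> V \<circ>\<^sub>m (op_adjoint M N V \<circ>\<^sub>m V) = V"

definition adjointable_polar_decomposable ::
  "('a::cstar_algebra, 'e) hmodule \<Rightarrow> ('a, 'f) hmodule \<Rightarrow> ('e \<rightharpoonup> 'f) \<Rightarrow> bool" where
  "adjointable_polar_decomposable M N T \<longleftrightarrow> adjointable M N T \<and>
    (\<exists>V. partial_isometry M N V \<and> T = V \<circ>\<^sub>m op_abs M N T \<and>
      op_ker N V = op_ker N T \<and>
      op_ker M (op_adjoint M N V) = op_ker M (op_adjoint M N T) \<and>
      ran V = hclosure N (ran T) \<and>
      ran (op_adjoint M N V) = hclosure M (ran (op_abs M N T)))"

text \<open>\<open>F\<^sub>t = t (1 + t\<^sup>* t)\<^sup>-\<^sup>1\<^sup>/\<^sup>2\<close>, the power being the positive square root of the inverse.\<close>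

definition bounded_transform ::
  "('a::cstar_algebra, 'e) hmodule \<Rightarrow> ('a, 'f) hmodule \<Rightarrow> ('e \<rightharpoonup> 'f) \<Rightarrow> ('e \<rightharpoonup> 'f)" where
  "bounded_transform M N t = t \<circ>\<^sub>m op_sqrt M (op_inverse (one_plus_adjoint_self M N t))"

definition polar_decomposable ::
  "('a::cstar_algebra, 'e) hmodule \<Rightarrow> ('a, 'f) hmodule \<Rightarrow> ('e \<rightharpoonup> 'f) \<Rightarrow> bool" where
  "polar_decomposable M N t \<longleftrightarrow>
    regular_operator M N t \<and> adjointable_polar_decomposable M N (bounded_transform M N t)"


section \<open>Hilbert complexes\<close>

text \<open>
  All modules of a complex have elements in one type \<open>'e\<close>. As the modules have separate carriers and
  operations, this is no restriction: the members of any family embed into a common set.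
\<close>

definition hilbert_complex ::
  "(int \<Rightarrow> ('a::cstar_algebra, 'e) hmodule) \<Rightarrow> (int \<Rightarrow> 'e \<rightharpoonup> 'e) \<Rightarrow> bool" where
  "hilbert_complex E t \<longleftrightarrow>
    (\<forall>k. hilbert_module (E k)) \<and>
    (\<forall>k. regular_operator (E k) (E (k + 1)) (t k)) \<and>
    (\<forall>k. ran (t k) \<subseteq> op_ker (E (k + 2)) (t (k + 1)))"

abbreviation differential_adjoint ::
  "(int \<Rightarrow> ('a::cstar_algebra, 'e) hmodule) \<Rightarrow> (int \<Rightarrow> 'e \<rightharpoonup> 'e) \<Rightarrow> int \<Rightarrow> 'e \<rightharpoonup> 'e" where
  "differential_adjoint E t k \<equiv> op_adjoint (E k) (E (k + 1)) (t k)"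

definition finite_length :: "(int \<Rightarrow> ('a::cstar_algebra, 'e) hmodule) \<Rightarrow> bool" where
  "finite_length E \<longleftrightarrow> (\<exists>n. \<forall>k. \<bar>k\<bar> > n \<longrightarrow> hcarrier (E k) = {hzero (E k)})"

definition weak_hodge_decomposition ::
  "(int \<Rightarrow> ('a::cstar_algebra, 'e) hmodule) \<Rightarrow> (int \<Rightarrow> 'e \<rightharpoonup> 'e) \<Rightarrow> bool" where
  "weak_hodge_decomposition E t \<longleftrightarrow>
    (\<forall>k. orthogonal_sum3 (E k)
      (op_ker (E (k + 1)) (t k) \<inter> op_ker (E (k - 1)) (differential_adjoint E t (k - 1)))
      (hclosure (E k) (ran (differential_adjoint E t k)))
      (hclosure (E k) (ran (t (k - 1)))))"

definition laplacian ::
  "(int \<Rightarrow> ('a::cstar_algebra, 'e) hmodule) \<Rightarrow> (int \<Rightarrow> 'e \<rightharpoonup> 'e) \<Rightarrow> int \<Rightarrow> 'e \<rightharpoonup> 'e" where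
  "laplacian E t k = op_add (E k)
    (differential_adjoint E t k \<circ>\<^sub>m t k)
    (t (k - 1) \<circ>\<^sub>m differential_adjoint E t (k - 1))"

definition even_module ::
  "(int \<Rightarrow> ('a::cstar_algebra, 'e) hmodule) \<Rightarrow> ('a, int \<Rightarrow> 'e) hmodule" where
  "even_module E = hdirect_sum (\<lambda>k. E (2 * k))"

definition odd_module ::
  "(int \<Rightarrow> ('a::cstar_algebra, 'e) hmodule) \<Rightarrow> ('a, int \<Rightarrow> 'e) hmodule" where
  "odd_module E = hdirect_sum (\<lambda>k. E (2 * k + 1))"

text \<open>
  The component \<open>x k\<close> of an element of the even module has degree \<open>2 * k\<close>, and component \<open>k\<close> of an
  element of the odd module has degree \<open>2 * k + 1\<close>.
\<close>

definition even_dirac ::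
  "(int \<Rightarrow> ('a::cstar_algebra, 'e) hmodule) \<Rightarrow> (int \<Rightarrow> 'e \<rightharpoonup> 'e)
    \<Rightarrow> (int \<Rightarrow> 'e) \<rightharpoonup> (int \<Rightarrow> 'e)" where
  "even_dirac E t = (\<lambda>x.
    if x \<in> hcarrier (even_module E) \<and>
       (\<forall>k. x k \<in> dom (t (2 * k)) \<inter> dom (differential_adjoint E t (2 * k - 1)))
    then Some (\<lambda>k. hadd (E (2 * k + 1))
      (the (t (2 * k) (x k)))
      (the (differential_adjoint E t (2 * k + 1) (x (k + 1)))))
    else None)"

end

theory Submission
  imports Defs
begin

text \<open>
  All four conditions are statements about splittings of the modules into kernels and closures of
  ranges, the orthogonality being automatic.

  For a regular operator \<open>t\<close> from \<open>M\<close> to \<open>N\<close>, polar decomposability means \<open>M = ker t + cl ran t\<^sup>*\<close> and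
  \<open>N = ker t\<^sup>* + cl ran t\<close> (\<open>regular_op.polar_decomposable_iff\<close>). If \<open>V\<close> is the partial isometry of
  a polar decomposition, the projections \<open>V\<^sup>* V\<close> and \<open>V V\<^sup>*\<close> give these splittings. Conversely the
  splittings allow the isometry \<open>|T| x \<mapsto> T x\<close>, with \<open>T\<close> the bounded transform, to be extended by zero
  to an operator with an adjoint. Kernels and closed ranges of \<open>T\<close> and \<open>T\<^sup>*\<close> are those of \<open>t\<close> and \<open>t\<^sup>*\<close>.

  Let \<open>p\<close> and \<open>r\<close> be the differentials into and out of one module \<open>M\<close> of the complex. As
  \<open>cl ran p \<subseteq> ker r\<close> and \<open>cl ran r\<^sup>* \<subseteq> ker p\<^sup>*\<close>, the weak Hodge decomposition of \<open>M\<close> is equivalent to the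
  two splittings \<open>M = ker r + cl ran r\<^sup>*\<close> and \<open>M = ker p\<^sup>* + cl ran p\<close> (\<open>two_step.hodge_iff_spans\<close>).
  The first is one half of the polar decomposability of \<open>r\<close> and the second one half of that of \<open>p\<close>;
  collecting the halves over all degrees gives the equivalence of (i) and (ii).

  The Laplace operator is self-adjoint, so its polar decomposability is \<open>M = ker \<Delta> + cl ran \<Delta>\<close>. Here
  \<open>ker \<Delta>\<close> is the harmonic part \<open>ker r \<inter> ker p\<^sup>*\<close>, and \<open>ran \<Delta> \<subseteq> ran r\<^sup>* + ran p\<close> with orthogonal
  summands; hence such a splitting is a Hodge decomposition. Given a Hodge decomposition, the ranges
  of \<open>r\<^sup>* r\<close> and of \<open>p p\<^sup>*\<close> lie in \<open>ran \<Delta>\<close>, and they are dense in \<open>ran r\<^sup>*\<close> and in \<open>ran p\<close>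
  (\<open>two_step.polar_decomposable_\<Delta>_iff\<close>). The argument for the Dirac operator is the same, with its
  two splittings giving the Hodge decompositions in even and in odd degrees
  (\<open>dirac_family.polar_decomposable_D_iff\<close>).

  Regularity of \<open>\<Delta>\<close> and of the Dirac operator is part of the claim. It comes from a criterion,
  \<open>regular_of_resolvent_onto\<close>: a formally adjoint pair \<open>D\<close>, \<open>D'\<close> of densely defined operators for
  which \<open>1 + D' D\<close> and \<open>1 + D D'\<close> are onto consists of regular operators adjoint to each other. The
  surjectivity rests on the factorization \<open>1 + \<Delta> = (1 + p p\<^sup>*) (1 + r\<^sup>* r)\<close>.

  In place of a functional calculus only square roots are used, obtained by the iteration
  \<open>y \<mapsto> (p + y\<^sup>2) / 2\<close>, which converges to \<open>1 - sqrt (1 - p)\<close>. In a C*-algebra with unit this yields the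
  order and the positivity of \<open>b\<^sup>* b\<close>; algebras without unit are embedded in their multiplier
  algebras. On a Hilbert module the same iteration, converging at each vector, yields the roots of
  positive operators. Closed submodules need not be complemented, so the density of \<open>ran T\<^sup>* T\<close> in
  \<open>ran T\<^sup>*\<close> is proved by an explicit approximation (\<open>adjoint_ops.range_adjoint_subset\<close>).
\<close>


section \<open>Square roots in C*-algebras with unit\<close>

lemma star_zero [simp]: "star (0::'a::cstar_algebra) = 0"
  by (metis add_cancel_left_left star_add)

lemma star_minus [simp]: "star (- a) = - star (a::'a::cstar_algebra)"
  by (metis add.right_inverse add_eq_0_iff star_add star_zero)

lemma star_diff: "star (a - b) = star a - star (b::'a::cstar_algebra)"
  by (metis diff_conv_add_uminus star_add star_minus)

lemma star_scaleR: "star (r *\<^sub>R a) = r *\<^sub>R star (a::'a::cstar_algebra)"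
  by (simp add: scaleR_scaleC star_scaleC)

lemma norm_star [simp]: "norm (star a) = norm (a::'a::cstar_algebra)"
proof -
  have le: "norm b \<le> norm (star b)" for b :: 'a
  proof (cases "b = 0")
    case False
    have "norm b * norm b \<le> norm (star b) * norm b"
      using norm_mult_ineq[of "star b" b] norm_star_mult_self[of b] by (simp add: power2_eq_square)
    then show ?thesis using False by simp
  qed simp
  show ?thesis using le[of a] le[of "star a"] by (simp add: star_star)
qed

lemma norm_mult_star_self: "norm (a * star a) = (norm (a::'a::cstar_algebra))\<^sup>2"
  using norm_star_mult_self[of "star a"] by (simp add: star_star)

lemma bounded_linear_star: "bounded_linear (star :: 'a::cstar_algebra \<Rightarrow> 'a)"
  by (rule bounded_linear_intro[where K=1]) (auto simp: star_add star_scaleR)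

lemmas tendsto_star = bounded_linear.tendsto[OF bounded_linear_star]

lemma norm_eq_of_square_self_adjoint:
  "star a = a \<Longrightarrow> norm (a * a) = (norm (a::'a::cstar_algebra))\<^sup>2"
  using norm_star_mult_self[of a] by simp

lemma scaleC_zero_right [simp]: "c *\<^sub>C (0::'a::cstar_algebra) = 0"
  by (metis add_cancel_left_left scaleC_add_right)

lemma scaleC_one [simp]: "1 *\<^sub>C (a::'a::cstar_algebra) = a"
  by (metis of_real_1 scaleR_one scaleR_scaleC)

lemma scaleC_minus_right: "c *\<^sub>C (- a) = - (c *\<^sub>C (a::'a::cstar_algebra))"
  by (metis add.right_inverse add_eq_0_iff scaleC_add_right scaleC_zero_right)

lemma scaleC_diff_right: "c *\<^sub>C (a - b) = c *\<^sub>C a - c *\<^sub>C (b::'a::cstar_algebra)"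
  by (metis diff_conv_add_uminus scaleC_add_right scaleC_minus_right)

lemma scaleC_minus_one [simp]: "(-1) *\<^sub>C (a::'a::cstar_algebra) = - a"
  by (metis of_real_1 of_real_minus scaleR_minus1_left scaleR_scaleC)

lemma scaleC_zero_left [simp]: "0 *\<^sub>C (a::'a::cstar_algebra) = 0"
  by (metis of_real_0 scaleR_scaleC scaleR_zero_left)

lemma scaleC_minus_left: "(-c) *\<^sub>C a = - (c *\<^sub>C (a::'a::cstar_algebra))"
  by (metis mult_minus1 scaleC_minus_one scaleC_scaleC)

lemma star_one [simp]: "star (1::'a::{cstar_algebra,monoid_mult}) = 1"
  by (metis mult.left_neutral mult.right_neutral star_mult star_star)

text \<open>
  Iterating \<open>y \<mapsto> (p + y\<^sup>2) / 2\<close> from \<open>0\<close> produces \<open>1 - sqrt (1 - p)\<close>. For a contraction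
  \<open>p\<close> the steps are dominated by those of the scalar iteration with \<open>p = 1\<close>, which increases
  to \<open>1\<close>; hence the iteration converges in norm, also on the boundary of the unit ball.
\<close>

primrec sqrt_majorant :: "nat \<Rightarrow> real" where
  "sqrt_majorant 0 = 0"
| "sqrt_majorant (Suc n) = (1 + (sqrt_majorant n)\<^sup>2) / 2"

lemma sqrt_majorant_bounds: "0 \<le> sqrt_majorant n \<and> sqrt_majorant n \<le> 1"
  by (induction n) (auto simp: power_le_one)

lemma sqrt_majorant_step: "sqrt_majorant n \<le> sqrt_majorant (Suc n)"
proof -
  have "0 \<le> (1 - sqrt_majorant n)\<^sup>2" by simp
  then show ?thesis by (simp add: power2_diff)
qed

lemma sqrt_majorant_mono: "m \<le> n \<Longrightarrow> sqrt_majorant m \<le> sqrt_majorant n"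
  using sqrt_majorant_step by (rule lift_Suc_mono_le)

lemma sqrt_majorant_tendsto: "sqrt_majorant \<longlonglongrightarrow> 1"
proof -
  have "incseq sqrt_majorant" by (simp add: incseq_def sqrt_majorant_mono)
  moreover have "\<forall>n. sqrt_majorant n \<le> 1" using sqrt_majorant_bounds by blast
  ultimately obtain l where l: "sqrt_majorant \<longlonglongrightarrow> l"
    by (meson incseq_convergent)
  have "(\<lambda>n. sqrt_majorant (Suc n)) \<longlonglongrightarrow> (1 + l\<^sup>2) / 2"
    unfolding sqrt_majorant.simps by (intro tendsto_intros l) simp
  then have "(1 + l\<^sup>2) / 2 = l" using LIMSEQ_unique LIMSEQ_Suc[OF l] by blast
  then have "1 + l\<^sup>2 = 2 * l" by simp
  then have "(1 - l)\<^sup>2 = 0" by (simp add: power2_eq_square algebra_simps)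
  then show ?thesis using l by simp
qed

lemma sqrt_majorant_Cauchy:
  assumes "e > 0"
  shows "\<exists>N. \<forall>m\<ge>N. \<forall>n\<ge>m. sqrt_majorant n - sqrt_majorant m < e"
proof -
  obtain N where N: "\<And>n. n \<ge> N \<Longrightarrow> \<bar>sqrt_majorant n - 1\<bar> < e"
    using LIMSEQ_D[OF sqrt_majorant_tendsto assms] by auto
  have "sqrt_majorant n - sqrt_majorant m < e" if "m \<ge> N" "n \<ge> m" for m n
    using N[of m] that sqrt_majorant_bounds[of n] sqrt_majorant_bounds[of m] by auto
  then show ?thesis by blast
qed

primrec sqrt_iterate :: "'a::cstar_algebra \<Rightarrow> nat \<Rightarrow> 'a" where
  "sqrt_iterate p 0 = 0"
| "sqrt_iterate p (Suc n) = (1/2) *\<^sub>R (p + sqrt_iterate p n * sqrt_iterate p n)"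

lemma norm_sqrt_iterate:
  assumes "norm p \<le> 1"
  shows "norm (sqrt_iterate p n) \<le> sqrt_majorant n"
proof (induction n)
  case (Suc n)
  have "norm (sqrt_iterate p n * sqrt_iterate p n) \<le> norm (sqrt_iterate p n) * norm (sqrt_iterate p n)"
    by (rule norm_mult_ineq)
  also have "\<dots> \<le> (sqrt_majorant n)\<^sup>2"
    using Suc by (simp add: mult_mono power2_eq_square sqrt_majorant_bounds)
  finally have "norm (p + sqrt_iterate p n * sqrt_iterate p n) \<le> 1 + (sqrt_majorant n)\<^sup>2"
    using assms norm_triangle_ineq[of p] by (smt (verit))
  then show ?case by simp
qed simp

lemma norm_sqrt_iterate_step:
  assumes "norm p \<le> 1"
  shows "norm (sqrt_iterate p (Suc n) - sqrt_iterate p n) \<le> sqrt_majorant (Suc n) - sqrt_majorant n"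
proof (induction n)
  case 0
  then show ?case using assms by simp
next
  case (Suc n)
  let ?Y = "sqrt_iterate p (Suc n)" and ?X = "sqrt_iterate p n"
  let ?y = "sqrt_majorant (Suc n)" and ?x = "sqrt_majorant n"
  have eq: "sqrt_iterate p (Suc (Suc n)) - ?Y = (1/2) *\<^sub>R (?Y * (?Y - ?X) + (?Y - ?X) * ?X)"
    by (simp only: sqrt_iterate.simps(2)[of p "Suc n"] sqrt_iterate.simps(2)[of p n]
        scaleR_diff_right[symmetric]) (simp add: algebra_simps del: sqrt_iterate.simps)
  have "norm (?Y * (?Y - ?X) + (?Y - ?X) * ?X) \<le> norm ?Y * norm (?Y - ?X) + norm (?Y - ?X) * norm ?X"
    by (intro norm_triangle_le add_mono norm_mult_ineq)
  also have "\<dots> \<le> ?y * (?y - ?x) + (?y - ?x) * ?x"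
    using Suc norm_sqrt_iterate[OF assms, of n] norm_sqrt_iterate[OF assms, of "Suc n"]
    by (intro add_mono mult_mono) (auto simp: sqrt_majorant_bounds sqrt_majorant_step simp del: sqrt_iterate.simps sqrt_majorant.simps)
  also have "\<dots> = 2 * (sqrt_majorant (Suc (Suc n)) - ?y)"
    by (simp only: sqrt_majorant.simps(2)[of "Suc n"]) (simp add: power2_eq_square algebra_simps)
  finally show ?case by (simp only: eq norm_scaleR) (simp del: sqrt_iterate.simps sqrt_majorant.simps)
qed

lemma norm_sqrt_iterate_diff:
  assumes "norm p \<le> 1" "m \<le> n"
  shows "norm (sqrt_iterate p n - sqrt_iterate p m) \<le> sqrt_majorant n - sqrt_majorant m"
  using assms(2)
proof (induction n rule: dec_induct)
  case (step n)
  have "norm (sqrt_iterate p (Suc n) - sqrt_iterate p m)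
      \<le> norm (sqrt_iterate p (Suc n) - sqrt_iterate p n) + norm (sqrt_iterate p n - sqrt_iterate p m)"
    using norm_triangle_ineq[of "sqrt_iterate p (Suc n) - sqrt_iterate p n" "sqrt_iterate p n - sqrt_iterate p m"]
    by (simp del: sqrt_iterate.simps)
  then show ?case using step norm_sqrt_iterate_step[OF assms(1), of n] by linarith
qed simp

text \<open>
  The image of an algebra in its multiplier algebra is such an ideal, so the square roots of its
  elements do not leave it.
\<close>

definition closed_right_ideal :: "'a::cstar_algebra set \<Rightarrow> bool" where
  "closed_right_ideal J \<longleftrightarrow> closed J \<and> subspace J \<and> (\<forall>a\<in>J. \<forall>b. a * b \<in> J)"

text \<open>
  Two properties of the root are read off from the iterates: it commutes with whatever commutes
  with \<open>p\<close>, and it lies in every closed right ideal that contains \<open>1 - p\<close>. The latter holds because,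
  modulo the ideal, the iteration is the scalar one, whose limit is \<open>1\<close>.
\<close>

lemma sqrt_one_minus:
  fixes p :: "'a::{cstar_algebra,monoid_mult}"
  assumes "star p = p" "norm p \<le> 1"
  obtains r where "star r = r" "r * r = 1 - p" "norm (1 - r) \<le> 1"
    "\<And>c. c * p = p * c \<Longrightarrow> c * r = r * c"
    "\<And>J. \<lbrakk>closed_right_ideal J; 1 - p \<in> J\<rbrakk> \<Longrightarrow> r \<in> J"
proof -
  let ?Y = "sqrt_iterate p"
  have "Cauchy ?Y"
  proof (rule CauchyI')
    fix e :: real assume "e > 0"
    then obtain N where N: "\<forall>m\<ge>N. \<forall>n\<ge>m. sqrt_majorant n - sqrt_majorant m < e"
      using sqrt_majorant_Cauchy by blast
    have "dist (?Y m) (?Y n) < e" if "m \<ge> N" "n > m" for m n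
      using norm_sqrt_iterate_diff[OF assms(2), of m n] N that
      by (auto simp: dist_norm norm_minus_commute intro: le_less_trans)
    then show "\<exists>M. \<forall>m\<ge>M. \<forall>n>m. dist (?Y m) (?Y n) < e" by blast
  qed
  then obtain y where y: "?Y \<longlonglongrightarrow> y" using Cauchy_convergent convergent_def by blast
  have sa: "star (?Y n) = ?Y n" for n
    by (induction n) (auto simp: star_scaleR star_add star_mult assms)
  have "star y = y"
    using LIMSEQ_unique[OF tendsto_star[OF y]] y by (simp add: sa)
  have "(\<lambda>n. ?Y (Suc n)) \<longlonglongrightarrow> (1/2) *\<^sub>R (p + y * y)"
    unfolding sqrt_iterate.simps by (intro tendsto_intros y)
  then have "(1/2) *\<^sub>R (p + y * y) = y"
    using LIMSEQ_unique LIMSEQ_Suc[OF y] by blast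
  then have yy: "y * y = 2 *\<^sub>R y - p"
  proof -
    have "2 *\<^sub>R ((1/2) *\<^sub>R (p + y * y)) = p + y * y" by simp
    with \<open>(1/2) *\<^sub>R (p + y * y) = y\<close> show ?thesis by (simp add: algebra_simps)
  qed
  have ny: "norm y \<le> 1"
    by (rule LIMSEQ_le_const2[OF tendsto_norm[OF y]])
      (meson norm_sqrt_iterate[OF assms(2)] order_trans sqrt_majorant_bounds)
  have comm: "c * y = y * c" if c: "c * p = p * c" for c
  proof -
    have "c * ?Y n = ?Y n * c" for n
    proof (induction n)
      case (Suc n)
      have "c * (?Y n * ?Y n) = ?Y n * ?Y n * c" by (metis Suc mult.assoc)
      then show ?case using c by (simp add: algebra_simps)
    qed simp
    moreover have "(\<lambda>n. c * ?Y n) \<longlonglongrightarrow> c * y" "(\<lambda>n. ?Y n * c) \<longlonglongrightarrow> y * c"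
      by (intro tendsto_intros y)+
    ultimately show ?thesis using LIMSEQ_unique by fastforce
  qed
  have ideal: "1 - y \<in> J" if ideal: "closed_right_ideal J" "1 - p \<in> J" for J
  proof -
    have J: "closed J" "subspace J" "\<And>a b. a \<in> J \<Longrightarrow> a * b \<in> J" "1 - p \<in> J"
      using ideal by (auto simp: closed_right_ideal_def)
    have "sqrt_majorant n *\<^sub>R 1 - ?Y n \<in> J" for n
    proof (induction n)
      case 0
      then show ?case using J by (simp add: subspace_0)
    next
      case (Suc n)
      let ?d = "sqrt_majorant n *\<^sub>R 1 - ?Y n"
      have "sqrt_majorant (Suc n) *\<^sub>R 1 - ?Y (Suc n)
          = (1/2) *\<^sub>R ((1 - p) + (sqrt_majorant n *\<^sub>R ?d + ?d * ?Y n))"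
        by (simp add: algebra_simps power2_eq_square scaleR_add_left scaleR_diff_right
            add_divide_distrib)
      moreover have "(1/2) *\<^sub>R ((1 - p) + (sqrt_majorant n *\<^sub>R ?d + ?d * ?Y n)) \<in> J"
        using J Suc by (intro subspace_scale subspace_add) auto
      ultimately show ?case by simp
    qed
    moreover have "(\<lambda>n. sqrt_majorant n *\<^sub>R 1 - ?Y n) \<longlonglongrightarrow> 1 *\<^sub>R 1 - y"
      by (intro tendsto_intros y sqrt_majorant_tendsto)
    ultimately have "1 *\<^sub>R 1 - y \<in> J" by (rule closed_sequentially[OF J(1)])
    then show ?thesis by simp
  qed
  show thesis
  proof (rule that[of "1 - y"])
    show "star (1 - y) = 1 - y" by (simp add: star_diff \<open>star y = y\<close>)
    show "(1 - y) * (1 - y) = 1 - p" by (simp add: algebra_simps yy scaleR_2)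
    show "norm (1 - (1 - y)) \<le> 1" using ny by simp
    show "c * (1 - y) = (1 - y) * c" if "c * p = p * c" for c
      using comm[OF that] by (simp add: algebra_simps)
  qed (use ideal in auto)
qed


section \<open>The order of a C*-algebra with unit\<close>

lemma norm_one_le: "norm (1::'a::{cstar_algebra,monoid_mult}) \<le> 1"
proof -
  have "norm (1::'a) = norm (1::'a) * norm (1::'a)"
    using norm_star_mult_self[of "1::'a"] by (simp add: power2_eq_square)
  then show ?thesis by (metis mult_cancel_right1 order_refl zero_le_one)
qed

lemma norm_scale_one: "t \<ge> 0 \<Longrightarrow> norm (t *\<^sub>R (1::'a::{cstar_algebra,monoid_mult})) \<le> t"
  using norm_one_le[where 'a='a] by (simp add: mult_left_le)

text \<open>
  If commuting self-adjoint \<open>h\<close> and \<open>k\<close> satisfy \<open>h\<^sup>2 + k\<^sup>2 = t\<close>, then \<open>h + ik\<close> is a multiple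
  of a unitary, and \<open>h\<close> and \<open>k\<close> are its real and imaginary parts.
\<close>

lemma norm_le_of_sum_squares:
  fixes h k :: "'a::{cstar_algebra,monoid_mult}"
  assumes "star h = h" "star k = k" "h * k = k * h" "h * h + k * k = t *\<^sub>R 1" "t \<ge> 0"
  shows "norm (h * h) \<le> t"
proof -
  let ?u = "h + \<i> *\<^sub>C k"
  have su: "star ?u = h - \<i> *\<^sub>C k"
    by (simp add: star_add star_scaleC assms scaleC_minus_left)
  have "star ?u * ?u = h * h + k * k"
    unfolding su using assms(3)
    by (simp add: algebra_simps mult_scaleC_left mult_scaleC_right scaleC_scaleC scaleC_diff_right
        scaleC_minus_left)
  then have "(norm ?u)\<^sup>2 = norm (t *\<^sub>R (1::'a))"
    using norm_star_mult_self[of ?u] assms(4) by simp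
  then have u: "(norm ?u)\<^sup>2 \<le> t" using norm_scale_one[OF assms(5), where 'a='a] by simp
  have "2 *\<^sub>R h = ?u + star ?u" unfolding su by (simp add: scaleR_2)
  then have "2 * norm h \<le> norm ?u + norm (star ?u)"
    using norm_triangle_ineq[of ?u "star ?u"] by (metis abs_numeral norm_scaleR)
  then have "norm h \<le> norm ?u" by simp
  then have "(norm h)\<^sup>2 \<le> (norm ?u)\<^sup>2" by (rule power_mono) simp
  then have "(norm h)\<^sup>2 \<le> t" using u by (rule order_trans)
  then show ?thesis by (simp add: norm_eq_of_square_self_adjoint assms)
qed

text \<open>
  With \<open>r = sqrt (1 - h\<^sup>2)\<close>, this is the preceding bound for \<open>r\<^sup>2 + h\<^sup>2 = 1\<close>.
\<close>

lemma norm_one_minus_square: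
  fixes h :: "'a::{cstar_algebra,monoid_mult}"
  assumes "star h = h" "norm h \<le> 1"
  shows "norm (1 - h * h) \<le> 1"
proof -
  have "norm (h * h) \<le> 1" using assms by (simp add: norm_eq_of_square_self_adjoint power_le_one)
  then obtain r where r: "star r = r" "r * r = 1 - h * h" "\<And>c. c * (h * h) = h * h * c \<Longrightarrow> c * r = r * c"
    using sqrt_one_minus[of "h * h"] assms by (metis star_mult)
  have "h * r = r * h" by (rule r(3)) (simp add: mult.assoc)
  then have "norm (r * r) \<le> 1"
    by (intro norm_le_of_sum_squares[of r h 1]) (auto simp: r assms)
  then show ?thesis by (simp add: r)
qed

text \<open>
  Squares of self-adjoint elements as positive elements. Their closure under addition comes from
  the metric description below, which the triangle inequality respects.
\<close>

definition unital_positive :: "'a::{cstar_algebra,monoid_mult} \<Rightarrow> bool" where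
  "unital_positive a \<longleftrightarrow> (\<exists>r. star r = r \<and> a = r * r)"

lemma unital_positive_self_adjoint: "unital_positive a \<Longrightarrow> star a = a"
  by (auto simp: unital_positive_def star_mult)

lemma unital_positive_norm:
  assumes "unital_positive a" "norm a \<le> t"
  shows "norm (t *\<^sub>R 1 - a) \<le> t"
proof (cases "t > 0")
  case True
  obtain r where r: "star r = r" "a = r * r" using assms by (auto simp: unital_positive_def)
  let ?h = "(1 / sqrt t) *\<^sub>R r"
  have t: "1 / sqrt t * (1 / sqrt t) = 1 / t" using True by simp
  have hh: "?h * ?h = (1/t) *\<^sub>R a" using t by (simp add: r)
  have "(norm ?h)\<^sup>2 = norm a / t"
    using norm_eq_of_square_self_adjoint[of ?h] hh r True by (simp add: star_scaleR)
  then have "(norm ?h)\<^sup>2 \<le> 1" using assms(2) True by simp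
  then have "norm ?h \<le> 1" using power2_le_imp_le[of "norm ?h" 1] by simp
  then have "norm (1 - ?h * ?h) \<le> 1" by (intro norm_one_minus_square) (simp_all add: star_scaleR r)
  moreover have "t *\<^sub>R 1 - a = t *\<^sub>R (1 - ?h * ?h)" unfolding hh using True by (simp add: scaleR_diff_right)
  ultimately show ?thesis using True by (simp add: mult_left_le)
next
  case False
  then have "norm a = 0" "t = 0" using assms(2) norm_ge_zero[of a] by linarith+
  then have "a = 0" "t = 0" by simp_all
  then show ?thesis by simp
qed

lemma unital_positive_sqrt_of_norm:
  fixes a :: "'a::{cstar_algebra,monoid_mult}"
  assumes "star a = a" "norm (t *\<^sub>R 1 - a) \<le> t" "t > 0"
  obtains r where "star r = r" "r * r = a" "norm (sqrt t *\<^sub>R 1 - r) \<le> sqrt t"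
    "\<And>c. c * a = a * c \<Longrightarrow> c * r = r * c"
    "\<And>J. \<lbrakk>closed_right_ideal J; a \<in> J\<rbrakk> \<Longrightarrow> r \<in> J"
proof -
  let ?p = "1 - (1/t) *\<^sub>R a"
  have "?p = (1/t) *\<^sub>R (t *\<^sub>R 1 - a)" using assms(3) by (simp add: scaleR_diff_right)
  then have np: "norm ?p \<le> 1" using assms by simp
  have sp: "star ?p = ?p" by (simp add: star_diff star_scaleR assms)
  obtain r where r: "star r = r" "r * r = 1 - ?p" "norm (1 - r) \<le> 1"
    "\<And>c. c * ?p = ?p * c \<Longrightarrow> c * r = r * c"
    "\<And>J. \<lbrakk>closed_right_ideal J; 1 - ?p \<in> J\<rbrakk> \<Longrightarrow> r \<in> J"
    by (rule sqrt_one_minus[OF sp np]) (rule that)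
  show thesis
  proof (rule that[of "sqrt t *\<^sub>R r"])
    show "star (sqrt t *\<^sub>R r) = sqrt t *\<^sub>R r" by (simp add: star_scaleR r)
    show "sqrt t *\<^sub>R r * sqrt t *\<^sub>R r = a" using assms(3) by (simp add: r)
    have "sqrt t *\<^sub>R 1 - sqrt t *\<^sub>R r = sqrt t *\<^sub>R (1 - r)" by (simp add: scaleR_diff_right)
    then show "norm (sqrt t *\<^sub>R 1 - sqrt t *\<^sub>R r) \<le> sqrt t" using r(3) assms(3) by (simp add: mult_left_le)
    show "c * sqrt t *\<^sub>R r = sqrt t *\<^sub>R r * c" if "c * a = a * c" for c
      using r(4)[of c] that by (simp add: algebra_simps)
    show "sqrt t *\<^sub>R r \<in> J" if "closed_right_ideal J" "a \<in> J" for J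
      using r(5)[of J] that by (auto simp: closed_right_ideal_def intro: subspace_scale)
  qed
qed

lemma unital_positive_iff:
  fixes a :: "'a::{cstar_algebra,monoid_mult}"
  assumes "norm a \<le> t" "t > 0"
  shows "unital_positive a \<longleftrightarrow> star a = a \<and> norm (t *\<^sub>R 1 - a) \<le> t"
  using unital_positive_norm[of a t] unital_positive_self_adjoint[of a] unital_positive_sqrt_of_norm[of a t] assms
  by (metis unital_positive_def)

lemma unital_positive_scale_minus:
  fixes c :: "'a::{cstar_algebra,monoid_mult}"
  assumes "star c = c" "norm c \<le> t"
  shows "unital_positive (t *\<^sub>R 1 - c)"
proof (cases "t > 0")
  case True
  have sa: "star (t *\<^sub>R 1 - c) = t *\<^sub>R 1 - c" by (simp add: star_diff star_scaleR assms)
  have "norm (t *\<^sub>R 1 - (t *\<^sub>R 1 - c)) \<le> t" using assms by simp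
  then obtain r where "star r = r" "r * r = t *\<^sub>R 1 - c"
    by (rule unital_positive_sqrt_of_norm[OF sa _ True]) (rule that)
  then show ?thesis unfolding unital_positive_def by metis
next
  case False
  then have "norm c = 0" "t = 0" using assms(2) norm_ge_zero[of c] by linarith+
  then have "c = 0" "t = 0" by simp_all
  then show ?thesis by (auto simp: unital_positive_def intro: exI[of _ 0])
qed

text \<open>
  The root produced by the iteration satisfies the norm estimate of a positive element, so it has a
  self-adjoint root in turn.
\<close>

lemma unital_positive_root:
  assumes "unital_positive a"
  obtains r where "unital_positive r" "r * r = a" "\<And>c. c * a = a * c \<Longrightarrow> c * r = r * c"
    "\<And>J. \<lbrakk>closed_right_ideal J; a \<in> J\<rbrakk> \<Longrightarrow> r \<in> J"
proof -
  let ?t = "norm a + 1"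
  have t: "?t > 0" by (rule add_nonneg_pos) simp_all
  have nt: "norm (?t *\<^sub>R 1 - a) \<le> ?t" by (rule unital_positive_norm[OF assms]) simp
  obtain r where r: "star r = r" "r * r = a" "norm (sqrt ?t *\<^sub>R 1 - r) \<le> sqrt ?t"
    "\<And>c. c * a = a * c \<Longrightarrow> c * r = r * c"
    "\<And>J. \<lbrakk>closed_right_ideal J; a \<in> J\<rbrakk> \<Longrightarrow> r \<in> J"
    by (rule unital_positive_sqrt_of_norm[OF unital_positive_self_adjoint[OF assms]
          nt t]) (rule that)
  obtain s where "star s = s" "s * s = r"
    by (rule unital_positive_sqrt_of_norm[OF r(1,3)]) (use t in simp, rule that)
  then have "unital_positive r" unfolding unital_positive_def by metis
  then show thesis using that r by blast
qed

lemma unital_positive_add: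
  assumes "unital_positive a" "unital_positive b"
  shows "unital_positive (a + b)"
proof -
  let ?s = "norm a + 1" and ?t = "norm b + 1"
  have "norm (?s *\<^sub>R 1 - a + (?t *\<^sub>R 1 - b)) \<le> ?s + ?t"
    using assms by (intro norm_triangle_le add_mono unital_positive_norm) auto
  moreover have "?s *\<^sub>R 1 - a + (?t *\<^sub>R 1 - b) = (?s + ?t) *\<^sub>R 1 - (a + b)"
    by (simp add: scaleR_add_left scaleR_2)
  ultimately have "norm ((?s + ?t) *\<^sub>R 1 - (a + b)) \<le> ?s + ?t" by simp
  moreover have "norm (a + b) \<le> ?s + ?t" using norm_triangle_ineq[of a b] by simp
  moreover have "?s + ?t > 0" using norm_ge_zero[of a] norm_ge_zero[of b] by linarith
  ultimately show ?thesis
    using assms by (subst unital_positive_iff[of _ "?s + ?t"]) (auto simp: star_add unital_positive_self_adjoint)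
qed

lemma unital_positive_scaleR:
  assumes "unital_positive a" "c \<ge> 0"
  shows "unital_positive (c *\<^sub>R a)"
proof -
  obtain r where "star r = r" "a = r * r" using assms by (auto simp: unital_positive_def)
  then have "star (sqrt c *\<^sub>R r) = sqrt c *\<^sub>R r \<and> c *\<^sub>R a = (sqrt c *\<^sub>R r) * (sqrt c *\<^sub>R r)"
    using assms by (simp add: star_scaleR)
  then show ?thesis unfolding unital_positive_def by blast
qed

text \<open>
  With \<open>t = \<parallel>a + b\<parallel>\<close>, the element \<open>t - a = (t - (a + b)) + b\<close> is positive; its root and a root of
  \<open>a\<close> have squares with sum \<open>t\<close>.
\<close>

lemma unital_positive_norm_mono:
  assumes "unital_positive a" "unital_positive b"
  shows "norm a \<le> norm (a + b)"
proof -
  let ?t = "norm (a + b)"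
  have sa: "star a = a" using assms unital_positive_self_adjoint by blast
  have "unital_positive (?t *\<^sub>R 1 - (a + b))"
    by (rule unital_positive_scale_minus) (simp_all add: star_add assms unital_positive_self_adjoint)
  then have "unital_positive (?t *\<^sub>R 1 - (a + b) + b)" by (rule unital_positive_add) (rule assms(2))
  then have ta: "unital_positive (?t *\<^sub>R 1 - a)" by (simp add: algebra_simps)
  obtain k where k: "unital_positive k" "k * k = ?t *\<^sub>R 1 - a"
    "\<And>c. c * (?t *\<^sub>R 1 - a) = (?t *\<^sub>R 1 - a) * c \<Longrightarrow> c * k = k * c"
    by (rule unital_positive_root[OF ta]) (rule that)
  obtain r where r: "star r = r" "a = r * r" using assms by (auto simp: unital_positive_def)
  have "r * k = k * r" by (rule k(3)) (simp add: r algebra_simps)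
  moreover have "r * r + k * k = ?t *\<^sub>R 1" unfolding k(2) r(2)[symmetric] by simp
  ultimately have "norm (r * r) \<le> ?t"
    by (intro norm_le_of_sum_squares r unital_positive_self_adjoint) (simp_all add: k(1))
  then show ?thesis by (simp add: r)
qed

lemma unital_positive_mult_commuting:
  assumes "unital_positive a" "unital_positive b" "a * b = b * a"
  shows "unital_positive (a * b)"
proof -
  obtain r where r: "unital_positive r" "r * r = a" "\<And>c. c * a = a * c \<Longrightarrow> c * r = r * c"
    by (rule unital_positive_root[OF assms(1)]) (rule that)
  obtain s where s: "unital_positive s" "s * s = b" "\<And>c. c * b = b * c \<Longrightarrow> c * s = s * c"
    by (rule unital_positive_root[OF assms(2)]) (rule that)
  have "b * r = r * b" using r(3)[of b] assms(3) by simp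
  then have rs: "r * s = s * r" using s(3)[of r] by simp
  have sa: "star r = r" "star s = s"
    by (rule unital_positive_self_adjoint[OF r(1)], rule unital_positive_self_adjoint[OF s(1)])
  have "(r * s) * (r * s) = r * (s * r) * s" by (simp only: mult.assoc)
  also have "\<dots> = a * b" unfolding rs[symmetric] r(2)[symmetric] s(2)[symmetric] by (simp only: mult.assoc)
  finally have eq: "a * b = (r * s) * (r * s)" by (rule sym)
  have "star (r * s) = r * s" by (simp only: star_mult sa) (rule rs[symmetric])
  with eq show ?thesis unfolding unital_positive_def by blast
qed


text \<open>
  The core of the theorem of Fukamiya, Kelley and Vaught. Away from \<open>0\<close>, \<open>c\<^sup>*c\<close> and \<open>cc\<^sup>*\<close> have
  the same spectrum, so the former cannot be negative and the latter positive. In place of spectra,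
  \<open>(t - cc\<^sup>*)\<^sup>n c = c (t + m)\<^sup>n\<close> is used: the left side is at most \<open>t\<^sup>n \<parallel>c\<parallel>\<close>, while the right
  side grows faster than that, by an arbitrary factor, unless \<open>m = 0\<close>.
\<close>

lemma neg_star_mult_self_eq_zero:
  fixes c :: "'a::{cstar_algebra,monoid_mult}"
  assumes neg: "star c * c = - m" and m: "unital_positive m"
  shows "c = 0"
proof -
  \<comment> \<open>The real and imaginary parts of \<open>c\<close>; \<open>c c\<^sup>* + c\<^sup>* c = 2 h\<^sup>2 + 2 k\<^sup>2\<close> shows that \<open>c c\<^sup>*\<close> is positive.\<close>
  define h where "h = (1/2) *\<^sub>R (c + star c)"
  define k where "k = (1/2) *\<^sub>R (- \<i>) *\<^sub>C (c - star c)"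
  define q where "q = c * star c"
  have h: "star h = h" by (simp add: h_def star_scaleR star_add star_star add.commute)
  have k: "star k = k"
    by (simp add: k_def star_scaleR star_scaleC star_diff star_star scaleC_diff_right scaleC_minus_left)
  have hh: "h * h = (1/4) *\<^sub>R ((c + star c) * (c + star c))" unfolding h_def mult_scaleR_left mult_scaleR_right by simp
  have kk: "k * k = - ((1/4) *\<^sub>R ((c - star c) * (c - star c)))"
    unfolding k_def scaleR_scaleC mult_scaleC_left mult_scaleC_right scaleC_scaleC
    by (simp add: scaleC_minus_left[symmetric])
  have "2 *\<^sub>R (h * h) + 2 *\<^sub>R (k * k)
      = (1/2) *\<^sub>R ((c + star c) * (c + star c) - (c - star c) * (c - star c))"
    unfolding hh kk by (simp add: scaleR_diff_right)
  also have "(c + star c) * (c + star c) - (c - star c) * (c - star c) = 2 *\<^sub>R (q + star c * c)"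
    by (simp add: q_def algebra_simps scaleR_2)
  finally have "q + star c * c = 2 *\<^sub>R (h * h) + 2 *\<^sub>R (k * k)" by simp
  then have "q = 2 *\<^sub>R (h * h) + 2 *\<^sub>R (k * k) + m" using neg by (simp add: algebra_simps)
  moreover have "unital_positive (h * h)" "unital_positive (k * k)"
    using h k by (auto simp: unital_positive_def)
  ultimately have q: "unital_positive q"
    by (simp add: unital_positive_add unital_positive_scaleR m)
  define t where "t = norm q + 1"
  have t: "t > 0" unfolding t_def by (rule add_nonneg_pos) simp_all
  define a where "a = t *\<^sub>R 1 - q"
  define b where "b = t *\<^sub>R 1 + m"
  have a: "norm a \<le> t" unfolding a_def using q by (intro unital_positive_norm) (auto simp: t_def)
  have "a * c = c * b"
    using neg by (simp add: a_def b_def q_def algebra_simps)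
  then have pow: "a ^ n * c = c * b ^ n" for n
    by (induction n) (simp, metis mult.assoc power_Suc power_Suc2)
  have an: "norm (a ^ n * c) \<le> t ^ n * norm c" for n
  proof (induction n)
    case (Suc n)
    have "norm (a ^ Suc n * c) \<le> norm a * norm (a ^ n * c)"
      using norm_mult_ineq[of a "a ^ n * c"] by (simp add: mult.assoc)
    also have "\<dots> \<le> t * (t ^ n * norm c)" by (intro mult_mono a Suc) (use t in auto)
    finally show ?case by (simp add: mult.assoc)
  qed simp
  have sb: "star b = b" by (simp add: b_def star_add star_scaleR unital_positive_self_adjoint m)
  have mb: "m * b = b * m" by (simp add: b_def algebra_simps)
  have mbn: "m * b ^ n = b ^ n * m" for n
    by (induction n) (simp, metis mb mult.assoc power_Suc)
  have sbn: "star (b ^ n) = b ^ n" for n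
    by (induction n) (simp_all add: star_mult sb power_commutes)
  have norm_sq: "norm (m * b ^ (2 * n)) \<le> t ^ (2 * n) * (norm c)\<^sup>2" for n
  proof -
    have "star (c * b ^ n) * (c * b ^ n) = b ^ n * (star c * c) * b ^ n"
      by (simp add: star_mult sbn mult.assoc)
    also have "\<dots> = - (m * b ^ (2 * n))"
      by (simp add: neg mbn[symmetric] mult_2 power_add mult.assoc)
    finally have "norm (m * b ^ (2 * n)) = (norm (a ^ n * c))\<^sup>2"
      using norm_star_mult_self[of "c * b ^ n"] pow[of n] by simp
    also have "\<dots> \<le> (t ^ n * norm c)\<^sup>2" by (rule power_mono[OF an]) simp
    finally show ?thesis by (simp add: power_mult_distrib power_mult mult.commute power_even_eq)
  qed
  have nm: "norm m = (norm c)\<^sup>2" using norm_star_mult_self[of c] neg by simp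
  \<comment> \<open>The first-order term of Bernoulli's inequality for \<open>(t + m)\<^sup>n\<close>.\<close>
  have bern: "\<exists>w. unital_positive w \<and> m * w = w * m \<and>
      b ^ Suc n = t ^ Suc n *\<^sub>R 1 + (real (Suc n) * t ^ n) *\<^sub>R m + w" for n
  proof (induction n)
    case 0
    show ?case
      by (rule exI[of _ 0]) (auto simp: b_def unital_positive_def intro: exI[of _ 0])
  next
    case (Suc n)
    then obtain w where w: "unital_positive w" "m * w = w * m"
      "b ^ Suc n = t ^ Suc n *\<^sub>R 1 + (real (Suc n) * t ^ n) *\<^sub>R m + w" by blast
    let ?w = "(real (Suc n) * t ^ n) *\<^sub>R (m * m) + t *\<^sub>R w + w * m"
    have "unital_positive (m * m)" "unital_positive (w * m)"
      using m w by (auto intro: unital_positive_mult_commuting)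
    then have "unital_positive ?w"
      using t w by (intro unital_positive_add unital_positive_scaleR) auto
    moreover have "m * (w * m) = w * m * m" using w(2) by (simp only: mult.assoc[symmetric])
    then have "m * ?w = ?w * m"
      using w(2) by (simp add: distrib_left distrib_right mult.assoc)
    moreover have "b ^ Suc (Suc n) = t ^ Suc (Suc n) *\<^sub>R 1 + (real (Suc (Suc n)) * t ^ Suc n) *\<^sub>R m + ?w"
      unfolding power_Suc2[of b "Suc n"] w(3)
      by (simp add: b_def algebra_simps) (simp add: scaleR_add_left[symmetric])
    ultimately show ?case by blast
  qed
  have "real (Suc n) * (norm m)\<^sup>2 \<le> t * norm m" if "odd n" for n
  proof -
    obtain w where w: "unital_positive w" "m * w = w * m"
      "b ^ Suc n = t ^ Suc n *\<^sub>R 1 + (real (Suc n) * t ^ n) *\<^sub>R m + w" using bern by blast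
    let ?c = "real (Suc n) * t ^ n"
    have "unital_positive (m * m)" "unital_positive (m * w)"
      using m w by (auto intro: unital_positive_mult_commuting)
    then have "norm (?c *\<^sub>R (m * m)) \<le> norm (?c *\<^sub>R (m * m) + (t ^ Suc n *\<^sub>R m + m * w))"
      using t m by (intro unital_positive_norm_mono unital_positive_add unital_positive_scaleR) auto
    also have "?c *\<^sub>R (m * m) + (t ^ Suc n *\<^sub>R m + m * w) = m * b ^ Suc n"
      unfolding w(3) by (simp add: algebra_simps)
    also have "norm (m * b ^ Suc n) \<le> t ^ Suc n * norm m"
      using norm_sq[of "Suc n div 2"] that nm by (simp add: dvd_mult_div_cancel)
    finally have "real (Suc n) * t ^ n * (norm m)\<^sup>2 \<le> t ^ Suc n * norm m"
      using t by (simp add: norm_eq_of_square_self_adjoint unital_positive_self_adjoint m)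
    then have "t ^ n * (real (Suc n) * (norm m)\<^sup>2) \<le> t ^ n * (t * norm m)"
      by (simp add: algebra_simps)
    then show ?thesis using t by (metis mult_le_cancel_left_pos zero_less_power)
  qed
  note key = this
  have "norm m = 0"
  proof (rule ccontr)
    assume "norm m \<noteq> 0"
    then have pos: "norm m > 0" by simp
    obtain N where N: "t / norm m < real N" using reals_Archimedean2 by blast
    have "real (Suc (2 * N + 1)) * (norm m)\<^sup>2 \<le> t * norm m" by (rule key) simp
    then have "real (Suc (2 * N + 1)) * norm m \<le> t"
      using pos by (simp add: power2_eq_square mult.assoc[symmetric])
    then have "real (Suc (2 * N + 1)) \<le> t / norm m" using pos by (simp add: pos_le_divide_eq)
    then show False using N by simp
  qed
  then show ?thesis using nm by simp
qed

text \<open>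
  With \<open>n\<close> the negative part of \<open>b\<^sup>*b\<close>, the element \<open>c = b n\<close> has \<open>c\<^sup>*c = - n\<^sup>3\<close>, whence \<open>c = 0\<close> and
  then \<open>n = 0\<close>.
\<close>

lemma unital_positive_star_mult_self:
  fixes b :: "'a::{cstar_algebra,monoid_mult}"
  shows "unital_positive (star b * b)"
proof -
  define h where "h = star b * b"
  have h: "star h = h" by (simp add: h_def star_mult star_star)
  then have hh: "unital_positive (h * h)" by (auto simp: unital_positive_def)
  \<comment> \<open>The absolute value of \<open>h\<close>, so that \<open>n = |h| - h\<close> below is twice the negative part.\<close>
  obtain g where g: "unital_positive g" "g * g = h * h"
    "\<And>c. c * (h * h) = h * h * c \<Longrightarrow> c * g = g * c"
    by (rule unital_positive_root[OF hh]) (rule that)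
  have gh: "h * g = g * h" by (rule g(3)) (simp add: mult.assoc)
  obtain r where r: "unital_positive r" "r * r = g" "\<And>c. c * g = g * c \<Longrightarrow> c * r = r * c"
    by (rule unital_positive_root[OF g(1)]) (rule that)
  define n where "n = g - h"
  have n: "star n = n" by (simp add: n_def star_diff h unital_positive_self_adjoint g)
  have nn: "n * n = 2 *\<^sub>R (g * n)" by (simp add: n_def algebra_simps gh g(2)[symmetric] scaleR_2)
  have hn: "n * h = - (n * n) + g * n" by (simp add: n_def algebra_simps gh g(2)[symmetric])
  have hn': "n * h * n = - (1/2) *\<^sub>R (n * n * n)"
  proof -
    have "n * h = (-1/2) *\<^sub>R (n * n)" unfolding hn nn by (simp add: scaleR_2)
    then show ?thesis by simp
  qed
  have "n * r = r * n" by (rule r(3)) (simp add: n_def algebra_simps gh)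
  then have "star (r * n) = r * n" by (simp add: star_mult n unital_positive_self_adjoint r)
  then have "unital_positive ((r * n) * (r * n))" by (auto simp: unital_positive_def)
  moreover have "(r * n) * (r * n) = g * n * n"
    using \<open>n * r = r * n\<close> by (metis mult.assoc r(2))
  ultimately have "unital_positive (g * n * n)" by simp
  moreover have "star (b * n) * (b * n) = - (g * n * n)"
  proof -
    have "star (b * n) * (b * n) = n * h * n" by (simp add: star_mult n h_def mult.assoc)
    also have "\<dots> = - (g * n * n)" unfolding hn' nn by simp
    finally show ?thesis .
  qed
  ultimately have "b * n = 0" using neg_star_mult_self_eq_zero by blast
  then have "h * n = 0" by (simp add: h_def mult.assoc)
  then have "n * n * n = 0" using hn' by (simp add: mult.assoc)
  then have "(n * n) * (n * n) = 0" by (metis mult.assoc mult_zero_left)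
  then have "norm (n * n) = 0"
    using norm_eq_of_square_self_adjoint[of "n * n"] by (simp add: star_mult n)
  then have "n = 0" using norm_eq_of_square_self_adjoint[OF n] by simp
  then show ?thesis using g(1) by (simp add: n_def h_def)
qed


section \<open>The multiplier algebra\<close>

lemma scaleC_scaleR: "c *\<^sub>C (r *\<^sub>R a) = r *\<^sub>R (c *\<^sub>C (a::'a::cstar_algebra))"
  by (simp add: scaleR_scaleC scaleC_scaleC mult.commute)

lemma bounded_linear_scaleC: "bounded_linear (\<lambda>a::'a::cstar_algebra. c *\<^sub>C a)"
  by (rule bounded_linear_intro[where K="cmod c"])
    (auto simp: scaleC_add_right scaleC_scaleR norm_scaleC)

lift_definition scaleC_blinfun :: "complex \<Rightarrow> 'a::cstar_algebra \<Rightarrow>\<^sub>L 'a" is "\<lambda>c a. c *\<^sub>C a"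
  by (rule bounded_linear_scaleC)

lift_definition mult_blinfun :: "'a::cstar_algebra \<Rightarrow> 'a \<Rightarrow>\<^sub>L 'a" is "\<lambda>a b. a * b"
  by (rule bounded_linear_mult_right)

text \<open>
  An algebra without unit is embedded, by left multiplication, into the algebra of its adjointable
  operators, which has a unit. An element is kept together with its adjoint, so that the involution
  is the swap and limits are taken in both components.
\<close>

typedef (overloaded) ('a::cstar_algebra) multiplier =
  "{(f :: 'a \<Rightarrow>\<^sub>L 'a, g :: 'a \<Rightarrow>\<^sub>L 'a). \<forall>x y. star (f x) * y = star x * g y}"
  by (rule exI[of _ "(0, 0)"]) simp

setup_lifting type_definition_multiplier

lemma adjoint_pair_swap:
  fixes f g :: "'a::cstar_algebra \<Rightarrow> 'a"
  assumes "\<forall>x y. star (f x) * y = star x * g y"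
  shows "star (g x) * y = star x * f y"
  by (metis assms star_mult star_star)

lemma adjoint_pair_norm_le:
  fixes f g :: "'a::cstar_algebra \<Rightarrow>\<^sub>L 'a"
  assumes "\<forall>x y. star (f x) * y = star x * g y"
  shows "norm f \<le> norm g"
proof (rule norm_blinfun_bound)
  fix x
  have "(norm (f x))\<^sup>2 = norm (star x * g (f x))"
    using norm_star_mult_self[of "f x"] assms by simp
  also have "\<dots> \<le> norm x * (norm g * norm (f x))"
    by (rule order_trans[OF norm_mult_ineq]) (simp add: mult_left_mono norm_blinfun)
  finally have "norm (f x) * norm (f x) \<le> (norm g * norm x) * norm (f x)"
    by (simp add: power2_eq_square mult_ac)
  then show "norm (f x) \<le> norm g * norm x"
    by (metis mult_right_le_imp_le norm_ge_zero order_le_less zero_le_mult_iff)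
qed simp

lemma adjoint_pair_norm_eq:
  fixes f g :: "'a::cstar_algebra \<Rightarrow>\<^sub>L 'a"
  assumes "\<forall>x y. star (f x) * y = star x * g y"
  shows "norm f = norm g"
  using adjoint_pair_norm_le[of f g] adjoint_pair_norm_le[of g f] adjoint_pair_swap[OF assms] assms
  by (intro order.antisym) auto

instantiation multiplier :: (cstar_algebra) real_vector
begin

lift_definition zero_multiplier :: "'a multiplier" is "(0, 0)" by simp

lift_definition plus_multiplier :: "'a multiplier \<Rightarrow> 'a multiplier \<Rightarrow> 'a multiplier"
  is "\<lambda>(f, g) (f', g'). (f + f', g + g')"
  by (auto simp: plus_blinfun.rep_eq star_add distrib_left distrib_right)

lift_definition uminus_multiplier :: "'a multiplier \<Rightarrow> 'a multiplier" is "\<lambda>(f, g). (- f, - g)"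
  by (auto simp: uminus_blinfun.rep_eq)

lift_definition minus_multiplier :: "'a multiplier \<Rightarrow> 'a multiplier \<Rightarrow> 'a multiplier"
  is "\<lambda>(f, g) (f', g'). (f - f', g - g')"
  by (auto simp: minus_blinfun.rep_eq star_diff left_diff_distrib right_diff_distrib)

lift_definition scaleR_multiplier :: "real \<Rightarrow> 'a multiplier \<Rightarrow> 'a multiplier"
  is "\<lambda>r (f, g). (r *\<^sub>R f, r *\<^sub>R g)"
  by (auto simp: scaleR_blinfun.rep_eq star_scaleR)

instance
  by standard (transfer; auto simp: algebra_simps)+

end

instantiation multiplier :: (cstar_algebra) real_normed_vector
begin

lift_definition norm_multiplier :: "'a multiplier \<Rightarrow> real" is "\<lambda>(f, g). norm f" .

definition sgn_multiplier :: "'a multiplier \<Rightarrow> 'a multiplier" where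
  "sgn_multiplier m = m /\<^sub>R norm m"

definition dist_multiplier :: "'a multiplier \<Rightarrow> 'a multiplier \<Rightarrow> real" where
  "dist_multiplier m n = norm (m - n)"

definition uniformity_multiplier :: "('a multiplier \<times> 'a multiplier) filter" where
  "uniformity_multiplier = (INF e\<in>{0<..}. principal {(x, y). dist x y < e})"

definition open_multiplier :: "'a multiplier set \<Rightarrow> bool" where
  "open_multiplier U \<longleftrightarrow> (\<forall>x\<in>U. eventually (\<lambda>(x', y). x' = x \<longrightarrow> y \<in> U) uniformity)"

instance
proof
  fix m n :: "'a multiplier" and r :: real
  show "norm m = 0 \<longleftrightarrow> m = 0"
    by transfer (use adjoint_pair_norm_eq in fastforce)
  show "norm (m + n) \<le> norm m + norm n" by transfer (auto intro: norm_triangle_ineq)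
  show "norm (r *\<^sub>R m) = \<bar>r\<bar> * norm m" by transfer auto
qed (simp_all add: sgn_multiplier_def dist_multiplier_def uniformity_multiplier_def open_multiplier_def)

end

instantiation multiplier :: (cstar_algebra) real_normed_algebra
begin

lift_definition times_multiplier :: "'a multiplier \<Rightarrow> 'a multiplier \<Rightarrow> 'a multiplier"
  is "\<lambda>(f, g) (f', g'). (f o\<^sub>L f', g' o\<^sub>L g)"
  by auto

instance
proof
  fix m n k :: "'a multiplier" and r :: real
  show "m * n * k = m * (n * k)" by transfer (auto intro!: blinfun_eqI)
  show "(m + n) * k = m * k + n * k"
    by transfer (auto intro!: blinfun_eqI simp: plus_blinfun.rep_eq blinfun.add_right)
  show "m * (n + k) = m * n + m * k"
    by transfer (auto intro!: blinfun_eqI simp: plus_blinfun.rep_eq blinfun.add_right)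
  show "r *\<^sub>R m * n = r *\<^sub>R (m * n)"
    by transfer (auto intro!: blinfun_eqI simp: scaleR_blinfun.rep_eq blinfun.scaleR_right)
  show "m * r *\<^sub>R n = r *\<^sub>R (m * n)"
    by transfer (auto intro!: blinfun_eqI simp: scaleR_blinfun.rep_eq blinfun.scaleR_right)
  show "norm (m * n) \<le> norm m * norm n" by transfer (auto intro: norm_blinfun_compose)
qed

end

lemma closed_adjoint_pairs:
  "closed {(f :: 'a::cstar_algebra \<Rightarrow>\<^sub>L 'a, g :: 'a \<Rightarrow>\<^sub>L 'a). \<forall>x y. star (f x) * y = star x * g y}"
proof -
  have eq: "{(f :: 'a \<Rightarrow>\<^sub>L 'a, g :: 'a \<Rightarrow>\<^sub>L 'a). \<forall>x y. star (f x) * y = star x * g y}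
      = (\<Inter>x. \<Inter>y. {p. star (blinfun_apply (fst p) x) * y = star x * blinfun_apply (snd p) y})"
    by auto
  have c: "continuous_on UNIV (\<lambda>a::'a. star a)"
    by (rule linear_continuous_on[OF bounded_linear_star])
  show ?thesis unfolding eq
    by (intro closed_INT ballI closed_Collect_eq continuous_intros continuous_on_compose2[OF c]) auto
qed

instance multiplier :: (cstar_algebra) banach
proof
  fix X :: "nat \<Rightarrow> 'a multiplier"
  assume X: "Cauchy X"
  have dist_fst: "dist (fst (Rep_multiplier m)) (fst (Rep_multiplier n)) = dist m n" for m n :: "'a multiplier"
    unfolding dist_norm by transfer auto
  have dist_snd: "dist (snd (Rep_multiplier m)) (snd (Rep_multiplier n)) = dist m n" for m n :: "'a multiplier"
  proof -
    have "\<forall>x y. star (fst (Rep_multiplier (m - n)) x) * y = star x * snd (Rep_multiplier (m - n)) y"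
      using Rep_multiplier[of "m - n"] by auto
    then have "norm (fst (Rep_multiplier (m - n))) = norm (snd (Rep_multiplier (m - n)))"
      by (rule adjoint_pair_norm_eq)
    then show ?thesis unfolding dist_norm by (simp add: minus_multiplier.rep_eq norm_multiplier.rep_eq split_beta)
  qed
  let ?f = "\<lambda>n. fst (Rep_multiplier (X n))" and ?g = "\<lambda>n. snd (Rep_multiplier (X n))"
  have "Cauchy ?f" "Cauchy ?g" using X by (simp_all add: Cauchy_def dist_fst dist_snd)
  then obtain f g where fg: "?f \<longlonglongrightarrow> f" "?g \<longlonglongrightarrow> g"
    using Cauchy_convergent convergent_def by metis
  have "(\<lambda>n. Rep_multiplier (X n)) \<longlonglongrightarrow> (f, g)" using tendsto_Pair[OF fg] by simp
  then have mem: "(f, g) \<in> {(f, g). \<forall>x y. star (blinfun_apply f x) * y = star x * blinfun_apply g y}"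
    by (rule closed_sequentially[OF closed_adjoint_pairs, rotated]) (rule Rep_multiplier)
  have "(\<lambda>n. dist (X n) (Abs_multiplier (f, g))) = (\<lambda>n. dist (?f n) f)"
    using Abs_multiplier_inverse[OF mem] by (simp add: dist_fst[symmetric])
  then have "X \<longlonglongrightarrow> Abs_multiplier (f, g)"
    using fg(1) tendsto_dist_iff by metis
  then show "convergent X" unfolding convergent_def by blast
qed

lemma eq_zero_of_star_mult: "(\<And>z. star z * a = 0) \<Longrightarrow> a = (0::'a::cstar_algebra)"
  using norm_star_mult_self[of a] by simp

lemma adjoint_pair_scaleC:
  fixes f g :: "'a::cstar_algebra \<Rightarrow> 'a"
  assumes "\<forall>x y. star (f x) * y = star x * g y"
  shows "g (c *\<^sub>C x) = c *\<^sub>C g x" "f (c *\<^sub>C x) = c *\<^sub>C f x"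
proof -
  have gen: "k (c *\<^sub>C x) = c *\<^sub>C k x" if "\<forall>x y. star (h x) * y = star x * k y" for h k :: "'a \<Rightarrow> 'a"
  proof -
    have "star z * (k (c *\<^sub>C x) - c *\<^sub>C k x) = 0" for z
      using that by (simp add: right_diff_distrib mult_scaleC_right that[rule_format, symmetric])
    then have "k (c *\<^sub>C x) - c *\<^sub>C k x = 0" by (rule eq_zero_of_star_mult)
    then show ?thesis by simp
  qed
  show "g (c *\<^sub>C x) = c *\<^sub>C g x" using gen[OF assms] .
  show "f (c *\<^sub>C x) = c *\<^sub>C f x" using gen[of g f] adjoint_pair_swap[OF assms] by blast
qed

lemma norm_scaleC_blinfun_compose:
  fixes f :: "'b::real_normed_vector \<Rightarrow>\<^sub>L 'a::cstar_algebra"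
  shows "norm (scaleC_blinfun c o\<^sub>L f) = cmod c * norm f"
proof (rule order.antisym)
  have le: "norm (scaleC_blinfun d o\<^sub>L h) \<le> cmod d * norm h" for d and h :: "'b \<Rightarrow>\<^sub>L 'a"
    by (rule norm_blinfun_bound)
      (auto simp: scaleC_blinfun.rep_eq norm_scaleC mult.assoc intro!: mult_left_mono norm_blinfun)
  show "norm (scaleC_blinfun c o\<^sub>L f) \<le> cmod c * norm f" by (rule le)
  show "cmod c * norm f \<le> norm (scaleC_blinfun c o\<^sub>L f)"
  proof (cases "c = 0")
    case False
    have "f = scaleC_blinfun (inverse c) o\<^sub>L (scaleC_blinfun c o\<^sub>L f)"
      using False by (intro blinfun_eqI) (simp add: scaleC_blinfun.rep_eq scaleC_scaleC)
    then have "norm f \<le> cmod (inverse c) * norm (scaleC_blinfun c o\<^sub>L f)" by (metis le)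
    then show ?thesis using False by (simp add: norm_divide field_simps)
  qed simp
qed

lemma norm_adjoint_pair_compose:
  fixes f g :: "'a::cstar_algebra \<Rightarrow>\<^sub>L 'a"
  assumes "\<forall>x y. star (f x) * y = star x * g y"
  shows "norm (g o\<^sub>L f) = (norm f)\<^sup>2"
proof (rule order.antisym)
  show "norm (g o\<^sub>L f) \<le> (norm f)\<^sup>2"
    using norm_blinfun_compose[of g f] adjoint_pair_norm_eq[OF assms] by (simp add: power2_eq_square)
  have "norm f \<le> sqrt (norm (g o\<^sub>L f))"
  proof (rule norm_blinfun_bound)
    fix x
    have "(norm (f x))\<^sup>2 = norm (star x * (g o\<^sub>L f) x)"
      using norm_star_mult_self[of "f x"] assms by simp
    also have "\<dots> \<le> norm x * (norm (g o\<^sub>L f) * norm x)"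
      by (rule order_trans[OF norm_mult_ineq])
        (simp only: norm_star, intro mult_left_mono norm_blinfun norm_ge_zero)
    also have "\<dots> = (sqrt (norm (g o\<^sub>L f)) * norm x)\<^sup>2"
      by (simp add: power_mult_distrib power2_eq_square[of "norm x"] mult_ac)
    finally show "norm (f x) \<le> sqrt (norm (g o\<^sub>L f)) * norm x"
      by (rule power2_le_imp_le) simp
  qed simp
  then have "(norm f)\<^sup>2 \<le> (sqrt (norm (g o\<^sub>L f)))\<^sup>2" by (rule power_mono) simp
  then show "(norm f)\<^sup>2 \<le> norm (g o\<^sub>L f)" by simp
qed

instantiation multiplier :: (cstar_algebra) cstar_algebra
begin

lift_definition scaleC_multiplier :: "complex \<Rightarrow> 'a multiplier \<Rightarrow> 'a multiplier"
  is "\<lambda>c (f, g). (scaleC_blinfun c o\<^sub>L f, scaleC_blinfun (cnj c) o\<^sub>L g)"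
  by (auto simp: scaleC_blinfun.rep_eq star_scaleC mult_scaleC_left mult_scaleC_right)

lift_definition star_multiplier :: "'a multiplier \<Rightarrow> 'a multiplier" is "\<lambda>(f, g). (g, f)"
  by (clarsimp, rule adjoint_pair_swap) blast

instance
proof
  fix m n :: "'a multiplier" and r :: real and c d :: complex
  show "r *\<^sub>R m = complex_of_real r *\<^sub>C m"
    by transfer (auto intro!: blinfun_eqI simp: scaleC_blinfun.rep_eq scaleR_blinfun.rep_eq scaleR_scaleC)
  show "c *\<^sub>C (m + n) = c *\<^sub>C m + c *\<^sub>C n"
    by transfer (auto intro!: blinfun_eqI simp: scaleC_blinfun.rep_eq plus_blinfun.rep_eq scaleC_add_right)
  show "(c + d) *\<^sub>C m = c *\<^sub>C m + d *\<^sub>C m"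
    by transfer (auto intro!: blinfun_eqI simp: scaleC_blinfun.rep_eq plus_blinfun.rep_eq scaleC_add_left)
  show "c *\<^sub>C d *\<^sub>C m = (c * d) *\<^sub>C m"
    by transfer (auto intro!: blinfun_eqI simp: scaleC_blinfun.rep_eq scaleC_scaleC)
  show "(c *\<^sub>C m) * n = c *\<^sub>C (m * n)"
    by transfer (auto intro!: blinfun_eqI simp: scaleC_blinfun.rep_eq adjoint_pair_scaleC)
  show "m * (c *\<^sub>C n) = c *\<^sub>C (m * n)"
    by (transfer, auto intro!: blinfun_eqI simp: scaleC_blinfun.rep_eq) (erule adjoint_pair_scaleC(2))
  show "norm (c *\<^sub>C m) = cmod c * norm m"
    by transfer (auto simp: norm_scaleC_blinfun_compose)
  show "star (m + n) = star m + star n" by transfer auto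
  show "star (c *\<^sub>C m) = cnj c *\<^sub>C star m" by transfer auto
  show "star (m * n) = star n * star m" by transfer auto
  show "star (star m) = m" by transfer auto
  show "norm (star m * m) = (norm m)\<^sup>2"
    by transfer (auto simp: norm_adjoint_pair_compose)
qed

end

instantiation multiplier :: (cstar_algebra) monoid_mult
begin

lift_definition one_multiplier :: "'a multiplier" is "(id_blinfun, id_blinfun)" by simp

instance
  by standard (transfer, auto intro!: blinfun_eqI)+

end

lift_definition left_mult :: "'a::cstar_algebra \<Rightarrow> 'a multiplier"
  is "\<lambda>a. (mult_blinfun a, mult_blinfun (star a))"
  by (simp add: mult_blinfun.rep_eq star_mult mult.assoc)

lemma left_mult_add: "left_mult (a + b) = left_mult a + left_mult b"
  by transfer (auto intro!: blinfun_eqI simp: mult_blinfun.rep_eq plus_blinfun.rep_eq distrib_right star_add)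

lemma left_mult_scaleR: "left_mult (r *\<^sub>R a) = r *\<^sub>R left_mult a"
  by transfer (auto intro!: blinfun_eqI simp: mult_blinfun.rep_eq scaleR_blinfun.rep_eq star_scaleR)

lemma left_mult_diff: "left_mult (a - b) = left_mult a - left_mult b"
  by transfer (auto intro!: blinfun_eqI simp: mult_blinfun.rep_eq minus_blinfun.rep_eq left_diff_distrib star_diff)

lemma left_mult_mult: "left_mult (a * b) = left_mult a * left_mult b"
  by transfer (auto intro!: blinfun_eqI simp: mult_blinfun.rep_eq star_mult mult.assoc)

lemma left_mult_star: "left_mult (star a) = star (left_mult a)"
  by transfer (auto simp: star_star)

lemma norm_left_mult [simp]: "norm (left_mult a) = norm a"
proof (transfer, clarsimp, rule order.antisym)
  fix a :: 'a
  show "norm (mult_blinfun a) \<le> norm a"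
    by (rule norm_blinfun_bound) (simp_all add: mult_blinfun.rep_eq norm_mult_ineq)
  have "norm a * norm a \<le> norm (mult_blinfun a) * norm a"
    using norm_blinfun[of "mult_blinfun a" "star a"]
    by (simp add: mult_blinfun.rep_eq norm_mult_star_self power2_eq_square)
  then show "norm a \<le> norm (mult_blinfun a)"
    by (metis mult_right_le_imp_le norm_ge_zero order_le_less)
qed

lemma left_mult_inject: "left_mult a = left_mult b \<longleftrightarrow> a = b"
  by (metis left_mult_diff norm_left_mult norm_eq_zero right_minus_eq)

text \<open>
  If \<open>g\<close> is the adjoint of the multiplier \<open>f\<close>, then \<open>a (f x) = (g a\<^sup>*)\<^sup>* x\<close>; so the algebra is an ideal.
\<close>

lemma left_mult_times_multiplier: "\<exists>b. left_mult a * m = left_mult b"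
proof (transfer, clarsimp)
  fix a :: 'a and f g :: "'a \<Rightarrow>\<^sub>L 'a"
  assume fg: "\<forall>x y. star (f x) * y = star x * g y"
  let ?b = "star (g (star a))"
  have "a * f x = ?b * x" for x
    using adjoint_pair_swap[OF fg, of "star a" x] by (simp add: star_star)
  moreover have "g (star a * x) = star ?b * x" for x
  proof -
    have "star z * (g (star a * x) - g (star a) * x) = 0" for z
      by (simp add: right_diff_distrib fg[rule_format, symmetric] mult.assoc[symmetric])
    then have "g (star a * x) - g (star a) * x = 0" by (rule eq_zero_of_star_mult)
    then show ?thesis by (simp add: star_star)
  qed
  ultimately have "mult_blinfun a o\<^sub>L f = mult_blinfun ?b \<and> g o\<^sub>L mult_blinfun (star a) = mult_blinfun (star ?b)"
    by (auto intro!: blinfun_eqI simp: mult_blinfun.rep_eq)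
  then show "\<exists>b. mult_blinfun a o\<^sub>L f = mult_blinfun b \<and> g o\<^sub>L mult_blinfun (star a) = mult_blinfun (star b)"
    by blast
qed

lemma closed_right_ideal_range_left_mult: "closed_right_ideal (range (left_mult :: 'a::cstar_algebra \<Rightarrow> _))"
  unfolding closed_right_ideal_def
proof (intro conjI ballI allI)
  have lin: "linear (left_mult :: 'a \<Rightarrow> _)"
    by (rule linearI) (simp_all add: left_mult_add left_mult_scaleR)
  then show "subspace (range (left_mult :: 'a \<Rightarrow> _))" by (rule linear_subspace_image) simp
  show "closed (range (left_mult :: 'a \<Rightarrow> _))"
  proof (rule complete_imp_closed, rule completeI)
    fix X assume X: "\<forall>n. X n \<in> range (left_mult :: 'a \<Rightarrow> _)" "Cauchy X"
    have "\<exists>a. X n = left_mult a" for n using X(1) by blast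
    then obtain a where a: "\<And>n. X n = left_mult (a n)" by metis
    have "Cauchy a" using X(2) by (simp add: a Cauchy_def dist_norm left_mult_diff[symmetric])
    then obtain l where "a \<longlonglongrightarrow> l" using Cauchy_convergent convergent_def by blast
    then have "X \<longlonglongrightarrow> left_mult l"
      by (simp add: a tendsto_dist_iff[of _ "left_mult l"] tendsto_dist_iff[of _ l] dist_norm
          left_mult_diff[symmetric])
    then show "\<exists>l\<in>range left_mult. X \<longlonglongrightarrow> l" by blast
  qed
next
  fix a and b :: "'a multiplier" assume "a \<in> range (left_mult :: 'a \<Rightarrow> _)"
  then show "a * b \<in> range left_mult" using left_mult_times_multiplier by (metis imageE rangeI)
qed


section \<open>The order of a C*-algebra\<close>

text \<open>
  Elements \<open>b\<^sup>* b\<close> are mapped to elements of the same form, which are positive. Conversely, the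
  positive root of \<open>left_mult a\<close> lies in the closed ideal that \<open>left_mult a\<close>
  belongs to, hence comes from the algebra itself.
\<close>

lemma cstar_positive_iff: "cstar_positive a \<longleftrightarrow> unital_positive (left_mult a)"
proof
  assume "cstar_positive a"
  then show "unital_positive (left_mult a)"
    by (auto simp: cstar_positive_def left_mult_mult left_mult_star intro: unital_positive_star_mult_self)
next
  assume pos: "unital_positive (left_mult a)"
  obtain r where r: "unital_positive r" "r * r = left_mult a"
    "\<And>J. \<lbrakk>closed_right_ideal J; left_mult a \<in> J\<rbrakk> \<Longrightarrow> r \<in> J"
    by (rule unital_positive_root[OF pos]) (rule that)
  obtain b where b: "r = left_mult b" using r(3)[OF closed_right_ideal_range_left_mult] by auto
  have "star (left_mult b) * left_mult b = left_mult a"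
    using r(1,2) b unital_positive_self_adjoint by metis
  then have "star b * b = a" by (simp add: left_mult_mult[symmetric] left_mult_star[symmetric] left_mult_inject)
  then show "cstar_positive a" unfolding cstar_positive_def by metis
qed

lemma cstar_positive_self_adjoint: "cstar_positive a \<Longrightarrow> star a = a"
  by (auto simp: cstar_positive_def star_mult star_star)

lemma cstar_positive_star_mult_self: "cstar_positive (star b * b)"
  by (auto simp: cstar_positive_def)

lemma cstar_positive_zero [simp]: "cstar_positive 0"
  unfolding cstar_positive_def by (rule exI[of _ 0]) simp

lemma cstar_positive_add: "cstar_positive a \<Longrightarrow> cstar_positive b \<Longrightarrow> cstar_positive (a + b)"
  by (simp add: cstar_positive_iff left_mult_add unital_positive_add)

lemma cstar_positive_sum: "(\<And>i. i \<in> I \<Longrightarrow> cstar_positive (f i)) \<Longrightarrow> cstar_positive (sum f I)"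
  by (induction I rule: infinite_finite_induct) (auto intro: cstar_positive_add)

lemma cstar_positive_scaleR: "cstar_positive a \<Longrightarrow> c \<ge> 0 \<Longrightarrow> cstar_positive (c *\<^sub>R a)"
  by (simp add: cstar_positive_iff left_mult_scaleR unital_positive_scaleR)

lemma cstar_positive_norm_mono:
  assumes "cstar_positive a" "cstar_positive (b - a)"
  shows "norm a \<le> norm b"
  using unital_positive_norm_mono[of "left_mult a" "left_mult (b - a)"] assms
  by (simp add: cstar_positive_iff left_mult_add[symmetric])

lemma cstar_positive_conjugate_le:
  assumes "star a = a" "norm a \<le> t"
  shows "cstar_positive (t *\<^sub>R (star c * c) - star c * a * c)"
proof -
  have "unital_positive (t *\<^sub>R 1 - left_mult a)"
    by (rule unital_positive_scale_minus) (simp_all add: assms left_mult_star[symmetric])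
  then obtain r where r: "star r = r" "t *\<^sub>R 1 - left_mult a = r * r"
    by (auto simp: unital_positive_def)
  have "left_mult (t *\<^sub>R (star c * c) - star c * a * c)
      = star (left_mult c) * (t *\<^sub>R 1 - left_mult a) * left_mult c"
    by (simp add: left_mult_diff left_mult_mult left_mult_scaleR left_mult_star algebra_simps)
  also have "\<dots> = star (r * left_mult c) * (r * left_mult c)"
    by (simp add: r star_mult mult.assoc)
  finally show ?thesis by (simp add: cstar_positive_iff unital_positive_star_mult_self)
qed

lemma cstar_positive_antisym: "cstar_positive a \<Longrightarrow> cstar_positive (- a) \<Longrightarrow> a = 0"
  using cstar_positive_norm_mono[of a 0] by simp


section \<open>Norm and topology of a Hilbert module\<close>

definition hsub :: "('a::cstar_algebra, 'e) hmodule \<Rightarrow> 'e \<Rightarrow> 'e \<Rightarrow> 'e" where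
  "hsub M x y = hadd M x (hscale M (- 1) y)"

definition hlim :: "('a::cstar_algebra, 'e) hmodule \<Rightarrow> (nat \<Rightarrow> 'e) \<Rightarrow> 'e \<Rightarrow> bool" where
  "hlim M X x \<longleftrightarrow> (\<lambda>n. hnorm M (hsub M (X n) x)) \<longlonglongrightarrow> 0"

lemma tendsto_zero_le:
  fixes f g :: "nat \<Rightarrow> real"
  shows "g \<longlonglongrightarrow> 0 \<Longrightarrow> (\<And>n. 0 \<le> f n) \<Longrightarrow> (\<And>n. f n \<le> g n) \<Longrightarrow> f \<longlonglongrightarrow> 0"
  by (rule tendsto_sandwich[OF _ _ tendsto_const]) auto

text \<open>
  Operators defined on a whole module are handled as functions together with an adjoint, which
  already forces them to be linear.
\<close>

definition adj_pair ::
  "('a::cstar_algebra, 'e) hmodule \<Rightarrow> ('a, 'f) hmodule \<Rightarrow> ('e \<Rightarrow> 'f) \<Rightarrow> ('f \<Rightarrow> 'e) \<Rightarrow> bool" where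
  "adj_pair M N T S \<longleftrightarrow> (\<forall>x\<in>hcarrier M. T x \<in> hcarrier N) \<and> (\<forall>y\<in>hcarrier N. S y \<in> hcarrier M) \<and>
    (\<forall>x\<in>hcarrier M. \<forall>y\<in>hcarrier N. hinner N (T x) y = hinner M x (S y))"

lemma adj_pairD:
  assumes "adj_pair M N T S"
  shows "x \<in> hcarrier M \<Longrightarrow> T x \<in> hcarrier N" "y \<in> hcarrier N \<Longrightarrow> S y \<in> hcarrier M"
    "x \<in> hcarrier M \<Longrightarrow> y \<in> hcarrier N \<Longrightarrow> hinner N (T x) y = hinner M x (S y)"
  using assms by (auto simp: adj_pair_def)

text \<open>
  The algebraic core of the Cauchy-Schwarz inequality: the assumption is the positivity of the form
  at \<open>x a - t y\<close>, where \<open>p\<close>, \<open>a\<close>, \<open>q\<close> are its values at \<open>(x, x)\<close>, \<open>(x, y)\<close>, \<open>(y, y)\<close>. For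
  \<open>t\<close> slightly above \<open>\<parallel>p\<parallel>\<close> this vector plays the part of the projection of \<open>y\<close> to \<open>x\<close>.
\<close>

lemma norm_square_le_of_form:
  fixes p a q :: "'a::cstar_algebra"
  assumes p: "star p = p"
    and pos: "\<And>t::real. cstar_positive (star a * (p * a - t *\<^sub>R a) - t *\<^sub>R (star a * a - t *\<^sub>R q))"
  shows "(norm a)\<^sup>2 \<le> norm p * norm q"
proof -
  have bound: "(norm a)\<^sup>2 \<le> (norm p + e) * norm q" if "e > 0" for e
  proof -
    define t where "t = norm p + e"
    have t: "t > 0" using that by (simp add: t_def add_nonneg_pos)
    have "cstar_positive (t *\<^sub>R (star a * a) - star a * p * a)"
      using p that by (intro cstar_positive_conjugate_le) (simp_all add: t_def)
    then have "cstar_positive (t *\<^sub>R (star a * a) - star a * p * a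
        + (star a * (p * a - t *\<^sub>R a) - t *\<^sub>R (star a * a - t *\<^sub>R q)))"
      by (intro cstar_positive_add pos)
    then have "cstar_positive ((1 / t) *\<^sub>R (t *\<^sub>R (star a * a) - star a * p * a
        + (star a * (p * a - t *\<^sub>R a) - t *\<^sub>R (star a * a - t *\<^sub>R q))))"
      by (rule cstar_positive_scaleR) (use t in simp)
    also have "t *\<^sub>R (star a * a) - star a * p * a
        + (star a * (p * a - t *\<^sub>R a) - t *\<^sub>R (star a * a - t *\<^sub>R q))
      = t *\<^sub>R (t *\<^sub>R q - star a * a)"
      by (simp only: scaleR_diff_right right_diff_distrib mult_scaleR_right mult.assoc) simp
    also have "(1 / t) *\<^sub>R (t *\<^sub>R (t *\<^sub>R q - star a * a)) = t *\<^sub>R q - star a * a"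
      using t by (subst scaleR_scaleR) simp
    finally have "norm (star a * a) \<le> norm (t *\<^sub>R q)"
      by (intro cstar_positive_norm_mono cstar_positive_star_mult_self)
    then show ?thesis using t by (simp add: norm_star_mult_self flip: t_def)
  qed
  have "(\<lambda>n. (norm p + inverse (real (Suc n))) * norm q) \<longlonglongrightarrow> (norm p + 0) * norm q"
    by (intro tendsto_intros LIMSEQ_inverse_real_of_nat)
  then have "(norm a)\<^sup>2 \<le> (norm p + 0) * norm q"
    by (rule LIMSEQ_le_const) (use bound in auto)
  then show ?thesis by simp
qed

context hilbert_module
begin

declare zero_closed [simp] add_closed [simp] scale_closed [simp] act_closed [simp]
  inner_add [simp] inner_scale [simp] inner_act [simp]

lemma sub_closed [simp]: "x \<in> hcarrier M \<Longrightarrow> y \<in> hcarrier M \<Longrightarrow> hsub M x y \<in> hcarrier M"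
  by (simp add: hsub_def)

lemma inner_add_left [simp]:
  "\<lbrakk>x \<in> hcarrier M; y \<in> hcarrier M; z \<in> hcarrier M\<rbrakk>
    \<Longrightarrow> hinner M (hadd M x y) z = hinner M x z + hinner M y z"
  using inner_star[of z "hadd M x y"] inner_star[of z x] inner_star[of z y] by (simp add: star_add)

lemma inner_scale_left [simp]:
  "\<lbrakk>x \<in> hcarrier M; y \<in> hcarrier M\<rbrakk> \<Longrightarrow> hinner M (hscale M c x) y = cnj c *\<^sub>C hinner M x y"
  using inner_star[of y "hscale M c x"] inner_star[of y x] by (simp add: star_scaleC)

lemma inner_act_left [simp]:
  "\<lbrakk>x \<in> hcarrier M; y \<in> hcarrier M\<rbrakk> \<Longrightarrow> hinner M (hact M x a) y = star a * hinner M x y"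
  using inner_star[of y "hact M x a"] inner_star[of y x] by (simp add: star_mult)

lemma inner_sub [simp]:
  "\<lbrakk>x \<in> hcarrier M; y \<in> hcarrier M; z \<in> hcarrier M\<rbrakk>
    \<Longrightarrow> hinner M x (hsub M y z) = hinner M x y - hinner M x z"
  by (simp add: hsub_def)

lemma inner_sub_left [simp]:
  "\<lbrakk>x \<in> hcarrier M; y \<in> hcarrier M; z \<in> hcarrier M\<rbrakk>
    \<Longrightarrow> hinner M (hsub M x y) z = hinner M x z - hinner M y z"
  by (simp add: hsub_def)

lemma inner_zero_right [simp]: "x \<in> hcarrier M \<Longrightarrow> hinner M x (hzero M) = 0"
  using inner_add[of x "hzero M" "hzero M"] by (simp add: add_zero)

lemma inner_zero_left [simp]: "x \<in> hcarrier M \<Longrightarrow> hinner M (hzero M) x = 0"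
  using inner_star[of x "hzero M"] by simp

lemma scale_zero: "x \<in> hcarrier M \<Longrightarrow> hscale M 0 x = hzero M"
  by (rule inner_definite) simp_all

text \<open>Equations between elements reduce in this way to equations in the algebra.\<close>

lemma inner_ext:
  assumes "x \<in> hcarrier M" "y \<in> hcarrier M" "\<And>z. z \<in> hcarrier M \<Longrightarrow> hinner M z x = hinner M z y"
  shows "x = y"
proof -
  have "hsub M x y = hzero M"
    by (rule inner_definite) (simp_all add: assms)
  then have "hadd M (hadd M x (hscale M (-1) y)) y = hadd M (hzero M) y" by (simp add: hsub_def)
  moreover have "hadd M (hadd M x (hscale M (-1) y)) y = x"
  proof -
    have "hadd M (hscale M (-1) y) y = hscale M (-1 + 1) y"
      by (subst scale_add_left) (simp_all add: assms scale_one)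
    then show ?thesis using assms by (simp add: add_assoc scale_zero add_zero)
  qed
  moreover have "hadd M (hzero M) y = y" using assms by (simp add: add_commute[of "hzero M"] add_zero)
  ultimately show ?thesis by simp
qed

lemma sub_eq_zero_iff:
  "x \<in> hcarrier M \<Longrightarrow> y \<in> hcarrier M \<Longrightarrow> hsub M x y = hzero M \<longleftrightarrow> x = y"
proof
  assume c: "x \<in> hcarrier M" "y \<in> hcarrier M" and "hsub M x y = hzero M"
  then have "hinner M z (hsub M x y) = 0" if "z \<in> hcarrier M" for z using that by simp
  then show "x = y" using c by (intro inner_ext) auto
qed (auto intro: inner_definite)

lemma add_sub_cancel:
  "x \<in> hcarrier M \<Longrightarrow> y \<in> hcarrier M \<Longrightarrow> hadd M y (hsub M x y) = x"
  by (rule inner_ext) auto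

lemma hnorm_nonneg [simp]: "0 \<le> hnorm M x"
  by (simp add: hnorm_def)

lemma hnorm_power2: "(hnorm M x)\<^sup>2 = norm (hinner M x x)"
  by (simp add: hnorm_def)

lemma hnorm_zero [simp]: "hnorm M (hzero M) = 0"
  by (simp add: hnorm_def)

lemma hnorm_eq_zero_iff: "x \<in> hcarrier M \<Longrightarrow> hnorm M x = 0 \<longleftrightarrow> x = hzero M"
  using inner_definite by (auto simp: hnorm_def)

lemma hnorm_le_of_order:
  "cstar_positive (hinner N y y - hinner M x x) \<Longrightarrow> x \<in> hcarrier M \<Longrightarrow> hnorm M x \<le> hnorm N y"
  unfolding hnorm_def by (intro real_sqrt_le_mono cstar_positive_norm_mono inner_positive)

text \<open>
  For the form \<open>(x, y) \<mapsto> \<langle>x, B y\<rangle>\<close> of a positive operator, which may be degenerate.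
\<close>

lemma cauchy_schwarz_positive:
  assumes B: "adj_pair M M B B" and pos: "\<And>x. x \<in> hcarrier M \<Longrightarrow> cstar_positive (hinner M x (B x))"
    and x: "x \<in> hcarrier M" and y: "y \<in> hcarrier M"
  shows "(norm (hinner M x (B y)))\<^sup>2 \<le> norm (hinner M x (B x)) * norm (hinner M y (B y))"
proof -
  define p a q where "p = hinner M x (B x)" and "a = hinner M x (B y)" and "q = hinner M y (B y)"
  note cl = adj_pairD[OF B]
  have a': "hinner M y (B x) = star a"
    unfolding a_def using cl x y inner_star[of "B x" y] inner_star[of x "B y"] cl(3)[of x y] by metis
  have "(norm a)\<^sup>2 \<le> norm p * norm q"
  proof (rule norm_square_le_of_form)
    show "star p = p" unfolding p_def by (rule cstar_positive_self_adjoint[OF pos[OF x]])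
    fix t :: real
    let ?z = "hsub M (hact M x a) (hscale M (complex_of_real t) y)"
    have z: "?z \<in> hcarrier M" using x y by simp
    have Bz: "hinner M w (B ?z) = hinner M w (B x) * a - t *\<^sub>R hinner M w (B y)" if "w \<in> hcarrier M" for w
    proof -
      have "hinner M w (B ?z) = hinner M (B w) ?z" using cl(3)[of w ?z] that z by simp
      also have "\<dots> = hinner M (B w) x * a - t *\<^sub>R hinner M (B w) y"
        using x y that cl by (simp add: scaleR_scaleC)
      finally show ?thesis using cl that x y by simp
    qed
    have "hinner M ?z (B ?z) = star a * hinner M x (B ?z) - t *\<^sub>R hinner M y (B ?z)"
      using x y cl(1)[OF z] by (simp add: scaleR_scaleC)
    then have "hinner M ?z (B ?z) = star a * (p * a - t *\<^sub>R a) - t *\<^sub>R (star a * a - t *\<^sub>R q)"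
      using x y by (simp add: Bz a' p_def[symmetric] a_def[symmetric] q_def[symmetric])
    then show "cstar_positive (star a * (p * a - t *\<^sub>R a) - t *\<^sub>R (star a * a - t *\<^sub>R q))"
      using pos[OF z] by simp
  qed
  then show ?thesis by (simp add: p_def a_def q_def)
qed

lemma cauchy_schwarz:
  assumes "x \<in> hcarrier M" "y \<in> hcarrier M"
  shows "norm (hinner M x y) \<le> hnorm M x * hnorm M y"
proof -
  have "(norm (hinner M x y))\<^sup>2 \<le> norm (hinner M x x) * norm (hinner M y y)"
    using cauchy_schwarz_positive[of "\<lambda>x. x" x y] assms by (simp add: adj_pair_def inner_positive)
  also have "\<dots> = (hnorm M x * hnorm M y)\<^sup>2" by (simp add: power_mult_distrib hnorm_power2)
  finally show ?thesis by (rule power2_le_imp_le) simp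
qed

lemma hnorm_triangle:
  assumes "x \<in> hcarrier M" "y \<in> hcarrier M"
  shows "hnorm M (hadd M x y) \<le> hnorm M x + hnorm M y"
proof (rule power2_le_imp_le)
  have "(hnorm M (hadd M x y))\<^sup>2 = norm (hinner M x x + hinner M x y + (hinner M y x + hinner M y y))"
    using assms by (simp add: hnorm_power2 algebra_simps)
  also have "\<dots> \<le> norm (hinner M x x) + norm (hinner M x y) + (norm (hinner M y x) + norm (hinner M y y))"
    by (intro norm_triangle_le add_mono order_refl)
  also have "\<dots> \<le> (hnorm M x)\<^sup>2 + hnorm M x * hnorm M y + (hnorm M y * hnorm M x + (hnorm M y)\<^sup>2)"
    using assms cauchy_schwarz by (intro add_mono) (auto simp: hnorm_power2)
  also have "\<dots> = (hnorm M x + hnorm M y)\<^sup>2" by (simp add: power2_eq_square algebra_simps)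
  finally show "(hnorm M (hadd M x y))\<^sup>2 \<le> (hnorm M x + hnorm M y)\<^sup>2" .
qed simp

lemma hnorm_scale: "x \<in> hcarrier M \<Longrightarrow> hnorm M (hscale M c x) = cmod c * hnorm M x"
  by (simp add: hnorm_def scaleC_scaleC norm_scaleC norm_mult real_sqrt_mult)

lemma hnorm_act: "x \<in> hcarrier M \<Longrightarrow> hnorm M (hact M x a) \<le> hnorm M x * norm a"
proof (rule power2_le_imp_le)
  assume "x \<in> hcarrier M"
  then have "(hnorm M (hact M x a))\<^sup>2 = norm (star a * (hinner M x x * a))"
    by (simp add: hnorm_power2 mult.assoc)
  also have "\<dots> \<le> norm a * (norm (hinner M x x) * norm a)"
    by (rule order_trans[OF norm_mult_ineq]) (simp add: mult_left_mono norm_mult_ineq)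
  finally show "(hnorm M (hact M x a))\<^sup>2 \<le> (hnorm M x * norm a)\<^sup>2"
    by (simp add: power_mult_distrib hnorm_power2) (simp add: power2_eq_square mult_ac)
qed simp

lemma hnorm_sub_commute:
  assumes "x \<in> hcarrier M" "y \<in> hcarrier M"
  shows "hnorm M (hsub M x y) = hnorm M (hsub M y x)"
proof -
  have "hsub M x y = hscale M (-1) (hsub M y x)" using assms by (intro inner_ext) auto
  then show ?thesis using assms by (simp add: hnorm_scale)
qed

lemma hnorm_sub_triangle:
  assumes "x \<in> hcarrier M" "y \<in> hcarrier M" "z \<in> hcarrier M"
  shows "hnorm M (hsub M x z) \<le> hnorm M (hsub M x y) + hnorm M (hsub M y z)"
proof -
  have "hsub M x z = hadd M (hsub M x y) (hsub M y z)" using assms by (intro inner_ext) auto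
  then show ?thesis using assms hnorm_triangle by simp
qed

lemma hnorm_le_add_sub:
  assumes "x \<in> hcarrier M" "y \<in> hcarrier M"
  shows "hnorm M x \<le> hnorm M y + hnorm M (hsub M x y)"
proof -
  have "hnorm M (hadd M y (hsub M x y)) \<le> hnorm M y + hnorm M (hsub M x y)"
    using assms by (intro hnorm_triangle) auto
  then show ?thesis using assms by (simp add: add_sub_cancel)
qed

sublocale metric: Metric_space "hcarrier M" "hdist M"
proof
  show "0 \<le> hdist M x y" for x y by (simp add: hdist_def hnorm_def)
  show "hdist M x y = hdist M y x" for x y
    using hnorm_sub_commute by (simp add: hdist_def hsub_def)
  show "hdist M x y = 0 \<longleftrightarrow> x = y" if "x \<in> hcarrier M" "y \<in> hcarrier M" for x y
    using that sub_eq_zero_iff[of x y] hnorm_eq_zero_iff[of "hsub M x y"]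
    by (simp add: hdist_def hsub_def)
  show "hdist M x z \<le> hdist M x y + hdist M y z"
    if "x \<in> hcarrier M" "y \<in> hcarrier M" "z \<in> hcarrier M" for x y z
    using that hnorm_sub_triangle[of x y z] by (simp add: hdist_def hsub_def)
qed

lemma hdist_eq: "x \<in> hcarrier M \<Longrightarrow> y \<in> hcarrier M \<Longrightarrow> hdist M x y = hnorm M (hsub M x y)"
  by (simp add: hdist_def hsub_def)

lemma htopology_eq: "htopology M = metric.mtopology"
  by (simp add: htopology_def)

lemma in_mball_iff: "x \<in> hcarrier M \<Longrightarrow> y \<in> metric.mball x e \<longleftrightarrow> y \<in> hcarrier M \<and> hnorm M (hsub M x y) < e"
  by (auto simp: hdist_eq)

lemma Cauchy_has_limit:
  assumes X: "\<And>n. X n \<in> hcarrier M"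
    and C: "\<And>e. e > 0 \<Longrightarrow> \<exists>N. \<forall>m\<ge>N. \<forall>n\<ge>m. hnorm M (hsub M (X n) (X m)) < e"
  obtains x where "x \<in> hcarrier M" "hlim M X x"
proof -
  have "metric.MCauchy X"
    unfolding metric.MCauchy_def
  proof (intro conjI allI impI)
    fix e :: real assume "e > 0"
    then obtain N where N: "\<And>m n. m \<ge> N \<Longrightarrow> n \<ge> m \<Longrightarrow> hnorm M (hsub M (X n) (X m)) < e"
      using C by blast
    have "hdist M (X n) (X m) < e" if "m \<ge> N" "n \<ge> N" for m n
      using N[of m n] N[of n m] that X hnorm_sub_commute[of "X m" "X n"]
      by (cases "m \<le> n") (auto simp: hdist_eq)
    then show "\<exists>N. \<forall>n n'. N \<le> n \<longrightarrow> N \<le> n' \<longrightarrow> hdist M (X n) (X n') < e" by blast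
  qed (use X in auto)
  then obtain x where "limitin metric.mtopology X x sequentially"
    using complete by (auto simp: metric.mcomplete_def)
  then have "x \<in> hcarrier M \<and> (\<forall>e>0. \<exists>N. \<forall>n\<ge>N. X n \<in> hcarrier M \<and> hdist M (X n) x < e)"
    by (simp add: metric.limit_metric_sequentially)
  then have x: "x \<in> hcarrier M" and lim: "\<And>e. e > 0 \<Longrightarrow> \<exists>N. \<forall>n\<ge>N. hdist M (X n) x < e"
    by blast+
  have "hlim M X x"
    unfolding hlim_def
  proof (rule LIMSEQ_I)
    fix e :: real assume "e > 0"
    then show "\<exists>N. \<forall>n\<ge>N. norm (hnorm M (hsub M (X n) x) - 0) < e"
      using lim[of e] x X by (auto simp: hdist_eq)
  qed
  then show thesis using that x by blast
qed

lemma hclosure_iff: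
  "S \<subseteq> hcarrier M \<Longrightarrow>
    x \<in> hclosure M S \<longleftrightarrow> x \<in> hcarrier M \<and> (\<forall>e>0. \<exists>y\<in>S. hnorm M (hsub M x y) < e)"
  unfolding hclosure_def htopology_eq metric.metric_closure_of
  by (auto simp: hdist_eq subset_iff) (metis hdist_eq)

lemma hclosure_sequence:
  assumes "S \<subseteq> hcarrier M" "x \<in> hclosure M S"
  obtains X where "\<And>n. X n \<in> S" "hlim M X x"
proof -
  have x: "x \<in> hcarrier M" using assms hclosure_iff by blast
  have "\<exists>y\<in>S. hnorm M (hsub M x y) < inverse (real (Suc n))" for n
    using assms hclosure_iff[OF assms(1), of x] by simp
  then obtain X where X: "\<And>n. X n \<in> S" "\<And>n. hnorm M (hsub M x (X n)) < inverse (real (Suc n))" by metis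
  have "hnorm M (hsub M (X n) x) \<le> inverse (real (Suc n))" for n
    using X[of n] assms x hnorm_sub_commute[of "X n" x] by (auto simp: subset_iff)
  then have "hlim M X x"
    unfolding hlim_def by (intro tendsto_zero_le[OF LIMSEQ_inverse_real_of_nat] hnorm_nonneg)
  then show thesis using that X by blast
qed

lemma hclosureI:
  assumes S: "S \<subseteq> hcarrier M" and x: "x \<in> hcarrier M" and X: "\<And>n. X n \<in> S" "hlim M X x"
  shows "x \<in> hclosure M S"
  unfolding hclosure_iff[OF S]
proof (intro conjI allI impI x)
  fix e :: real assume "e > 0"
  then obtain n where "hnorm M (hsub M (X n) x) < e"
    using LIMSEQ_D[OF X(2)[unfolded hlim_def]] by fastforce
  then show "\<exists>y\<in>S. hnorm M (hsub M x y) < e"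
    using X(1)[of n] S x hnorm_sub_commute[of "X n" x] by (metis subsetD)
qed

lemma hclosure_subset: "hclosure M S \<subseteq> hcarrier M"
  unfolding hclosure_def htopology_eq by (metis closure_of_subset_topspace metric.topspace_mtopology)

lemma subset_hclosure: "S \<subseteq> hcarrier M \<Longrightarrow> S \<subseteq> hclosure M S"
  unfolding hclosure_def htopology_eq by (simp add: closure_of_subset)

lemma hclosure_mono: "S \<subseteq> T \<Longrightarrow> hclosure M S \<subseteq> hclosure M T"
  unfolding hclosure_def by (rule closure_of_mono)

lemma hclosure_hclosure: "hclosure M (hclosure M S) = hclosure M S"
  unfolding hclosure_def by (rule closure_of_closure_of)

lemma hclosure_minimal: "S \<subseteq> hclosure M T \<Longrightarrow> hclosure M S \<subseteq> hclosure M T"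
  using hclosure_mono hclosure_hclosure by blast

lemma hlim_unique:
  assumes "hlim M X x" "hlim M X y" "\<And>n. X n \<in> hcarrier M" "x \<in> hcarrier M" "y \<in> hcarrier M"
  shows "x = y"
proof -
  have "(\<lambda>n. hnorm M (hsub M (X n) x) + hnorm M (hsub M (X n) y)) \<longlonglongrightarrow> 0 + 0"
    using assms(1,2) unfolding hlim_def by (rule tendsto_add)
  moreover have "hnorm M (hsub M x y) \<le> hnorm M (hsub M (X n) x) + hnorm M (hsub M (X n) y)" for n
    using hnorm_sub_triangle[of x "X n" y] hnorm_sub_commute[of x "X n"] assms by simp
  ultimately have "hnorm M (hsub M x y) \<le> 0 + 0" by (intro LIMSEQ_le_const) auto
  then show ?thesis
    using assms hnorm_eq_zero_iff[of "hsub M x y"] sub_eq_zero_iff[of x y] hnorm_nonneg[of "hsub M x y"]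
    by (simp add: order_le_less)
qed

lemma hlim_inner:
  assumes "hlim M X x" "\<And>n. X n \<in> hcarrier M" "x \<in> hcarrier M" "z \<in> hcarrier M"
  shows "(\<lambda>n. hinner M z (X n)) \<longlonglongrightarrow> hinner M z x"
proof -
  have "(\<lambda>n. hnorm M z * hnorm M (hsub M (X n) x)) \<longlonglongrightarrow> hnorm M z * 0"
    using assms(1) unfolding hlim_def by (rule tendsto_mult_left)
  then have lim: "(\<lambda>n. hnorm M z * hnorm M (hsub M (X n) x)) \<longlonglongrightarrow> 0" by simp
  have "norm (hinner M z (X n) - hinner M z x) \<le> hnorm M z * hnorm M (hsub M (X n) x)" for n
    using cauchy_schwarz[of z "hsub M (X n) x"] assms by simp
  then have "(\<lambda>n. norm (hinner M z (X n) - hinner M z x)) \<longlonglongrightarrow> 0"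
    by (intro tendsto_zero_le[OF lim] norm_ge_zero)
  then have "(\<lambda>n. hinner M z (X n) - hinner M z x) \<longlonglongrightarrow> 0" by (rule tendsto_norm_zero_cancel)
  then show ?thesis by (rule LIM_zero_cancel)
qed

lemma hlim_inner_left:
  assumes "hlim M X x" "\<And>n. X n \<in> hcarrier M" "x \<in> hcarrier M" "z \<in> hcarrier M"
  shows "(\<lambda>n. hinner M (X n) z) \<longlonglongrightarrow> hinner M x z"
  using tendsto_star[OF hlim_inner[OF assms]] assms by (simp add: inner_star[symmetric])

lemma hlim_add:
  assumes "hlim M X x" "hlim M Y y" "\<And>n. X n \<in> hcarrier M" "\<And>n. Y n \<in> hcarrier M"
    "x \<in> hcarrier M" "y \<in> hcarrier M"
  shows "hlim M (\<lambda>n. hadd M (X n) (Y n)) (hadd M x y)"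
proof -
  have "hnorm M (hsub M (hadd M (X n) (Y n)) (hadd M x y))
      \<le> hnorm M (hsub M (X n) x) + hnorm M (hsub M (Y n) y)" for n
  proof -
    have "hsub M (hadd M (X n) (Y n)) (hadd M x y) = hadd M (hsub M (X n) x) (hsub M (Y n) y)"
      using assms by (intro inner_ext) auto
    then show ?thesis using assms hnorm_triangle by simp
  qed
  then show ?thesis
    using tendsto_add[OF assms(1,2)[unfolded hlim_def]] unfolding hlim_def add_0_right
    by (intro tendsto_zero_le[of "\<lambda>n. hnorm M (hsub M (X n) x) + hnorm M (hsub M (Y n) y)", OF _ hnorm_nonneg])
qed

lemma hlim_bounded_map:
  assumes "hlim M X x" "\<And>n. X n \<in> hcarrier M" "x \<in> hcarrier M"
    and "\<And>z. z \<in> hcarrier M \<Longrightarrow> hnorm N (hsub N (f z) (f x)) \<le> K * hnorm M (hsub M z x)"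
    and "hilbert_module N"
  shows "hlim N (\<lambda>n. f (X n)) (f x)"
proof -
  have "(\<lambda>n. K * hnorm M (hsub M (X n) x)) \<longlonglongrightarrow> K * 0"
    using assms(1) unfolding hlim_def by (rule tendsto_mult_left)
  then have lim: "(\<lambda>n. K * hnorm M (hsub M (X n) x)) \<longlonglongrightarrow> 0" by simp
  show ?thesis unfolding hlim_def
    by (intro tendsto_zero_le[OF lim] hilbert_module.hnorm_nonneg[OF assms(5)] assms(2,4))
qed

lemma hlim_scale:
  assumes "hlim M X x" "\<And>n. X n \<in> hcarrier M" "x \<in> hcarrier M"
  shows "hlim M (\<lambda>n. hscale M c (X n)) (hscale M c x)"
proof (rule hlim_bounded_map[OF assms, where K="cmod c"])
  fix z assume "z \<in> hcarrier M"
  then have "hsub M (hscale M c z) (hscale M c x) = hscale M c (hsub M z x)"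
    using assms by (intro inner_ext) (auto simp: scaleC_diff_right)
  then show "hnorm M (hsub M (hscale M c z) (hscale M c x)) \<le> cmod c * hnorm M (hsub M z x)"
    using \<open>z \<in> _\<close> assms by (simp add: hnorm_scale)
qed (rule hilbert_module_axioms)

lemma hlim_act:
  assumes "hlim M X x" "\<And>n. X n \<in> hcarrier M" "x \<in> hcarrier M"
  shows "hlim M (\<lambda>n. hact M (X n) a) (hact M x a)"
proof (rule hlim_bounded_map[OF assms, where K="norm a"])
  fix z assume "z \<in> hcarrier M"
  then have "hsub M (hact M z a) (hact M x a) = hact M (hsub M z x) a"
    using assms by (intro inner_ext) (auto simp: left_diff_distrib)
  then show "hnorm M (hsub M (hact M z a) (hact M x a)) \<le> norm a * hnorm M (hsub M z x)"
    using \<open>z \<in> _\<close> assms hnorm_act[of "hsub M z x" a] by (simp add: mult.commute)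
qed (rule hilbert_module_axioms)

lemma hlim_const: "x \<in> hcarrier M \<Longrightarrow> hlim M (\<lambda>n. x) x"
  using sub_eq_zero_iff[of x x] by (simp add: hlim_def)

lemma hsubmoduleD:
  assumes "hsubmodule M S"
  shows "S \<subseteq> hcarrier M" "x \<in> S \<Longrightarrow> x \<in> hcarrier M" "hzero M \<in> S"
    "x \<in> S \<Longrightarrow> y \<in> S \<Longrightarrow> hadd M x y \<in> S" "x \<in> S \<Longrightarrow> hscale M c x \<in> S"
    "x \<in> S \<Longrightarrow> hact M x a \<in> S" "x \<in> S \<Longrightarrow> y \<in> S \<Longrightarrow> hsub M x y \<in> S"
  using assms by (auto simp: hsubmodule_def hsub_def)

lemma hsubmodule_hclosure:
  assumes "hsubmodule M S"
  shows "hsubmodule M (hclosure M S)"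
proof -
  note S = hsubmoduleD[OF assms]
  have cl: "\<And>x. x \<in> hclosure M S \<Longrightarrow> x \<in> hcarrier M" using hclosure_subset by blast
  show ?thesis
    unfolding hsubmodule_def
  proof (intro conjI ballI allI)
    show "hclosure M S \<subseteq> hcarrier M" by (rule hclosure_subset)
    show "hzero M \<in> hclosure M S" using S(1,3) subset_hclosure by blast
    fix x assume x: "x \<in> hclosure M S"
    obtain X where X: "\<And>n. X n \<in> S" "hlim M X x" using hclosure_sequence[OF S(1) x] by blast
    have Xc: "\<And>n. X n \<in> hcarrier M" using X S by blast
    show "hscale M c x \<in> hclosure M S" for c
      by (rule hclosureI[OF S(1) _ _ hlim_scale[OF X(2) Xc]]) (use cl x X S in auto)
    show "hact M x a \<in> hclosure M S" for a
      by (rule hclosureI[OF S(1) _ _ hlim_act[OF X(2) Xc]]) (use cl x X S in auto)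
    fix y assume y: "y \<in> hclosure M S"
    obtain Y where Y: "\<And>n. Y n \<in> S" "hlim M Y y" using hclosure_sequence[OF S(1) y] by blast
    have Yc: "\<And>n. Y n \<in> hcarrier M" using Y S by blast
    show "hadd M x y \<in> hclosure M S"
      by (rule hclosureI[OF S(1) _ _ hlim_add[OF X(2) Y(2) Xc Yc]]) (use cl x y X Y S in auto)
  qed
qed

lemma orthogonal_hclosure:
  assumes "S \<subseteq> hcarrier M" "x \<in> hclosure M S" "z \<in> hcarrier M" "\<And>s. s \<in> S \<Longrightarrow> hinner M s z = 0"
  shows "hinner M x z = 0"
proof -
  obtain X where X: "\<And>n. X n \<in> S" "hlim M X x" using hclosure_sequence[OF assms(1,2)] by blast
  have "(\<lambda>n. hinner M (X n) z) \<longlonglongrightarrow> hinner M x z"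
    using X assms subsetD[OF hclosure_subset assms(2)] by (intro hlim_inner_left) auto
  then show ?thesis using X assms by (simp add: LIMSEQ_const_iff)
qed

lemma dense_ext:
  assumes "hdense M D" "x \<in> hcarrier M" "y \<in> hcarrier M" "\<And>d. d \<in> D \<Longrightarrow> hinner M d x = hinner M d y"
  shows "x = y"
proof (rule inner_ext)
  fix z assume z: "z \<in> hcarrier M"
  have D: "D \<subseteq> hcarrier M" "hclosure M D = hcarrier M" using assms(1) by (auto simp: hdense_def)
  have "hinner M z (hsub M x y) = 0"
    by (rule orthogonal_hclosure[OF D(1)]) (use assms D z in \<open>auto simp: subset_iff\<close>)
  then show "hinner M z x = hinner M z y" using assms z by simp
qed (use assms in auto)

lemma hdense_iff:
  "hdense M D \<longleftrightarrow> D \<subseteq> hcarrier M \<and> (\<forall>x\<in>hcarrier M. \<forall>e>0. \<exists>d\<in>D. hnorm M (hsub M x d) < e)"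
  unfolding hdense_def using hclosure_iff[of D] hclosure_subset[of D] by blast

end

text \<open>
  Products of balls form a base of the product topology, which turns closedness of the graph
  into a statement on norms.
\<close>

lemma closed_operator_iff:
  assumes "hilbert_module M" "hilbert_module N"
  shows "closed_operator M N t \<longleftrightarrow>
    (\<forall>x y. t x = Some y \<longrightarrow> x \<in> hcarrier M \<and> y \<in> hcarrier N) \<and>
    (\<forall>x\<in>hcarrier M. \<forall>y\<in>hcarrier N. (\<forall>e>0. \<exists>x' y'. t x' = Some y' \<and>
      hnorm M (hsub M x x') < e \<and> hnorm N (hsub N y y') < e) \<longrightarrow> t x = Some y)"
    (is "_ \<longleftrightarrow> ?sub \<and> ?lim")
proof -
  interpret M: hilbert_module M by fact
  interpret N: hilbert_module N by fact
  let ?X = "prod_topology (htopology M) (htopology N)"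
  have top: "topspace ?X = hcarrier M \<times> hcarrier N"
    by (simp add: M.htopology_eq N.htopology_eq)
  have sub: "Map.graph t \<subseteq> topspace ?X \<longleftrightarrow> ?sub" unfolding top by (auto simp: Map.graph_def)
  have clos: "(x, y) \<in> ?X closure_of Map.graph t \<longleftrightarrow> x \<in> hcarrier M \<and> y \<in> hcarrier N \<and>
      (\<forall>e>0. \<exists>x' y'. t x' = Some y' \<and> hnorm M (hsub M x x') < e \<and> hnorm N (hsub N y y') < e)"
    (is "_ \<longleftrightarrow> _ \<and> _ \<and> ?eps") if ?sub for x y
  proof (intro iffI conjI)
    assume c: "(x, y) \<in> ?X closure_of Map.graph t"
    then have "(x, y) \<in> topspace ?X" by (simp only: in_closure_of)
    then show x: "x \<in> hcarrier M" and y: "y \<in> hcarrier N" unfolding top by auto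
    show ?eps
    proof (intro allI impI)
      fix e :: real assume e: "e > 0"
      let ?U = "M.metric.mball x e \<times> N.metric.mball y e"
      have open_U: "openin ?X ?U"
        by (simp add: openin_prod_Times_iff M.htopology_eq N.htopology_eq)
      have mem: "(x, y) \<in> ?U" using x y e by simp
      have "\<forall>T. (x, y) \<in> T \<and> openin ?X T \<longrightarrow> (\<exists>p. p \<in> Map.graph t \<and> p \<in> T)"
        using c unfolding in_closure_of by (rule conjunct2)
      from this[rule_format, OF conjI[OF mem open_U]]
      obtain p where "p \<in> Map.graph t" "p \<in> ?U" by (elim exE conjE)
      then show "\<exists>x' y'. t x' = Some y' \<and> hnorm M (hsub M x x') < e \<and> hnorm N (hsub N y y') < e"
        using M.in_mball_iff[OF x] N.in_mball_iff[OF y] unfolding Map.graph_def by blast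
    qed
  next
    assume r: "x \<in> hcarrier M \<and> y \<in> hcarrier N \<and> ?eps"
    show "(x, y) \<in> ?X closure_of Map.graph t"
      unfolding in_closure_of
    proof (intro conjI allI impI)
      show "(x, y) \<in> topspace ?X" using r unfolding top by simp
      fix T assume T: "(x, y) \<in> T \<and> openin ?X T"
      then obtain U V where UV: "openin (htopology M) U" "openin (htopology N) V" "x \<in> U" "y \<in> V" "U \<times> V \<subseteq> T"
        unfolding openin_prod_topology_alt by metis
      obtain d1 d2 where d: "d1 > 0" "M.metric.mball x d1 \<subseteq> U" "d2 > 0" "N.metric.mball y d2 \<subseteq> V"
        using UV unfolding M.htopology_eq N.htopology_eq M.metric.openin_mtopology N.metric.openin_mtopology
        by metis
      then obtain x' y' where xy: "t x' = Some y'" "hnorm M (hsub M x x') < min d1 d2" "hnorm N (hsub N y y') < min d1 d2"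
        using r by (metis min_less_iff_conj)
      have "x' \<in> hcarrier M" "y' \<in> hcarrier N" using xy(1) that by blast+
      then have "x' \<in> M.metric.mball x d1" "y' \<in> N.metric.mball y d2"
        using xy(2,3) r by (simp_all add: M.hdist_eq N.hdist_eq)
      then have "(x', y') \<in> U \<times> V" using d by blast
      then show "\<exists>p. p \<in> Map.graph t \<and> p \<in> T" using UV xy by (auto simp: Map.graph_def)
    qed
  qed
  have "closed_operator M N t \<longleftrightarrow> Map.graph t \<subseteq> topspace ?X \<and> ?X closure_of Map.graph t \<subseteq> Map.graph t"
    unfolding closed_operator_def
    by (metis closedin_subset closure_of_subset_eq)
  also have "\<dots> \<longleftrightarrow> ?sub \<and> ?lim"
  proof (cases ?sub)
    case True
    have "?X closure_of Map.graph t \<subseteq> Map.graph t \<longleftrightarrow> (\<forall>x y. (x, y) \<in> ?X closure_of Map.graph t \<longrightarrow> t x = Some y)"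
      by (auto simp: Map.graph_def)
    also have "\<dots> \<longleftrightarrow> ?lim" unfolding clos[OF True] by blast
    finally show ?thesis using sub True by blast
  next
    case False
    then show ?thesis using sub by blast
  qed
  finally show ?thesis .
qed


section \<open>Adjointable operators and square roots\<close>

definition contractive ::
  "('a::cstar_algebra, 'e) hmodule \<Rightarrow> ('a, 'f) hmodule \<Rightarrow> ('e \<Rightarrow> 'f) \<Rightarrow> bool" where
  "contractive M N T \<longleftrightarrow> (\<forall>x\<in>hcarrier M. hnorm N (T x) \<le> hnorm M x)"

definition form_positive :: "('a::cstar_algebra, 'e) hmodule \<Rightarrow> ('e \<Rightarrow> 'e) \<Rightarrow> bool" where
  "form_positive M B \<longleftrightarrow> (\<forall>x\<in>hcarrier M. cstar_positive (hinner M x (B x)))"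

text \<open>
  The two properties by which the values \<open>R\<close> of a functional calculus at \<open>P\<close> are used: \<open>R\<close>
  commutes with the operators that commute with \<open>P\<close>, and closed invariant submodules of \<open>P\<close>
  are invariant under \<open>R\<close>.
\<close>

definition function_of ::
  "('a::cstar_algebra, 'e) hmodule \<Rightarrow> ('e \<Rightarrow> 'e) \<Rightarrow> ('e \<Rightarrow> 'e) \<Rightarrow> bool" where
  "function_of M P R \<longleftrightarrow>
    (\<forall>C D. adj_pair M M C D \<and> (\<forall>x\<in>hcarrier M. C (P x) = P (C x)) \<longrightarrow>
      (\<forall>x\<in>hcarrier M. C (R x) = R (C x))) \<and>
    (\<forall>K. hsubmodule M K \<and> hclosure M K \<subseteq> K \<and> (\<forall>x\<in>K. P x \<in> K) \<longrightarrow> (\<forall>x\<in>K. R x \<in> K))"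

locale adjoint_ops = M: hilbert_module M + N: hilbert_module N
  for M :: "('a::cstar_algebra, 'e) hmodule" and N :: "('a, 'f) hmodule" +
  fixes T :: "'e \<Rightarrow> 'f" and S :: "'f \<Rightarrow> 'e"
  assumes adj: "adj_pair M N T S"
begin

lemma closed [simp]: "x \<in> hcarrier M \<Longrightarrow> T x \<in> hcarrier N"
  using adj by (simp add: adj_pair_def)

lemma adjoint_closed [simp]: "y \<in> hcarrier N \<Longrightarrow> S y \<in> hcarrier M"
  using adj by (simp add: adj_pair_def)

lemma inner: "x \<in> hcarrier M \<Longrightarrow> y \<in> hcarrier N \<Longrightarrow> hinner N (T x) y = hinner M x (S y)"
  using adj by (simp add: adj_pair_def)

lemma inner_right: "x \<in> hcarrier M \<Longrightarrow> y \<in> hcarrier N \<Longrightarrow> hinner N y (T x) = hinner M (S y) x"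
  by (metis M.inner_star N.inner_star adjoint_closed closed inner)

lemma add: "x \<in> hcarrier M \<Longrightarrow> y \<in> hcarrier M \<Longrightarrow> T (hadd M x y) = hadd N (T x) (T y)"
  by (rule N.inner_ext) (simp_all add: inner_right)

lemma scale: "x \<in> hcarrier M \<Longrightarrow> T (hscale M c x) = hscale N c (T x)"
  by (rule N.inner_ext) (simp_all add: inner_right)

lemma act: "x \<in> hcarrier M \<Longrightarrow> T (hact M x a) = hact N (T x) a"
  by (rule N.inner_ext) (simp_all add: inner_right)

lemma sub: "x \<in> hcarrier M \<Longrightarrow> y \<in> hcarrier M \<Longrightarrow> T (hsub M x y) = hsub N (T x) (T y)"
  by (rule N.inner_ext) (simp_all add: inner_right)

lemma zero: "T (hzero M) = hzero N"
  by (rule N.inner_ext) (simp_all add: inner_right)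

lemma swap: "adj_pair N M S T"
  unfolding adj_pair_def by (auto simp: inner_right)

lemma image_submodule: "hsubmodule N (T ` hcarrier M)"
  unfolding hsubmodule_def
proof (intro conjI ballI allI)
  show "hzero N \<in> T ` hcarrier M" using zero M.zero_closed by (metis imageI)
qed (auto simp: add[symmetric] scale[symmetric] act[symmetric])

lemma adjoint_contraction:
  assumes "contractive M N T"
  shows "contractive N M S"
  unfolding contractive_def
proof
  fix y assume y: "y \<in> hcarrier N"
  have "(hnorm M (S y))\<^sup>2 = norm (hinner N (T (S y)) y)"
    using y by (simp add: M.hnorm_power2 inner)
  also have "\<dots> \<le> hnorm N (T (S y)) * hnorm N y" using y by (intro N.cauchy_schwarz) auto
  also have "\<dots> \<le> hnorm M (S y) * hnorm N y"
    using assms y by (intro mult_right_mono) (auto simp: contractive_def)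
  finally have "hnorm M (S y) * hnorm M (S y) \<le> hnorm M (S y) * hnorm N y"
    by (simp add: power2_eq_square)
  then show "hnorm M (S y) \<le> hnorm N y"
    using M.hnorm_nonneg[of "S y"] N.hnorm_nonneg[of y]
    by (metis mult_le_cancel_left_pos order_le_less)
qed

end

primrec op_sqrt_iterate ::
  "('a::cstar_algebra, 'e) hmodule \<Rightarrow> ('e \<Rightarrow> 'e) \<Rightarrow> nat \<Rightarrow> 'e \<Rightarrow> 'e" where
  "op_sqrt_iterate M P 0 x = hzero M"
| "op_sqrt_iterate M P (Suc n) x =
    hscale M (1/2) (hadd M (P x) (op_sqrt_iterate M P n (op_sqrt_iterate M P n x)))"

text \<open>
  The operators \<open>Y n\<close> converge at each vector, to \<open>L = 1 - sqrt (1 - P)\<close>.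
\<close>

locale self_adjoint_contraction = adjoint_ops M M P P
  for M :: "('a::cstar_algebra, 'e) hmodule" and P +
  assumes contractive: "contractive M M P"
begin

lemma contraction: "x \<in> hcarrier M \<Longrightarrow> hnorm M (P x) \<le> hnorm M x"
  using contractive by (simp add: contractive_def)

abbreviation "Y \<equiv> op_sqrt_iterate M P"

lemma iterate_closed [simp]: "x \<in> hcarrier M \<Longrightarrow> Y n x \<in> hcarrier M"
  by (induction n arbitrary: x) simp_all

lemma iterate_inner: "x \<in> hcarrier M \<Longrightarrow> y \<in> hcarrier M \<Longrightarrow> hinner M (Y n x) y = hinner M x (Y n y)"
  by (induction n arbitrary: x y) (simp_all add: inner)

sublocale iterate: adjoint_ops M M "Y n" "Y n" for n
  by unfold_locales (auto simp: adj_pair_def iterate_inner)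

lemma iterate_norm: "x \<in> hcarrier M \<Longrightarrow> hnorm M (Y n x) \<le> sqrt_majorant n * hnorm M x"
proof (induction n arbitrary: x)
  case (Suc n)
  have "hnorm M (hadd M (P x) (Y n (Y n x))) \<le> hnorm M (P x) + hnorm M (Y n (Y n x))"
    using Suc by (intro M.hnorm_triangle) auto
  also have "\<dots> \<le> hnorm M x + sqrt_majorant n * (sqrt_majorant n * hnorm M x)"
    using Suc contraction sqrt_majorant_bounds[of n]
    by (intro add_mono order_trans[OF Suc.IH] mult_left_mono) auto
  finally show ?case using Suc
    by (simp add: M.hnorm_scale power2_eq_square algebra_simps)
qed simp

lemma iterate_step:
  "x \<in> hcarrier M \<Longrightarrow> hnorm M (hsub M (Y (Suc n) x) (Y n x)) \<le> (sqrt_majorant (Suc n) - sqrt_majorant n) * hnorm M x"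
proof (induction n arbitrary: x)
  case 0
  have "hsub M (Y (Suc 0) x) (Y 0 x) = hscale M (1/2) (P x)"
    using 0 by (intro M.inner_ext) auto
  then show ?case using 0 contraction by (simp add: M.hnorm_scale)
next
  case (Suc n)
  let ?y = "sqrt_majorant (Suc n)" and ?z = "sqrt_majorant n"
  let ?d = "hsub M (Y (Suc n) x) (Y n x)"
  let ?e = "hsub M (Y (Suc n) (Y n x)) (Y n (Y n x))"
  note Y_Suc = op_sqrt_iterate.simps(2)
  have c: "?d \<in> hcarrier M" "?e \<in> hcarrier M"
    using Suc.prems iterate_closed by (simp_all del: Y_Suc)
  have "hsub M (Y (Suc (Suc n)) x) (Y (Suc n) x) = hscale M (1/2) (hadd M (Y (Suc n) ?d) ?e)"
  proof (rule M.inner_ext)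
    fix z assume z: "z \<in> hcarrier M"
    have "hinner M z (Y (Suc (Suc n)) x) = (1/2) *\<^sub>C (hinner M z (P x) + hinner M z (Y (Suc n) (Y (Suc n) x)))"
      using Suc.prems z iterate_closed by (simp only: Y_Suc[of M P "Suc n"]) (simp del: Y_Suc)
    moreover have "hinner M z (Y (Suc n) x) = (1/2) *\<^sub>C (hinner M z (P x) + hinner M z (Y n (Y n x)))"
      using Suc.prems z iterate_closed by (simp only: Y_Suc[of M P "n"]) (simp del: Y_Suc)
    ultimately show "hinner M z (hsub M (Y (Suc (Suc n)) x) (Y (Suc n) x))
        = hinner M z (hscale M (1/2) (hadd M (Y (Suc n) ?d) ?e))"
      using Suc.prems z c iterate_closed iterate.sub[of "Y (Suc n) x" "Y n x" "Suc n"]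
      by (simp del: Y_Suc add: scaleC_diff_right scaleC_add_right)
  qed (use Suc.prems c iterate_closed in \<open>simp_all del: Y_Suc\<close>)
  then have "2 * hnorm M (hsub M (Y (Suc (Suc n)) x) (Y (Suc n) x)) = hnorm M (hadd M (Y (Suc n) ?d) ?e)"
    using c iterate_closed by (simp add: M.hnorm_scale del: Y_Suc)
  also have "\<dots> \<le> hnorm M (Y (Suc n) ?d) + hnorm M ?e"
    using c iterate_closed by (intro M.hnorm_triangle) (simp_all del: Y_Suc)
  also have "\<dots> \<le> ?y * ((?y - ?z) * hnorm M x) + (?y - ?z) * (?z * hnorm M x)"
  proof (rule add_mono)
    have "hnorm M (Y (Suc n) ?d) \<le> ?y * hnorm M ?d" by (rule iterate_norm[OF c(1)])
    also have "\<dots> \<le> ?y * ((?y - ?z) * hnorm M x)"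
      using Suc.IH[OF Suc.prems] sqrt_majorant_bounds[of "Suc n"] by (intro mult_left_mono) blast+
    finally show "hnorm M (Y (Suc n) ?d) \<le> ?y * ((?y - ?z) * hnorm M x)" .
    have "hnorm M ?e \<le> (?y - ?z) * hnorm M (Y n x)" using Suc.IH[of "Y n x"] Suc.prems iterate_closed by blast
    also have "\<dots> \<le> (?y - ?z) * (?z * hnorm M x)"
      using iterate_norm[OF Suc.prems] sqrt_majorant_step[of n] by (intro mult_left_mono) auto
    finally show "hnorm M ?e \<le> (?y - ?z) * (?z * hnorm M x)" .
  qed
  also have "\<dots> = 2 * ((sqrt_majorant (Suc (Suc n)) - ?y) * hnorm M x)"
  proof -
    have "2 * sqrt_majorant (Suc (Suc n)) = 1 + ?y\<^sup>2" by (simp only: sqrt_majorant.simps(2)[of "Suc n"]) simp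
    moreover have "2 * ?y = 1 + ?z\<^sup>2" by simp
    ultimately have "2 * (sqrt_majorant (Suc (Suc n)) - ?y) = ?y\<^sup>2 - ?z\<^sup>2" by (simp only: right_diff_distrib)
    then have "2 * ((sqrt_majorant (Suc (Suc n)) - ?y) * hnorm M x) = (?y\<^sup>2 - ?z\<^sup>2) * hnorm M x"
      by (simp only: mult.assoc[symmetric])
    then show ?thesis by (simp only:) (simp add: power2_eq_square algebra_simps del: sqrt_majorant.simps)
  qed
  finally show ?case by linarith
qed

lemma iterate_diff:
  assumes x: "x \<in> hcarrier M" and "m \<le> n"
  shows "hnorm M (hsub M (Y n x) (Y m x)) \<le> (sqrt_majorant n - sqrt_majorant m) * hnorm M x"
  using assms(2)
proof (induction n rule: dec_induct)
  case base
  have "hsub M (Y m x) (Y m x) = hzero M" using M.sub_eq_zero_iff x by simp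
  then show ?case by simp
next
  case (step n)
  have "hnorm M (hsub M (Y (Suc n) x) (Y m x))
      \<le> hnorm M (hsub M (Y (Suc n) x) (Y n x)) + hnorm M (hsub M (Y n x) (Y m x))"
    by (rule M.hnorm_sub_triangle) (use x iterate_closed in blast)+
  also have "\<dots> \<le> (sqrt_majorant (Suc n) - sqrt_majorant n) * hnorm M x + (sqrt_majorant n - sqrt_majorant m) * hnorm M x"
    using step iterate_step[OF x, of n] by (intro add_mono) blast+
  finally show ?case by (simp add: algebra_simps)
qed

lemma iterate_limit_exists: "x \<in> hcarrier M \<Longrightarrow> \<exists>y\<in>hcarrier M. hlim M (\<lambda>n. Y n x) y"
proof -
  assume x: "x \<in> hcarrier M"
  have "\<exists>N. \<forall>m\<ge>N. \<forall>n\<ge>m. hnorm M (hsub M (Y n x) (Y m x)) < e" if e: "e > 0" for e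
  proof -
    have p: "hnorm M x + 1 > 0" using M.hnorm_nonneg[of x] by linarith
    then obtain N where N: "\<forall>m\<ge>N. \<forall>n\<ge>m. sqrt_majorant n - sqrt_majorant m < e / (hnorm M x + 1)"
      using sqrt_majorant_Cauchy[of "e / (hnorm M x + 1)"] e by auto
    have "hnorm M (hsub M (Y n x) (Y m x)) < e" if mn: "m \<ge> N" "n \<ge> m" for m n
    proof -
      have "hnorm M (hsub M (Y n x) (Y m x)) \<le> (sqrt_majorant n - sqrt_majorant m) * (hnorm M x + 1)"
        using iterate_diff[OF x mn(2)] sqrt_majorant_mono[OF mn(2)]
        by (smt (verit) mult_left_mono)
      also have "\<dots> < e" using N mn p by (simp add: pos_less_divide_eq)
      finally show ?thesis .
    qed
    then show ?thesis by blast
  qed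
  then obtain y where "y \<in> hcarrier M" "hlim M (\<lambda>n. Y n x) y"
    using M.Cauchy_has_limit[of "\<lambda>n. Y n x"] x iterate_closed by blast
  then show ?thesis by blast
qed

definition L where "L x = (SOME y. y \<in> hcarrier M \<and> hlim M (\<lambda>n. Y n x) y)"

lemma L: "x \<in> hcarrier M \<Longrightarrow> L x \<in> hcarrier M" "x \<in> hcarrier M \<Longrightarrow> hlim M (\<lambda>n. Y n x) (L x)"
  unfolding L_def using someI_ex[OF iterate_limit_exists[unfolded Bex_def]] by blast+

lemma L_inner_lim:
  assumes "x \<in> hcarrier M" "z \<in> hcarrier M"
  shows "(\<lambda>n. hinner M z (Y n x)) \<longlonglongrightarrow> hinner M z (L x)"
  using assms L iterate_closed by (intro M.hlim_inner) auto

lemma L_self_adjoint: "adj_pair M M L L"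
  unfolding adj_pair_def
proof (intro conjI ballI)
  fix x y assume xy: "x \<in> hcarrier M" "y \<in> hcarrier M"
  have "(\<lambda>n. star (hinner M y (Y n x))) \<longlonglongrightarrow> star (hinner M y (L x))"
    by (intro tendsto_star L_inner_lim xy)
  moreover have "star (hinner M y (Y n x)) = hinner M x (Y n y)" for n
    using xy iterate_closed by (simp add: M.inner_star[symmetric] iterate_inner)
  moreover have "star (hinner M y (L x)) = hinner M (L x) y" using xy L by (simp add: M.inner_star[symmetric])
  ultimately show "hinner M (L x) y = hinner M x (L y)"
    using LIMSEQ_unique[OF _ L_inner_lim[OF xy(2,1)]] by simp
qed (use L in auto)

lemma L_norm: "x \<in> hcarrier M \<Longrightarrow> hnorm M (L x) \<le> hnorm M x"
proof -
  assume x: "x \<in> hcarrier M"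
  have "hnorm M (L x) \<le> hnorm M x + hnorm M (hsub M (Y n x) (L x))" for n
  proof -
    have "hnorm M (Y n x) \<le> 1 * hnorm M x"
      by (rule order_trans[OF iterate_norm[OF x]]) (use sqrt_majorant_bounds[of n] in \<open>simp add: mult_left_le_one_le\<close>)
    then show ?thesis
      using M.hnorm_le_add_sub[of "L x" "Y n x"] M.hnorm_sub_commute[of "L x" "Y n x"] x L iterate_closed[of x n] by simp
  qed
  moreover have "(\<lambda>n. hnorm M x + hnorm M (hsub M (Y n x) (L x))) \<longlonglongrightarrow> hnorm M x + 0"
    using L(2)[OF x] unfolding hlim_def by (intro tendsto_intros)
  ultimately have "hnorm M (L x) \<le> hnorm M x + 0" by (intro LIMSEQ_le_const) auto
  then show ?thesis by simp
qed

lemma L_square: "x \<in> hcarrier M \<Longrightarrow> hadd M (P x) (L (L x)) = hscale M 2 (L x)"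
proof (rule M.inner_ext)
  fix z assume x: "x \<in> hcarrier M" and z: "z \<in> hcarrier M"
  have diff: "(\<lambda>n. hinner M (Y n z) (Y n x) - hinner M (Y n z) (L x)) \<longlonglongrightarrow> 0"
  proof (rule tendsto_norm_zero_cancel)
    have "(\<lambda>n. hnorm M z * hnorm M (hsub M (Y n x) (L x))) \<longlonglongrightarrow> hnorm M z * 0"
      using L(2)[OF x] unfolding hlim_def by (rule tendsto_mult_left)
    then have lim: "(\<lambda>n. hnorm M z * hnorm M (hsub M (Y n x) (L x))) \<longlonglongrightarrow> 0" by simp
    have "norm (hinner M (Y n z) (Y n x) - hinner M (Y n z) (L x)) \<le> hnorm M z * hnorm M (hsub M (Y n x) (L x))" for n
    proof -
      have "norm (hinner M (Y n z) (Y n x) - hinner M (Y n z) (L x)) \<le> hnorm M (Y n z) * hnorm M (hsub M (Y n x) (L x))"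
        using M.cauchy_schwarz[of "Y n z" "hsub M (Y n x) (L x)"] x z L iterate_closed by simp
      also have "hnorm M (Y n z) \<le> 1 * hnorm M z"
        by (rule order_trans[OF iterate_norm[OF z]]) (use sqrt_majorant_bounds[of n] in \<open>simp add: mult_left_le_one_le\<close>)
      finally show ?thesis by (simp add: mult_right_mono)
    qed
    then show "(\<lambda>n. norm (hinner M (Y n z) (Y n x) - hinner M (Y n z) (L x))) \<longlonglongrightarrow> 0"
      by (intro tendsto_zero_le[OF lim] norm_ge_zero)
  qed
  have "(\<lambda>n. hinner M (Y n z) (L x)) \<longlonglongrightarrow> hinner M (L z) (L x)"
    using z x L iterate_closed by (intro M.hlim_inner_left) auto
  from tendsto_add[OF diff this]
  have "(\<lambda>n. hinner M (Y n z) (Y n x)) \<longlonglongrightarrow> hinner M (L z) (L x)" by simp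
  moreover have "hinner M (Y n z) (Y n x) = 2 *\<^sub>C hinner M z (Y (Suc n) x) - hinner M z (P x)" for n
    using x z iterate_closed by (simp add: iterate_inner scaleC_add_right scaleC_scaleC)
  moreover have "(\<lambda>n. 2 *\<^sub>C hinner M z (Y (Suc n) x) - hinner M z (P x))
      \<longlonglongrightarrow> 2 *\<^sub>C hinner M z (L x) - hinner M z (P x)"
    by (intro tendsto_diff tendsto_const bounded_linear.tendsto[OF bounded_linear_scaleC]
        LIMSEQ_Suc[OF L_inner_lim[OF x z]])
  ultimately have "hinner M (L z) (L x) = 2 *\<^sub>C hinner M z (L x) - hinner M z (P x)"
    using LIMSEQ_unique by fastforce
  moreover have "hinner M (L z) (L x) = hinner M z (L (L x))"
    using L_self_adjoint x z by (simp add: adj_pair_def)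
  ultimately show "hinner M z (hadd M (P x) (L (L x))) = hinner M z (hscale M 2 (L x))"
    using x z L by simp
qed (use L in auto)

lemma L_commute:
  assumes C: "adj_pair M M C D" "\<And>x. x \<in> hcarrier M \<Longrightarrow> C (P x) = P (C x)" and x: "x \<in> hcarrier M"
  shows "C (L x) = L (C x)"
proof -
  interpret C: adjoint_ops M M C D by unfold_locales (rule C(1))
  have comm: "C (Y n x) = Y n (C x)" if "x \<in> hcarrier M" for n x
    using that
  proof (induction n arbitrary: x)
    case (Suc n)
    then show ?case using iterate_closed by (simp add: C.scale C.add C(2))
  qed (simp add: C.zero)
  show ?thesis
  proof (rule M.inner_ext)
    fix z assume z: "z \<in> hcarrier M"
    have "(\<lambda>n. hinner M (D z) (Y n x)) \<longlonglongrightarrow> hinner M (D z) (L x)"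
      using x z by (intro L_inner_lim) auto
    moreover have "hinner M (D z) (Y n x) = hinner M z (Y n (C x))" for n
      using x z iterate_closed by (simp add: C.inner_right[symmetric] comm)
    moreover have "(\<lambda>n. hinner M z (Y n (C x))) \<longlonglongrightarrow> hinner M z (L (C x))"
      using x z by (intro L_inner_lim) auto
    ultimately have "hinner M (D z) (L x) = hinner M z (L (C x))"
      using LIMSEQ_unique by fastforce
    then show "hinner M z (C (L x)) = hinner M z (L (C x))" using x z L by (simp add: C.inner_right)
  qed (use x L in auto)
qed

lemma L_invariant:
  assumes K: "hsubmodule M K" "hclosure M K \<subseteq> K" "\<And>x. x \<in> K \<Longrightarrow> P x \<in> K" and x: "x \<in> K"
  shows "L x \<in> K"
proof -
  note S = M.hsubmoduleD[OF K(1)]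
  have "Y n x \<in> K" if "x \<in> K" for n x
    using that by (induction n arbitrary: x) (simp_all add: S K)
  then have "L x \<in> hclosure M K"
    using S x L by (intro M.hclosureI[where X="\<lambda>n. Y n x"]) auto
  then show ?thesis using K by blast
qed

end

text \<open>
  The root is obtained as in a C*-algebra, with convergence at each vector in place of norm
  convergence.
\<close>

lemma sqrt_one_minus_operator:
  assumes "hilbert_module M" "adj_pair M M P P" "contractive M M P"
  obtains R where "adj_pair M M R R" "\<forall>x\<in>hcarrier M. R (R x) = hsub M x (P x)"
    "contractive M M (\<lambda>x. hsub M x (R x))" "function_of M P R"
proof -
  interpret M: hilbert_module M by fact
  interpret self_adjoint_contraction M P by unfold_locales fact+
  interpret L: adjoint_ops M M L L by unfold_locales (rule L_self_adjoint)
  let ?R = "\<lambda>x. hsub M x (L x)"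
  show thesis
  proof (rule that[of ?R])
    show "adj_pair M M ?R ?R" by (auto simp: adj_pair_def L.inner)
    have "?R (?R x) = hsub M x (P x)" if x: "x \<in> hcarrier M" for x
    proof (rule M.inner_ext)
      fix z assume z: "z \<in> hcarrier M"
      have "hinner M z (P x) + hinner M z (L (L x)) = 2 *\<^sub>C hinner M z (L x)"
        using arg_cong[OF L_square[OF x], of "hinner M z"] x z by simp
      also have "\<dots> = hinner M z (L x) + hinner M z (L x)"
        using scaleC_add_left[of 1 1 "hinner M z (L x)"] by simp
      finally show "hinner M z (?R (?R x)) = hinner M z (hsub M x (P x))"
        using x z by (simp add: L.sub algebra_simps)
    qed (use x in auto)
    then show "\<forall>x\<in>hcarrier M. ?R (?R x) = hsub M x (P x)" by blast
    have "hsub M x (?R x) = L x" if "x \<in> hcarrier M" for x using that by (intro M.inner_ext) auto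
    then show "contractive M M (\<lambda>x. hsub M x (?R x))" by (simp add: contractive_def L_norm)
    show "function_of M P ?R"
      unfolding function_of_def
    proof (intro conjI allI impI ballI)
      fix C D x assume "adj_pair M M C D \<and> (\<forall>x\<in>hcarrier M. C (P x) = P (C x))" and x: "x \<in> hcarrier M"
      then have C: "adj_pair M M C D" and comm: "\<forall>x\<in>hcarrier M. C (P x) = P (C x)" by auto
      interpret C: adjoint_ops M M C D by unfold_locales (rule C)
      have "C (L x) = L (C x)" by (rule L_commute[OF C _ x]) (use comm in blast)
      then show "C (?R x) = ?R (C x)" using x by (simp add: C.sub)
    next
      fix K x assume "hsubmodule M K \<and> hclosure M K \<subseteq> K \<and> (\<forall>x\<in>K. P x \<in> K)" and x: "x \<in> K"
      then have K: "hsubmodule M K" "hclosure M K \<subseteq> K" "\<forall>x\<in>K. P x \<in> K" by auto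
      have "L x \<in> K" by (rule L_invariant[OF K(1,2) _ x]) (use K(3) in blast)
      then show "?R x \<in> K" by (rule M.hsubmoduleD(7)[OF K(1) x])
    qed
  qed
qed

lemma self_adjoint_contraction_le:
  assumes "hilbert_module M" "adj_pair M M P P" "contractive M M P" and x: "x \<in> hcarrier M"
  shows "cstar_positive (hinner M x x - hinner M x (P x))"
proof -
  interpret M: hilbert_module M by fact
  obtain R where R: "adj_pair M M R R" "\<forall>x\<in>hcarrier M. R (R x) = hsub M x (P x)"
    using sqrt_one_minus_operator[OF assms(1-3)] by blast
  have c: "R x \<in> hcarrier M" "P x \<in> hcarrier M" using R(1) assms(2) x by (auto simp: adj_pair_def)
  have "hinner M (R x) (R x) = hinner M x (R (R x))" using R(1) x c by (simp add: adj_pair_def)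
  also have "\<dots> = hinner M x x - hinner M x (P x)" using R(2) x c by simp
  finally show ?thesis using M.inner_positive[OF c(1)] by simp
qed

lemma (in adjoint_ops) contraction_le:
  assumes "contractive M N T" and x: "x \<in> hcarrier M"
  shows "cstar_positive (hinner M x x - hinner N (T x) (T x))"
proof -
  have "adj_pair M M (\<lambda>x. S (T x)) (\<lambda>x. S (T x))"
    by (auto simp: adj_pair_def inner[symmetric] inner_right[symmetric])
  moreover have "contractive M M (\<lambda>x. S (T x))"
    using adjoint_contraction[OF assms(1)] assms(1) unfolding contractive_def
    by (meson closed order_trans)
  ultimately have "cstar_positive (hinner M x x - hinner M x (S (T x)))"
    using x by (intro self_adjoint_contraction_le M.hilbert_module_axioms) auto
  then show ?thesis using x by (simp add: inner)
qed

text \<open>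
  The two form bounds give the norm bound through the Cauchy-Schwarz inequality for the form of \<open>P\<close>.
\<close>

lemma (in hilbert_module) contractive_of_form_bounds:
  assumes P: "adj_pair M M P P" and pos: "form_positive M P" and le: "form_positive M (\<lambda>x. hsub M x (P x))"
  shows "contractive M M P"
  unfolding contractive_def
proof
  fix x assume x: "x \<in> hcarrier M"
  have Pc: "P y \<in> hcarrier M" if "y \<in> hcarrier M" for y using P that by (simp add: adj_pair_def)
  have pos': "cstar_positive (hinner M y (P y))" if "y \<in> hcarrier M" for y
    using pos that by (simp add: form_positive_def)
  have form: "norm (hinner M y (P y)) \<le> (hnorm M y)\<^sup>2" if "y \<in> hcarrier M" for y
    unfolding hnorm_power2
    by (rule cstar_positive_norm_mono[OF pos'[OF that]])
      (use le that Pc in \<open>simp add: form_positive_def\<close>)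
  have "((hnorm M (P x))\<^sup>2)\<^sup>2 \<le> norm (hinner M (P x) (P (P x))) * norm (hinner M x (P x))"
    using cauchy_schwarz_positive[OF P pos' Pc[OF x] x] by (simp add: hnorm_power2)
  also have "\<dots> \<le> (hnorm M (P x))\<^sup>2 * (hnorm M x)\<^sup>2"
    by (intro mult_mono form x Pc) auto
  finally have "(hnorm M (P x))\<^sup>2 * (hnorm M (P x))\<^sup>2 \<le> (hnorm M (P x))\<^sup>2 * (hnorm M x)\<^sup>2"
    by (simp only: power2_eq_square[of "(hnorm M (P x))\<^sup>2"])
  then have "(hnorm M (P x))\<^sup>2 \<le> (hnorm M x)\<^sup>2"
    by (metis mult_le_cancel_left_pos power_zero_numeral zero_less_power2 zero_le_power2)
  then show "hnorm M (P x) \<le> hnorm M x" by (rule power2_le_imp_le) simp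
qed

lemma positive_sqrt_exists:
  assumes M: "hilbert_module M" and B: "adj_pair M M B B" and pos: "form_positive M B"
    and bound: "\<forall>x\<in>hcarrier M. hnorm M (B x) \<le> K * hnorm M x"
  obtains R where "adj_pair M M R R" "form_positive M R"
    "\<forall>x\<in>hcarrier M. R (R x) = B x" "function_of M B R"
proof -
  interpret M: hilbert_module M by fact
  interpret B: adjoint_ops M M B B by unfold_locales (rule B)
  \<comment> \<open>A scalar that bounds \<open>B\<close> and is positive, so that \<open>P = 1 - B / t\<close> is a contraction.\<close>
  define t where "t = max K 1"
  have t: "t > 0" "K \<le> t" by (auto simp: t_def)
  define s where "s = complex_of_real (1 / t)"
  define P where "P x = hsub M x (hscale M s (B x))" for x
  have s: "s *\<^sub>C a = (1/t) *\<^sub>R a" "cnj s = s" "cmod s = 1 / t" for a :: 'a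
    using t by (auto simp: s_def scaleR_scaleC norm_divide)
  have Bs: "adj_pair M M (\<lambda>x. hscale M s (B x)) (\<lambda>x. hscale M s (B x))"
    by (simp add: adj_pair_def B.inner s(2))
  have Bs_contr: "contractive M M (\<lambda>x. hscale M s (B x))"
    unfolding contractive_def
  proof
    fix x assume x: "x \<in> hcarrier M"
    have "hnorm M (B x) \<le> K * hnorm M x" using bound x by blast
    also have "\<dots> \<le> t * hnorm M x" using t by (simp add: mult_right_mono)
    finally show "hnorm M (hscale M s (B x)) \<le> hnorm M x"
      using t x by (simp add: M.hnorm_scale s(3) pos_divide_le_eq mult.commute)
  qed
  have P: "adj_pair M M P P"
    unfolding P_def using Bs by (auto simp: adj_pair_def)
  have P_form: "hinner M x (P x) = hinner M x x - hinner M x (hscale M s (B x))" if "x \<in> hcarrier M" for x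
    using that by (simp add: P_def)
  have "contractive M M P"
  proof (rule M.contractive_of_form_bounds[OF P])
    show "form_positive M P"
      using self_adjoint_contraction_le[OF M Bs Bs_contr] P_form by (simp add: form_positive_def)
    have "cstar_positive (hinner M y (hsub M y (P y)))" if y: "y \<in> hcarrier M" for y
    proof -
      have "hinner M y (hsub M y (P y)) = (1/t) *\<^sub>R hinner M y (B y)"
        using y by (simp add: P_def s(1))
      then show ?thesis using pos y t by (simp add: form_positive_def cstar_positive_scaleR)
    qed
    then show "form_positive M (\<lambda>x. hsub M x (P x))" by (simp add: form_positive_def)
  qed
  then obtain R where R: "adj_pair M M R R" "\<forall>x\<in>hcarrier M. R (R x) = hsub M x (P x)"
    "contractive M M (\<lambda>x. hsub M x (R x))" "function_of M P R"
    using sqrt_one_minus_operator[OF M P] by blast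
  interpret R: adjoint_ops M M R R by unfold_locales (rule R)
  define r where "r = complex_of_real (sqrt t)"
  have r: "r *\<^sub>C a = sqrt t *\<^sub>R a" "cnj r = r" "r * r = inverse s" for a :: 'a
    using t by (auto simp: r_def s_def scaleR_scaleC simp flip: of_real_mult)
  have s0: "s \<noteq> 0" using t by (simp add: s_def)
  show thesis
  proof (rule that[of "\<lambda>x. hscale M r (R x)"])
    show "adj_pair M M (\<lambda>x. hscale M r (R x)) (\<lambda>x. hscale M r (R x))"
      by (simp add: adj_pair_def R.inner r(2))
    have R': "adj_pair M M (\<lambda>x. hsub M x (R x)) (\<lambda>x. hsub M x (R x))"
      by (simp add: adj_pair_def R.inner)
    have "cstar_positive (hinner M x (hscale M r (R x)))" if x: "x \<in> hcarrier M" for x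
      using self_adjoint_contraction_le[OF M R' R(3) x] x t by (simp add: r(1) cstar_positive_scaleR)
    then show "form_positive M (\<lambda>x. hscale M r (R x))" by (simp add: form_positive_def)
    have "hscale M r (R (hscale M r (R x))) = B x" if x: "x \<in> hcarrier M" for x
    proof -
      have "hscale M r (R (hscale M r (R x))) = hscale M (r * r) (hsub M x (P x))"
        using x R(2) P by (simp add: R.scale M.scale_scale adj_pair_def)
      also have "\<dots> = B x"
        using x s0 by (intro M.inner_ext) (simp_all add: P_def scaleC_scaleC r(3))
      finally show ?thesis .
    qed
    then show "\<forall>x\<in>hcarrier M. hscale M r (R (hscale M r (R x))) = B x" by blast
    show "function_of M B (\<lambda>x. hscale M r (R x))"
      unfolding function_of_def
    proof (intro conjI allI impI ballI)
      fix C D x assume "adj_pair M M C D \<and> (\<forall>x\<in>hcarrier M. C (B x) = B (C x))" and x: "x \<in> hcarrier M"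
      then have C: "adj_pair M M C D" and comm: "\<forall>x\<in>hcarrier M. C (B x) = B (C x)" by auto
      interpret C: adjoint_ops M M C D by unfold_locales (rule C)
      have "\<forall>x\<in>hcarrier M. C (P x) = P (C x)" using comm by (simp add: P_def C.sub C.scale)
      then have "C (R x) = R (C x)" using R(4) C x unfolding function_of_def by blast
      then show "C (hscale M r (R x)) = hscale M r (R (C x))" using x by (simp add: C.scale)
    next
      fix K x assume "hsubmodule M K \<and> hclosure M K \<subseteq> K \<and> (\<forall>x\<in>K. B x \<in> K)" and x: "x \<in> K"
      then have K: "hsubmodule M K" "hclosure M K \<subseteq> K" "\<forall>x\<in>K. B x \<in> K" by auto
      note S = M.hsubmoduleD[OF K(1)]
      have "\<forall>x\<in>K. P x \<in> K"
        unfolding P_def by (intro ballI S(7) S(5)) (use K(3) in blast)+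
      then have "R x \<in> K" using R(4) K x unfolding function_of_def by blast
      then show "hscale M r (R x) \<in> K" by (rule S)
    qed
  qed
qed

text \<open>
  For two positive roots \<open>R\<close> and \<open>S\<close> that commute, \<open>(S + R)(S - R) = 0\<close>; by positivity both
  summands vanish on the range of \<open>S - R\<close>. One root that is a function of \<open>B\<close> suffices for
  uniqueness, since any other root commutes with \<open>B\<close>.
\<close>

lemma positive_sqrt_unique:
  assumes M: "hilbert_module M"
    and R: "adj_pair M M R R" "form_positive M R" "\<forall>x\<in>hcarrier M. R (R x) = B x" "function_of M B R"
    and S: "adj_pair M M S S" "form_positive M S" "\<forall>x\<in>hcarrier M. S (S x) = B x"
    and x: "x \<in> hcarrier M"
  shows "S x = R x"
proof -
  interpret M: hilbert_module M by fact
  interpret R: adjoint_ops M M R R by unfold_locales (rule R)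
  interpret S: adjoint_ops M M S S by unfold_locales (rule S)
  have "\<forall>x\<in>hcarrier M. S (B x) = B (S x)" using S(3) by (metis S.closed)
  then have comm: "S (R x) = R (S x)" if "x \<in> hcarrier M" for x
    using R(4) S(1) that unfolding function_of_def by blast
  define y where "y = hsub M (S x) (R x)"
  have y: "y \<in> hcarrier M" using x by (simp add: y_def)
  have "hadd M (S y) (R y) = hzero M"
  proof -
    have "S y = hsub M (B x) (R (S x))" "R y = hsub M (R (S x)) (B x)"
      using x R(3) S(3) comm by (simp_all add: y_def S.sub R.sub)
    moreover have "B x \<in> hcarrier M" using x R(3) by (metis R.closed)
    ultimately show ?thesis using x by (intro M.inner_ext) simp_all
  qed
  then have "hinner M y (S y) + hinner M y (R y) = 0"
    using y by (metis M.inner_add M.inner_zero_right R.closed S.closed)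
  then have neg: "hinner M y (S y) = - hinner M y (R y)" by (simp add: eq_neg_iff_add_eq_0)
  moreover have pos: "cstar_positive (hinner M y (S y))" "cstar_positive (hinner M y (R y))"
    using R(2) S(2) y by (auto simp: form_positive_def)
  ultimately have "hinner M y (R y) = 0" "hinner M y (S y) = 0"
    using cstar_positive_antisym[OF pos(2)] by auto
  have vanish: "T y = hzero M" if "adj_pair M M T T" "form_positive M T" "hinner M y (T y) = 0" for T
  proof (rule M.inner_ext)
    fix z assume z: "z \<in> hcarrier M"
    have pos: "\<And>w. w \<in> hcarrier M \<Longrightarrow> cstar_positive (hinner M w (T w))"
      using that(2) by (simp add: form_positive_def)
    have "(norm (hinner M z (T y)))\<^sup>2 \<le> norm (hinner M z (T z)) * norm (hinner M y (T y))"
      by (rule M.cauchy_schwarz_positive[OF that(1) pos z y])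
    then show "hinner M z (T y) = hinner M z (hzero M)" using that(3) z by simp
  qed (use that y in \<open>auto simp: adj_pair_def\<close>)
  have "S y = hzero M" "R y = hzero M"
    using vanish R S \<open>hinner M y (R y) = 0\<close> \<open>hinner M y (S y) = 0\<close> by blast+
  then have "hinner M (S x) y = 0" "hinner M (R x) y = 0"
    using x y by (simp_all add: S.inner R.inner)
  then have "hinner M y y = 0" unfolding y_def[of] using x y by (simp add: y_def)
  then have "y = hzero M" using M.inner_definite y by blast
  then show ?thesis using x M.sub_eq_zero_iff by (simp add: y_def)
qed

section \<open>Square roots and absolute values as partial maps\<close>

definition total_op :: "('a::cstar_algebra, 'e) hmodule \<Rightarrow> ('e \<Rightarrow> 'f) \<Rightarrow> ('e \<rightharpoonup> 'f)" where
  "total_op M T = (\<lambda>x. if x \<in> hcarrier M then Some (T x) else None)"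

lemma total_op_apply [simp]: "x \<in> hcarrier M \<Longrightarrow> total_op M T x = Some (T x)"
  by (simp add: total_op_def)

lemma dom_total_op [simp]: "dom (total_op M T) = hcarrier M"
  by (auto simp: total_op_def split: if_splits)

lemma ran_total_op [simp]: "ran (total_op M T) = T ` hcarrier M"
  by (auto simp: total_op_def ran_def)

lemma total_op_cong: "(\<And>x. x \<in> hcarrier M \<Longrightarrow> T x = T' x) \<Longrightarrow> total_op M T = total_op M T'"
  by (auto simp: total_op_def)

lemma total_op_eq_iff: "total_op M T = total_op M T' \<longleftrightarrow> (\<forall>x\<in>hcarrier M. T x = T' x)"
  by (metis option.sel total_op_apply total_op_cong)

lemma total_op_comp:
  "(\<And>x. x \<in> hcarrier M \<Longrightarrow> T x \<in> hcarrier N) \<Longrightarrow>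
    total_op N S \<circ>\<^sub>m total_op M T = total_op M (\<lambda>x. S (T x))"
  by (auto simp: total_op_def map_comp_def)

lemma total_op_of_dom: "dom X = hcarrier M \<Longrightarrow> X = total_op M (\<lambda>x. the (X x))"
proof
  fix x assume X: "dom X = hcarrier M"
  show "X x = total_op M (\<lambda>x. the (X x)) x"
  proof (cases "x \<in> hcarrier M")
    case True
    then obtain y where "X x = Some y" using X by blast
    then show ?thesis using True by simp
  next
    case False
    then have "X x = None" using X by blast
    then show ?thesis using False by (simp add: total_op_def)
  qed
qed

lemma op_ker_total_op: "op_ker N (total_op M T) = {x \<in> hcarrier M. T x = hzero N}"
  by (auto simp: op_ker_def total_op_def)

context adjoint_ops
begin

lemma op_adjoint_total: "op_adjoint M N (total_op M T) = total_op N S"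
proof
  fix y
  let ?P = "\<lambda>y z. z \<in> hcarrier M \<and>
    (\<forall>x\<in>dom (total_op M T). hinner N (the (total_op M T x)) y = hinner M x z)"
  have "(THE z. ?P y z) = S y" "\<exists>z. ?P y z" if y: "y \<in> hcarrier N"
  proof -
    have "?P y (S y)" using y by (simp add: inner)
    moreover have "z = S y" if "?P y z" for z
      using that y by (intro M.inner_ext) (auto simp: inner)
    ultimately show "(THE z. ?P y z) = S y" by (rule the_equality)
    show "\<exists>z. ?P y z" by (rule exI) fact
  qed
  then show "op_adjoint M N (total_op M T) y = total_op N S y"
    unfolding op_adjoint_def Let_def by (auto simp: total_op_def[of N])
qed

lemma adjointable_total: "adjointable M N (total_op M T)"
  unfolding adjointable_def
  by (intro conjI exI[of _ "total_op N S"]) (auto simp: inner)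

end

lemma adjointableE:
  assumes "adjointable M N X"
  obtains T S where "X = total_op M T" "adj_pair M N T S"
proof -
  obtain Z where Z: "dom Z = hcarrier N" "ran Z \<subseteq> hcarrier M" "dom X = hcarrier M" "ran X \<subseteq> hcarrier N"
    "\<forall>x\<in>hcarrier M. \<forall>y\<in>hcarrier N. hinner N (the (X x)) y = hinner M x (the (Z y))"
    using assms unfolding adjointable_def by blast
  have "adj_pair M N (\<lambda>x. the (X x)) (\<lambda>y. the (Z y))"
    unfolding adj_pair_def
    using Z by (metis domD option.sel ranI subsetD)
  then show thesis using that total_op_of_dom[OF Z(3)] by blast
qed

lemma op_positiveE:
  assumes "hilbert_module M" "op_positive M X"
  obtains B where "X = total_op M B" "adj_pair M M B B" "form_positive M B"
proof -
  interpret M: hilbert_module M by fact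
  obtain Z where Z: "adjointable M M Z" "X = op_adjoint M M Z \<circ>\<^sub>m Z"
    using assms by (auto simp: op_positive_def)
  obtain T S where TS: "Z = total_op M T" "adj_pair M M T S" using adjointableE[OF Z(1)] .
  interpret TS: adjoint_ops M M T S by unfold_locales (rule TS)
  show thesis
  proof (rule that[of "\<lambda>x. S (T x)"])
    show "X = total_op M (\<lambda>x. S (T x))"
      unfolding Z(2) TS(1) TS.op_adjoint_total by (rule total_op_comp) simp
    show "adj_pair M M (\<lambda>x. S (T x)) (\<lambda>x. S (T x))"
      by (auto simp: adj_pair_def TS.inner[symmetric] TS.inner_right[symmetric])
    show "form_positive M (\<lambda>x. S (T x))"
      by (auto simp: form_positive_def TS.inner[symmetric] M.inner_positive)
  qed
qed

lemma op_positiveI: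
  assumes M: "hilbert_module M" and B: "adj_pair M M B B" "form_positive M B"
    "\<forall>x\<in>hcarrier M. hnorm M (B x) \<le> K * hnorm M x"
  shows "op_positive M (total_op M B)"
proof -
  obtain R where R: "adj_pair M M R R" "\<forall>x\<in>hcarrier M. R (R x) = B x"
    using positive_sqrt_exists[OF M B] by blast
  interpret M: hilbert_module M by fact
  interpret R: adjoint_ops M M R R by unfold_locales (rule R)
  have "total_op M B = op_adjoint M M (total_op M R) \<circ>\<^sub>m total_op M R"
    unfolding R.op_adjoint_total using R(2) by (subst total_op_comp) (auto intro: total_op_cong)
  then show ?thesis unfolding op_positive_def using R.adjointable_total by blast
qed

lemma op_sqrt_total:
  assumes M: "hilbert_module M" and B: "adj_pair M M B B" "form_positive M B"
    "\<forall>x\<in>hcarrier M. hnorm M (B x) \<le> K * hnorm M x" "0 \<le> K"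
  obtains R where "op_sqrt M (total_op M B) = total_op M R" "adj_pair M M R R" "form_positive M R"
    "\<forall>x\<in>hcarrier M. R (R x) = B x" "function_of M B R"
proof -
  interpret M: hilbert_module M by fact
  interpret B: adjoint_ops M M B B by unfold_locales (rule B)
  obtain R where R: "adj_pair M M R R" "form_positive M R"
    "\<forall>x\<in>hcarrier M. R (R x) = B x" "function_of M B R"
    using positive_sqrt_exists[OF M B(1-3)] by blast
  interpret R: adjoint_ops M M R R by unfold_locales (rule R)
  have "\<forall>x\<in>hcarrier M. hnorm M (R x) \<le> sqrt K * hnorm M x"
  proof
    fix x assume x: "x \<in> hcarrier M"
    have "(hnorm M (R x))\<^sup>2 = norm (hinner M x (B x))" using x R(3) by (simp add: M.hnorm_power2 R.inner)
    also have "\<dots> \<le> hnorm M x * hnorm M (B x)" using x by (intro M.cauchy_schwarz) auto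
    also have "\<dots> \<le> hnorm M x * (K * hnorm M x)" using x B(3) by (intro mult_left_mono) auto
    also have "\<dots> = (sqrt K * hnorm M x)\<^sup>2" using B(4) by (simp add: power_mult_distrib) (simp add: power2_eq_square)
    finally show "hnorm M (R x) \<le> sqrt K * hnorm M x" by (rule power2_le_imp_le) (simp add: B(4))
  qed
  then have pos: "op_positive M (total_op M R)" by (rule op_positiveI[OF M R(1,2)])
  have "op_sqrt M (total_op M B) = total_op M R"
    unfolding op_sqrt_def
  proof (rule the_equality, intro conjI pos)
    show "total_op M R \<circ>\<^sub>m total_op M R = total_op M B"
      using R(3) by (subst total_op_comp) (auto intro: total_op_cong)
    fix X assume X: "op_positive M X \<and> X \<circ>\<^sub>m X = total_op M B"
    then obtain S where S: "X = total_op M S" "adj_pair M M S S" "form_positive M S"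
      using op_positiveE[OF M] by blast
    interpret S: adjoint_ops M M S S by unfold_locales (rule S)
    have "total_op M (\<lambda>x. S (S x)) = total_op M B"
      using X total_op_comp[of M S M S] by (simp add: S(1))
    then have "\<forall>x\<in>hcarrier M. S (S x) = B x" by (simp add: total_op_eq_iff)
    then show "X = total_op M R"
      unfolding S(1) using positive_sqrt_unique[OF M R S(2,3)] by (blast intro: total_op_cong)
  qed
  then show thesis using that R by blast
qed


section \<open>Polar decomposition of adjointable contractions\<close>

definition spans :: "('a::cstar_algebra, 'e) hmodule \<Rightarrow> 'e set \<Rightarrow> 'e set \<Rightarrow> bool" where
  "spans M U V \<longleftrightarrow> (\<forall>x\<in>hcarrier M. \<exists>u\<in>U. \<exists>v\<in>V. x = hadd M u v)"

lemma (in hilbert_module) hlim_Cauchy: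
  assumes "hlim M X x" "\<And>n. X n \<in> hcarrier M" "x \<in> hcarrier M" "e > 0"
  shows "\<exists>N. \<forall>m\<ge>N. \<forall>n\<ge>m. hnorm M (hsub M (X n) (X m)) < e"
proof -
  obtain N where N: "\<forall>n\<ge>N. hnorm M (hsub M (X n) x) < e / 2"
    using LIMSEQ_D[OF assms(1)[unfolded hlim_def], of "e / 2"] assms(4) by auto
  have "hnorm M (hsub M (X n) (X m)) < e" if "m \<ge> N" "n \<ge> m" for m n
  proof -
    have "hnorm M (hsub M (X n) (X m)) \<le> hnorm M (hsub M (X n) x) + hnorm M (hsub M x (X m))"
      by (intro hnorm_sub_triangle assms)
    moreover have "hnorm M (hsub M x (X m)) = hnorm M (hsub M (X m) x)"
      by (intro hnorm_sub_commute assms)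
    moreover have "hnorm M (hsub M (X n) x) < e / 2" "hnorm M (hsub M (X m) x) < e / 2"
      using N that by auto
    ultimately show ?thesis by linarith
  qed
  then show ?thesis by blast
qed

text \<open>
  For a contraction \<open>T\<close> with adjoint \<open>S\<close> the vectors \<open>y\<^sub>i = (1 - T S)\<^sup>i y\<close> satisfy
  \<open>\<langle>y\<^sub>i\<^sub>+\<^sub>1, y\<^sub>i\<^sub>+\<^sub>1\<rangle> \<le> \<langle>y\<^sub>i, y\<^sub>i\<rangle> - b\<^sub>i\<close> with \<open>b\<^sub>i = \<langle>S y\<^sub>i, S y\<^sub>i\<rangle>\<close> decreasing, so that
  \<open>n b\<^sub>n \<le> \<langle>y, y\<rangle>\<close>. Since \<open>S y - S y\<^sub>n\<close> lies in the range of \<open>S T\<close>, this range is dense in the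
  range of \<open>S\<close>. In Hilbert modules this cannot be argued by orthogonal complements.
\<close>

lemma (in adjoint_ops) range_adjoint_subset:
  assumes contr: "contractive M N T"
  shows "S ` hcarrier N \<subseteq> hclosure M ((\<lambda>x. S (T x)) ` hcarrier M)"
proof
  fix w assume "w \<in> S ` hcarrier N"
  then obtain y where y: "y \<in> hcarrier N" "w = S y" by blast
  interpret adj: adjoint_ops N M S T by unfold_locales (rule swap)
  have contr': "contractive N M S" by (rule adjoint_contraction[OF contr])
  define Y where "Y n = ((\<lambda>z. hsub N z (T (S z))) ^^ n) y" for n
  have Y: "Y n \<in> hcarrier N" for n by (induction n) (simp_all add: Y_def y)
  have Y_Suc: "Y (Suc n) = hsub N (Y n) (T (S (Y n)))" for n by (simp add: Y_def)
  define b where "b n = hinner M (S (Y n)) (S (Y n))" for n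
  define c where "c n = hinner N (Y n) (Y n)" for n
  have step: "cstar_positive (c n - c (Suc n) - b n)" for n
  proof -
    have "c n - c (Suc n) - b n = b n - hinner N (T (S (Y n))) (T (S (Y n)))"
      using Y[of n] by (simp add: c_def b_def Y_Suc inner inner_right adj.sub algebra_simps)
    then show ?thesis using contraction_le[OF contr, of "S (Y n)"] Y[of n] by (simp add: b_def)
  qed
  have decr: "cstar_positive (b n - b (Suc n))" for n
  proof -
    define w where "w = S (Y n)"
    have w: "w \<in> hcarrier M" using Y[of n] by (simp add: w_def)
    have "S (Y (Suc n)) = hsub M w (S (T w))" using Y[of n] by (simp add: w_def Y_Suc adj.sub)
    moreover have "hinner M w (S (T w)) = hinner N (T w) (T w)" using w by (simp add: inner)
    moreover have "hinner M (S (T w)) w = hinner N (T w) (T w)" using w by (simp add: inner_right)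
    ultimately have "b n - b (Suc n) = hinner N (T w) (T w)
        + (hinner N (T w) (T w) - hinner M (S (T w)) (S (T w)))"
      using w by (simp add: b_def w_def[symmetric] algebra_simps)
    then show ?thesis
      using N.inner_positive[of "T w"] adj.contraction_le[OF contr', of "T w"] w
      by (simp add: cstar_positive_add)
  qed
  have sum: "cstar_positive (c 0 - c n - real n *\<^sub>R b n)" for n
  proof (induction n)
    case (Suc n)
    have "cstar_positive ((c 0 - c n - real n *\<^sub>R b n) + (c n - c (Suc n) - b n)
        + real (Suc n) *\<^sub>R (b n - b (Suc n)))"
      using Suc step decr by (intro cstar_positive_add cstar_positive_scaleR) auto
    then show ?case by (simp add: algebra_simps)
  qed simp
  have "cstar_positive (c 0 - real n *\<^sub>R b n)" for n
    using cstar_positive_add[OF sum[of n] N.inner_positive[OF Y[of n]]] by (simp add: c_def)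
  then have "norm (real n *\<^sub>R b n) \<le> norm (c 0)" for n
    using Y by (intro cstar_positive_norm_mono cstar_positive_scaleR) (auto simp: b_def M.inner_positive)
  then have nb: "real n * (hnorm M (S (Y n)))\<^sup>2 \<le> (hnorm N y)\<^sup>2" for n
    by (simp add: b_def c_def M.hnorm_power2 N.hnorm_power2 Y_def)
  have diff: "\<exists>u\<in>hcarrier M. hsub M w (S (T u)) = S (Y n)" for n
  proof (induction n)
    case 0
    have "hsub M w (S (T (hzero M))) = S (Y 0)"
      using y by (intro M.inner_ext) (simp_all add: zero adj.zero Y_def)
    then show ?case using M.zero_closed by blast
  next
    case (Suc n)
    then obtain u where u: "u \<in> hcarrier M" "hsub M w (S (T u)) = S (Y n)" by blast
    have "hsub M w (S (T (hadd M u (S (Y n))))) = hsub M (hsub M w (S (T u))) (S (T (S (Y n))))"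
      using u(1) Y[of n] y by (intro M.inner_ext) (simp_all add: add adj.add)
    also have "\<dots> = S (Y (Suc n))" using u Y[of n] by (simp add: Y_Suc adj.sub)
    finally show ?case using u Y[of n] by (intro bexI[of _ "hadd M u (S (Y n))"]) auto
  qed
  show "w \<in> hclosure M ((\<lambda>x. S (T x)) ` hcarrier M)"
  proof (subst M.hclosure_iff, force, intro conjI allI impI)
    show "w \<in> hcarrier M" using y by simp
    fix e :: real assume e: "e > 0"
    obtain n where n: "(hnorm N y)\<^sup>2 / e\<^sup>2 < real n" using reals_Archimedean2 by blast
    then have pos: "real n > 0" by (rule le_less_trans[rotated]) simp
    have "real n * (hnorm M (S (Y n)))\<^sup>2 < real n * e\<^sup>2"
      using nb[of n] n e by (simp add: pos_divide_less_eq)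
    then have "(hnorm M (S (Y n)))\<^sup>2 < e\<^sup>2" using pos by (simp add: mult_less_cancel_left_pos)
    then have "hnorm M (S (Y n)) < e" by (rule power2_less_imp_less) (use e in simp)
    moreover obtain u where "u \<in> hcarrier M" "hsub M w (S (T u)) = S (Y n)" using diff[of n] by blast
    ultimately show "\<exists>z\<in>(\<lambda>x. S (T x)) ` hcarrier M. hnorm M (hsub M w z) < e"
      by (intro bexI[of _ "S (T u)"]) auto
  qed
qed

text \<open>
  If \<open>T\<close> and \<open>T'\<close> have equal norms at every vector, the relation between \<open>T x\<close> and \<open>T' x\<close> extends
  to the closures of the ranges, since Cauchy sequences correspond to each other.
\<close>

lemma equal_norm_limit:
  assumes "adjoint_ops M N T S" "adjoint_ops M N' T' S'"
    and eq: "\<forall>x\<in>hcarrier M. hnorm N (T x) = hnorm N' (T' x)"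
    and c: "c \<in> hclosure N (T ` hcarrier M)"
  shows "\<exists>X d. (\<forall>n. X n \<in> hcarrier M) \<and> c \<in> hcarrier N \<and> d \<in> hcarrier N' \<and>
    hlim N (\<lambda>n. T (X n)) c \<and> hlim N' (\<lambda>n. T' (X n)) d"
proof -
  interpret T: adjoint_ops M N T S by fact
  interpret T': adjoint_ops M N' T' S' by fact
  have TM: "T ` hcarrier M \<subseteq> hcarrier N" by auto
  have cN: "c \<in> hcarrier N" using c T.N.hclosure_subset by blast
  obtain Z where Z: "\<And>n. Z n \<in> T ` hcarrier M" "hlim N Z c"
    using T.N.hclosure_sequence[OF TM c] by blast
  then have "\<exists>x. x \<in> hcarrier M \<and> Z n = T x" for n by blast
  then obtain X where X: "\<And>n. X n \<in> hcarrier M" "\<And>n. Z n = T (X n)" by metis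
  have "Z = (\<lambda>n. T (X n))" using X(2) by auto
  then have lim: "hlim N (\<lambda>n. T (X n)) c" using Z(2) by simp
  have "hnorm N' (hsub N' (T' (X n)) (T' (X m))) = hnorm N (hsub N (T (X n)) (T (X m)))" for n m
    using eq X by (simp add: T.sub[symmetric] T'.sub[symmetric])
  then have "\<exists>K. \<forall>m\<ge>K. \<forall>n\<ge>m. hnorm N' (hsub N' (T' (X n)) (T' (X m))) < e" if "e > 0" for e
    using T.N.hlim_Cauchy[OF lim _ cN that] X by simp
  then obtain d where "d \<in> hcarrier N'" "hlim N' (\<lambda>n. T' (X n)) d"
    using T'.N.Cauchy_has_limit[of "\<lambda>n. T' (X n)"] X by (metis T'.closed)
  then show ?thesis using X lim cN by blast
qed

context adjoint_ops
begin

text \<open>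
  Since \<open>A = |T|\<close> satisfies \<open>A\<^sup>2 = S T\<close> and is its own adjoint, the ranges of \<open>A\<close> and of \<open>S\<close> both
  have the closure of the range of \<open>S T\<close>.
\<close>

lemma op_abs_total:
  assumes contr: "contractive M N T"
  obtains A where "op_abs M N (total_op M T) = total_op M A" "adj_pair M M A A"
    "\<forall>x\<in>hcarrier M. \<forall>y\<in>hcarrier M. hinner M (A x) (A y) = hinner N (T x) (T y)"
    "hclosure M (A ` hcarrier M) = hclosure M (S ` hcarrier N)"
proof -
  have adjST: "adj_pair M M (\<lambda>x. S (T x)) (\<lambda>x. S (T x))"
    by (auto simp: adj_pair_def inner[symmetric] inner_right[symmetric])
  have "contractive M M (\<lambda>x. S (T x))"
    using adjoint_contraction[OF contr] contr unfolding contractive_def by (meson closed order_trans)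
  then have bound: "\<forall>x\<in>hcarrier M. hnorm M (S (T x)) \<le> 1 * hnorm M x" by (simp add: contractive_def)
  have "form_positive M (\<lambda>x. S (T x))"
    by (auto simp: form_positive_def inner[symmetric] N.inner_positive)
  then obtain A where A: "op_sqrt M (total_op M (\<lambda>x. S (T x))) = total_op M A" "adj_pair M M A A"
    "\<forall>x\<in>hcarrier M. A (A x) = S (T x)"
    using op_sqrt_total[OF M.hilbert_module_axioms adjST _ bound] by auto
  interpret A: adjoint_ops M M A A by unfold_locales (rule A)
  have abs: "op_abs M N (total_op M T) = total_op M A"
    unfolding op_abs_def op_adjoint_total by (subst total_op_comp) (simp_all add: A)
  have inn: "hinner M (A x) (A y) = hinner N (T x) (T y)" if "x \<in> hcarrier M" "y \<in> hcarrier M" for x y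
    using that A(3) by (simp add: A.inner inner)
  have A_contr: "contractive M M A"
    using contr inn by (auto simp: contractive_def hnorm_def)
  have cl: "\<And>U. hclosure M U \<subseteq> hcarrier M" by (rule M.hclosure_subset)
  have im: "(\<lambda>x. A (A x)) ` hcarrier M = (\<lambda>x. S (T x)) ` hcarrier M" using A(3) by simp
  have "A ` hcarrier M \<subseteq> hclosure M ((\<lambda>x. S (T x)) ` hcarrier M)"
    using A.range_adjoint_subset[OF A_contr] by (simp only: im)
  also have "\<dots> \<subseteq> hclosure M (S ` hcarrier N)" by (rule M.hclosure_mono) auto
  finally have 1: "hclosure M (A ` hcarrier M) \<subseteq> hclosure M (S ` hcarrier N)" by (rule M.hclosure_minimal)
  have "S ` hcarrier N \<subseteq> hclosure M ((\<lambda>x. S (T x)) ` hcarrier M)" by (rule range_adjoint_subset[OF contr])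
  also have "\<dots> \<subseteq> hclosure M (A ` hcarrier M)"
    unfolding im[symmetric] by (rule M.hclosure_mono) auto
  finally have 2: "hclosure M (S ` hcarrier N) \<subseteq> hclosure M (A ` hcarrier M)" by (rule M.hclosure_minimal)
  show thesis using that[OF abs A(2)] inn 1 2 by blast
qed

text \<open>
  The first component of \<open>x\<close> is \<open>x - V\<^sup>* V x\<close>, which \<open>V\<close> and hence \<open>T\<close> annihilates. The second
  splitting uses \<open>V V\<^sup>*\<close> in the same way.
\<close>

lemma spans_of_polar_decomposable:
  assumes contr: "contractive M N T" and "adjointable_polar_decomposable M N (total_op M T)"
  shows "spans M {x \<in> hcarrier M. T x = hzero N} (hclosure M (S ` hcarrier N))"
    "spans N {y \<in> hcarrier N. S y = hzero M} (hclosure N (T ` hcarrier M))"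
proof -
  obtain A where A: "op_abs M N (total_op M T) = total_op M A"
    "hclosure M (A ` hcarrier M) = hclosure M (S ` hcarrier N)"
    using op_abs_total[OF contr] by metis
  obtain V where V: "partial_isometry M N V" "op_ker N V = op_ker N (total_op M T)"
    "op_ker M (op_adjoint M N V) = op_ker M (total_op N S)"
    "ran V = hclosure N (T ` hcarrier M)"
    "ran (op_adjoint M N V) = hclosure M (A ` hcarrier M)"
    using assms(2) unfolding adjointable_polar_decomposable_def op_adjoint_total A(1) ran_total_op by blast
  have "adjointable M N V" using V(1) by (simp add: partial_isometry_def)
  then obtain W W' where W: "V = total_op M W" "adj_pair M N W W'" by (rule adjointableE)
  interpret W: adjoint_ops M N W W' by unfold_locales (rule W)
  interpret W': adjoint_ops N M W' W by unfold_locales (rule W.swap)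
  have "total_op M (\<lambda>x. W (W' (W x))) = total_op M W"
    using V(1) unfolding partial_isometry_def W(1) W.op_adjoint_total
    by (subst (asm) total_op_comp, simp, subst (asm) total_op_comp, simp_all)
  then have www: "W (W' (W x)) = W x" if "x \<in> hcarrier M" for x using that by (simp add: total_op_eq_iff)
  have www': "W' (W (W' y)) = W' y" if "y \<in> hcarrier N" for y
  proof (rule M.inner_ext)
    fix z assume z: "z \<in> hcarrier M"
    have "hinner M z (W' (W (W' y))) = hinner N (W (W' (W z))) y"
      using z that by (simp add: W.inner W'.inner)
    also have "\<dots> = hinner M z (W' y)" using z that by (simp add: www W.inner)
    finally show "hinner M z (W' (W (W' y))) = hinner M z (W' y)" .
  qed (use that in simp_all)
  note V' = V[unfolded W(1) W.op_adjoint_total op_ker_total_op ran_total_op A(2)]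
  show "spans M {x \<in> hcarrier M. T x = hzero N} (hclosure M (S ` hcarrier N))"
    unfolding spans_def
  proof
    fix x assume x: "x \<in> hcarrier M"
    have "W (hsub M x (W' (W x))) = hzero N"
      using x www N.sub_eq_zero_iff by (simp add: W.sub)
    then have "hsub M x (W' (W x)) \<in> {x \<in> hcarrier M. W x = hzero N}" using x by simp
    then have "hsub M x (W' (W x)) \<in> {x \<in> hcarrier M. T x = hzero N}" by (simp only: V'(2))
    moreover have "W' (W x) \<in> hclosure M (S ` hcarrier N)"
      unfolding V'(5)[symmetric] using x by simp
    moreover have "x = hadd M (hsub M x (W' (W x))) (W' (W x))" using x by (intro M.inner_ext) auto
    ultimately show "\<exists>u\<in>{x \<in> hcarrier M. T x = hzero N}. \<exists>v\<in>hclosure M (S ` hcarrier N). x = hadd M u v"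
      by blast
  qed
  show "spans N {y \<in> hcarrier N. S y = hzero M} (hclosure N (T ` hcarrier M))"
    unfolding spans_def
  proof
    fix y assume y: "y \<in> hcarrier N"
    have "W' (hsub N y (W (W' y))) = hzero M"
      using y www' M.sub_eq_zero_iff by (simp add: W'.sub)
    then have "hsub N y (W (W' y)) \<in> {y \<in> hcarrier N. W' y = hzero M}" using y by simp
    then have "hsub N y (W (W' y)) \<in> {y \<in> hcarrier N. S y = hzero M}" by (simp only: V'(3))
    moreover have "W (W' y) \<in> hclosure N (T ` hcarrier M)"
      unfolding V'(4)[symmetric] using y by simp
    moreover have "y = hadd N (hsub N y (W (W' y))) (W (W' y))" using y by (intro N.inner_ext) auto
    ultimately show "\<exists>u\<in>{y \<in> hcarrier N. S y = hzero M}. \<exists>v\<in>hclosure N (T ` hcarrier M). y = hadd N u v"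
      by blast
  qed
qed

text \<open>
  The partial isometry extends \<open>|T| x \<mapsto> T x\<close>, which preserves inner products, by continuity to
  the closures of the two ranges and by zero to \<open>ker T\<close>; its adjoint is built in the same way from
  the inverse map. The relation \<open>\<Gamma>\<close> is the closure of the graph of \<open>|T| x \<mapsto> T x\<close>.
\<close>

lemma polar_decomposable_of_spans:
  assumes contr: "contractive M N T"
    and span_M: "spans M {x \<in> hcarrier M. T x = hzero N} (hclosure M (S ` hcarrier N))"
    and span_N: "spans N {y \<in> hcarrier N. S y = hzero M} (hclosure N (T ` hcarrier M))"
  shows "adjointable_polar_decomposable M N (total_op M T)"
proof -
  obtain A where A: "op_abs M N (total_op M T) = total_op M A" "adj_pair M M A A"
    "\<forall>x\<in>hcarrier M. \<forall>y\<in>hcarrier M. hinner M (A x) (A y) = hinner N (T x) (T y)"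
    "hclosure M (A ` hcarrier M) = hclosure M (S ` hcarrier N)"
    using op_abs_total[OF contr] by metis
  interpret A: adjoint_ops M M A A by unfold_locales (rule A)
  have norm_eq: "\<forall>x\<in>hcarrier M. hnorm M (A x) = hnorm N (T x)" using A(3) by (simp add: hnorm_def)
  define \<Gamma> where "\<Gamma> c d \<longleftrightarrow> c \<in> hcarrier M \<and> d \<in> hcarrier N \<and>
    (\<exists>X. (\<forall>n. X n \<in> hcarrier M) \<and> hlim M (\<lambda>n. A (X n)) c \<and> hlim N (\<lambda>n. T (X n)) d)" for c d
  have \<Gamma>c: "c \<in> hcarrier M" "d \<in> hcarrier N" if "\<Gamma> c d" for c d using that by (auto simp: \<Gamma>_def)
  have \<Gamma>_ex1: "\<exists>d. \<Gamma> c d" if "c \<in> hclosure M (S ` hcarrier N)" for c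
    using equal_norm_limit[OF A.adjoint_ops_axioms adjoint_ops_axioms norm_eq] that
    unfolding A(4) \<Gamma>_def by metis
  have \<Gamma>_ex2: "\<exists>c. \<Gamma> c d" if "d \<in> hclosure N (T ` hcarrier M)" for d
    using equal_norm_limit[OF adjoint_ops_axioms A.adjoint_ops_axioms _ that] norm_eq
    unfolding \<Gamma>_def by metis
  have \<Gamma>_graph: "\<Gamma> (A x) (T x)" if "x \<in> hcarrier M" for x
    unfolding \<Gamma>_def using that by (auto intro!: exI[of _ "\<lambda>n. x"] M.hlim_const N.hlim_const)
  have \<Gamma>_cl: "c \<in> hclosure M (S ` hcarrier N)" "d \<in> hclosure N (T ` hcarrier M)" if "\<Gamma> c d" for c d
  proof -
    obtain X where X: "\<forall>n. X n \<in> hcarrier M" "hlim M (\<lambda>n. A (X n)) c" "hlim N (\<lambda>n. T (X n)) d"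
      using \<open>\<Gamma> c d\<close> unfolding \<Gamma>_def by blast
    show "c \<in> hclosure M (S ` hcarrier N)"
      unfolding A(4)[symmetric] using X \<Gamma>c[OF that] by (intro M.hclosureI[OF _ _ _ X(2)]) auto
    show "d \<in> hclosure N (T ` hcarrier M)"
      using X \<Gamma>c[OF that] by (intro N.hclosureI[OF _ _ _ X(3)]) auto
  qed
  have \<Gamma>_inner: "hinner M c c' = hinner N d d'" if G: "\<Gamma> c d" "\<Gamma> c' d'" for c d c' d'
  proof -
    note cc = \<Gamma>c[OF G(1)] \<Gamma>c[OF G(2)]
    obtain X where X: "\<And>n. X n \<in> hcarrier M" "hlim M (\<lambda>n. A (X n)) c" "hlim N (\<lambda>n. T (X n)) d"
      using G(1) unfolding \<Gamma>_def by blast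
    obtain X' where X': "\<And>n. X' n \<in> hcarrier M" "hlim M (\<lambda>n. A (X' n)) c'" "hlim N (\<lambda>n. T (X' n)) d'"
      using G(2) unfolding \<Gamma>_def by blast
    have 1: "hinner M c (A x) = hinner N d (T x)" if x: "x \<in> hcarrier M" for x
    proof (rule LIMSEQ_unique)
      show "(\<lambda>n. hinner M (A (X n)) (A x)) \<longlonglongrightarrow> hinner M c (A x)"
        using X x cc by (intro M.hlim_inner_left) auto
      have "(\<lambda>n. hinner N (T (X n)) (T x)) \<longlonglongrightarrow> hinner N d (T x)"
        using X x cc by (intro N.hlim_inner_left) auto
      then show "(\<lambda>n. hinner M (A (X n)) (A x)) \<longlonglongrightarrow> hinner N d (T x)"
        using A(3) X x by simp
    qed
    show ?thesis
    proof (rule LIMSEQ_unique)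
      show "(\<lambda>n. hinner M c (A (X' n))) \<longlonglongrightarrow> hinner M c c'"
        using X' cc by (intro M.hlim_inner) auto
      have "(\<lambda>n. hinner N d (T (X' n))) \<longlonglongrightarrow> hinner N d d'"
        using X' cc by (intro N.hlim_inner) auto
      then show "(\<lambda>n. hinner M c (A (X' n))) \<longlonglongrightarrow> hinner N d d'"
        using X' by (simp add: 1)
    qed
  qed
  have diff_inner: "hinner M (hsub M c c') (hsub M c c') = hinner N (hsub N d d') (hsub N d d')"
    if G: "\<Gamma> c d" "\<Gamma> c' d'" for c d c' d'
    using \<Gamma>c[OF G(1)] \<Gamma>c[OF G(2)] \<Gamma>_inner[OF G(1) G(1)] \<Gamma>_inner[OF G(1) G(2)]
      \<Gamma>_inner[OF G(2) G(1)] \<Gamma>_inner[OF G(2) G(2)] by simp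
  have eq_iff: "c = c' \<longleftrightarrow> d = d'" if G: "\<Gamma> c d" "\<Gamma> c' d'" for c d c' d'
    using diff_inner[OF G] \<Gamma>c[OF G(1)] \<Gamma>c[OF G(2)] M.sub_eq_zero_iff N.sub_eq_zero_iff
      M.inner_definite N.inner_definite
    by (metis M.inner_zero_left M.sub_closed M.zero_closed N.inner_zero_left N.sub_closed N.zero_closed)
  have orth_M: "hinner M c k = 0" if "\<Gamma> c d" "k \<in> hcarrier M" "T k = hzero N" for c d k
    by (rule M.orthogonal_hclosure[OF _ \<Gamma>_cl(1)[OF that(1)] that(2)])
      (use that in \<open>auto simp: inner_right[symmetric]\<close>)
  have orth_N: "hinner N d k = 0" if "\<Gamma> c d" "k \<in> hcarrier N" "S k = hzero M" for c d k
    by (rule N.orthogonal_hclosure[OF _ \<Gamma>_cl(2)[OF that(1)] that(2)])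
      (use that in \<open>auto simp: inner\<close>)
  \<comment> \<open>In \<open>dec x k c d\<close>, \<open>x = k + c\<close> with \<open>k\<close> in the kernel, and \<open>d\<close> becomes the value at \<open>x\<close>.\<close>
  define dec where "dec x k c d \<longleftrightarrow> k \<in> hcarrier M \<and> T k = hzero N \<and> \<Gamma> c d \<and> x = hadd M k c" for x k c d
  define dec' where "dec' y k c d \<longleftrightarrow> k \<in> hcarrier N \<and> S k = hzero M \<and> \<Gamma> c d \<and> y = hadd N k d" for y k c d
  have dec_ex: "\<exists>d k c. dec x k c d" if "x \<in> hcarrier M" for x
    using span_M that \<Gamma>_ex1 unfolding spans_def dec_def by blast
  have dec'_ex: "\<exists>c k d. dec' y k c d" if "y \<in> hcarrier N" for y
    using span_N that \<Gamma>_ex2 unfolding spans_def dec'_def by blast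
  have dec_unique: "d = d'" if D: "dec x k c d" "dec x k' c' d'" for x k c d k' c' d'
  proof -
    have G: "\<Gamma> c d" "\<Gamma> c' d'" using D by (auto simp: dec_def)
    note cc = \<Gamma>c[OF G(1)] \<Gamma>c[OF G(2)]
    have k: "k \<in> hcarrier M" "k' \<in> hcarrier M" using D by (auto simp: dec_def)
    have eq: "hadd M k c = hadd M k' c'" using D by (auto simp: dec_def)
    have sub: "hinner M z (hsub M c c') = hinner M z (hsub M k' k)" if "z \<in> hcarrier M" for z
      using arg_cong[OF eq, of "hinner M z"] that cc k by (simp add: algebra_simps)
    have "hinner M (hsub M c c') (hsub M c c') = hinner M (hsub M c c') (hsub M k' k)"
      by (rule sub) (use cc in simp)
    also have "\<dots> = 0" using D cc k orth_M[OF G(1)] orth_M[OF G(2)] by (simp add: dec_def)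
    finally have "c = c'" using cc M.inner_definite[of "hsub M c c'"] M.sub_eq_zero_iff by simp
    then show ?thesis using eq_iff[OF G] by simp
  qed
  have dec'_unique: "c = c'" if D: "dec' y k c d" "dec' y k' c' d'" for y k c d k' c' d'
  proof -
    have G: "\<Gamma> c d" "\<Gamma> c' d'" using D by (auto simp: dec'_def)
    note cc = \<Gamma>c[OF G(1)] \<Gamma>c[OF G(2)]
    have k: "k \<in> hcarrier N" "k' \<in> hcarrier N" using D by (auto simp: dec'_def)
    have eq: "hadd N k d = hadd N k' d'" using D by (auto simp: dec'_def)
    have sub: "hinner N z (hsub N d d') = hinner N z (hsub N k' k)" if "z \<in> hcarrier N" for z
      using arg_cong[OF eq, of "hinner N z"] that cc k by (simp add: algebra_simps)
    have "hinner N (hsub N d d') (hsub N d d') = hinner N (hsub N d d') (hsub N k' k)"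
      by (rule sub) (use cc in simp)
    also have "\<dots> = 0" using D cc k orth_N[OF G(1)] orth_N[OF G(2)] by (simp add: dec'_def)
    finally have "d = d'" using cc N.inner_definite[of "hsub N d d'"] N.sub_eq_zero_iff by simp
    then show ?thesis using eq_iff[OF G] by simp
  qed
  define V where "V x = (SOME d. \<exists>k c. dec x k c d)" for x
  define V' where "V' y = (SOME c. \<exists>k d. dec' y k c d)" for y
  have V_eq: "V x = d" if "dec x k c d" for x k c d
    unfolding V_def using that dec_unique by (intro some_equality) blast+
  have V'_eq: "V' y = c" if "dec' y k c d" for y k c d
    unfolding V'_def using that dec'_unique by (intro some_equality) blast+
  have \<Gamma>_zero: "\<Gamma> (hzero M) (hzero N)" using \<Gamma>_graph[of "hzero M"] by (simp add: A.zero zero)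
  have dec_\<Gamma>: "dec c (hzero M) c d" "dec' d (hzero N) c d" if "\<Gamma> c d" for c d
    unfolding dec_def dec'_def using that \<Gamma>c[OF that] zero adjoint_ops.zero[of N M S T] swap
    by (auto simp: M.add_commute[of "hzero M"] M.add_zero N.add_commute[of "hzero N"] N.add_zero
        adjoint_ops_def adjoint_ops_axioms_def M.hilbert_module_axioms N.hilbert_module_axioms)
  have V_\<Gamma>: "V c = d" "V' d = c" if "\<Gamma> c d" for c d
    using V_eq[OF dec_\<Gamma>(1)[OF that]] V'_eq[OF dec_\<Gamma>(2)[OF that]] by auto
  have adjV: "adj_pair M N V V'"
    unfolding adj_pair_def
  proof (intro conjI ballI)
    fix x assume "x \<in> hcarrier M"
    then obtain d k c where D: "dec x k c d" using dec_ex by blast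
    then show "V x \<in> hcarrier N" unfolding V_eq[OF D] using \<Gamma>c(2) unfolding dec_def by blast
  next
    fix y assume "y \<in> hcarrier N"
    then obtain c k d where D: "dec' y k c d" using dec'_ex by blast
    then show "V' y \<in> hcarrier M" unfolding V'_eq[OF D] using \<Gamma>c(1) unfolding dec'_def by blast
  next
    fix x y assume "x \<in> hcarrier M" "y \<in> hcarrier N"
    then obtain d k c d' k' c' where D: "dec x k c d" "dec' y k' c' d'" using dec_ex dec'_ex by metis
    have G: "\<Gamma> c d" "\<Gamma> c' d'" using D by (auto simp: dec_def dec'_def)
    note cc = \<Gamma>c[OF G(1)] \<Gamma>c[OF G(2)]
    have k: "k \<in> hcarrier M" "T k = hzero N" "k' \<in> hcarrier N" "S k' = hzero M"
      using D by (auto simp: dec_def dec'_def)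
    have "hinner N (V x) y = hinner N d d'"
      unfolding V_eq[OF D(1)] using D(2) orth_N[OF G(1)] k cc by (simp add: dec'_def)
    also have "\<dots> = hinner M c c'" using \<Gamma>_inner[OF G] by simp
    also have "\<dots> = hinner M x c'"
      using D(1) M.inner_star[of c' k] orth_M[OF G(2) k(1,2)] k cc by (simp add: dec_def)
    finally show "hinner N (V x) y = hinner M x (V' y)" unfolding V'_eq[OF D(2)] .
  qed
  interpret V: adjoint_ops M N V V' by unfold_locales (rule adjV)
  have VVV: "V (V' (V x)) = V x" if x: "x \<in> hcarrier M" for x
  proof -
    obtain d k c where D: "dec x k c d" using dec_ex[OF x] by blast
    then have "\<Gamma> c d" by (simp add: dec_def)
    then show ?thesis by (simp add: V_eq[OF D] V_\<Gamma>)
  qed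
  have "partial_isometry M N (total_op M V)"
    unfolding partial_isometry_def V.op_adjoint_total
    using V.adjointable_total VVV
    by (subst total_op_comp, simp, subst total_op_comp, simp) (auto simp: total_op_eq_iff)
  moreover have "total_op M T = total_op M V \<circ>\<^sub>m op_abs M N (total_op M T)"
    unfolding A(1) using V_\<Gamma>(1)[OF \<Gamma>_graph]
    by (subst total_op_comp) (auto simp: total_op_eq_iff)
  moreover have "op_ker N (total_op M V) = op_ker N (total_op M T)"
    unfolding op_ker_total_op
  proof (intro Collect_cong conj_cong refl iffI)
    fix x assume x: "x \<in> hcarrier M" and V0: "V x = hzero N"
    obtain d k c where D: "dec x k c d" using dec_ex[OF x] by blast
    have G: "\<Gamma> c (hzero N)" using D V_eq[OF D] V0 by (simp add: dec_def)
    then have "c = hzero M" using eq_iff[OF G \<Gamma>_zero] by simp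
    then show "T x = hzero N" using D M.add_zero by (auto simp: dec_def)
  next
    fix x assume x: "x \<in> hcarrier M" "T x = hzero N"
    then have "dec x x (hzero M) (hzero N)" using \<Gamma>_zero by (simp add: dec_def M.add_zero)
    then show "V x = hzero N" by (rule V_eq)
  qed
  moreover have "op_ker M (op_adjoint M N (total_op M V)) = op_ker M (op_adjoint M N (total_op M T))"
    unfolding V.op_adjoint_total op_adjoint_total op_ker_total_op
  proof (intro Collect_cong conj_cong refl iffI)
    fix y assume y: "y \<in> hcarrier N" and V0: "V' y = hzero M"
    obtain c k d where D: "dec' y k c d" using dec'_ex[OF y] by blast
    have G: "\<Gamma> (hzero M) d" using D V'_eq[OF D] V0 by (simp add: dec'_def)
    then have "d = hzero N" using eq_iff[OF G \<Gamma>_zero] by simp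
    then show "S y = hzero M" using D N.add_zero by (auto simp: dec'_def)
  next
    fix y assume y: "y \<in> hcarrier N" "S y = hzero M"
    then have "dec' y y (hzero M) (hzero N)" using \<Gamma>_zero by (simp add: dec'_def N.add_zero)
    then show "V' y = hzero M" by (rule V'_eq)
  qed
  moreover have "ran (total_op M V) = hclosure N (ran (total_op M T))"
    unfolding ran_total_op
  proof (intro equalityI subsetI)
    fix y assume "y \<in> V ` hcarrier M"
    then obtain x where x: "x \<in> hcarrier M" "y = V x" by blast
    then obtain d k c where D: "dec x k c d" using dec_ex by blast
    from x(2) D show "y \<in> hclosure N (T ` hcarrier M)" unfolding V_eq[OF D] dec_def using \<Gamma>_cl(2) by blast
  next
    fix y assume "y \<in> hclosure N (T ` hcarrier M)"
    then obtain c where c: "\<Gamma> c y" using \<Gamma>_ex2 by blast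
    then show "y \<in> V ` hcarrier M" using V_\<Gamma>(1)[OF c] \<Gamma>c(1)[OF c] by blast
  qed
  moreover have "ran (op_adjoint M N (total_op M V)) = hclosure M (ran (op_abs M N (total_op M T)))"
    unfolding V.op_adjoint_total A(1) ran_total_op A(4)
  proof (intro equalityI subsetI)
    fix x assume "x \<in> V' ` hcarrier N"
    then obtain y where y: "y \<in> hcarrier N" "x = V' y" by blast
    then obtain c k d where D: "dec' y k c d" using dec'_ex by blast
    from y(2) D show "x \<in> hclosure M (S ` hcarrier N)" unfolding V'_eq[OF D] dec'_def using \<Gamma>_cl(1) by blast
  next
    fix x assume "x \<in> hclosure M (S ` hcarrier N)"
    then obtain d where d: "\<Gamma> x d" using \<Gamma>_ex1 by blast
    then show "x \<in> V' ` hcarrier N" using V_\<Gamma>(2)[OF d] \<Gamma>c(2)[OF d] by blast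
  qed
  ultimately show ?thesis
    unfolding adjointable_polar_decomposable_def using adjointable_total by blast
qed

end


section \<open>Densely defined operators and their adjoints\<close>

lemma module_operatorD:
  assumes "hilbert_module M" "hilbert_module N" "module_operator M N t"
  shows "t x = Some y \<Longrightarrow> x \<in> hcarrier M" "t x = Some y \<Longrightarrow> y \<in> hcarrier N"
    "t x = Some y \<Longrightarrow> t x' = Some y' \<Longrightarrow> t (hadd M x x') = Some (hadd N y y')"
    "t x = Some y \<Longrightarrow> t (hscale M c x) = Some (hscale N c y)"
    "t x = Some y \<Longrightarrow> t (hact M x a) = Some (hact N y a)"
    "t x = Some y \<Longrightarrow> t x' = Some y' \<Longrightarrow> t (hsub M x x') = Some (hsub N y y')"
    "t (hzero M) = Some (hzero N)"
proof -
  interpret M: hilbert_module M by fact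
  interpret N: hilbert_module N by fact
  have dom: "hsubmodule M (dom t)" and ran: "ran t \<subseteq> hcarrier N"
    and add: "\<And>x x' y y'. t x = Some y \<Longrightarrow> t x' = Some y' \<Longrightarrow> t (hadd M x x') = Some (hadd N y y')"
    and scale: "\<And>x y c. t x = Some y \<Longrightarrow> t (hscale M c x) = Some (hscale N c y)"
    and act: "\<And>x y a. t x = Some y \<Longrightarrow> t (hact M x a) = Some (hact N y a)"
    using assms(3) unfolding module_operator_def by (auto simp: domI)
  show "t x = Some y \<Longrightarrow> x \<in> hcarrier M" using M.hsubmoduleD(2)[OF dom] by blast
  show "t x = Some y \<Longrightarrow> y \<in> hcarrier N" using ran by (auto simp: ran_def)
  show "t x = Some y \<Longrightarrow> t x' = Some y' \<Longrightarrow> t (hadd M x x') = Some (hadd N y y')" by (rule add)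
  show "t x = Some y \<Longrightarrow> t (hscale M c x) = Some (hscale N c y)" by (rule scale)
  show "t x = Some y \<Longrightarrow> t (hact M x a) = Some (hact N y a)" by (rule act)
  show "t x = Some y \<Longrightarrow> t x' = Some y' \<Longrightarrow> t (hsub M x x') = Some (hsub N y y')"
    unfolding hsub_def by (intro add scale)
  obtain y where y: "t (hzero M) = Some y" using M.hsubmoduleD(3)[OF dom] by blast
  then have "y \<in> hcarrier N" using ran by (auto simp: ran_def)
  then show "t (hzero M) = Some (hzero N)"
    using scale[OF y, of 0] M.scale_zero[OF M.zero_closed] N.scale_zero by simp
qed

lemma module_operatorI:
  assumes "\<And>x y. t x = Some y \<Longrightarrow> x \<in> hcarrier M \<and> y \<in> hcarrier N"
    and "t (hzero M) = Some (hzero N)"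
    and "\<And>x y x' y'. t x = Some y \<Longrightarrow> t x' = Some y' \<Longrightarrow> t (hadd M x x') = Some (hadd N y y')"
    and "\<And>x y c. t x = Some y \<Longrightarrow> t (hscale M c x) = Some (hscale N c y)"
    and "\<And>x y a. t x = Some y \<Longrightarrow> t (hact M x a) = Some (hact N y a)"
  shows "module_operator M N t"
  unfolding module_operator_def hsubmodule_def using assms by (fastforce simp: ran_def)

lemma hsubmodule_ran:
  assumes "hilbert_module M" "hilbert_module N" "module_operator M N t"
  shows "hsubmodule N (ran t)"
proof -
  note t = module_operatorD[OF assms]
  show ?thesis
    unfolding hsubmodule_def
  proof (intro conjI ballI allI)
    show "ran t \<subseteq> hcarrier N" using t(2) by (auto simp: ran_def)
    show "hzero N \<in> ran t" using t(7) by (rule ranI)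
    fix y assume "y \<in> ran t"
    then obtain x where x: "t x = Some y" by (auto simp: ran_def)
    show "hscale N c y \<in> ran t" for c using t(4)[OF x] by (rule ranI)
    show "hact N y a \<in> ran t" for a using t(5)[OF x] by (rule ranI)
    fix y' assume "y' \<in> ran t"
    then obtain x' where x': "t x' = Some y'" by (auto simp: ran_def)
    show "hadd N y y' \<in> ran t" using t(3)[OF x x'] by (rule ranI)
  qed
qed

lemma hsubmodule_op_ker:
  assumes "hilbert_module M" "hilbert_module N" "module_operator M N t"
  shows "hsubmodule M (op_ker N t)"
proof -
  interpret N: hilbert_module N by fact
  note t = module_operatorD[OF assms]
  have "hact N (hzero N) a = hzero N" "hscale N c (hzero N) = hzero N" "hadd N (hzero N) (hzero N) = hzero N" for a c
    by (rule N.inner_ext; simp)+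
  then show ?thesis
    unfolding hsubmodule_def op_ker_def using t(1,7) t(3,4,5)[of _ "hzero N"] by fastforce
qed

lemma op_adjoint_eq_Some_iff:
  assumes "hilbert_module M" "hdense M (dom t)"
  shows "op_adjoint M N t u = Some v \<longleftrightarrow>
    u \<in> hcarrier N \<and> v \<in> hcarrier M \<and> (\<forall>x y. t x = Some y \<longrightarrow> hinner N y u = hinner M x v)"
proof -
  interpret M: hilbert_module M by fact
  let ?P = "\<lambda>z. z \<in> hcarrier M \<and> (\<forall>x\<in>dom t. hinner N (the (t x)) u = hinner M x z)"
  have uniq: "z = z'" if "?P z" "?P z'" for z z'
    using that by (intro M.dense_ext[OF assms(2)]) auto
  have P: "?P z \<longleftrightarrow> z \<in> hcarrier M \<and> (\<forall>x y. t x = Some y \<longrightarrow> hinner N y u = hinner M x z)" for z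
    by (auto simp: dom_def)
  have "op_adjoint M N t u = Some v \<longleftrightarrow> u \<in> hcarrier N \<and> ?P v"
  proof
    assume "op_adjoint M N t u = Some v"
    then have u: "u \<in> hcarrier N" "\<exists>z. ?P z" and v: "(THE z. ?P z) = v"
      unfolding op_adjoint_def Let_def by (auto split: if_splits)
    have "?P (THE z. ?P z)" by (rule theI') (use u(2) uniq in blast)
    then show "u \<in> hcarrier N \<and> ?P v" using u(1) v by blast
  next
    assume *: "u \<in> hcarrier N \<and> ?P v"
    then have "(THE z. ?P z) = v" using uniq by (intro the_equality) blast+
    then show "op_adjoint M N t u = Some v" unfolding op_adjoint_def Let_def using * by auto
  qed
  then show ?thesis using P by blast
qed

lemma module_operator_adjoint:
  assumes M: "hilbert_module M" and N: "hilbert_module N" and t: "module_operator M N t"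
    and dense: "hdense M (dom t)"
  shows "module_operator N M (op_adjoint M N t)"
proof -
  interpret M: hilbert_module M by fact
  interpret N: hilbert_module N by fact
  note c = module_operatorD(1,2)[OF M N t]
  show ?thesis
    by (rule module_operatorI) (auto simp: op_adjoint_eq_Some_iff[OF M dense] c)
qed

lemma closed_operator_adjoint:
  assumes M: "hilbert_module M" and N: "hilbert_module N" and t: "module_operator M N t"
    and dense: "hdense M (dom t)"
  shows "closed_operator N M (op_adjoint M N t)"
  unfolding closed_operator_iff[OF N M]
proof (intro conjI allI impI ballI)
  interpret M: hilbert_module M by fact
  interpret N: hilbert_module N by fact
  note c = module_operatorD(1,2)[OF M N t]
  note iff = op_adjoint_eq_Some_iff[OF M dense, of N]
  show "u \<in> hcarrier N" "v \<in> hcarrier M" if "op_adjoint M N t u = Some v" for u v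
    using that by (auto simp: iff)
  fix u v assume u: "u \<in> hcarrier N" and v: "v \<in> hcarrier M"
    and lim: "\<forall>e>0. \<exists>u' v'. op_adjoint M N t u' = Some v' \<and> hnorm N (hsub N u u') < e \<and> hnorm M (hsub M v v') < e"
  show "op_adjoint M N t u = Some v"
    unfolding iff
  proof (intro conjI allI impI u v)
    fix x y assume xy: "t x = Some y"
    note cxy = c[OF xy]
    let ?K = "hnorm N y + hnorm M x + 1"
    have K: "?K > 0" using N.hnorm_nonneg[of y] M.hnorm_nonneg[of x] by linarith
    have "norm (hinner N y u - hinner M x v) \<le> e" if e: "e > 0" for e
    proof -
      obtain u' v' where uv: "op_adjoint M N t u' = Some v'"
        "hnorm N (hsub N u u') < e / ?K" "hnorm M (hsub M v v') < e / ?K"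
        using lim e K by (metis divide_pos_pos)
      have uv': "u' \<in> hcarrier N" "v' \<in> hcarrier M" "hinner N y u' = hinner M x v'"
        using uv(1) xy by (auto simp: iff)
      have "hinner N y u - hinner M x v = hinner N y (hsub N u u') - hinner M x (hsub M v v')"
        using u v uv' cxy by simp
      also have "norm \<dots> \<le> hnorm N y * hnorm N (hsub N u u') + hnorm M x * hnorm M (hsub M v v')"
        using u v uv' cxy N.cauchy_schwarz[of y "hsub N u u'"] M.cauchy_schwarz[of x "hsub M v v'"]
        by (intro order_trans[OF norm_triangle_ineq4] add_mono) auto
      also have "\<dots> \<le> hnorm N y * (e / ?K) + hnorm M x * (e / ?K)"
        using uv by (intro add_mono mult_left_mono) auto
      also have "\<dots> = (hnorm N y + hnorm M x) * (e / ?K)" by (simp only: distrib_right)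
      also have "\<dots> \<le> ?K * (e / ?K)" using e K by (intro mult_right_mono) auto
      also have "\<dots> = e" using K by simp
      finally show ?thesis .
    qed
    then have "norm (hinner N y u - hinner M x v) \<le> 0" by (rule field_le_epsilon[of _ 0, simplified])
    then show "hinner N y u = hinner M x v" by simp
  qed
qed

lemma closed_operator_limit:
  assumes M: "hilbert_module M" and N: "hilbert_module N" and "closed_operator M N t"
    and X: "\<And>n. t (X n) = Some (Z n)" "hlim M X x" "hlim N Z z" and x: "x \<in> hcarrier M" and z: "z \<in> hcarrier N"
  shows "t x = Some z"
proof -
  interpret M: hilbert_module M by fact
  interpret N: hilbert_module N by fact
  have c: "\<And>n. X n \<in> hcarrier M" "\<And>n. Z n \<in> hcarrier N"
    and cl: "\<forall>x\<in>hcarrier M. \<forall>y\<in>hcarrier N. (\<forall>e>0. \<exists>x' y'. t x' = Some y' \<and>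
      hnorm M (hsub M x x') < e \<and> hnorm N (hsub N y y') < e) \<longrightarrow> t x = Some y"
    using assms(3) X(1) unfolding closed_operator_iff[OF M N] by blast+
  have "\<exists>x' y'. t x' = Some y' \<and> hnorm M (hsub M x x') < e \<and> hnorm N (hsub N z y') < e" if e: "e > 0" for e
  proof -
    have "eventually (\<lambda>n. hnorm M (hsub M (X n) x) < e \<and> hnorm N (hsub N (Z n) z) < e) sequentially"
      using X(2,3) e unfolding hlim_def by (intro eventually_conj order_tendstoD) auto
    then obtain n where n: "hnorm M (hsub M (X n) x) < e" "hnorm N (hsub N (Z n) z) < e"
      by (auto simp: eventually_sequentially)
    have "hnorm M (hsub M x (X n)) < e" "hnorm N (hsub N z (Z n)) < e"
      using n M.hnorm_sub_commute[OF x c(1)[of n]] N.hnorm_sub_commute[OF z c(2)[of n]] by simp_all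
    then show ?thesis using X(1)[of n] by blast
  qed
  then show ?thesis using cl x z by blast
qed

definition resolvent_onto ::
  "('a::cstar_algebra, 'e) hmodule \<Rightarrow> ('e \<rightharpoonup> 'f) \<Rightarrow> ('f \<rightharpoonup> 'e) \<Rightarrow> bool" where
  "resolvent_onto M t s \<longleftrightarrow>
    (\<forall>z\<in>hcarrier M. \<exists>x y. x \<in> hcarrier M \<and> t x = Some y \<and> s y = Some (hsub M z x))"

lemma one_plus_adjoint_self_eq_Some:
  "one_plus_adjoint_self M N t x = Some w \<longleftrightarrow>
    x \<in> hcarrier M \<and> (\<exists>y v. t x = Some y \<and> op_adjoint M N t y = Some v \<and> w = hadd M x v)"
  unfolding one_plus_adjoint_self_def op_add_def op_id_def
  by (auto simp: map_comp_def restrict_map_def dom_def split: option.splits if_splits)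

text \<open>
  A criterion for regularity. If \<open>1 + D'D\<close> and \<open>1 + DD'\<close> are onto, each \<open>y\<close> in the domain of
  \<open>D\<^sup>*\<close> differs from a suitable element \<open>y' = v + D u\<close> of the domain of \<open>D'\<close> by some \<open>r\<close> with
  \<open>r = - D D\<^sup>* r\<close>, whence \<open>r = 0\<close>.
\<close>

lemma adjoint_eq_of_resolvent_onto:
  assumes M: "hilbert_module M" and N: "hilbert_module N"
    and D: "module_operator M N D" "hdense M (dom D)" and D': "module_operator N M D'"
    and formal: "\<And>x y u v. D x = Some y \<Longrightarrow> D' u = Some v \<Longrightarrow> hinner N y u = hinner M x v"
    and onto: "resolvent_onto M D D'" "resolvent_onto N D' D"
  shows "op_adjoint M N D = D'"
proof
  interpret M: hilbert_module M by fact
  interpret N: hilbert_module N by fact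
  note d = module_operatorD[OF M N D(1)] and d' = module_operatorD[OF N M D']
  let ?A = "op_adjoint M N D"
  note iff = op_adjoint_eq_Some_iff[OF M D(2), of N]
  note a = module_operatorD[OF N M module_operator_adjoint[OF M N D]]
  have sub: "?A u = Some v" if "D' u = Some v" for u v
    unfolding iff using that formal d' by blast
  have sup: "D' y = Some w" if yw: "?A y = Some w" for y w
  proof -
    have y: "y \<in> hcarrier N" and w: "w \<in> hcarrier M" using yw by (auto simp: iff)
    obtain u p where u: "u \<in> hcarrier M" "D u = Some p" "D' p = Some (hsub M w u)"
      using onto(1) w unfolding resolvent_onto_def by blast
    obtain v q where v: "v \<in> hcarrier N" "D' v = Some q" "D q = Some (hsub N y v)"
      using onto(2) y unfolding resolvent_onto_def by blast
    have p: "p \<in> hcarrier N" and q: "q \<in> hcarrier M" using d(2)[OF u(2)] d'(2)[OF v(2)] by auto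
    let ?y = "hadd N v p" and ?w = "hadd M q (hsub M w u)"
    have D'y: "D' ?y = Some ?w" using d'(3)[OF v(2) u(3)] .
    let ?r = "hsub N y ?y" and ?\<rho> = "hsub M u q"
    have r: "?A ?r = Some (hsub M w ?w)" by (rule a(6)[OF yw sub[OF D'y]])
    have eq1: "hsub M w ?w = ?\<rho>" using w u q by (intro M.inner_ext) auto
    have "D ?\<rho> = Some (hsub N p (hsub N y v))" by (rule d(6)[OF u(2) v(3)])
    moreover have "hsub N p (hsub N y v) = hscale N (-1) ?r"
      using y v p by (intro N.inner_ext) auto
    ultimately have "D ?\<rho> = Some (hscale N (-1) ?r)" by simp
    then have "hinner N (hscale N (-1) ?r) ?r = hinner M ?\<rho> ?\<rho>"
      using r unfolding eq1 iff by blast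
    then have "- hinner N ?r ?r = hinner M ?\<rho> ?\<rho>" using y v p by (simp del: N.inner_sub N.inner_sub_left M.inner_sub M.inner_sub_left)
    then have "cstar_positive (- hinner N ?r ?r)" using M.inner_positive[of ?\<rho>] u q by (simp only: M.sub_closed)
    then have "hinner N ?r ?r = 0"
      using N.inner_positive[of ?r] y v p by (intro cstar_positive_antisym) auto
    then have "y = ?y" using N.inner_definite[of ?r] N.sub_eq_zero_iff y v p by simp
    then have "?A ?y = Some w" using yw by simp
    then show ?thesis using sub[OF D'y] D'y \<open>y = ?y\<close> by simp
  qed
  fix y
  show "?A y = D' y"
  proof (cases "?A y")
    case None
    then have "D' y = None" using sub by (cases "D' y") auto
    with None show ?thesis by simp
  next
    case (Some w)
    then show ?thesis using sup by simp
  qed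
qed

lemma regular_of_resolvent_onto:
  assumes M: "hilbert_module M" and N: "hilbert_module N"
    and D: "module_operator M N D" "hdense M (dom D)" and D': "module_operator N M D'" "hdense N (dom D')"
    and formal: "\<And>x y u v. D x = Some y \<Longrightarrow> D' u = Some v \<Longrightarrow> hinner N y u = hinner M x v"
    and onto: "resolvent_onto M D D'" "resolvent_onto N D' D"
  shows "op_adjoint M N D = D'" "regular_operator M N D"
proof -
  interpret M: hilbert_module M by fact
  interpret N: hilbert_module N by fact
  note d = module_operatorD[OF M N D(1)] and d' = module_operatorD[OF N M D'(1)]
  show adj: "op_adjoint M N D = D'" by (rule adjoint_eq_of_resolvent_onto[OF M N D D'(1) formal onto])
  have formal': "hinner M y u = hinner N x v" if "D' x = Some y" "D u = Some v" for x y u v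
    using formal[OF that(2,1)] N.inner_star[of v x] M.inner_star[of u y] d(1,2)[OF that(2)] d'(1,2)[OF that(1)]
    by simp
  have adj': "op_adjoint N M D' = D"
    by (rule adjoint_eq_of_resolvent_onto[OF N M D' D(1) formal' onto(2,1)])
  have "closed_operator M N D"
    using closed_operator_adjoint[OF N M D'] unfolding adj' .
  moreover have "ran (one_plus_adjoint_self M N D) = hcarrier M"
  proof (intro equalityI subsetI)
    fix w assume "w \<in> ran (one_plus_adjoint_self M N D)"
    then show "w \<in> hcarrier M" using d'(2) by (auto simp: ran_def one_plus_adjoint_self_eq_Some adj)
  next
    fix w assume w: "w \<in> hcarrier M"
    then obtain x y where x: "x \<in> hcarrier M" "D x = Some y" "D' y = Some (hsub M w x)"
      using onto(1) unfolding resolvent_onto_def by blast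
    then have "one_plus_adjoint_self M N D x = Some w"
      using M.add_sub_cancel[OF w x(1)] by (auto simp: one_plus_adjoint_self_eq_Some adj)
    then show "w \<in> ran (one_plus_adjoint_self M N D)" by (rule ranI)
  qed
  moreover have "hdense M (hcarrier M)"
    using M.subset_hclosure[of "hcarrier M"] M.hclosure_subset[of "hcarrier M"] by (simp add: hdense_def)
  ultimately show "regular_operator M N D"
    unfolding regular_operator_def semi_regular_def adj using D D' by simp
qed


section \<open>Regular operators and their bounded transforms\<close>

locale regular_op = M: hilbert_module M + N: hilbert_module N
  for M :: "('a::cstar_algebra, 'e) hmodule" and N :: "('a, 'f) hmodule" +
  fixes t :: "'e \<rightharpoonup> 'f"
  assumes regular: "regular_operator M N t"
begin

abbreviation s where "s \<equiv> op_adjoint M N t"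

lemma module_operator: "module_operator M N t"
  and dense_dom: "hdense M (dom t)"
  and dense_dom_adjoint: "hdense N (dom s)"
  and closed_op: "closed_operator M N t"
  using regular by (auto simp: regular_operator_def semi_regular_def)

lemmas t = module_operatorD[OF M.hilbert_module_axioms N.hilbert_module_axioms module_operator]

lemmas module_operator_s =
  module_operator_adjoint[OF M.hilbert_module_axioms N.hilbert_module_axioms module_operator dense_dom]

lemmas s = module_operatorD[OF N.hilbert_module_axioms M.hilbert_module_axioms module_operator_s]

lemmas s_iff = op_adjoint_eq_Some_iff[OF M.hilbert_module_axioms dense_dom, of N]

lemma adjoint: "t x = Some y \<Longrightarrow> s u = Some v \<Longrightarrow> hinner N y u = hinner M x v"
  by (auto simp: s_iff)

lemma adjoint': "t x = Some y \<Longrightarrow> s u = Some v \<Longrightarrow> hinner N u y = hinner M v x"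
  using adjoint[of x y u v] t(1,2)[of x y] s(1,2)[of u v] N.inner_star[of y u] M.inner_star[of x v] by simp

text \<open>
  \<open>1 + t\<^sup>* t\<close> expands the graph norm, so its range is closed.
\<close>

lemma resolvent_estimate:
  assumes "t x = Some y" "s y = Some v"
  shows "hnorm M x \<le> hnorm M (hadd M x v)" "hnorm N y \<le> hnorm M (hadd M x v)"
proof -
  let ?w = "hadd M x v"
  have c: "x \<in> hcarrier M" "y \<in> hcarrier N" "v \<in> hcarrier M" using t(1,2)[OF assms(1)] s(2)[OF assms(2)] by auto
  have eq: "hinner M x ?w = hinner M x x + hinner N y y" using c adjoint[OF assms] by simp
  have "norm (hinner M x x) \<le> norm (hinner M x ?w)"
    unfolding eq by (intro cstar_positive_norm_mono M.inner_positive c) (simp add: N.inner_positive c)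
  also have "\<dots> \<le> hnorm M x * hnorm M ?w" using c by (intro M.cauchy_schwarz) auto
  finally have "hnorm M x * hnorm M x \<le> hnorm M x * hnorm M ?w"
    by (simp add: M.hnorm_power2[symmetric] power2_eq_square)
  then show x: "hnorm M x \<le> hnorm M ?w"
    using M.hnorm_nonneg[of x] M.hnorm_nonneg[of ?w] by (metis mult_le_cancel_left_pos order_le_less)
  have "norm (hinner N y y) \<le> norm (hinner M x ?w)"
    unfolding eq by (intro cstar_positive_norm_mono N.inner_positive c) (simp add: M.inner_positive c)
  also have "\<dots> \<le> hnorm M x * hnorm M ?w" using c by (intro M.cauchy_schwarz) auto
  also have "\<dots> \<le> hnorm M ?w * hnorm M ?w" using x by (intro mult_right_mono) auto
  finally have "(hnorm N y)\<^sup>2 \<le> (hnorm M ?w)\<^sup>2"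
    by (simp only: N.hnorm_power2 power2_eq_square[of "hnorm M ?w"])
  then show "hnorm N y \<le> hnorm M ?w" by (rule power2_le_imp_le) simp
qed

lemma onto: "resolvent_onto M t s"
  unfolding resolvent_onto_def
proof
  fix z assume z: "z \<in> hcarrier M"
  have "hdense M (ran (one_plus_adjoint_self M N t))" using regular by (simp add: regular_operator_def)
  then have "ran (one_plus_adjoint_self M N t) \<subseteq> hcarrier M"
    "z \<in> hclosure M (ran (one_plus_adjoint_self M N t))" using z by (simp_all add: hdense_def)
  then obtain W where W: "\<And>n. W n \<in> ran (one_plus_adjoint_self M N t)" "hlim M W z"
    by (meson M.hclosure_sequence)
  have "\<exists>x y v. t x = Some y \<and> s y = Some v \<and> W n = hadd M x v" for n
    using W(1)[of n] by (auto simp: ran_def one_plus_adjoint_self_eq_Some)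
  then obtain X Y V where XYV: "\<And>n. t (X n) = Some (Y n)" "\<And>n. s (Y n) = Some (V n)"
    "\<And>n. W n = hadd M (X n) (V n)" by metis
  have c: "\<And>n. X n \<in> hcarrier M" "\<And>n. Y n \<in> hcarrier N" "\<And>n. V n \<in> hcarrier M" "\<And>n. W n \<in> hcarrier M"
    using t(1,2)[OF XYV(1)] s(2)[OF XYV(2)] by (auto simp: XYV(3))
  have diff: "hnorm M (hsub M (X n) (X m)) \<le> hnorm M (hsub M (W n) (W m))"
    "hnorm N (hsub N (Y n) (Y m)) \<le> hnorm M (hsub M (W n) (W m))" for n m
  proof -
    have "hsub M (W n) (W m) = hadd M (hsub M (X n) (X m)) (hsub M (V n) (V m))"
      unfolding XYV(3) using c by (intro M.inner_ext) auto
    then show "hnorm M (hsub M (X n) (X m)) \<le> hnorm M (hsub M (W n) (W m))"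
      "hnorm N (hsub N (Y n) (Y m)) \<le> hnorm M (hsub M (W n) (W m))"
      using resolvent_estimate[OF t(6)[OF XYV(1)[of n] XYV(1)[of m]] s(6)[OF XYV(2)[of n] XYV(2)[of m]]]
      by simp_all
  qed
  have Cauchy: "\<exists>K. \<forall>m\<ge>K. \<forall>n\<ge>m. hnorm M (hsub M (W n) (W m)) < e" if "e > 0" for e
    by (rule M.hlim_Cauchy[OF W(2) c(4) z that])
  have "\<exists>K. \<forall>m\<ge>K. \<forall>n\<ge>m. hnorm M (hsub M (X n) (X m)) < e" if "e > 0" for e
    using Cauchy[OF that] diff(1) by (meson le_less_trans)
  then obtain x where x: "x \<in> hcarrier M" "hlim M X x"
    using M.Cauchy_has_limit[of X] c(1) by blast
  have "\<exists>K. \<forall>m\<ge>K. \<forall>n\<ge>m. hnorm N (hsub N (Y n) (Y m)) < e" if "e > 0" for e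
    using Cauchy[OF that] diff(2) by (meson le_less_trans)
  then obtain y where y: "y \<in> hcarrier N" "hlim N Y y"
    using N.Cauchy_has_limit[of Y] c(2) by blast
  have tx: "t x = Some y"
    by (rule closed_operator_limit[OF M.hilbert_module_axioms N.hilbert_module_axioms closed_op XYV(1) x(2) y(2) x(1) y(1)])
  have "s y = Some (hsub M z x)"
    unfolding s_iff
  proof (intro conjI allI impI)
    fix a b assume ab: "t a = Some b"
    note cab = t(1,2)[OF ab]
    have "(\<lambda>n. hinner N b (Y n)) \<longlonglongrightarrow> hinner N b y" by (intro N.hlim_inner y c cab)
    moreover have "(\<lambda>n. hinner M a (W n) - hinner M a (X n)) \<longlonglongrightarrow> hinner M a z - hinner M a x"
      by (intro tendsto_diff M.hlim_inner W(2) x z c cab)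
    moreover have "hinner N b (Y n) = hinner M a (W n) - hinner M a (X n)" for n
      using adjoint[OF ab XYV(2)[of n]] c cab by (simp add: XYV(3))
    ultimately show "hinner N b y = hinner M a (hsub M z x)"
      using LIMSEQ_unique x z cab by fastforce
  qed (use x y z in auto)
  then show "\<exists>x y. x \<in> hcarrier M \<and> t x = Some y \<and> s y = Some (hsub M z x)" using x tx by blast
qed

text \<open>\<open>B = (1 + t\<^sup>* t)\<^sup>-\<^sup>1\<close>, \<open>C = t B\<close>, and \<open>Q\<close> is the root of \<open>B\<close>.\<close>

definition B where "B z = (SOME x. x \<in> hcarrier M \<and> (\<exists>y. t x = Some y \<and> s y = Some (hsub M z x)))"

definition C where "C z = the (t (B z))"

lemma B_C:
  assumes "z \<in> hcarrier M"
  shows "B z \<in> hcarrier M" "t (B z) = Some (C z)" "s (C z) = Some (hsub M z (B z))" "C z \<in> hcarrier N"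
proof -
  have "B z \<in> hcarrier M \<and> (\<exists>y. t (B z) = Some y \<and> s y = Some (hsub M z (B z)))"
  proof -
    have "\<exists>x. x \<in> hcarrier M \<and> (\<exists>y. t x = Some y \<and> s y = Some (hsub M z x))"
      using onto assms unfolding resolvent_onto_def by blast
    from someI_ex[OF this] show ?thesis unfolding B_def .
  qed
  then show "B z \<in> hcarrier M" "t (B z) = Some (C z)" "s (C z) = Some (hsub M z (B z))" "C z \<in> hcarrier N"
    using t(2) by (auto simp: C_def)
qed

lemma B_unique:
  assumes "t x = Some y" "s y = Some v" "z = hadd M x v"
  shows "x = B z" "y = C z"
proof -
  have c: "x \<in> hcarrier M" "y \<in> hcarrier N" "v \<in> hcarrier M" "z \<in> hcarrier M"
    using t(1,2)[OF assms(1)] s(2)[OF assms(2)] by (auto simp: assms(3))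
  note b = B_C[OF c(4)]
  have "hadd M (hsub M x (B z)) (hsub M v (hsub M z (B z))) = hzero M"
    using c(1-3) b(1) by (intro M.inner_ext) (simp_all add: assms(3))
  then have "hnorm M (hsub M x (B z)) \<le> 0"
    using resolvent_estimate(1)[OF t(6)[OF assms(1) b(2)] s(6)[OF assms(2) b(3)]] by simp
  then have "hnorm M (hsub M x (B z)) = 0" using M.hnorm_nonneg[of "hsub M x (B z)"] by simp
  then show "x = B z" using M.hnorm_eq_zero_iff[of "hsub M x (B z)"] M.sub_eq_zero_iff c b by simp
  then show "y = C z" using assms(1) b(2) by simp
qed

lemma form:
  assumes "z \<in> hcarrier M" "w \<in> hcarrier M"
  shows "hinner M (B z) w = hinner M (B z) (B w) + hinner N (C z) (C w)"
    "hinner M w (B z) = hinner M (B w) (B z) + hinner N (C w) (C z)"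
proof -
  note c = B_C(1)[OF assms(1)] B_C(1)[OF assms(2)] assms
  show "hinner M (B z) w = hinner M (B z) (B w) + hinner N (C z) (C w)"
    unfolding adjoint[OF B_C(2)[OF assms(1)] B_C(3)[OF assms(2)]] using c by simp
  show "hinner M w (B z) = hinner M (B w) (B z) + hinner N (C w) (C z)"
    unfolding adjoint'[OF B_C(2)[OF assms(1)] B_C(3)[OF assms(2)]] using c by simp
qed

lemma B_self_adjoint: "adj_pair M M B B"
  unfolding adj_pair_def
proof (intro conjI ballI)
  fix x y assume "x \<in> hcarrier M" "y \<in> hcarrier M"
  then show "hinner M (B x) y = hinner M x (B y)"
    using form(1)[of x y] form(2)[of y x] by (metis (no_types))
qed (auto intro: B_C(1))

sublocale B: adjoint_ops M M B B
  by unfold_locales (rule B_self_adjoint)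

lemma B_form_positive: "form_positive M B"
  unfolding form_positive_def
proof
  fix z assume z: "z \<in> hcarrier M"
  show "cstar_positive (hinner M z (B z))"
    unfolding form(2)[OF z z] by (intro cstar_positive_add M.inner_positive N.inner_positive B_C z)
qed

lemma B_norm: "z \<in> hcarrier M \<Longrightarrow> hnorm M (B z) \<le> 1 * hnorm M z"
  using resolvent_estimate(1)[OF B_C(2,3), of z] M.add_sub_cancel[of z "B z"] B_C(1)[of z] by simp

lemma op_inverse_eq: "op_inverse (one_plus_adjoint_self M N t) = total_op M B"
proof
  fix z
  have P: "one_plus_adjoint_self M N t x = Some z \<longleftrightarrow> z \<in> hcarrier M \<and> x = B z" for x
  proof
    assume "one_plus_adjoint_self M N t x = Some z"
    then obtain y v where "x \<in> hcarrier M" "t x = Some y" "s y = Some v" "z = hadd M x v"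
      by (auto simp: one_plus_adjoint_self_eq_Some)
    then show "z \<in> hcarrier M \<and> x = B z" using B_unique(1) s(2) by auto
  next
    assume "z \<in> hcarrier M \<and> x = B z"
    then show "one_plus_adjoint_self M N t x = Some z"
      using B_C[of z] M.add_sub_cancel[of z "B z"] by (auto simp: one_plus_adjoint_self_eq_Some)
  qed
  then have "z \<in> ran (one_plus_adjoint_self M N t) \<longleftrightarrow> z \<in> hcarrier M" by (auto simp: ran_def)
  then show "op_inverse (one_plus_adjoint_self M N t) z = total_op M B z"
    unfolding op_inverse_def total_op_def by (auto simp: P)
qed

text \<open>
  For \<open>x\<close> in the domain of \<open>t\<close> and \<open>u\<^sub>n \<rightarrow> t x\<close> in the domain of \<open>t\<^sup>*\<close>, the elements
  \<open>B x + B t\<^sup>* u\<^sub>n\<close> converge to \<open>x\<close>; so the domain of \<open>t\<^sup>* t\<close> is dense.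
\<close>

lemma dense_ran_B: "hdense M (B ` hcarrier M)"
proof -
  have sub: "B ` hcarrier M \<subseteq> hcarrier M" using B_C by auto
  have "dom t \<subseteq> hclosure M (B ` hcarrier M)"
  proof
    fix x assume "x \<in> dom t"
    then obtain y where xy: "t x = Some y" by blast
    note c = t(1,2)[OF xy]
    show "x \<in> hclosure M (B ` hcarrier M)"
      unfolding M.hclosure_iff[OF sub]
    proof (intro conjI allI impI c)
      fix e :: real assume "e > 0"
      then obtain u where u: "u \<in> dom s" "hnorm N (hsub N y u) < e"
        using dense_dom_adjoint c unfolding N.hdense_iff by blast
      then obtain v where uv: "s u = Some v" by blast
      note cu = s(1,2)[OF uv]
      let ?b = "B (hadd M x v)"
      let ?d = "hsub M x ?b"
      have b: "?b \<in> hcarrier M" "?d \<in> hcarrier M" using c cu by auto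
      have "hinner M ?d z = hinner N (hsub N y u) (C z)" if z: "z \<in> hcarrier M" for z
      proof -
        have "hinner M ?d z = hinner M x z - hinner M (hadd M x v) (B z)"
          using z c cu B_C by (simp add: B.inner)
        also have "\<dots> = hinner M x (hsub M z (B z)) - hinner M v (B z)"
          using z c cu B_C by (simp add: algebra_simps)
        also have "\<dots> = hinner N (hsub N y u) (C z)"
          using z c cu B_C[OF z] adjoint[OF xy B_C(3)[OF z]] adjoint'[OF B_C(2)[OF z] uv] by simp
        finally show ?thesis .
      qed
      then have "(hnorm M ?d)\<^sup>2 = norm (hinner N (hsub N y u) (C ?d))" using b by (simp only: M.hnorm_power2)
      also have "\<dots> \<le> hnorm N (hsub N y u) * hnorm N (C ?d)"
        using c cu B_C[OF b(2)] by (intro N.cauchy_schwarz) auto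
      also have "\<dots> \<le> hnorm N (hsub N y u) * hnorm M ?d"
        using resolvent_estimate(2)[OF B_C(2,3)[OF b(2)]] M.add_sub_cancel[OF b(2) B_C(1)[OF b(2)]]
        by (intro mult_left_mono) auto
      finally have "hnorm M ?d * hnorm M ?d \<le> hnorm N (hsub N y u) * hnorm M ?d" by (simp add: power2_eq_square)
      then have "hnorm M ?d \<le> hnorm N (hsub N y u)"
        using M.hnorm_nonneg[of ?d] N.hnorm_nonneg[of "hsub N y u"] by (metis mult_le_cancel_right_pos order_le_less)
      then show "\<exists>z\<in>B ` hcarrier M. hnorm M (hsub M x z) < e"
        using u(2) c cu by (intro bexI[of _ ?b]) auto
    qed
  qed
  then have "hclosure M (dom t) \<subseteq> hclosure M (B ` hcarrier M)" by (rule M.hclosure_minimal)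
  then show ?thesis
    using dense_dom sub M.hclosure_subset[of "B ` hcarrier M"] by (auto simp: hdense_def)
qed

definition Q where "Q = (SOME R. op_sqrt M (total_op M B) = total_op M R \<and> adj_pair M M R R \<and>
  form_positive M R \<and> (\<forall>x\<in>hcarrier M. R (R x) = B x) \<and> function_of M B R)"

lemma Q:
  "op_sqrt M (total_op M B) = total_op M Q" "adj_pair M M Q Q" "form_positive M Q"
  "x \<in> hcarrier M \<Longrightarrow> Q (Q x) = B x" "function_of M B Q"
proof -
  have "\<exists>R. op_sqrt M (total_op M B) = total_op M R \<and> adj_pair M M R R \<and>
    form_positive M R \<and> (\<forall>x\<in>hcarrier M. R (R x) = B x) \<and> function_of M B R"
  proof -
    have "\<forall>x\<in>hcarrier M. hnorm M (B x) \<le> 1 * hnorm M x" using B_norm by blast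
    from op_sqrt_total[OF M.hilbert_module_axioms B_self_adjoint B_form_positive this zero_le_one]
    show ?thesis by blast
  qed
  from someI_ex[OF this]
  show "op_sqrt M (total_op M B) = total_op M Q" "adj_pair M M Q Q" "form_positive M Q"
    "x \<in> hcarrier M \<Longrightarrow> Q (Q x) = B x" "function_of M B Q"
    unfolding Q_def by blast+
qed

sublocale Q: adjoint_ops M M Q Q
  by unfold_locales (rule Q(2))

lemma Q_contractive: "contractive M M Q"
  unfolding contractive_def
proof
  fix x assume x: "x \<in> hcarrier M"
  have "(hnorm M (Q x))\<^sup>2 = norm (hinner M x (B x))" using x Q(4) by (simp add: M.hnorm_power2 Q.inner)
  also have "\<dots> \<le> hnorm M x * hnorm M (B x)" using x by (intro M.cauchy_schwarz) auto
  also have "\<dots> \<le> hnorm M x * hnorm M x" using x B_norm[OF x] by (intro mult_left_mono) auto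
  finally have "(hnorm M (Q x))\<^sup>2 \<le> (hnorm M x)\<^sup>2" by (simp only: power2_eq_square)
  then show "hnorm M (Q x) \<le> hnorm M x" by (rule power2_le_imp_le) simp
qed

lemma dense_ran_Q: "hdense M (Q ` hcarrier M)"
proof -
  have "B ` hcarrier M \<subseteq> Q ` hcarrier M" using Q(4) by (metis Q.closed image_subsetI rev_image_eqI)
  then have "hclosure M (B ` hcarrier M) \<subseteq> hclosure M (Q ` hcarrier M)" by (rule M.hclosure_mono)
  then show ?thesis
    using dense_ran_B M.hclosure_subset[of "Q ` hcarrier M"] by (auto simp: hdense_def)
qed

lemma Q_hlim:
  assumes "hlim M X x" "\<And>n. X n \<in> hcarrier M" and x: "x \<in> hcarrier M"
  shows "hlim M (\<lambda>n. Q (X n)) (Q x)"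
proof (rule M.hlim_bounded_map[OF assms, where K=1])
  fix z assume "z \<in> hcarrier M"
  then show "hnorm M (hsub M (Q z) (Q x)) \<le> 1 * hnorm M (hsub M z x)"
    using x Q_contractive by (simp add: Q.sub[symmetric] contractive_def)
qed (rule M.hilbert_module_axioms)

text \<open>
  On the range of \<open>Q\<close>, \<open>t Q Q z = C z\<close> and \<open>\<langle>C z, C z\<rangle> \<le> \<langle>Q z, Q z\<rangle>\<close>; as \<open>t\<close> is closed,
  \<open>F = t Q\<close> is defined everywhere.
\<close>

lemma t_Q_exists:
  assumes x: "x \<in> hcarrier M"
  shows "\<exists>y. t (Q x) = Some y \<and> hnorm N y \<le> hnorm M x"
proof -
  have le: "hnorm N (C z) \<le> hnorm M (Q z)" if z: "z \<in> hcarrier M" for z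
  proof -
    have "hinner M (Q z) (Q z) - hinner N (C z) (C z) = hinner M (B z) (B z)"
      using form(2)[OF z z] z Q(4) by (simp add: Q.inner)
    then have "cstar_positive (hinner M (Q z) (Q z) - hinner N (C z) (C z))"
      using M.inner_positive z by simp
    then show ?thesis using B_C(4)[OF z] by (rule N.hnorm_le_of_order)
  qed
  have C_sub: "C (hsub M z w) = hsub N (C z) (C w)" if "z \<in> hcarrier M" "w \<in> hcarrier M" for z w
    using t(6)[OF B_C(2) B_C(2), of z w] B_C(2)[of "hsub M z w"] that by (simp add: B.sub)
  have Qsub: "Q ` hcarrier M \<subseteq> hcarrier M" by auto
  have "x \<in> hclosure M (Q ` hcarrier M)" using dense_ran_Q x by (simp add: hdense_def)
  then obtain W where W: "\<And>n. W n \<in> Q ` hcarrier M" "hlim M W x"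
    using M.hclosure_sequence[OF Qsub] by blast
  then have "\<exists>z. z \<in> hcarrier M \<and> W n = Q z" for n by blast
  then obtain Z where Z: "\<And>n. Z n \<in> hcarrier M" "\<And>n. W n = Q (Z n)" by metis
  have Wc: "\<And>n. W n \<in> hcarrier M" using Z by simp
  have "hnorm N (hsub N (C (Z n)) (C (Z m))) \<le> hnorm M (hsub M (W n) (W m))" for n m
    using le[of "hsub M (Z n) (Z m)"] Z(1) by (simp add: C_sub Q.sub Z(2))
  then have "\<exists>K. \<forall>m\<ge>K. \<forall>n\<ge>m. hnorm N (hsub N (C (Z n)) (C (Z m))) < e" if "e > 0" for e
    using M.hlim_Cauchy[OF W(2) Wc x that] by (meson le_less_trans)
  then obtain y where y: "y \<in> hcarrier N" "hlim N (\<lambda>n. C (Z n)) y"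
    using N.Cauchy_has_limit[of "\<lambda>n. C (Z n)"] Z(1) B_C(4) by metis
  have "t (Q x) = Some y"
  proof (rule closed_operator_limit[OF M.hilbert_module_axioms N.hilbert_module_axioms closed_op])
    show "t (Q (W n)) = Some (C (Z n))" for n using Z(1)[of n] B_C(2) by (simp add: Z(2) Q(4))
    show "hlim M (\<lambda>n. Q (W n)) (Q x)" by (rule Q_hlim[OF W(2) Wc x])
  qed (use x y in auto)
  moreover have "hnorm N y \<le> hnorm M x"
  proof -
    have "hnorm N y \<le> hnorm M x + hnorm M (hsub M (W n) x) + hnorm N (hsub N (C (Z n)) y)" for n
    proof -
      have "hnorm N y \<le> hnorm N (C (Z n)) + hnorm N (hsub N (C (Z n)) y)"
        using N.hnorm_le_add_sub[of y "C (Z n)"] N.hnorm_sub_commute[of y "C (Z n)"] y B_C(4)[OF Z(1)[of n]] by simp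
      moreover have "hnorm N (C (Z n)) \<le> hnorm M (W n)" using le[OF Z(1)[of n]] by (simp add: Z(2))
      moreover have "hnorm M (W n) \<le> hnorm M x + hnorm M (hsub M (W n) x)"
        by (rule M.hnorm_le_add_sub[OF Wc x])
      ultimately show ?thesis by linarith
    qed
    moreover have "(\<lambda>n. hnorm M x + hnorm M (hsub M (W n) x) + hnorm N (hsub N (C (Z n)) y)) \<longlonglongrightarrow> hnorm M x + 0 + 0"
      using W(2) y(2) unfolding hlim_def by (intro tendsto_intros)
    ultimately have "hnorm N y \<le> hnorm M x + 0 + 0" by (intro LIMSEQ_le_const) auto
    then show ?thesis by simp
  qed
  ultimately show ?thesis by blast
qed

definition F where "F x = the (t (Q x))"

lemma F:
  assumes "x \<in> hcarrier M"
  shows "t (Q x) = Some (F x)" "hnorm N (F x) \<le> hnorm M x" "F x \<in> hcarrier N"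
  using t_Q_exists[OF assms] t(2) by (auto simp: F_def)

lemma F_contractive: "contractive M N F"
  using F(2) by (simp add: contractive_def)

text \<open>
  On the dense domain of \<open>t\<^sup>*\<close>, the adjoint of \<open>F\<close> is \<open>u \<mapsto> Q t\<^sup>* u\<close>. It is a contraction there because
  \<open>F\<close> is one, so it extends to \<open>N\<close>.
\<close>

lemma F_adjoint_exists:
  assumes y: "y \<in> hcarrier N"
  shows "\<exists>g\<in>hcarrier M. \<forall>x\<in>hcarrier M. hinner N (F x) y = hinner M x g"
proof -
  have F_inner: "hinner N (F x) u = hinner M x (Q v)" if "x \<in> hcarrier M" "s u = Some v" for x u v
    using adjoint[OF F(1)[OF that(1)] that(2)] that s(2)[OF that(2)] by (simp add: Q.inner)
  have F_sub: "F (hsub M x x') = hsub N (F x) (F x')" if "x \<in> hcarrier M" "x' \<in> hcarrier M" for x x'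
    using t(6)[OF F(1) F(1), of x x'] F(1)[of "hsub M x x'"] that by (simp add: Q.sub)
  have "y \<in> hclosure N (dom s)" "dom s \<subseteq> hcarrier N" using dense_dom_adjoint y by (auto simp: hdense_def)
  then obtain U where U: "\<And>n. U n \<in> dom s" "hlim N U y" by (meson N.hclosure_sequence)
  then have "\<exists>v. s (U n) = Some v" for n by blast
  then obtain V where V: "\<And>n. s (U n) = Some (V n)" by metis
  have c: "\<And>n. U n \<in> hcarrier N" "\<And>n. V n \<in> hcarrier M" using s(1,2)[OF V] by auto
  have "hnorm M (hsub M (Q (V n)) (Q (V m))) \<le> hnorm N (hsub N (U n) (U m))" for n m
  proof -
    let ?g = "hsub M (Q (V n)) (Q (V m))" and ?u = "hsub N (U n) (U m)"
    have g: "?g \<in> hcarrier M" using c by simp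
    have u: "?u \<in> hcarrier N" using c by simp
    have "hinner N (F ?g) ?u = hinner M ?g ?g"
      using F_inner[OF g V[of n]] F_inner[OF g V[of m]] F(3)[OF g] c g
      by (simp only: N.inner_sub M.inner_sub[OF g] Q.closed)
    then have "(hnorm M ?g)\<^sup>2 = norm (hinner N (F ?g) ?u)" by (simp only: M.hnorm_power2)
    also have "\<dots> \<le> hnorm N (F ?g) * hnorm N ?u" by (rule N.cauchy_schwarz[OF F(3)[OF g] u])
    also have "\<dots> \<le> hnorm M ?g * hnorm N ?u" using F(2)[OF g] by (intro mult_right_mono) auto
    finally have "hnorm M ?g * hnorm M ?g \<le> hnorm M ?g * hnorm N ?u" by (simp add: power2_eq_square)
    then show ?thesis
      using M.hnorm_nonneg[of ?g] N.hnorm_nonneg[of ?u] by (metis mult_le_cancel_left_pos order_le_less)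
  qed
  then have "\<exists>K. \<forall>m\<ge>K. \<forall>n\<ge>m. hnorm M (hsub M (Q (V n)) (Q (V m))) < e" if "e > 0" for e
    using N.hlim_Cauchy[OF U(2) c(1) y that] by (meson le_less_trans)
  then obtain g where g: "g \<in> hcarrier M" "hlim M (\<lambda>n. Q (V n)) g"
    using M.Cauchy_has_limit[of "\<lambda>n. Q (V n)"] c(2) by (metis Q.closed)
  have "hinner N (F x) y = hinner M x g" if x: "x \<in> hcarrier M" for x
  proof (rule LIMSEQ_unique)
    show "(\<lambda>n. hinner N (F x) (U n)) \<longlonglongrightarrow> hinner N (F x) y" by (intro N.hlim_inner U(2) c y F(3) x)
    have "(\<lambda>n. hinner M x (Q (V n))) \<longlonglongrightarrow> hinner M x g" by (intro M.hlim_inner g c x Q.closed)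
    then show "(\<lambda>n. hinner N (F x) (U n)) \<longlonglongrightarrow> hinner M x g" by (simp add: F_inner[OF x V])
  qed
  then show ?thesis using g by blast
qed

definition G where "G y = (SOME g. g \<in> hcarrier M \<and> (\<forall>x\<in>hcarrier M. hinner N (F x) y = hinner M x g))"

lemma F_G: "adj_pair M N F G"
proof -
  have "G y \<in> hcarrier M \<and> (\<forall>x\<in>hcarrier M. hinner N (F x) y = hinner M x (G y))" if "y \<in> hcarrier N" for y
  proof -
    have "\<exists>g. g \<in> hcarrier M \<and> (\<forall>x\<in>hcarrier M. hinner N (F x) y = hinner M x g)"
      using F_adjoint_exists[OF that] by blast
    from someI_ex[OF this] show ?thesis unfolding G_def .
  qed
  then show ?thesis unfolding adj_pair_def using F(3) by blast
qed

sublocale F: adjoint_ops M N F G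
  by unfold_locales (rule F_G)

lemma bounded_transform_eq: "bounded_transform M N t = total_op M F"
  unfolding bounded_transform_def op_inverse_eq Q(1)
  by (rule ext) (auto simp: map_comp_def total_op_def F(1))

lemma G_of_adjoint: "s u = Some v \<Longrightarrow> G u = Q v"
  using s(1,2)[of u v]
  by (intro M.inner_ext) (auto simp: F.inner[symmetric] Q.inner[symmetric] adjoint[OF F(1)])

lemma Q_B: "x \<in> hcarrier M \<Longrightarrow> Q (B x) = B (Q x)"
  using Q(4)[of x] Q(4)[of "Q x"] by simp

lemma F_Q: "z \<in> hcarrier M \<Longrightarrow> F (Q z) = C z"
  using F(1)[of "Q z"] B_C(2)[of z] by (simp add: Q(4))

text \<open>
  \<open>F\<^sup>* F = 1 - B\<close>, first between vectors of the dense range of \<open>Q\<close>, where \<open>F\<close> is known to be \<open>C\<close>.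
\<close>

lemma G_F: "x \<in> hcarrier M \<Longrightarrow> G (F x) = hsub M x (B x)"
proof -
  have ran: "hinner M (Q w) (G (F (Q z))) = hinner M (Q w) (hsub M (Q z) (B (Q z)))"
    if "z \<in> hcarrier M" "w \<in> hcarrier M" for z w
  proof -
    have "hinner M (Q w) (G (F (Q z))) = hinner N (F (Q w)) (F (Q z))"
      by (rule F.inner[symmetric]) (use that in simp_all)
    also have "\<dots> = hinner N (C w) (C z)" using that by (simp add: F_Q)
    also have "\<dots> = hinner M (B w) (hsub M z (B z))"
      using adjoint[OF B_C(2)[OF that(2)] B_C(3)[OF that(1)]] .
    also have "\<dots> = hinner M (Q w) (Q (hsub M z (B z)))"
      using that by (simp add: Q(4)[symmetric] Q.inner del: M.inner_sub)
    also have "\<dots> = hinner M (Q w) (hsub M (Q z) (B (Q z)))"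
      using that by (simp add: Q.sub Q_B)
    finally show ?thesis .
  qed
  have ran_Q: "G (F (Q z)) = hsub M (Q z) (B (Q z))" if "z \<in> hcarrier M" for z
    by (rule M.dense_ext[OF dense_ran_Q]) (use that ran in auto)
  show "G (F x) = hsub M x (B x)" if x: "x \<in> hcarrier M"
  proof (rule M.dense_ext[OF dense_ran_Q])
    fix d assume "d \<in> Q ` hcarrier M"
    then obtain w where w: "w \<in> hcarrier M" "d = Q w" by blast
    have "hinner M d (G (F x)) = hinner M (G (F d)) x"
      using x w by (simp add: F.inner[symmetric] F.inner_right[symmetric])
    also have "\<dots> = hinner M (hsub M d (B d)) x" using ran_Q w by simp
    also have "\<dots> = hinner M d (hsub M x (B x))" using x w by (simp add: B.inner)
    finally show "hinner M d (G (F x)) = hinner M d (hsub M x (B x))" .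
  qed (use x in auto)
qed

text \<open>
  From \<open>x = B x + (1 - B) x\<close>, where formally \<open>(1 - B) x = B t\<^sup>* y = Q F\<^sup>* y\<close>. Hence the domain of \<open>t\<close> is
  the range of \<open>Q\<close>, and \<open>t\<close> and \<open>F\<close> have the same range.
\<close>

lemma dom_eq_Q:
  assumes "t x = Some y"
  shows "x = Q (hadd M (Q x) (G y))" "y = F (hadd M (Q x) (G y))"
proof -
  note c = t(1,2)[OF assms]
  show eq: "x = Q (hadd M (Q x) (G y))"
  proof (rule M.inner_ext)
    fix z assume z: "z \<in> hcarrier M"
    have "hinner M z x = hinner M (B z) x + hinner M (hsub M z (B z)) x" using z c by simp
    also have "hinner M (hsub M z (B z)) x = hinner N (C z) y" using adjoint'[OF assms B_C(3)[OF z]] ..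
    also have "hinner N (C z) y = hinner M (Q z) (G y)" using z c by (simp add: F_Q[symmetric] F.inner)
    also have "hinner M (B z) x = hinner M (Q z) (Q x)" using z c by (simp add: Q(4)[symmetric] Q.inner)
    finally show "hinner M z x = hinner M z (Q (hadd M (Q x) (G y)))" using z c by (simp add: Q.inner[symmetric])
  qed (use c in auto)
  show "y = F (hadd M (Q x) (G y))"
    using F(1)[of "hadd M (Q x) (G y)"] assms c by (simp add: eq[symmetric])
qed

lemma ran_F: "F ` hcarrier M = ran t"
proof (intro equalityI subsetI)
  fix y assume "y \<in> F ` hcarrier M"
  then show "y \<in> ran t" using F(1) by (auto intro: ranI)
next
  fix y assume "y \<in> ran t"
  then obtain x where xy: "t x = Some y" by (auto simp: ran_def)
  then show "y \<in> F ` hcarrier M" using dom_eq_Q(2)[OF xy] t(1,2)[OF xy] by (metis F.adjoint_closed M.add_closed Q.closed imageI)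
qed

text \<open>
  As \<open>B x = x\<close>, the vector \<open>y = Q x - x\<close> satisfies \<open>Q y = - y\<close>, and vanishes by positivity of \<open>Q\<close>.
\<close>

lemma ker_Q: "t x = Some (hzero N) \<Longrightarrow> Q x = x"
proof -
  assume tx: "t x = Some (hzero N)"
  then have x: "x \<in> hcarrier M" by (rule t(1))
  have "B x = x" using B_unique(1)[OF tx s(7)] x M.add_zero by simp
  define y where "y = hsub M (Q x) x"
  have y: "y \<in> hcarrier M" using x by (simp add: y_def)
  have "hadd M (Q y) y = hzero M"
    unfolding y_def using x Q(4)[OF x] \<open>B x = x\<close> by (intro M.inner_ext) (auto simp: Q.sub)
  then have "hinner M y (Q y) + hinner M y y = 0"
    using y by (metis M.inner_add M.inner_zero_right Q.closed)
  then have "hinner M y y = - hinner M y (Q y)" by (simp add: eq_neg_iff_add_eq_0 add.commute)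
  moreover have "cstar_positive (hinner M y (Q y))" using Q(3) y by (simp add: form_positive_def)
  ultimately have "hinner M y y = 0"
    using cstar_positive_antisym[of "hinner M y y"] M.inner_positive[OF y] by simp
  then have "y = hzero M" using M.inner_definite y by blast
  then show "Q x = x" using x M.sub_eq_zero_iff by (simp add: y_def)
qed

lemma Q_injective: "z \<in> hcarrier M \<Longrightarrow> Q z = hzero M \<Longrightarrow> z = hzero M"
proof -
  assume z: "z \<in> hcarrier M" "Q z = hzero M"
  then have B0: "B z = hzero M" using Q(4)[OF z(1)] Q.zero by simp
  then have "C z = hzero N" using B_C(2)[OF z(1)] t(7) by simp
  then have "hsub M z (hzero M) = hzero M" using B_C(3)[OF z(1)] s(7) B0 by simp
  then show "z = hzero M" using z M.sub_eq_zero_iff by simp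
qed

lemma ker_F: "{x \<in> hcarrier M. F x = hzero N} = op_ker N t"
proof (intro equalityI subsetI)
  fix x assume "x \<in> {x \<in> hcarrier M. F x = hzero N}"
  then have x: "x \<in> hcarrier M" "t (Q x) = Some (hzero N)" using F(1) by auto
  have "Q (hsub M (Q x) x) = hzero M"
    using ker_Q[OF x(2)] x(1) M.sub_eq_zero_iff by (simp add: Q.sub)
  then have "Q x = x" using Q_injective[of "hsub M (Q x) x"] x(1) M.sub_eq_zero_iff by simp
  then show "x \<in> op_ker N t" using x(2) by (simp add: op_ker_def)
next
  fix x assume "x \<in> op_ker N t"
  then have x: "t x = Some (hzero N)" by (simp add: op_ker_def)
  then show "x \<in> {x \<in> hcarrier M. F x = hzero N}" using F(1)[of x] ker_Q[OF x] t(1)[OF x] by simp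
qed

lemma ker_G: "{y \<in> hcarrier N. G y = hzero M} = op_ker M s"
proof -
  have "G y = hzero M \<longleftrightarrow> s y = Some (hzero M)" if y: "y \<in> hcarrier N" for y
  proof
    assume G0: "G y = hzero M"
    show "s y = Some (hzero M)"
      unfolding s_iff
    proof (intro conjI allI impI y)
      fix x z assume xz: "t x = Some z"
      then obtain w where "w \<in> hcarrier M" "z = F w" using ran_F by (blast intro: ranI)
      then show "hinner N z y = hinner M x (hzero M)" using y t(1)[OF xz] by (simp add: F.inner G0)
    qed simp
  next
    assume "s y = Some (hzero M)"
    then show "G y = hzero M" using G_of_adjoint Q.zero by simp
  qed
  then show ?thesis using s(1) by (auto simp: op_ker_def)
qed

text \<open>
  The range of \<open>t\<^sup>*\<close> has the same closure as the range of \<open>F\<^sup>*\<close>, since \<open>t\<^sup>* y = F\<^sup>* F t\<^sup>* y + Q F\<^sup>* y\<close>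
  and the closure of the range of \<open>F\<^sup>*\<close> is invariant under \<open>B = 1 - F\<^sup>* F\<close>, hence under \<open>Q\<close>.
\<close>

lemma ran_adjoint_subset: "ran s \<subseteq> hclosure M (G ` hcarrier N)"
proof
  fix v assume "v \<in> ran s"
  then obtain y where yv: "s y = Some v" by (auto simp: ran_def)
  note c = s(1,2)[OF yv]
  let ?K = "hclosure M (G ` hcarrier N)"
  interpret G: adjoint_ops N M G F by unfold_locales (rule F.swap)
  have sub: "G ` hcarrier N \<subseteq> hcarrier M" by auto
  have K: "hsubmodule M ?K" by (rule M.hsubmodule_hclosure[OF G.image_submodule])
  note k = M.hsubmoduleD[OF K]
  have G_in: "G u \<in> ?K" if "u \<in> hcarrier N" for u using M.subset_hclosure[OF sub] that by blast
  have B_inv: "B x \<in> ?K" if x: "x \<in> ?K" for x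
  proof -
    have "x \<in> hcarrier M" using x k(1) by blast
    then have "B x = hsub M x (G (F x))" by (simp only: G_F) (intro M.inner_ext, auto)
    moreover have "G (F x) \<in> ?K" using \<open>x \<in> hcarrier M\<close> by (intro G_in) simp
    ultimately show ?thesis using k(7)[OF x] by simp
  qed
  have "Q (G y) \<in> ?K"
    using Q(5) K B_inv G_in[OF c(1)] unfolding function_of_def
    by (metis M.hclosure_hclosure order_refl)
  moreover have "G (F v) \<in> ?K" using c by (intro G_in) simp
  moreover have "v = hadd M (G (F v)) (Q (G y))"
    using c G_of_adjoint[OF yv] by (intro M.inner_ext) (simp_all add: G_F Q(4))
  ultimately show "v \<in> ?K" using k(4) by metis
qed

text \<open>
  The range of \<open>F\<^sup>* F = 1 - B\<close> is contained in that of \<open>t\<^sup>* t\<close>.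
\<close>

lemma ran_adjoint_subset_ran_comp: "ran s \<subseteq> hclosure M (ran (s \<circ>\<^sub>m t))"
proof -
  have "(\<lambda>x. G (F x)) ` hcarrier M \<subseteq> ran (s \<circ>\<^sub>m t)"
  proof
    fix z assume "z \<in> (\<lambda>x. G (F x)) ` hcarrier M"
    then obtain x where x: "x \<in> hcarrier M" "z = hsub M x (B x)" using G_F by auto
    then have "(s \<circ>\<^sub>m t) (B x) = Some z" using B_C[OF x(1)] by (simp add: map_comp_def)
    then show "z \<in> ran (s \<circ>\<^sub>m t)" by (rule ranI)
  qed
  then have "hclosure M ((\<lambda>x. G (F x)) ` hcarrier M) \<subseteq> hclosure M (ran (s \<circ>\<^sub>m t))" by (rule M.hclosure_mono)
  with F.range_adjoint_subset[OF F_contractive]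
  have "G ` hcarrier N \<subseteq> hclosure M (ran (s \<circ>\<^sub>m t))" by blast
  then have "hclosure M (G ` hcarrier N) \<subseteq> hclosure M (ran (s \<circ>\<^sub>m t))" by (rule M.hclosure_minimal)
  then show ?thesis using ran_adjoint_subset by blast
qed

lemma hclosure_ran_G: "hclosure M (G ` hcarrier N) = hclosure M (ran s)"
proof
  show "hclosure M (ran s) \<subseteq> hclosure M (G ` hcarrier N)"
    by (rule M.hclosure_minimal[OF ran_adjoint_subset])
  have "(\<lambda>x. G (F x)) ` hcarrier M \<subseteq> ran s"
    using G_F B_C(3) by (auto intro: ranI)
  then have "hclosure M ((\<lambda>x. G (F x)) ` hcarrier M) \<subseteq> hclosure M (ran s)" by (rule M.hclosure_mono)
  with F.range_adjoint_subset[OF F_contractive] show "hclosure M (G ` hcarrier N) \<subseteq> hclosure M (ran s)"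
    by (intro M.hclosure_minimal) blast
qed

text \<open>
  Polar decomposability of \<open>t\<close> is a statement about complements of kernels only.
\<close>

theorem polar_decomposable_iff:
  "polar_decomposable M N t \<longleftrightarrow>
    spans M (op_ker N t) (hclosure M (ran s)) \<and> spans N (op_ker M s) (hclosure N (ran t))"
  unfolding polar_decomposable_def bounded_transform_eq
  using F.spans_of_polar_decomposable[OF F_contractive] F.polar_decomposable_of_spans[OF F_contractive] regular
  unfolding ker_F ker_G hclosure_ran_G ran_F by blast

text \<open>
  The resolvent \<open>(1 + t t\<^sup>*)\<^sup>-\<^sup>1\<close> is \<open>1 - F F\<^sup>*\<close>.
\<close>

lemma onto_adjoint: "resolvent_onto N s t"
  unfolding resolvent_onto_def
proof
  fix y assume y: "y \<in> hcarrier N"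
  let ?u = "hsub N y (F (G y))"
  interpret G: adjoint_ops N M G F by unfold_locales (rule F.swap)
  have Gu: "G ?u = Q (Q (G y))"
    using y by (intro M.inner_ext) (simp_all add: G.sub G_F Q(4))
  have "s ?u = Some (Q (G y))"
    unfolding s_iff
  proof (intro conjI allI impI)
    fix x w assume xw: "t x = Some w"
    note c = t(1,2)[OF xw]
    define z where "z = hadd M (Q x) (G w)"
    have z: "z \<in> hcarrier M" using c by (simp add: z_def)
    have "hinner N w ?u = hinner M z (G ?u)"
      unfolding dom_eq_Q(2)[OF xw, folded z_def] by (rule F.inner) (use z y in auto)
    also have "\<dots> = hinner M (Q z) (Q (G y))" unfolding Gu using z y by (simp add: Q.inner)
    also have "Q z = x" using dom_eq_Q(1)[OF xw] by (simp add: z_def)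
    finally show "hinner N w ?u = hinner M x (Q (G y))" .
  qed (use y in auto)
  moreover have "t (Q (G y)) = Some (hsub N y ?u)"
  proof -
    have "hsub N y ?u = F (G y)" using y by (intro N.inner_ext) auto
    then show ?thesis using F(1) y by simp
  qed
  ultimately show "\<exists>u x. u \<in> hcarrier N \<and> s u = Some x \<and> t x = Some (hsub N y u)"
    using y by (intro exI[of _ ?u]) auto
qed

lemma double_adjoint: "op_adjoint N M s = t"
  and regular_adjoint: "regular_operator N M s"
  using regular_of_resolvent_onto[OF N.hilbert_module_axioms M.hilbert_module_axioms
      module_operator_s dense_dom_adjoint module_operator dense_dom adjoint'[symmetric] onto_adjoint onto]
    adjoint' by (metis (full_types), metis (full_types))

end


section \<open>Weak Hodge decompositions in a single degree\<close>

text \<open>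
  A sequence \<open>L \<rightarrow> M \<rightarrow> N\<close> is the part of a complex that the decomposition of \<open>M\<close> involves.
\<close>

locale two_step = P: regular_op L M p + R: regular_op M N r
  for L :: "('a::cstar_algebra, 'd) hmodule" and M :: "('a, 'e) hmodule" and N :: "('a, 'f) hmodule"
    and p :: "'d \<rightharpoonup> 'e" and r :: "'e \<rightharpoonup> 'f" +
  assumes ran_p: "ran p \<subseteq> op_ker N r"
begin

abbreviation p' where "p' \<equiv> op_adjoint L M p"
abbreviation r' where "r' \<equiv> op_adjoint M N r"

sublocale P': regular_op M L p'
  by unfold_locales (rule P.regular_adjoint)

sublocale R': regular_op N M r'
  by unfold_locales (rule R.regular_adjoint)

lemma p_r: "p a = Some b \<Longrightarrow> r b = Some (hzero N)"
  using ran_p by (auto simp: op_ker_def ran_def)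

lemma r'_p': "r' y = Some v \<Longrightarrow> p' v = Some (hzero L)"
  unfolding P.s_iff
proof (intro conjI allI impI)
  assume yv: "r' y = Some v"
  note c = R.s(1,2)[OF yv]
  show "v \<in> hcarrier M" by (rule c)
  fix a b assume ab: "p a = Some b"
  have "hinner N (hzero N) y = hinner M b v" by (rule R.adjoint[OF p_r[OF ab] yv])
  then show "hinner M b v = hinner L a (hzero L)" using c P.t(1)[OF ab] by simp
qed simp

lemma dual: "two_step N M L r' p'"
proof unfold_locales
  show "ran r' \<subseteq> op_ker L p'" using r'_p' by (auto simp: op_ker_def ran_def)
qed

lemma closed_ker:
  assumes "regular_op M N' q" "S \<subseteq> op_ker N' q" "x \<in> hclosure M S"
  shows "q x = Some (hzero N')"
proof -
  interpret q: regular_op M N' q by fact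
  have N': "hilbert_module N'" using assms(1) by (simp add: regular_op_def)
  have sub: "S \<subseteq> hcarrier M" using assms(2) q.t(1) by (auto simp: op_ker_def)
  obtain X where X: "\<And>n. X n \<in> S" "hlim M X x" using P.N.hclosure_sequence[OF sub assms(3)] by blast
  show ?thesis
  proof (rule closed_operator_limit[OF P.N.hilbert_module_axioms N' q.closed_op])
    show "q (X n) = Some (hzero N')" for n using X(1) assms(2) by (auto simp: op_ker_def)
    show "hlim M X x" by (rule X)
    show "hlim N' (\<lambda>n. hzero N') (hzero N')" by (intro hilbert_module.hlim_const[OF N'] hilbert_module.zero_closed[OF N'])
    show "x \<in> hcarrier M" using assms(3) P.N.hclosure_subset by blast
  qed (rule hilbert_module.zero_closed[OF N'])
qed

abbreviation "H \<equiv> op_ker N r \<inter> op_ker L p'"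
abbreviation "V \<equiv> hclosure M (ran r')"
abbreviation "W \<equiv> hclosure M (ran p)"

lemma V_ker: "v \<in> V \<Longrightarrow> p' v = Some (hzero L)"
  by (rule closed_ker[OF P'.regular_op_axioms]) (auto simp: op_ker_def ran_def r'_p')

lemma W_ker: "w \<in> W \<Longrightarrow> r w = Some (hzero N)"
  by (rule closed_ker[OF R.regular_op_axioms ran_p])

lemma in_H: "h \<in> H \<longleftrightarrow> r h = Some (hzero N) \<and> p' h = Some (hzero L)"
  by (auto simp: op_ker_def)

lemma V_closed: "v \<in> V \<Longrightarrow> v \<in> hcarrier M"
  and W_closed: "w \<in> W \<Longrightarrow> w \<in> hcarrier M"
  using P.N.hclosure_subset by blast+

lemma ran_subsets: "ran r' \<subseteq> hcarrier M" "ran p \<subseteq> hcarrier M"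
  using R.s(2) P.t(2) by (auto simp: ran_def)

lemma submodules: "hsubmodule M H" "hsubmodule M V" "hsubmodule M W"
proof -
  have 1: "hsubmodule M (op_ker N r)"
    by (rule hsubmodule_op_ker[OF P.N.hilbert_module_axioms R.N.hilbert_module_axioms R.module_operator])
  have 2: "hsubmodule M (op_ker L p')"
    by (rule hsubmodule_op_ker[OF P.N.hilbert_module_axioms P.M.hilbert_module_axioms P.module_operator_s])
  show "hsubmodule M H" using 1 2 by (auto simp: hsubmodule_def)
  show "hsubmodule M V"
    by (intro P.N.hsubmodule_hclosure
        hsubmodule_ran[OF R.N.hilbert_module_axioms P.N.hilbert_module_axioms R.module_operator_s])
  show "hsubmodule M W"
    by (intro P.N.hsubmodule_hclosure
        hsubmodule_ran[OF P.M.hilbert_module_axioms P.N.hilbert_module_axioms P.module_operator])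
qed

lemma orthogonal_V: "r x = Some (hzero N) \<Longrightarrow> v \<in> V \<Longrightarrow> hinner M x v = 0"
proof -
  assume x: "r x = Some (hzero N)" and v: "v \<in> V"
  have xc: "x \<in> hcarrier M" by (rule R.t(1)[OF x])
  have "hinner M v x = 0"
  proof (rule P.N.orthogonal_hclosure[OF ran_subsets(1) v xc])
    fix z assume "z \<in> ran r'"
    then obtain y where y: "r' y = Some z" by (auto simp: ran_def)
    show "hinner M z x = 0" using R.adjoint'[OF x y] R.s(1)[OF y] by simp
  qed
  then show ?thesis using P.N.inner_star[OF V_closed[OF v] xc] by simp
qed

lemma orthogonal_W: "p' x = Some (hzero L) \<Longrightarrow> w \<in> W \<Longrightarrow> hinner M x w = 0"
proof -
  assume x: "p' x = Some (hzero L)" and w: "w \<in> W"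
  have xc: "x \<in> hcarrier M" by (rule P.s(1)[OF x])
  have "hinner M w x = 0"
  proof (rule P.N.orthogonal_hclosure[OF ran_subsets(2) w xc])
    fix z assume "z \<in> ran p"
    then obtain y where y: "p y = Some z" by (auto simp: ran_def)
    show "hinner M z x = 0" using P.adjoint[OF y x] P.t(1)[OF y] by simp
  qed
  then show ?thesis using P.N.inner_star[OF W_closed[OF w] xc] by simp
qed

text \<open>
  Existence of the three components only; their orthogonality always holds.
\<close>

definition hodge :: bool where
  "hodge \<longleftrightarrow> (\<forall>x\<in>hcarrier M. \<exists>h\<in>H. \<exists>v\<in>V. \<exists>w\<in>W. x = hadd M (hadd M h v) w)"

lemma hodgeE:
  assumes hodge "x \<in> hcarrier M"
  obtains h v w where "r h = Some (hzero N)" "p' h = Some (hzero L)" "v \<in> V" "w \<in> W"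
    "x = hadd M (hadd M h v) w" "h \<in> hcarrier M"
proof -
  obtain h v w where "h \<in> H" "v \<in> V" "w \<in> W" "x = hadd M (hadd M h v) w"
    using assms unfolding hodge_def by blast
  then show thesis using that R.t(1) by (metis in_H)
qed

lemma hodge_iff_orthogonal_sum3: "orthogonal_sum3 M H V W \<longleftrightarrow> hodge"
proof -
  have orth: "horthogonal M H V" "horthogonal M H W" "horthogonal M V W"
    using orthogonal_V orthogonal_W V_ker by (simp_all add: horthogonal_def op_ker_def)
  have "{hadd M (hadd M h v) w |h v w. h \<in> H \<and> v \<in> V \<and> w \<in> W} \<subseteq> hcarrier M"
    using P.N.hsubmoduleD(2)[OF submodules(1)] by (auto simp: V_closed W_closed)
  then have "hcarrier M = {hadd M (hadd M h v) w |h v w. h \<in> H \<and> v \<in> V \<and> w \<in> W} \<longleftrightarrow>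
      (\<forall>x\<in>hcarrier M. x \<in> {hadd M (hadd M h v) w |h v w. h \<in> H \<and> v \<in> V \<and> w \<in> W})"
    by (intro iffI equalityI subsetI) auto
  also have "\<dots> \<longleftrightarrow> hodge" unfolding hodge_def by (simp only: mem_Collect_eq Bex_def) metis
  finally have "hcarrier M = {hadd M (hadd M h v) w |h v w. h \<in> H \<and> v \<in> V \<and> w \<in> W} \<longleftrightarrow> hodge" .
  with orth show ?thesis unfolding orthogonal_sum3_def by (simp only: submodules simp_thms)
qed

text \<open>
  For the converse, \<open>x\<close> is split along \<open>ker r\<close> and \<open>V\<close>, and the component in \<open>ker r\<close> is then split
  along \<open>ker p\<^sup>*\<close> and \<open>W\<close>. As \<open>W\<close> is contained in \<open>ker r\<close>, this leaves a remainder in \<open>H\<close>.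
\<close>

lemma hodge_iff_spans: "hodge \<longleftrightarrow> spans M (op_ker N r) V \<and> spans M (op_ker L p') W"
proof
  assume hodge: hodge
  have "\<exists>u\<in>op_ker N r. \<exists>v\<in>V. x = hadd M u v" "\<exists>u\<in>op_ker L p'. \<exists>w\<in>W. x = hadd M u w"
    if x: "x \<in> hcarrier M" for x
  proof -
    obtain h v w where d: "r h = Some (hzero N)" "p' h = Some (hzero L)" "v \<in> V" "w \<in> W"
      "x = hadd M (hadd M h v) w" "h \<in> hcarrier M" using hodgeE[OF hodge x] by metis
    note c = d(6) V_closed[OF d(3)] W_closed[OF d(4)]
    have "r (hadd M h w) = Some (hadd N (hzero N) (hzero N))" by (rule R.t(3)[OF d(1) W_ker[OF d(4)]])
    then have "hadd M h w \<in> op_ker N r" by (simp add: op_ker_def R.N.add_zero)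
    moreover have "x = hadd M (hadd M h w) v" unfolding d(5) using c by (intro P.N.inner_ext) auto
    ultimately show "\<exists>u\<in>op_ker N r. \<exists>v\<in>V. x = hadd M u v" using d(3) by blast
    have "p' (hadd M h v) = Some (hadd L (hzero L) (hzero L))" by (rule P.s(3)[OF d(2) V_ker[OF d(3)]])
    then have "hadd M h v \<in> op_ker L p'" by (simp add: op_ker_def P.M.add_zero)
    then show "\<exists>u\<in>op_ker L p'. \<exists>w\<in>W. x = hadd M u w" using d(4,5) by blast
  qed
  then show "spans M (op_ker N r) V \<and> spans M (op_ker L p') W" unfolding spans_def by blast
next
  assume spans: "spans M (op_ker N r) V \<and> spans M (op_ker L p') W"
  show hodge
    unfolding hodge_def
  proof
    fix x assume x: "x \<in> hcarrier M"
    obtain u v where uv: "r u = Some (hzero N)" "v \<in> V" "x = hadd M u v"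
      using spans x unfolding spans_def op_ker_def by blast
    have u: "u \<in> hcarrier M" by (rule R.t(1)[OF uv(1)])
    obtain h w where hw: "p' h = Some (hzero L)" "w \<in> W" "u = hadd M h w"
      using spans u unfolding spans_def op_ker_def by blast
    have h: "h \<in> hcarrier M" by (rule P.s(1)[OF hw(1)])
    note c = u h V_closed[OF uv(2)] W_closed[OF hw(2)]
    have "r (hsub M u w) = Some (hsub N (hzero N) (hzero N))" by (rule R.t(6)[OF uv(1) W_ker[OF hw(2)]])
    moreover have "hsub M u w = h" using c unfolding hw(3) by (intro P.N.inner_ext) auto
    moreover have "hsub N (hzero N) (hzero N) = hzero N" by (simp add: R.N.sub_eq_zero_iff)
    ultimately have "h \<in> H" unfolding in_H using hw(1) by simp
    moreover have "x = hadd M (hadd M h v) w" unfolding uv(3) hw(3) using c by (intro P.N.inner_ext) auto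
    ultimately show "\<exists>h\<in>H. \<exists>v\<in>V. \<exists>w\<in>W. x = hadd M (hadd M h v) w" using uv(2) hw(2) by blast
  qed
qed

end

lemma (in two_step) dual_hodge: "two_step.hodge N M L r' p' \<longleftrightarrow> hodge"
proof -
  interpret dual: two_step N M L r' p' by (rule dual)
  have swap: "hadd M (hadd M h v) w = hadd M (hadd M h w) v"
    if "h \<in> H" "v \<in> V" "w \<in> W" for h v w
    using that P.N.hsubmoduleD(2)[OF submodules(1)] V_closed W_closed by (intro P.N.inner_ext) auto
  have "(\<exists>h\<in>H. \<exists>v\<in>V. \<exists>w\<in>W. x = hadd M (hadd M h v) w)
      \<longleftrightarrow> (\<exists>h\<in>H. \<exists>w\<in>W. \<exists>v\<in>V. x = hadd M (hadd M h w) v)" for x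
    using swap by metis
  then show ?thesis
    unfolding hodge_def dual.hodge_def P.double_adjoint R.double_adjoint
    by (simp only: Int_commute[of "op_ker L p'"])
qed


section \<open>Laplace operators\<close>

lemma (in hilbert_module) orthogonal_norm_le:
  assumes "x \<in> hcarrier M" "y \<in> hcarrier M" "hinner M x y = 0"
  shows "hnorm M x \<le> hnorm M (hadd M x y)" "hnorm M y \<le> hnorm M (hadd M x y)"
proof -
  have "hinner M y x = 0" using inner_star[OF assms(1,2)] assms(3) by simp
  then have eq: "hinner M (hadd M x y) (hadd M x y) = hinner M x x + hinner M y y" using assms by simp
  show "hnorm M x \<le> hnorm M (hadd M x y)"
    by (rule hnorm_le_of_order[OF _ assms(1)]) (simp only: eq add_diff_cancel_left' inner_positive[OF assms(2)])
  show "hnorm M y \<le> hnorm M (hadd M x y)"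
    by (rule hnorm_le_of_order[OF _ assms(2)]) (simp only: eq add_diff_cancel_right' inner_positive[OF assms(1)])
qed

text \<open>
  By orthogonality the components of a Cauchy sequence are Cauchy sequences.
\<close>

lemma (in hilbert_module) hclosure_orthogonal_sum:
  assumes X: "hsubmodule M X" and Y: "hsubmodule M Y" and orth: "horthogonal M X Y"
    and S: "S \<subseteq> {hadd M x y |x y. x \<in> X \<and> y \<in> Y}" and d: "d \<in> hclosure M S"
  shows "\<exists>v\<in>hclosure M X. \<exists>w\<in>hclosure M Y. d = hadd M v w"
proof -
  note X' = hsubmoduleD[OF X] and Y' = hsubmoduleD[OF Y]
  have "{hadd M x y |x y. x \<in> X \<and> y \<in> Y} \<subseteq> hcarrier M" by (auto simp: X'(2) Y'(2))
  with S have sub: "S \<subseteq> hcarrier M" by (rule order_trans)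
  have dc: "d \<in> hcarrier M" using d hclosure_subset by blast
  obtain D where D: "\<And>n. D n \<in> S" "hlim M D d" using hclosure_sequence[OF sub d] by blast
  then have "\<exists>x y. x \<in> X \<and> y \<in> Y \<and> D n = hadd M x y" for n using S by blast
  then obtain A B where AB: "\<And>n. A n \<in> X" "\<And>n. B n \<in> Y" "\<And>n. D n = hadd M (A n) (B n)" by metis
  have c: "\<And>n. A n \<in> hcarrier M" "\<And>n. B n \<in> hcarrier M" "\<And>n. D n \<in> hcarrier M"
    using AB X'(2) Y'(2) by auto
  have le: "hnorm M (hsub M (A n) (A m)) \<le> hnorm M (hsub M (D n) (D m))"
    "hnorm M (hsub M (B n) (B m)) \<le> hnorm M (hsub M (D n) (D m))" for n m
  proof -
    let ?a = "hsub M (A n) (A m)" and ?b = "hsub M (B n) (B m)"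
    have ab: "?a \<in> X" "?b \<in> Y" using X'(7)[OF AB(1) AB(1)] Y'(7)[OF AB(2) AB(2)] by auto
    then have abc: "?a \<in> hcarrier M" "?b \<in> hcarrier M" using X'(2) Y'(2) by auto
    have "hinner M ?a ?b = 0" using orth ab by (auto simp: horthogonal_def)
    from orthogonal_norm_le[OF abc this]
    have "hnorm M ?a \<le> hnorm M (hadd M ?a ?b)" "hnorm M ?b \<le> hnorm M (hadd M ?a ?b)" .
    moreover have "hsub M (D n) (D m) = hadd M ?a ?b"
      unfolding AB(3) using c by (intro inner_ext) auto
    ultimately show "hnorm M ?a \<le> hnorm M (hsub M (D n) (D m))" "hnorm M ?b \<le> hnorm M (hsub M (D n) (D m))"
      by simp_all
  qed
  have Cauchy: "\<exists>K. \<forall>m\<ge>K. \<forall>n\<ge>m. hnorm M (hsub M (D n) (D m)) < e" if "e > 0" for e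
    by (rule hlim_Cauchy[OF D(2) c(3) dc that])
  have "\<exists>K. \<forall>m\<ge>K. \<forall>n\<ge>m. hnorm M (hsub M (A n) (A m)) < e" if "e > 0" for e
    using Cauchy[OF that] le(1) by (meson le_less_trans)
  then obtain v where v: "v \<in> hcarrier M" "hlim M A v" using Cauchy_has_limit[of A] c by blast
  have "\<exists>K. \<forall>m\<ge>K. \<forall>n\<ge>m. hnorm M (hsub M (B n) (B m)) < e" if "e > 0" for e
    using Cauchy[OF that] le(2) by (meson le_less_trans)
  then obtain w where w: "w \<in> hcarrier M" "hlim M B w" using Cauchy_has_limit[of B] c by blast
  have "hlim M D (hadd M v w)"
    using hlim_add[OF v(2) w(2) c(1) c(2) v(1) w(1)] by (simp only: AB(3)[symmetric])
  then have "d = hadd M v w" using hlim_unique[OF D(2)] c v w dc by simp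
  moreover have "v \<in> hclosure M X" by (rule hclosureI[OF X'(1) v(1) AB(1) v(2)])
  moreover have "w \<in> hclosure M Y" by (rule hclosureI[OF Y'(1) w(1) AB(2) w(2)])
  ultimately show ?thesis by blast
qed

text \<open>Neumann series at one vector.\<close>

lemma solve_one_minus:
  assumes "adjoint_ops M M T S" and half: "\<forall>x\<in>hcarrier M. 2 * hnorm M (T x) \<le> hnorm M x"
    and z: "z \<in> hcarrier M"
  shows "\<exists>w\<in>hcarrier M. hsub M w (T w) = z"
proof -
  interpret adjoint_ops M M T S by fact
  define X where "X n = ((\<lambda>w. hadd M z (T w)) ^^ n) (hzero M)" for n
  have X_Suc: "X (Suc n) = hadd M z (T (X n))" and X_0: "X 0 = hzero M" for n by (simp_all add: X_def)
  have X: "X n \<in> hcarrier M" for n by (induction n) (simp_all add: X_Suc X_0 z)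
  have step: "hnorm M (hsub M (X (Suc n)) (X n)) \<le> (1/2) ^ n * hnorm M z" for n
  proof (induction n)
    case 0
    have "hsub M (X (Suc 0)) (X 0) = z" using z by (intro M.inner_ext) (simp_all add: X_Suc X_0 zero)
    then show ?case by simp
  next
    case (Suc n)
    have "hsub M (X (Suc (Suc n))) (X (Suc n)) = T (hsub M (X (Suc n)) (X n))"
      using X[of n] X[of "Suc n"] z unfolding X_Suc[of "Suc n"]
      by (subst (2) X_Suc) (intro M.inner_ext, simp_all add: sub)
    moreover have "2 * hnorm M (T (hsub M (X (Suc n)) (X n))) \<le> hnorm M (hsub M (X (Suc n)) (X n))"
      using half X by simp
    ultimately show ?case using Suc by simp
  qed
  have diff: "hnorm M (hsub M (X n) (X m)) \<le> 2 * ((1/2) ^ m - (1/2) ^ n) * hnorm M z" if "m \<le> n" for m n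
    using that
  proof (induction n rule: dec_induct)
    case base
    have "hsub M (X m) (X m) = hzero M" using M.sub_eq_zero_iff X by blast
    then show ?case by simp
  next
    case (step n)
    have "hnorm M (hsub M (X (Suc n)) (X m)) \<le> hnorm M (hsub M (X (Suc n)) (X n)) + hnorm M (hsub M (X n) (X m))"
      by (intro M.hnorm_sub_triangle X)
    also have "\<dots> \<le> (1/2) ^ n * hnorm M z + 2 * ((1/2) ^ m - (1/2) ^ n) * hnorm M z"
      by (intro add_mono step.IH \<open>\<And>n. hnorm M (hsub M (X (Suc n)) (X n)) \<le> (1/2) ^ n * hnorm M z\<close>)
    also have "\<dots> = 2 * ((1/2) ^ m - (1/2) ^ Suc n) * hnorm M z" by (simp add: algebra_simps)
    finally show ?case .
  qed
  have "\<exists>K. \<forall>m\<ge>K. \<forall>n\<ge>m. hnorm M (hsub M (X n) (X m)) < e" if e: "e > 0" for e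
  proof -
    have "(\<lambda>m. 2 * (1/2) ^ m * hnorm M z) \<longlonglongrightarrow> 2 * 0 * hnorm M z"
      by (intro tendsto_intros LIMSEQ_power_zero) simp
    then have "eventually (\<lambda>m. 2 * (1/2) ^ m * hnorm M z < e) sequentially"
      by (rule order_tendstoD) (use e in simp)
    then obtain K where K: "\<forall>m\<ge>K. 2 * (1/2) ^ m * hnorm M z < e" by (auto simp: eventually_sequentially)
    have "hnorm M (hsub M (X n) (X m)) < e" if "m \<ge> K" "n \<ge> m" for m n
    proof -
      have "2 * ((1/2) ^ m - (1/2) ^ n) * hnorm M z \<le> 2 * (1/2) ^ m * hnorm M z"
        by (intro mult_right_mono) auto
      then show ?thesis using diff[OF that(2)] K that(1) by fastforce
    qed
    then show ?thesis by blast
  qed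
  then obtain w where w: "w \<in> hcarrier M" "hlim M X w" using M.Cauchy_has_limit[of X] X by blast
  have le: "hnorm M (hsub M (X (Suc n)) (hadd M z (T w))) \<le> hnorm M (hsub M (X n) w)" for n
  proof -
    have "hsub M (X (Suc n)) (hadd M z (T w)) = T (hsub M (X n) w)"
      using X[of n] z w by (intro M.inner_ext) (simp_all add: X_Suc sub)
    moreover have "2 * hnorm M (T (hsub M (X n) w)) \<le> hnorm M (hsub M (X n) w)" using half X w by simp
    then have "hnorm M (T (hsub M (X n) w)) \<le> hnorm M (hsub M (X n) w)"
      using M.hnorm_nonneg[of "T (hsub M (X n) w)"] by linarith
    ultimately show ?thesis by simp
  qed
  have "hlim M (\<lambda>n. X (Suc n)) (hadd M z (T w))"
    unfolding hlim_def by (intro tendsto_zero_le[OF w(2)[unfolded hlim_def] M.hnorm_nonneg le])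
  moreover have "hlim M (\<lambda>n. X (Suc n)) w" using LIMSEQ_Suc[OF w(2)[unfolded hlim_def]] by (simp only: hlim_def)
  ultimately have "w = hadd M z (T w)" using M.hlim_unique X w z by (metis M.add_closed closed)
  then have "hsub M w (T w) = hsub M (hadd M z (T w)) (T w)" by simp
  also have "\<dots> = z" using z w by (intro M.inner_ext) simp_all
  finally show ?thesis using w by blast
qed

context two_step
begin

definition \<Delta> where "\<Delta> = op_add M (r' \<circ>\<^sub>m r) (p \<circ>\<^sub>m p')"

lemma \<Delta>_iff: "\<Delta> x = Some z \<longleftrightarrow>
    (\<exists>y v a b. r x = Some y \<and> r' y = Some v \<and> p' x = Some a \<and> p a = Some b \<and> z = hadd M v b)"
  unfolding \<Delta>_def op_add_def by (auto simp: map_comp_def dom_def split: option.splits)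

lemma module_operator_\<Delta>: "module_operator M M \<Delta>"
proof (rule module_operatorI)
  fix x z assume "\<Delta> x = Some z"
  then obtain y v a b where "r x = Some y" "r' y = Some v" "p' x = Some a" "p a = Some b" "z = hadd M v b"
    unfolding \<Delta>_iff by blast
  then show "x \<in> hcarrier M \<and> z \<in> hcarrier M" using R.t(1) R.s(2) P.t(2) by auto
next
  show "\<Delta> (hzero M) = Some (hzero M)"
    unfolding \<Delta>_iff using R.t(7) R.s(7) P.s(7) P.t(7) P.N.add_zero[OF P.N.zero_closed] by metis
next
  fix x z x' z' assume "\<Delta> x = Some z" "\<Delta> x' = Some z'"
  then obtain y v a b y' v' a' b' where
    1: "r x = Some y" "r' y = Some v" "p' x = Some a" "p a = Some b" "z = hadd M v b" and
    2: "r x' = Some y'" "r' y' = Some v'" "p' x' = Some a'" "p a' = Some b'" "z' = hadd M v' b'"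
    unfolding \<Delta>_iff by blast
  have "hadd M z z' = hadd M (hadd M v v') (hadd M b b')"
    unfolding 1(5) 2(5) using R.s(2)[OF 1(2)] R.s(2)[OF 2(2)] P.t(2)[OF 1(4)] P.t(2)[OF 2(4)]
    by (intro P.N.inner_ext) auto
  then show "\<Delta> (hadd M x x') = Some (hadd M z z')"
    unfolding \<Delta>_iff
    using R.t(3)[OF 1(1) 2(1)] R.s(3)[OF 1(2) 2(2)] P.s(3)[OF 1(3) 2(3)] P.t(3)[OF 1(4) 2(4)] by blast
next
  fix x z c assume "\<Delta> x = Some z"
  then obtain y v a b where
    1: "r x = Some y" "r' y = Some v" "p' x = Some a" "p a = Some b" "z = hadd M v b"
    unfolding \<Delta>_iff by blast
  have "hscale M c z = hadd M (hscale M c v) (hscale M c b)"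
    unfolding 1(5) using R.s(2)[OF 1(2)] P.t(2)[OF 1(4)] by (rule P.N.scale_add_right)
  then show "\<Delta> (hscale M c x) = Some (hscale M c z)"
    unfolding \<Delta>_iff using R.t(4)[OF 1(1)] R.s(4)[OF 1(2)] P.s(4)[OF 1(3)] P.t(4)[OF 1(4)] by blast
next
  fix x z c assume "\<Delta> x = Some z"
  then obtain y v a b where
    1: "r x = Some y" "r' y = Some v" "p' x = Some a" "p a = Some b" "z = hadd M v b"
    unfolding \<Delta>_iff by blast
  have "hact M z c = hadd M (hact M v c) (hact M b c)"
    unfolding 1(5) using R.s(2)[OF 1(2)] P.t(2)[OF 1(4)] by (rule P.N.act_add_left)
  then show "\<Delta> (hact M x c) = Some (hact M z c)"
    unfolding \<Delta>_iff using R.t(5)[OF 1(1)] R.s(5)[OF 1(2)] P.s(5)[OF 1(3)] P.t(5)[OF 1(4)] by blast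
qed

lemmas \<Delta> = module_operatorD[OF P.N.hilbert_module_axioms P.N.hilbert_module_axioms module_operator_\<Delta>]

lemma \<Delta>_form:
  assumes "\<Delta> x = Some z" "r x = Some y" "p' x = Some a" "r x' = Some y'" "p' x' = Some a'"
  shows "hinner M z x' = hinner N y y' + hinner L a a'" "hinner M x' z = hinner N y' y + hinner L a' a"
proof -
  obtain v b where 1: "r' y = Some v" "p a = Some b" "z = hadd M v b"
    using assms unfolding \<Delta>_iff by auto
  note c = R.s(2)[OF 1(1)] P.t(2)[OF 1(2)] R.t(1)[OF assms(4)]
  show "hinner M z x' = hinner N y y' + hinner L a a'"
    using c R.adjoint'[OF assms(4) 1(1)] P.adjoint[OF 1(2) assms(5)] by (simp add: 1(3))
  show "hinner M x' z = hinner N y' y + hinner L a' a"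
    using c R.adjoint[OF assms(4) 1(1)] P.adjoint'[OF 1(2) assms(5)] by (simp add: 1(3))
qed

lemma \<Delta>_symmetric: "\<Delta> x = Some z \<Longrightarrow> \<Delta> x' = Some z' \<Longrightarrow> hinner M z x' = hinner M x z'"
proof -
  assume x: "\<Delta> x = Some z" and x': "\<Delta> x' = Some z'"
  obtain y a where 1: "r x = Some y" "p' x = Some a" using x unfolding \<Delta>_iff by blast
  obtain y' a' where 2: "r x' = Some y'" "p' x' = Some a'" using x' unfolding \<Delta>_iff by blast
  show ?thesis using \<Delta>_form(1)[OF x 1 2] \<Delta>_form(2)[OF x' 2 1] by simp
qed

text \<open>
  \<open>1 + \<Delta> = (1 + p p\<^sup>*) (1 + r\<^sup>* r)\<close>, because \<open>p\<^sup>*\<close> vanishes on the range of \<open>r\<^sup>*\<close>. Hence the product \<open>K\<close> of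
  the inverses in the opposite order is the inverse of \<open>1 + \<Delta>\<close>.
\<close>

definition K where "K z = R.B (P'.B z)"

lemma K_closed [simp]: "z \<in> hcarrier M \<Longrightarrow> K z \<in> hcarrier M"
  by (simp add: K_def)

lemma \<Delta>_resolvent:
  assumes u: "p' u = Some a" "p a = Some b"
  shows "\<Delta> (R.B u) = Some (hadd M (hsub M u (R.B u)) b)" "p' (R.B u) = Some a"
proof -
  have uc: "u \<in> hcarrier M" by (rule P.s(1)[OF u(1)])
  note b = R.B_C[OF uc]
  have "p' (hsub M u (hsub M u (R.B u))) = Some (hsub L a (hzero L))"
    by (rule P.s(6)[OF u(1) r'_p'[OF b(3)]])
  moreover have "hsub M u (hsub M u (R.B u)) = R.B u" using uc b(1) by (intro P.N.inner_ext) auto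
  moreover have "hsub L a (hzero L) = a" using P.s(2)[OF u(1)] by (intro P.M.inner_ext) auto
  ultimately show "p' (R.B u) = Some a" by simp
  then show "\<Delta> (R.B u) = Some (hadd M (hsub M u (R.B u)) b)"
    unfolding \<Delta>_iff using b u by blast
qed

lemma \<Delta>_K: "z \<in> hcarrier M \<Longrightarrow> \<Delta> (K z) = Some (hsub M z (K z))"
proof -
  assume z: "z \<in> hcarrier M"
  note u = P'.B_C[OF z, unfolded P.double_adjoint]
  have "\<Delta> (K z) = Some (hadd M (hsub M (P'.B z) (K z)) (hsub M z (P'.B z)))"
    unfolding K_def by (rule \<Delta>_resolvent(1)[OF u(2,3)])
  moreover have "hadd M (hsub M (P'.B z) (K z)) (hsub M z (P'.B z)) = hsub M z (K z)"
    using z by (intro P.N.inner_ext) auto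
  ultimately show ?thesis by simp
qed

lemma dense_dom_\<Delta>: "hdense M (dom \<Delta>)"
  unfolding P.N.hdense_iff
proof (intro conjI ballI allI impI)
  show "dom \<Delta> \<subseteq> hcarrier M" using \<Delta>(1) by blast
  fix x and e :: real assume x: "x \<in> hcarrier M" and e: "e > 0"
  obtain z where z: "z \<in> hcarrier M" "hnorm M (hsub M x (R.B z)) < e / 2"
    using R.dense_ran_B x e unfolding P.N.hdense_iff by (metis half_gt_zero imageE)
  obtain w where w: "w \<in> hcarrier M" "hnorm M (hsub M z (P'.B w)) < e / 2"
    using P'.dense_ran_B z e unfolding P.N.hdense_iff by (metis half_gt_zero imageE)
  have "hnorm M (hsub M x (K w)) \<le> hnorm M (hsub M x (R.B z)) + hnorm M (hsub M (R.B z) (K w))"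
    using x z w by (intro P.N.hnorm_sub_triangle) auto
  also have "hsub M (R.B z) (K w) = R.B (hsub M z (P'.B w))"
    using z w by (simp add: K_def R.B.sub)
  also have "hnorm M (R.B (hsub M z (P'.B w))) \<le> hnorm M (hsub M z (P'.B w))"
    using R.B_norm[of "hsub M z (P'.B w)"] z w by simp
  finally have "hnorm M (hsub M x (K w)) < e" using z w by simp
  then show "\<exists>d\<in>dom \<Delta>. hnorm M (hsub M x d) < e" using \<Delta>_K[OF w(1)] by blast
qed

lemma K_form:
  assumes "z \<in> hcarrier M" "w \<in> hcarrier M"
  shows "hinner M (K z) w = hinner M z (K w)"
  using \<Delta>_symmetric[OF \<Delta>_K[OF assms(1)] \<Delta>_K[OF assms(2)]] assms by (simp add: algebra_simps)

sublocale K: adjoint_ops M M K K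
  by unfold_locales (auto simp: adj_pair_def K_form)

lemma \<Delta>_positive:
  assumes "\<Delta> x = Some z"
  shows "cstar_positive (hinner M x z)"
proof -
  obtain y a where 1: "r x = Some y" "p' x = Some a" using assms unfolding \<Delta>_iff by blast
  show ?thesis
    unfolding \<Delta>_form(2)[OF assms 1 1]
    by (intro cstar_positive_add P.M.inner_positive R.N.inner_positive R.t(2)[OF 1(1)] P.s(2)[OF 1(2)])
qed

text \<open>
  In terms of \<open>K\<close>, \<open>1 + \<Delta>\<^sup>2\<close> is \<open>(1 - J) K\<^sup>-\<^sup>2\<close> with \<open>J = 2 K (1 - K)\<close>. As \<open>0 \<le> K \<le> 1\<close>,
  \<open>0 \<le> J \<le> 1/2\<close>, where \<open>1 - 2 J = (1 - 2 K)\<^sup>2\<close>; so \<open>1 - J\<close> is invertible.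
\<close>

lemma onto_\<Delta>: "resolvent_onto M \<Delta> \<Delta>"
  unfolding resolvent_onto_def
proof
  fix z assume z: "z \<in> hcarrier M"
  define J where "J x = hscale M 2 (K (hsub M x (K x)))" for x
  define J2 where "J2 x = hscale M 2 (J x)" for x
  have J_adj: "adj_pair M M J J" "adj_pair M M J2 J2"
    by (auto simp: adj_pair_def J_def J2_def K.inner K.sub)
  interpret J: adjoint_ops M M J J by unfold_locales (rule J_adj)
  have K_pos: "cstar_positive (hinner M x (K (hsub M x (K x))))" if x: "x \<in> hcarrier M" for x
  proof -
    have "hinner M x (K (hsub M x (K x))) = hinner M (K x) (hsub M x (K x))"
      using x by (simp only: K.inner P.N.sub_closed K_closed)
    then show ?thesis using \<Delta>_positive[OF \<Delta>_K[OF x]] by simp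
  qed
  have "contractive M M J2"
  proof (rule P.N.contractive_of_form_bounds[OF J_adj(2)])
    have "hinner M x (J2 x) = 4 *\<^sub>R hinner M x (K (hsub M x (K x)))" if "x \<in> hcarrier M" for x
      using that unfolding J2_def J_def by (simp add: scaleC_scaleC scaleR_scaleC del: P.N.inner_sub)
    then show "form_positive M J2" using K_pos by (simp add: form_positive_def cstar_positive_scaleR)
    have "hinner M x (hsub M x (J2 x)) = hinner M (hsub M x (hscale M 2 (K x))) (hsub M x (hscale M 2 (K x)))"
      if x: "x \<in> hcarrier M" for x
    proof -
      have "hinner M (hsub M x (hscale M 2 (K x))) (hsub M x (hscale M 2 (K x)))
          = hinner M x (hsub M (hsub M x (hscale M 2 (K x))) (hscale M 2 (K (hsub M x (hscale M 2 (K x))))))"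
        using x by (simp add: K.inner K.sub K.scale)
      also have "hsub M (hsub M x (hscale M 2 (K x))) (hscale M 2 (K (hsub M x (hscale M 2 (K x))))) = hsub M x (J2 x)"
      proof (rule P.N.inner_ext)
        fix z assume z: "z \<in> hcarrier M"
        have [simp]: "4 *\<^sub>C a = 2 *\<^sub>C a + 2 *\<^sub>C a" for a :: 'a
          using scaleC_add_left[of 2 2 a] by simp
        show "hinner M z (hsub M (hsub M x (hscale M 2 (K x))) (hscale M 2 (K (hsub M x (hscale M 2 (K x)))))) = hinner M z (hsub M x (J2 x))"
          using x z by (simp add: J2_def J_def K.sub K.scale scaleC_scaleC scaleC_diff_right)
      qed (use x in \<open>simp_all add: J2_def J_def\<close>)
      finally show ?thesis by simp
    qed
    then show "form_positive M (\<lambda>x. hsub M x (J2 x))"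
      by (simp add: form_positive_def P.N.inner_positive del: P.N.inner_sub P.N.inner_sub_left)
  qed
  then have "\<forall>x\<in>hcarrier M. 2 * hnorm M (J x) \<le> hnorm M x"
    unfolding contractive_def J2_def by (simp add: P.N.hnorm_scale)
  from solve_one_minus[OF J.adjoint_ops_axioms this z]
  obtain w where w: "w \<in> hcarrier M" "hsub M w (J w) = z" by blast
  let ?x = "K (K w)" and ?y = "K (hsub M w (K w))"
  have "\<Delta> ?x = Some ?y" using \<Delta>_K[of "K w"] w by (simp add: K.sub)
  moreover have "\<Delta> ?y = Some (hsub M z ?x)"
  proof -
    have "hsub M (hsub M w (K w)) ?y = hsub M z ?x"
    proof (rule P.N.inner_ext)
      fix v assume v: "v \<in> hcarrier M"
      have [simp]: "2 *\<^sub>C a = a + a" for a :: 'a using scaleC_add_left[of 1 1 a] by simp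
      show "hinner M v (hsub M (hsub M w (K w)) ?y) = hinner M v (hsub M z ?x)"
        unfolding w(2)[symmetric] using v w(1) by (simp add: J_def K.sub)
    qed (use w z in auto)
    then show ?thesis using \<Delta>_K[of "hsub M w (K w)"] w by simp
  qed
  ultimately show "\<exists>x y. x \<in> hcarrier M \<and> \<Delta> x = Some y \<and> \<Delta> y = Some (hsub M z x)"
    using w by (metis K_closed)
qed

lemma \<Delta>_self_adjoint: "op_adjoint M M \<Delta> = \<Delta>"
  and regular_\<Delta>: "regular_operator M M \<Delta>"
  using regular_of_resolvent_onto[OF P.N.hilbert_module_axioms P.N.hilbert_module_axioms
      module_operator_\<Delta> dense_dom_\<Delta> module_operator_\<Delta> dense_dom_\<Delta> _ onto_\<Delta> onto_\<Delta>] \<Delta>_symmetric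
  by blast+

lemma ker_\<Delta>: "op_ker M \<Delta> = H"
proof (intro equalityI subsetI)
  fix x assume "x \<in> op_ker M \<Delta>"
  then have x: "\<Delta> x = Some (hzero M)" by (simp add: op_ker_def)
  obtain y a where 1: "r x = Some y" "p' x = Some a" using x unfolding \<Delta>_iff by blast
  have ya: "y \<in> hcarrier N" "a \<in> hcarrier L" using R.t(2)[OF 1(1)] P.s(2)[OF 1(2)] by auto
  have "hinner N y y + hinner L a a = 0"
    using \<Delta>_form(2)[OF x 1 1] \<Delta>(1)[OF x] by simp
  then have "hinner N y y = - hinner L a a" by (simp add: eq_neg_iff_add_eq_0)
  then have "hinner N y y = 0" "hinner L a a = 0"
    using cstar_positive_antisym[of "hinner L a a"] R.N.inner_positive[OF ya(1)] P.M.inner_positive[OF ya(2)] by auto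
  then have "y = hzero N" "a = hzero L" using R.N.inner_definite P.M.inner_definite ya by auto
  then show "x \<in> H" unfolding in_H using 1 by simp
next
  fix x assume "x \<in> H"
  then have "r x = Some (hzero N)" "p' x = Some (hzero L)" unfolding in_H by auto
  then have "\<Delta> x = Some (hadd M (hzero M) (hzero M))"
    unfolding \<Delta>_iff using R.s(7) P.t(7) by blast
  then show "x \<in> op_ker M \<Delta>" by (simp add: op_ker_def P.N.add_zero)
qed

lemma ran_\<Delta>_subset: "ran \<Delta> \<subseteq> {hadd M x y |x y. x \<in> ran r' \<and> y \<in> ran p}"
  using \<Delta>_iff by (fastforce simp: ran_def)

lemma hodge_of_hclosure_sum:
  assumes "x \<in> hclosure M S" "S \<subseteq> {hadd M x y |x y. x \<in> ran r' \<and> y \<in> ran p}"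
  shows "\<exists>v\<in>V. \<exists>w\<in>W. x = hadd M v w"
proof (rule P.N.hclosure_orthogonal_sum[OF _ _ _ assms(2,1)])
  show "hsubmodule M (ran r')"
    by (rule hsubmodule_ran[OF R.N.hilbert_module_axioms P.N.hilbert_module_axioms R.module_operator_s])
  show "hsubmodule M (ran p)"
    by (rule hsubmodule_ran[OF P.M.hilbert_module_axioms P.N.hilbert_module_axioms P.module_operator])
  show "horthogonal M (ran r') (ran p)"
    unfolding horthogonal_def
    using orthogonal_W[OF V_ker] P.N.subset_hclosure[OF ran_subsets(1)] P.N.subset_hclosure[OF ran_subsets(2)] by blast
qed

text \<open>
  Given the decomposition, a vector may be replaced by its component in \<open>V\<close> without changing its
  image under \<open>r\<close>, and that component is annihilated by \<open>p\<^sup>*\<close>; dually for \<open>W\<close>.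
\<close>

lemma hodge_component_V:
  assumes hodge "r x = Some y"
  obtains v where "r v = Some y" "p' v = Some (hzero L)"
proof -
  obtain h v w where d: "r h = Some (hzero N)" "p' h = Some (hzero L)" "v \<in> V" "w \<in> W"
    "x = hadd M (hadd M h v) w" "h \<in> hcarrier M" using hodgeE[OF assms(1) R.t(1)[OF assms(2)]] by metis
  have "r (hsub M (hsub M x h) w) = Some (hsub N (hsub N y (hzero N)) (hzero N))"
    by (intro R.t(6) assms(2) d(1) W_ker[OF d(4)])
  moreover have "hsub M (hsub M x h) w = v"
    unfolding d(5) using d(6) V_closed[OF d(3)] W_closed[OF d(4)] by (intro P.N.inner_ext) auto
  moreover have "hsub N (hsub N y (hzero N)) (hzero N) = y"
    using R.t(2)[OF assms(2)] by (intro R.N.inner_ext) auto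
  ultimately show thesis using that V_ker[OF d(3)] by simp
qed

lemma hodge_component_W:
  assumes hodge "p' x = Some a"
  obtains w where "p' w = Some a" "r w = Some (hzero N)"
proof -
  interpret dual: two_step N M L r' p' by (rule dual)
  show thesis
    using dual.hodge_component_V[OF _ assms(2)] assms(1) that unfolding dual_hodge R.double_adjoint by blast
qed

text \<open>
  \<open>\<Delta>\<close> takes the value \<open>r\<^sup>* r v\<close> at a \<open>v\<close> with \<open>p\<^sup>* v = 0\<close>. As such a \<open>v\<close> is available for each value of
  \<open>r\<close>, the range of \<open>\<Delta>\<close> contains that of \<open>r\<^sup>* r\<close>, which is dense in \<open>V\<close>; likewise for \<open>W\<close>.
\<close>

theorem polar_decomposable_\<Delta>_iff: "polar_decomposable M M \<Delta> \<longleftrightarrow> hodge"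
proof -
  interpret \<Delta>: regular_op M M \<Delta> by unfold_locales (rule regular_\<Delta>)
  have "polar_decomposable M M \<Delta> \<longleftrightarrow> spans M H (hclosure M (ran \<Delta>))"
    unfolding \<Delta>.polar_decomposable_iff \<Delta>_self_adjoint ker_\<Delta> by simp
  also have "\<dots> \<longleftrightarrow> hodge"
  proof
    assume spans: "spans M H (hclosure M (ran \<Delta>))"
    show hodge
      unfolding hodge_def
    proof
      fix x assume "x \<in> hcarrier M"
      then obtain h d where hd: "h \<in> H" "d \<in> hclosure M (ran \<Delta>)" "x = hadd M h d"
        using spans unfolding spans_def by blast
      obtain v w where vw: "v \<in> V" "w \<in> W" "d = hadd M v w"
        using hodge_of_hclosure_sum[OF hd(2) ran_\<Delta>_subset] by blast
      have "x = hadd M (hadd M h v) w"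
        unfolding hd(3) vw(3) using P.N.hsubmoduleD(2)[OF submodules(1) hd(1)] V_closed[OF vw(1)] W_closed[OF vw(2)]
        by (intro P.N.inner_ext) auto
      then show "\<exists>h\<in>H. \<exists>v\<in>V. \<exists>w\<in>W. x = hadd M (hadd M h v) w" using hd vw by blast
    qed
  next
    assume hodge: hodge
    have "ran (r' \<circ>\<^sub>m r) \<subseteq> ran \<Delta>"
    proof
      fix z assume "z \<in> ran (r' \<circ>\<^sub>m r)"
      then obtain x y where xy: "r x = Some y" "r' y = Some z"
        by (auto simp: ran_def map_comp_def split: option.splits)
      obtain v where "r v = Some y" "p' v = Some (hzero L)" using hodge_component_V[OF hodge xy(1)] .
      then have "\<Delta> v = Some (hadd M z (hzero M))" unfolding \<Delta>_iff using xy(2) P.t(7) by blast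
      then show "z \<in> ran \<Delta>" using R.s(2)[OF xy(2)] by (auto simp: P.N.add_zero intro: ranI)
    qed
    then have "V \<subseteq> hclosure M (ran \<Delta>)"
      using R.ran_adjoint_subset_ran_comp P.N.hclosure_mono P.N.hclosure_minimal by (meson order_trans)
    moreover have "ran (p \<circ>\<^sub>m p') \<subseteq> ran \<Delta>"
    proof
      fix z assume "z \<in> ran (p \<circ>\<^sub>m p')"
      then obtain x a where xa: "p' x = Some a" "p a = Some z"
        by (auto simp: ran_def map_comp_def split: option.splits)
      obtain w where "p' w = Some a" "r w = Some (hzero N)" using hodge_component_W[OF hodge xa(1)] .
      then have "\<Delta> w = Some (hadd M (hzero M) z)" unfolding \<Delta>_iff using xa(2) R.s(7) by blast
      then show "z \<in> ran \<Delta>"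
        using P.t(2)[OF xa(2)] by (auto simp: P.N.add_zero P.N.add_commute[of "hzero M"] intro: ranI)
    qed
    then have "W \<subseteq> hclosure M (ran \<Delta>)"
      using P'.ran_adjoint_subset_ran_comp[unfolded P.double_adjoint] P.N.hclosure_mono P.N.hclosure_minimal
      by (meson order_trans)
    moreover have sub: "hsubmodule M (hclosure M (ran \<Delta>))"
      by (intro P.N.hsubmodule_hclosure
          hsubmodule_ran[OF P.N.hilbert_module_axioms P.N.hilbert_module_axioms module_operator_\<Delta>])
    ultimately have VW: "hadd M v w \<in> hclosure M (ran \<Delta>)" if "v \<in> V" "w \<in> W" for v w
      using P.N.hsubmoduleD(4)[OF sub] that by blast
    show "spans M H (hclosure M (ran \<Delta>))"
      unfolding spans_def
    proof
      fix x assume x: "x \<in> hcarrier M"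
      obtain h v w where d: "h \<in> H" "v \<in> V" "w \<in> W" "x = hadd M (hadd M h v) w"
        using hodge x unfolding hodge_def by blast
      have "x = hadd M h (hadd M v w)"
        unfolding d(4) using P.N.hsubmoduleD(2)[OF submodules(1) d(1)] V_closed[OF d(2)] W_closed[OF d(3)]
        by (rule P.N.add_assoc)
      then show "\<exists>u\<in>H. \<exists>v\<in>hclosure M (ran \<Delta>). x = hadd M u v" using d VW by blast
    qed
  qed
  finally show ?thesis .
qed

end


section \<open>Finite direct sums of Hilbert modules\<close>

text \<open>
  Families that are trivial outside a finite set, so that the direct sum consists of all families of
  elements and inner products are sums over that set.
\<close>

locale finite_family =
  fixes Ms :: "'i \<Rightarrow> ('a::cstar_algebra, 'e) hmodule" and I :: "'i set"
  assumes module: "hilbert_module (Ms i)"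
    and finite_index: "finite I"
    and trivial: "i \<notin> I \<Longrightarrow> hcarrier (Ms i) = {hzero (Ms i)}"
begin

sublocale M: hilbert_module "Ms i" for i
  by (rule module)

abbreviation "S \<equiv> hdirect_sum Ms"

lemma outside: "i \<notin> I \<Longrightarrow> x \<in> hcarrier (Ms i) \<Longrightarrow> x = hzero (Ms i)"
  using trivial by blast

lemma carrier_iff: "x \<in> hcarrier S \<longleftrightarrow> (\<forall>i. x i \<in> hcarrier (Ms i))"
proof -
  have "finite {i. x i \<noteq> hzero (Ms i)}" if "\<forall>i. x i \<in> hcarrier (Ms i)"
    by (rule finite_subset[OF _ finite_index]) (use that outside in blast)
  then show ?thesis by (auto simp: hdirect_sum_def)
qed

lemma component: "x \<in> hcarrier S \<Longrightarrow> x i \<in> hcarrier (Ms i)"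
  by (simp add: carrier_iff)

lemma operations:
  "hzero S = (\<lambda>i. hzero (Ms i))" "hadd S x y = (\<lambda>i. hadd (Ms i) (x i) (y i))"
  "hscale S c x = (\<lambda>i. hscale (Ms i) c (x i))" "hact S x a = (\<lambda>i. hact (Ms i) (x i) a)"
  "hsub S x y = (\<lambda>i. hsub (Ms i) (x i) (y i))"
  by (simp_all add: hdirect_sum_def hsub_def)

lemma inner_eq_sum:
  assumes "x \<in> hcarrier S" "y \<in> hcarrier S" "finite J" "I \<subseteq> J"
  shows "hinner S x y = (\<Sum>i\<in>J. hinner (Ms i) (x i) (y i))"
proof -
  have "(\<Sum>i\<in>{i. x i \<noteq> hzero (Ms i)}. hinner (Ms i) (x i) (y i)) = (\<Sum>i\<in>J. hinner (Ms i) (x i) (y i))"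
  proof (rule sum.mono_neutral_left[OF assms(3)])
    show "{i. x i \<noteq> hzero (Ms i)} \<subseteq> J" using assms(1,4) outside component by blast
    show "\<forall>i\<in>J - {i. x i \<noteq> hzero (Ms i)}. hinner (Ms i) (x i) (y i) = 0"
      using assms(2) component by auto
  qed
  then show ?thesis by (simp add: hdirect_sum_def)
qed

lemmas inner_eq = inner_eq_sum[OF _ _ finite_index subset_refl]

lemma sum_positive: "x \<in> hcarrier S \<Longrightarrow> cstar_positive (\<Sum>i\<in>J. hinner (Ms i) (x i) (x i))"
  by (intro cstar_positive_sum M.inner_positive component)

lemma hnorm_component: "x \<in> hcarrier S \<Longrightarrow> hnorm (Ms i) (x i) \<le> hnorm S x"
proof (cases "i \<in> I")
  case True
  assume x: "x \<in> hcarrier S"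
  have "norm (hinner (Ms i) (x i) (x i)) \<le> norm (hinner S x x)"
  proof (rule cstar_positive_norm_mono)
    show "cstar_positive (hinner (Ms i) (x i) (x i))" by (intro M.inner_positive component x)
    have "hinner S x x - hinner (Ms i) (x i) (x i) = (\<Sum>i\<in>I - {i}. hinner (Ms i) (x i) (x i))"
      unfolding inner_eq[OF x x] using finite_index True by (simp add: sum.remove[of I i])
    then show "cstar_positive (hinner S x x - hinner (Ms i) (x i) (x i))" using sum_positive[OF x] by simp
  qed
  then show ?thesis by (simp add: hnorm_def)
next
  case False
  assume "x \<in> hcarrier S"
  then have "x i = hzero (Ms i)" using outside[OF False] component by blast
  then show ?thesis by (simp add: hnorm_def[of S])
qed

lemma hnorm_le_sum: "x \<in> hcarrier S \<Longrightarrow> hnorm S x \<le> (\<Sum>i\<in>I. hnorm (Ms i) (x i))"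
proof -
  assume x: "x \<in> hcarrier S"
  have "norm (hinner S x x) \<le> (\<Sum>i\<in>I. (hnorm (Ms i) (x i))\<^sup>2)"
    unfolding inner_eq[OF x x] M.hnorm_power2 by (rule norm_sum)
  then have "hnorm S x \<le> L2_set (\<lambda>i. hnorm (Ms i) (x i)) I"
    unfolding hnorm_def[of S] L2_set_def by (rule real_sqrt_le_mono)
  also have "\<dots> \<le> (\<Sum>i\<in>I. hnorm (Ms i) (x i))" by (rule L2_set_le_sum) simp
  finally show ?thesis .
qed

text \<open>
  The Cauchy-Schwarz inequality comes before the direct sum is known to be a Hilbert module, because
  its metric and completeness depend on it.
\<close>

lemma cauchy_schwarz_sum:
  assumes x: "x \<in> hcarrier S" and y: "y \<in> hcarrier S"
  shows "(norm (hinner S x y))\<^sup>2 \<le> norm (hinner S x x) * norm (hinner S y y)"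
proof (rule norm_square_le_of_form)
  have sa: "star (\<Sum>i\<in>I. hinner (Ms i) (x i) (y i)) = (\<Sum>i\<in>I. hinner (Ms i) (y i) (x i))"
    by (subst Real_Vector_Spaces.linear_sum[OF bounded_linear.linear[OF bounded_linear_star]])
      (simp add: M.inner_star[symmetric] component[OF x] component[OF y])
  show "star (hinner S x x) = hinner S x x"
    by (intro cstar_positive_self_adjoint) (simp only: inner_eq[OF x x] sum_positive[OF x])
  fix t :: real
  let ?a = "hinner S x y" and ?p = "hinner S x x" and ?q = "hinner S y y"
  define z where "z i = hsub (Ms i) (hact (Ms i) (x i) ?a) (hscale (Ms i) (complex_of_real t) (y i))" for i
  have z: "z \<in> hcarrier S" using component[OF x] component[OF y] by (simp add: carrier_iff z_def)
  have "hinner (Ms i) (z i) (z i) = star ?a * (hinner (Ms i) (x i) (x i) * ?a - t *\<^sub>R hinner (Ms i) (x i) (y i))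
      - t *\<^sub>R (hinner (Ms i) (y i) (x i) * ?a - t *\<^sub>R hinner (Ms i) (y i) (y i))" for i
    using component[OF x, of i] component[OF y, of i]
    by (simp add: z_def scaleR_scaleC scaleC_diff_right right_diff_distrib left_diff_distrib mult_scaleC_right mult_scaleC_left mult.assoc)
  then have "(\<Sum>i\<in>I. hinner (Ms i) (z i) (z i))
      = star ?a * (?p * ?a - t *\<^sub>R ?a) - t *\<^sub>R (star ?a * ?a - t *\<^sub>R ?q)"
    by (simp only: sum_subtractf sum_distrib_left[symmetric] sum_distrib_right[symmetric]
        scaleR_sum_right[symmetric] inner_eq[OF x x] inner_eq[OF x y] inner_eq[OF y y] sa)
  then show "cstar_positive (star ?a * (?p * ?a - t *\<^sub>R ?a) - t *\<^sub>R (star ?a * ?a - t *\<^sub>R ?q))"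
    using sum_positive[OF z, of I] by simp
qed

lemma hnorm_triangle_sum:
  assumes x: "x \<in> hcarrier S" and y: "y \<in> hcarrier S"
  shows "hnorm S (hadd S x y) \<le> hnorm S x + hnorm S y"
proof (rule power2_le_imp_le)
  have cs: "norm (hinner S u v) \<le> hnorm S u * hnorm S v" if "u \<in> hcarrier S" "v \<in> hcarrier S" for u v
    by (rule power2_le_imp_le)
      (use cauchy_schwarz_sum[OF that] in \<open>simp_all add: power_mult_distrib hnorm_def\<close>)
  have xy: "hadd S x y \<in> hcarrier S" using component[OF x] component[OF y] by (simp add: carrier_iff operations)
  have eq: "hinner S (hadd S x y) (hadd S x y) = hinner S x x + hinner S x y + (hinner S y x + hinner S y y)"
    unfolding inner_eq[OF xy xy] inner_eq[OF x x] inner_eq[OF x y] inner_eq[OF y x] inner_eq[OF y y]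
    using component[OF x] component[OF y] by (simp add: operations sum.distrib[symmetric] algebra_simps)
  have "(hnorm S (hadd S x y))\<^sup>2 \<le> norm (hinner S x x) + norm (hinner S x y) + (norm (hinner S y x) + norm (hinner S y y))"
    unfolding hnorm_def eq real_sqrt_pow2[OF norm_ge_zero]
    by (intro norm_triangle_le add_mono order_refl)
  also have "\<dots> \<le> (hnorm S x)\<^sup>2 + hnorm S x * hnorm S y + (hnorm S y * hnorm S x + (hnorm S y)\<^sup>2)"
    by (intro add_mono cs x y) (simp_all add: hnorm_def)
  also have "\<dots> = (hnorm S x + hnorm S y)\<^sup>2" by (simp add: power2_eq_square algebra_simps)
  finally show "(hnorm S (hadd S x y))\<^sup>2 \<le> (hnorm S x + hnorm S y)\<^sup>2" .
qed (simp add: hnorm_def)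

lemma definite: "x \<in> hcarrier S \<Longrightarrow> hnorm S x = 0 \<Longrightarrow> x = hzero S"
proof
  fix i assume x: "x \<in> hcarrier S" "hnorm S x = 0"
  have "hnorm (Ms i) (x i) = 0"
    using hnorm_component[OF x(1), of i] x(2) M.hnorm_nonneg[of i "x i"] by simp
  then show "x i = hzero S i" using M.hnorm_eq_zero_iff component[OF x(1)] by (simp add: operations)
qed

lemma sub_closed: "x \<in> hcarrier S \<Longrightarrow> y \<in> hcarrier S \<Longrightarrow> hsub S x y \<in> hcarrier S"
  by (simp add: carrier_iff operations)

lemma hdist_sum: "x \<in> hcarrier S \<Longrightarrow> y \<in> hcarrier S \<Longrightarrow> hdist S x y = hnorm S (hsub S x y)"
  by (simp add: hdist_def hsub_def)

lemma metric_space_sum: "Metric_space (hcarrier S) (hdist S)"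
proof
  show "0 \<le> hdist S x y" for x y by (simp add: hdist_def hnorm_def)
  show "hdist S x y = hdist S y x" for x y
  proof (cases "x \<in> hcarrier S \<and> y \<in> hcarrier S")
    case True
    have *: "hinner (Ms i) (hsub S x y i) (hsub S x y i) = hinner (Ms i) (hsub S y x i) (hsub S y x i)" for i
      using component[of x i] component[of y i] True by (simp add: operations algebra_simps)
    have "hnorm S (hsub S x y) = hnorm S (hsub S y x)"
      unfolding hnorm_def using True by (subst (1 2) inner_eq) (auto simp only: sub_closed *)
    then show ?thesis using True by (simp add: hdist_sum)
  qed (auto simp: hdist_def)
  show "hdist S x y = 0 \<longleftrightarrow> x = y" if x: "x \<in> hcarrier S" and y: "y \<in> hcarrier S" for x y
  proof
    assume "hdist S x y = 0"
    then have eq: "hsub S x y = hzero S" using x y definite[OF sub_closed] by (simp add: hdist_sum)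
    show "x = y"
    proof
      fix i
      have "hsub (Ms i) (x i) (y i) = hzero (Ms i)" using fun_cong[OF eq, of i] by (simp add: operations)
      then show "x i = y i" using component[OF x] component[OF y] M.sub_eq_zero_iff by blast
    qed
  next
    assume "x = y"
    have "hsub S y y = hzero S" using component[OF y] M.sub_eq_zero_iff by (auto simp: operations)
    moreover have "hzero S \<in> hcarrier S" by (simp add: carrier_iff operations)
    ultimately show "hdist S x y = 0"
      using y \<open>x = y\<close> by (simp add: hdist_sum hnorm_def inner_eq) (simp add: operations)
  qed
  show "hdist S x z \<le> hdist S x y + hdist S y z"
    if x: "x \<in> hcarrier S" and y: "y \<in> hcarrier S" and z: "z \<in> hcarrier S" for x y z
  proof -
    have "hsub S x z = hadd S (hsub S x y) (hsub S y z)"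
    proof
      fix i
      show "hsub S x z i = hadd S (hsub S x y) (hsub S y z) i"
        unfolding operations using component[OF x] component[OF y] component[OF z]
        by (intro M.inner_ext[where i=i]) auto
    qed
    then show ?thesis using hnorm_triangle_sum[OF sub_closed[OF x y] sub_closed[OF y z]] x y z
      by (simp add: hdist_sum)
  qed
qed

lemma complete_sum: "Metric_space.mcomplete (hcarrier S) (hdist S)"
proof -
  interpret S: Metric_space "hcarrier S" "hdist S" by (rule metric_space_sum)
  show ?thesis
    unfolding S.mcomplete_def
  proof (intro allI impI)
    fix \<sigma> assume "S.MCauchy \<sigma>"
    then have \<sigma>: "\<And>n. \<sigma> n \<in> hcarrier S"
      and C: "\<And>e. e > 0 \<Longrightarrow> \<exists>N. \<forall>n n'. N \<le> n \<longrightarrow> N \<le> n' \<longrightarrow> hdist S (\<sigma> n) (\<sigma> n') < e"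
      by (auto simp: S.MCauchy_def)
    have "\<exists>x\<in>hcarrier (Ms i). hlim (Ms i) (\<lambda>n. \<sigma> n i) x" for i
    proof -
      have "\<exists>N. \<forall>m\<ge>N. \<forall>n\<ge>m. hnorm (Ms i) (hsub (Ms i) (\<sigma> n i) (\<sigma> m i)) < e" if e: "e > 0" for e
      proof -
        obtain N where N: "\<forall>n n'. N \<le> n \<longrightarrow> N \<le> n' \<longrightarrow> hdist S (\<sigma> n) (\<sigma> n') < e" using C[OF e] by blast
        have "hnorm (Ms i) (hsub (Ms i) (\<sigma> n i) (\<sigma> m i)) < e" if "m \<ge> N" "n \<ge> m" for m n
        proof -
          have "hnorm (Ms i) (hsub S (\<sigma> n) (\<sigma> m) i) \<le> hnorm S (hsub S (\<sigma> n) (\<sigma> m))"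
            by (intro hnorm_component sub_closed \<sigma>)
          also have "\<dots> < e" using N that by (simp add: hdist_sum[OF \<sigma> \<sigma>, symmetric])
          finally show ?thesis by (simp add: operations)
        qed
        then show ?thesis by blast
      qed
      then obtain x where "x \<in> hcarrier (Ms i)" "hlim (Ms i) (\<lambda>n. \<sigma> n i) x"
        using M.Cauchy_has_limit[where i=i and X="\<lambda>n. \<sigma> n i"] component[OF \<sigma>] by blast
      then show ?thesis by blast
    qed
    then obtain x where x: "\<And>i. x i \<in> hcarrier (Ms i)" "\<And>i. hlim (Ms i) (\<lambda>n. \<sigma> n i) (x i)" by metis
    have xS: "x \<in> hcarrier S" using x by (simp add: carrier_iff)
    have lim: "(\<lambda>n. \<Sum>i\<in>I. hnorm (Ms i) (hsub (Ms i) (\<sigma> n i) (x i))) \<longlonglongrightarrow> (\<Sum>i\<in>I. 0)"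
      using x(2) unfolding hlim_def by (intro tendsto_sum)
    have "\<exists>N. \<forall>n\<ge>N. \<sigma> n \<in> hcarrier S \<and> hdist S (\<sigma> n) x < e" if e: "e > 0" for e
    proof -
      obtain N where N: "\<forall>n\<ge>N. (\<Sum>i\<in>I. hnorm (Ms i) (hsub (Ms i) (\<sigma> n i) (x i))) < e"
        using order_tendstoD(2)[OF lim, of e] e by (auto simp: eventually_sequentially)
      have "hdist S (\<sigma> n) x \<le> (\<Sum>i\<in>I. hnorm (Ms i) (hsub (Ms i) (\<sigma> n i) (x i)))" for n
        using hnorm_le_sum[OF sub_closed[OF \<sigma>[of n] xS]] by (simp add: hdist_sum[OF \<sigma> xS] operations)
      then show ?thesis using N \<sigma> by (meson le_less_trans)
    qed
    then have "limitin S.mtopology \<sigma> x sequentially" using xS by (simp add: S.limit_metric_sequentially)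
    then show "\<exists>x. limitin S.mtopology \<sigma> x sequentially" by blast
  qed
qed

lemma hilbert_module_sum: "hilbert_module S"
proof
  fix x y z :: "'i \<Rightarrow> 'e" and a b :: 'a and c d :: complex
  show "hzero S \<in> hcarrier S" by (simp add: carrier_iff operations)
  show "Metric_space.mcomplete (hcarrier S) (hdist S)" by (rule complete_sum)
  assume x: "x \<in> hcarrier S"
  note xi = component[OF x]
  show "hscale S c x \<in> hcarrier S" "hact S x a \<in> hcarrier S" using xi by (simp_all add: carrier_iff operations)
  show "hadd S x (hzero S) = x" using xi by (simp add: operations M.add_zero)
  show "\<exists>y\<in>hcarrier S. hadd S x y = hzero S"
  proof (intro bexI[of _ "hscale S (-1) x"] ext)
    show "hscale S (-1) x \<in> hcarrier S" using xi by (simp add: carrier_iff operations)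
    show "hadd S x (hscale S (-1) x) i = hzero S i" for i
      unfolding operations using xi[of i] by (intro M.inner_ext[where i=i]) auto
  qed
  show "hscale S (c + d) x = hadd S (hscale S c x) (hscale S d x)"
    "hscale S c (hscale S d x) = hscale S (c * d) x" "hscale S 1 x = x"
    using xi by (simp_all add: operations M.scale_add_left M.scale_scale M.scale_one)
  show "hact S x (a + b) = hadd S (hact S x a) (hact S x b)" "hact S (hact S x a) b = hact S x (a * b)"
    "hact S (hscale S c x) a = hscale S c (hact S x a)" "hact S x (c *\<^sub>C a) = hscale S c (hact S x a)"
    using xi by (simp_all add: operations M.act_add_right M.act_act M.act_scale_left M.act_scale_right)
  show "cstar_positive (hinner S x x)" unfolding inner_eq[OF x x] by (rule sum_positive[OF x])
  show "x = hzero S" if "hinner S x x = 0" using definite[OF x] that by (simp add: hnorm_def)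
  assume y: "y \<in> hcarrier S"
  note yi = component[OF y]
  show xy: "hadd S x y \<in> hcarrier S" using xi yi by (simp add: carrier_iff operations)
  show "hadd S x y = hadd S y x" using xi yi by (simp add: operations M.add_commute)
  show "hscale S c (hadd S x y) = hadd S (hscale S c x) (hscale S c y)"
    "hact S (hadd S x y) a = hadd S (hact S x a) (hact S y a)"
    using xi yi by (simp_all add: operations M.scale_add_right M.act_add_left)
  have cy: "hscale S c y \<in> hcarrier S" "hact S y a \<in> hcarrier S" using yi by (simp_all add: carrier_iff operations)
  show "hinner S x (hscale S c y) = c *\<^sub>C hinner S x y"
    unfolding inner_eq[OF x cy(1)] inner_eq[OF x y]
    by (subst Real_Vector_Spaces.linear_sum[OF bounded_linear.linear[OF bounded_linear_scaleC]])
      (simp add: operations xi yi)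
  show "hinner S x (hact S y a) = hinner S x y * a"
    unfolding inner_eq[OF x cy(2)] inner_eq[OF x y] by (simp add: operations xi yi sum_distrib_right)
  show "hinner S y x = star (hinner S x y)"
    unfolding inner_eq[OF y x] inner_eq[OF x y]
    by (subst Real_Vector_Spaces.linear_sum[OF bounded_linear.linear[OF bounded_linear_star]])
      (simp add: M.inner_star[symmetric] xi yi)
  assume z: "z \<in> hcarrier S"
  note zi = component[OF z]
  have yz: "hadd S y z \<in> hcarrier S" using yi zi by (simp add: carrier_iff operations)
  show "hadd S (hadd S x y) z = hadd S x (hadd S y z)" using xi yi zi by (simp add: operations M.add_assoc)
  show "hinner S x (hadd S y z) = hinner S x y + hinner S x z"
    unfolding inner_eq[OF x yz] inner_eq[OF x y] inner_eq[OF x z]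
    using xi yi zi by (simp add: operations sum.distrib)
qed

sublocale S: hilbert_module S
  by (rule hilbert_module_sum)

lemma approximate_components:
  assumes "x \<in> hcarrier S" "e > 0"
  obtains \<delta> where "\<delta> > 0" "\<And>y. y \<in> hcarrier S \<Longrightarrow> (\<And>i. hnorm (Ms i) (hsub (Ms i) (x i) (y i)) < \<delta>)
    \<Longrightarrow> hnorm S (hsub S x y) < e"
proof (rule that)
  let ?d = "e / (real (card I) + 1)"
  show "?d > 0" using assms by simp
  fix y assume y: "y \<in> hcarrier S" and le: "\<And>i. hnorm (Ms i) (hsub (Ms i) (x i) (y i)) < ?d"
  have "hnorm S (hsub S x y) \<le> (\<Sum>i\<in>I. hnorm (Ms i) (hsub (Ms i) (x i) (y i)))"
    using hnorm_le_sum[OF sub_closed[OF assms(1) y]] by (simp add: operations)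
  also have "\<dots> \<le> (\<Sum>i\<in>I. ?d)" by (intro sum_mono less_imp_le le)
  also have "\<dots> = real (card I) * ?d" by simp
  also have "\<dots> < (real (card I) + 1) * ?d" using assms by (intro mult_strict_right_mono) simp_all
  also have "\<dots> = e" by (simp add: field_simps)
  finally show "hnorm S (hsub S x y) < e" .
qed

end


section \<open>Dirac operators\<close>

text \<open>
  The components of \<open>D x\<close> combine the values of \<open>a\<close> and \<open>c\<close> at components of \<open>x\<close> whose indices differ
  by \<open>e\<close>. With \<open>e = 1\<close> this is the even Dirac operator, and its adjoint has the same form with
  \<open>e = - 1\<close>.
\<close>

definition dirac ::
  "(int \<Rightarrow> ('a::cstar_algebra, 'e) hmodule) \<Rightarrow> (int \<Rightarrow> ('a, 'e) hmodule) \<Rightarrow>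
    (int \<Rightarrow> 'e \<rightharpoonup> 'e) \<Rightarrow> (int \<Rightarrow> 'e \<rightharpoonup> 'e) \<Rightarrow> int \<Rightarrow> (int \<Rightarrow> 'e) \<rightharpoonup> (int \<Rightarrow> 'e)" where
  "dirac Ms Ns a c e = (\<lambda>x.
    if x \<in> hcarrier (hdirect_sum Ms) \<and> (\<forall>j. x j \<in> dom (a j) \<inter> dom (c j))
    then Some (\<lambda>j. hadd (Ns j) (the (a j (x j))) (the (c (j + e) (x (j + e)))))
    else None)"

text \<open>
  The modules form the sequence \<open>\<dots> \<rightarrow> Ms j \<rightarrow> Ns j \<rightarrow> Ms (j + e) \<rightarrow> \<dots>\<close> with the maps \<open>a j\<close> and
  \<open>d (j + e)\<close>. Reversing it by taking adjoints changes \<open>e\<close> into \<open>- e\<close> and exchanges the two families,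
  whence what is shown for \<open>D\<close> on \<open>Ms\<close> holds for \<open>D'\<close> on \<open>Ns\<close>.
\<close>

locale dirac_family = M: finite_family Ms I + N: finite_family Ns I
  for Ms Ns :: "int \<Rightarrow> ('a::cstar_algebra, 'e) hmodule" and I +
  fixes a d :: "int \<Rightarrow> 'e \<rightharpoonup> 'e" and e :: int
  assumes at_M: "two_step (Ns (j - e)) (Ms j) (Ns j) (d j) (a j)"
    and at_N: "two_step (Ms j) (Ns j) (Ms (j + e)) (a j) (d (j + e))"
begin

abbreviation c where "c j \<equiv> op_adjoint (Ns (j - e)) (Ms j) (d j)"
abbreviation a' where "a' j \<equiv> op_adjoint (Ms j) (Ns j) (a j)"
abbreviation D where "D \<equiv> dirac Ms Ns a c e"
abbreviation D' where "D' \<equiv> dirac Ns Ms a' (\<lambda>j. d (j + e)) (- e)"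

sublocale A: two_step "Ns (j - e)" "Ms j" "Ns j" "d j" "a j" for j
  by (rule at_M)

sublocale B: two_step "Ms j" "Ns j" "Ms (j + e)" "a j" "d (j + e)" for j
  by (rule at_N)

lemma dual: "dirac_family Ns Ms I a' (\<lambda>j. c (j + e)) (- e)"
proof (rule dirac_family.intro[OF N.finite_family_axioms M.finite_family_axioms dirac_family_axioms.intro])
  show "two_step (Ms (j - - e)) (Ns j) (Ms j) (c (j + e)) (a' j)" for j using B.dual[of j] by simp
  show "two_step (Ns j) (Ms j) (Ns (j + - e)) (a' j) (c (j + - e + e))" for j using A.dual[of j] by simp
qed

lemma dual_D: "dirac Ns Ms a' (\<lambda>j. op_adjoint (Ms (j - - e)) (Ns j) (c (j + e))) (- e) = D'"
proof -
  have "op_adjoint (Ms (j - - e)) (Ns j) (c (j + e)) = d (j + e)" for j using B.R.double_adjoint[of j] by simp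
  then show ?thesis by simp
qed

lemma dual_D': "dirac Ms Ns (\<lambda>j. op_adjoint (Ns j) (Ms j) (a' j)) (\<lambda>j. c (j + - e + e)) (- (- e)) = D"
  by (simp add: A.R.double_adjoint)

lemma D_iff: "D x = Some z \<longleftrightarrow> x \<in> hcarrier M.S \<and> (\<exists>u v. (\<forall>j. a j (x j) = Some (u j)) \<and>
    (\<forall>j. c j (x j) = Some (v j)) \<and> z = (\<lambda>j. hadd (Ns j) (u j) (v (j + e))))"
proof
  assume Dx: "D x = Some z"
  then have x: "x \<in> hcarrier M.S" "\<And>j. x j \<in> dom (a j) \<inter> dom (c j)"
    and z: "z = (\<lambda>j. hadd (Ns j) (the (a j (x j))) (the (c (j + e) (x (j + e)))))"
    unfolding dirac_def by (auto simp only: option.sel option.distinct split: if_splits)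
  show "x \<in> hcarrier M.S \<and> (\<exists>u v. (\<forall>j. a j (x j) = Some (u j)) \<and>
    (\<forall>j. c j (x j) = Some (v j)) \<and> z = (\<lambda>j. hadd (Ns j) (u j) (v (j + e))))"
    by (intro conjI x exI[of _ "\<lambda>j. the (a j (x j))"] exI[of _ "\<lambda>j. the (c j (x j))"] z allI)
      (use x in \<open>auto simp: domIff\<close>)
next
  assume "x \<in> hcarrier M.S \<and> (\<exists>u v. (\<forall>j. a j (x j) = Some (u j)) \<and>
    (\<forall>j. c j (x j) = Some (v j)) \<and> z = (\<lambda>j. hadd (Ns j) (u j) (v (j + e))))"
  then obtain u v where x: "x \<in> hcarrier M.S" and u: "\<And>j. a j (x j) = Some (u j)"
    and v: "\<And>j. c j (x j) = Some (v j)" and z: "z = (\<lambda>j. hadd (Ns j) (u j) (v (j + e)))" by blast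
  have "\<forall>j. x j \<in> dom (a j) \<inter> dom (c j)" using u v by blast
  moreover have "the (a j (x j)) = u j" "the (c (j + e) (x (j + e))) = v (j + e)" for j
    by (simp only: u option.sel, simp only: v option.sel)
  ultimately show "D x = Some z" unfolding dirac_def z using x by (simp only: if_True simp_thms)
qed

lemma D_components:
  assumes "\<And>j. a j (x j) = Some (u j)" "\<And>j. c j (x j) = Some (v j)"
  shows "x j \<in> hcarrier (Ms j)" "u j \<in> hcarrier (Ns j)" "v j \<in> hcarrier (Ns (j - e))"
    "v (j + e) \<in> hcarrier (Ns j)" "x \<in> hcarrier M.S"
proof -
  show x: "x j \<in> hcarrier (Ms j)" for j by (rule A.R.t(1)[OF assms(1)])
  show "u j \<in> hcarrier (Ns j)" by (rule A.R.t(2)[OF assms(1)])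
  show v: "v j \<in> hcarrier (Ns (j - e))" for j by (rule A.P.s(2)[OF assms(2)])
  show "v (j + e) \<in> hcarrier (Ns j)" using v[of "j + e"] by simp
  show "x \<in> hcarrier M.S" using x by (simp add: M.carrier_iff)
qed

lemma D_eq_Some:
  assumes "\<And>j. a j (x j) = Some (u j)" "\<And>j. c j (x j) = Some (v j)" "\<And>j. z j = hadd (Ns j) (u j) (v (j + e))"
  shows "D x = Some z"
  unfolding D_iff using D_components(5)[OF assms(1,2)] assms by blast

lemma module_operator_D: "module_operator M.S N.S D"
proof (rule module_operatorI)
  fix x z assume "D x = Some z"
  then obtain u v where 1: "\<And>j. a j (x j) = Some (u j)" "\<And>j. c j (x j) = Some (v j)"
    "z = (\<lambda>j. hadd (Ns j) (u j) (v (j + e)))" "x \<in> hcarrier M.S" unfolding D_iff by blast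
  have "z \<in> hcarrier N.S"
    unfolding N.carrier_iff 1(3) using D_components(2,4)[OF 1(1,2)] by (blast intro: N.M.add_closed)
  then show "x \<in> hcarrier M.S \<and> z \<in> hcarrier N.S" using 1(4) by blast
next
  show "D (hzero M.S) = Some (hzero N.S)"
  proof (rule D_eq_Some)
    show "a j (hzero M.S j) = Some (hzero (Ns j))" for j by (simp add: M.operations A.R.t(7))
    show "c j (hzero M.S j) = Some (hzero (Ns (j - e)))" for j by (simp add: M.operations A.P.s(7))
    show "hzero N.S j = hadd (Ns j) (hzero (Ns j)) (hzero (Ns (j + e - e)))" for j
      by (simp add: N.operations N.M.add_zero)
  qed
next
  fix x z x' z' assume "D x = Some z" "D x' = Some z'"
  then obtain u v u' v' where 1: "\<And>j. a j (x j) = Some (u j)" "\<And>j. c j (x j) = Some (v j)"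
    "z = (\<lambda>j. hadd (Ns j) (u j) (v (j + e)))" and 2: "\<And>j. a j (x' j) = Some (u' j)" "\<And>j. c j (x' j) = Some (v' j)"
    "z' = (\<lambda>j. hadd (Ns j) (u' j) (v' (j + e)))" unfolding D_iff by blast
  show "D (hadd M.S x x') = Some (hadd N.S z z')"
  proof (rule D_eq_Some)
    show "a j (hadd M.S x x' j) = Some (hadd (Ns j) (u j) (u' j))" for j
      unfolding M.operations by (rule A.R.t(3)[OF 1(1) 2(1)])
    show "c j (hadd M.S x x' j) = Some (hadd (Ns (j - e)) (v j) (v' j))" for j
      unfolding M.operations by (rule A.P.s(3)[OF 1(2) 2(2)])
    show "hadd N.S z z' j = hadd (Ns j) (hadd (Ns j) (u j) (u' j)) (hadd (Ns (j + e - e)) (v (j + e)) (v' (j + e)))" for j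
      unfolding N.operations 1(3) 2(3) using D_components(2,4)[OF 1(1,2), of j] D_components(2,4)[OF 2(1,2), of j]
      by (intro N.M.inner_ext[where i=j]) (simp_all add: algebra_simps)
  qed
next
  fix x z k assume "D x = Some z"
  then obtain u v where 1: "\<And>j. a j (x j) = Some (u j)" "\<And>j. c j (x j) = Some (v j)"
    "z = (\<lambda>j. hadd (Ns j) (u j) (v (j + e)))" unfolding D_iff by blast
  show "D (hscale M.S k x) = Some (hscale N.S k z)"
  proof (rule D_eq_Some)
    show "a j (hscale M.S k x j) = Some (hscale (Ns j) k (u j))" for j
      unfolding M.operations by (rule A.R.t(4)[OF 1(1)])
    show "c j (hscale M.S k x j) = Some (hscale (Ns (j - e)) k (v j))" for j
      unfolding M.operations by (rule A.P.s(4)[OF 1(2)])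
    show "hscale N.S k z j = hadd (Ns j) (hscale (Ns j) k (u j)) (hscale (Ns (j + e - e)) k (v (j + e)))" for j
      unfolding N.operations 1(3) using D_components(2,4)[OF 1(1,2), of j]
      by (simp add: N.M.scale_add_right)
  qed
next
  fix x z k assume "D x = Some z"
  then obtain u v where 1: "\<And>j. a j (x j) = Some (u j)" "\<And>j. c j (x j) = Some (v j)"
    "z = (\<lambda>j. hadd (Ns j) (u j) (v (j + e)))" unfolding D_iff by blast
  show "D (hact M.S x k) = Some (hact N.S z k)"
  proof (rule D_eq_Some)
    show "a j (hact M.S x k j) = Some (hact (Ns j) (u j) k)" for j
      unfolding M.operations by (rule A.R.t(5)[OF 1(1)])
    show "c j (hact M.S x k j) = Some (hact (Ns (j - e)) (v j) k)" for j
      unfolding M.operations by (rule A.P.s(5)[OF 1(2)])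
    show "hact N.S z k j = hadd (Ns j) (hact (Ns j) (u j) k) (hact (Ns (j + e - e)) (v (j + e)) k)" for j
      unfolding N.operations 1(3) using D_components(2,4)[OF 1(1,2), of j]
      by (simp add: N.M.act_add_left)
  qed
qed

lemma dense_dom_D: "hdense M.S (dom D)"
  unfolding M.S.hdense_iff
proof (intro conjI ballI allI impI)
  show "dom D \<subseteq> hcarrier M.S" using D_iff by (auto simp: dom_def)
  fix x and \<epsilon> :: real assume x: "x \<in> hcarrier M.S" and \<epsilon>: "\<epsilon> > 0"
  obtain \<delta> where \<delta>: "\<delta> > 0" "\<And>y. y \<in> hcarrier M.S \<Longrightarrow> (\<And>i. hnorm (Ms i) (hsub (Ms i) (x i) (y i)) < \<delta>)
    \<Longrightarrow> hnorm M.S (hsub M.S x y) < \<epsilon>" using M.approximate_components[OF x \<epsilon>] by blast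
  have "\<exists>y u v. a j y = Some u \<and> c j y = Some v \<and> hnorm (Ms j) (hsub (Ms j) (x j) y) < \<delta>" for j
  proof -
    obtain y where "y \<in> dom (A.\<Delta> j)" "hnorm (Ms j) (hsub (Ms j) (x j) y) < \<delta>"
      using A.dense_dom_\<Delta>[of j] M.component[OF x] \<delta>(1) unfolding M.M.hdense_iff by blast
    then show ?thesis using A.\<Delta>_iff by blast
  qed
  then obtain y u v where y: "\<And>j. a j (y j) = Some (u j)" "\<And>j. c j (y j) = Some (v j)"
    "\<And>j. hnorm (Ms j) (hsub (Ms j) (x j) (y j)) < \<delta>" by metis
  have "D y = Some (\<lambda>j. hadd (Ns j) (u j) (v (j + e)))" by (rule D_eq_Some[OF y(1,2)]) simp
  moreover have "hnorm M.S (hsub M.S x y) < \<epsilon>" by (rule \<delta>(2)[OF D_components(5)[OF y(1,2)] y(3)])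
  ultimately show "\<exists>y\<in>dom D. hnorm M.S (hsub M.S x y) < \<epsilon>" by blast
qed

lemma D'_iff: "D' y = Some w \<longleftrightarrow> y \<in> hcarrier N.S \<and> (\<exists>p q. (\<forall>j. a' j (y j) = Some (p j)) \<and>
    (\<forall>j. d (j + e) (y j) = Some (q j)) \<and> w = (\<lambda>j. hadd (Ms j) (p j) (q (j - e))))"
proof -
  interpret dual: dirac_family Ns Ms I a' "\<lambda>j. c (j + e)" "- e" by (rule dual)
  have "op_adjoint (Ms (j - - e)) (Ns j) (c (j + e)) = d (j + e)" for j using B.R.double_adjoint[of j] by simp
  then show ?thesis using dual.D_iff[of y w] unfolding dual_D by simp
qed

lemma formal:
  assumes "D x = Some z" "D' y = Some w"
  shows "hinner N.S z y = hinner M.S x w"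
proof -
  obtain u v where 1: "\<And>j. a j (x j) = Some (u j)" "\<And>j. c j (x j) = Some (v j)"
    "z = (\<lambda>j. hadd (Ns j) (u j) (v (j + e)))" using assms(1) unfolding D_iff by blast
  obtain p q where 2: "\<And>j. a' j (y j) = Some (p j)" "\<And>j. d (j + e) (y j) = Some (q j)"
    "w = (\<lambda>j. hadd (Ms j) (p j) (q (j - e)))" using assms(2) unfolding D'_iff by blast
  note x = D_components[OF 1(1,2)]
  have y: "y j \<in> hcarrier (Ns j)" "p j \<in> hcarrier (Ms j)" "q j \<in> hcarrier (Ms (j + e))" for j
    using A.R.s(1,2)[OF 2(1)] A.P.t(2)[of "j + e" "y j" "q j"] 2(2)[of j] by simp_all
  then have q: "q (j - e) \<in> hcarrier (Ms j)" for j using y(3)[of "j - e"] by simp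
  have S: "x \<in> hcarrier M.S" "y \<in> hcarrier N.S" "z \<in> hcarrier N.S" "w \<in> hcarrier M.S"
    using x y q 1(3) 2(3) by (simp_all add: M.carrier_iff N.carrier_iff)
  \<comment> \<open>Both \<open>J\<close> and its translate by \<open>e\<close> contain \<open>I\<close>, outside of which all terms vanish.\<close>
  let ?J = "I \<union> (\<lambda>j. j - e) ` I"
  define g where "g j = hinner (Ms j) (x j) (q (j - e))" for j
  have J: "finite ?J" "I \<subseteq> ?J" using M.finite_index by auto
  have out: "hinner (Ms j) (x j) k = 0" if "j \<notin> I" "k \<in> hcarrier (Ms j)" for j k
    using M.outside[OF that(1) x(1)] that(2) by simp
  have "hinner N.S z y = (\<Sum>j\<in>?J. hinner (Ns j) (u j) (y j) + hinner (Ns j) (v (j + e)) (y j))"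
    using x y by (subst N.inner_eq_sum[OF S(3,2) J]) (simp add: 1(3))
  also have "\<dots> = (\<Sum>j\<in>?J. hinner (Ms j) (x j) (p j) + g (j + e))"
  proof (intro sum.cong refl arg_cong2[of _ _ _ _ "(+)"])
    fix j
    show "hinner (Ns j) (u j) (y j) = hinner (Ms j) (x j) (p j)" by (rule A.R.adjoint[OF 1(1) 2(1)])
    show "hinner (Ns j) (v (j + e)) (y j) = g (j + e)"
    proof -
      have "c (j + e) (x (j + e)) = Some (v (j + e))" by (rule 1(2))
      then have "op_adjoint (Ns j) (Ms (j + e)) (d (j + e)) (x (j + e)) = Some (v (j + e))" by simp
      from B.R.adjoint'[OF 2(2) this] show ?thesis by (simp add: g_def)
    qed
  qed
  also have "\<dots> = (\<Sum>j\<in>I. hinner (Ms j) (x j) (p j)) + (\<Sum>j\<in>I. g j)"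
    unfolding sum.distrib
  proof (rule arg_cong2[of _ _ _ _ "(+)"])
    show "(\<Sum>j\<in>?J. hinner (Ms j) (x j) (p j)) = (\<Sum>j\<in>I. hinner (Ms j) (x j) (p j))"
      by (rule sum.mono_neutral_right[OF J]) (use out y(2) in blast)
    have "(\<Sum>j\<in>?J. g (j + e)) = (\<Sum>j\<in>(\<lambda>j. j + e) ` ?J. g j)" by (subst sum.reindex) (auto simp: inj_on_def)
    also have "\<dots> = (\<Sum>j\<in>I. g j)"
    proof (rule sum.mono_neutral_right)
      show "finite ((\<lambda>j. j + e) ` ?J)" using J by blast
      show "I \<subseteq> (\<lambda>j. j + e) ` ?J"
      proof
        fix i assume "i \<in> I"
        then have "i - e \<in> ?J" by blast
        then show "i \<in> (\<lambda>j. j + e) ` ?J" by (rule rev_image_eqI) simp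
      qed
      show "\<forall>j\<in>(\<lambda>j. j + e) ` ?J - I. g j = 0" unfolding g_def using out q by blast
    qed
    finally show "(\<Sum>j\<in>?J. g (j + e)) = (\<Sum>j\<in>I. g j)" .
  qed
  also have "\<dots> = hinner M.S x w"
    using x(1) y q by (subst M.inner_eq[OF S(1,4)]) (simp add: 2(3) g_def sum.distrib)
  finally show ?thesis .
qed

text \<open>
  \<open>D\<^sup>* D\<close> contains the sum of the Laplace operators, so \<open>1 + D\<^sup>* D\<close> is onto because each \<open>1 + \<Delta>\<close> is.
\<close>

lemma onto_D: "resolvent_onto M.S D D'"
  unfolding resolvent_onto_def
proof
  fix z assume z: "z \<in> hcarrier M.S"
  define x where "x j = A.K j (z j)" for j
  have zc: "z j \<in> hcarrier (Ms j)" for j by (rule M.component[OF z])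
  have xc: "x j \<in> hcarrier (Ms j)" for j unfolding x_def by (rule A.K_closed[OF zc])
  have "A.\<Delta> j (x j) = Some (hsub (Ms j) (z j) (x j))" for j unfolding x_def by (rule A.\<Delta>_K[OF zc])
  then have "\<exists>u p v q. a j (x j) = Some u \<and> a' j u = Some p \<and> c j (x j) = Some v \<and> d j v = Some q \<and>
    hsub (Ms j) (z j) (x j) = hadd (Ms j) p q" for j unfolding A.\<Delta>_iff by blast
  then obtain u p v q where u: "\<And>j. a j (x j) = Some (u j)" "\<And>j. a' j (u j) = Some (p j)"
    and v: "\<And>j. c j (x j) = Some (v j)" "\<And>j. d j (v j) = Some (q j)"
    and pq: "\<And>j. hsub (Ms j) (z j) (x j) = hadd (Ms j) (p j) (q j)" by metis
  define y where "y j = hadd (Ns j) (u j) (v (j + e))" for j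
  have Dx: "D x = Some y" by (rule D_eq_Some[OF u(1) v(1)]) (simp add: y_def)
  have pc: "p j \<in> hcarrier (Ms j)" "q j \<in> hcarrier (Ms j)" for j using A.R.s(2)[OF u(2)] A.P.t(2)[OF v(2)] by auto
  have v': "op_adjoint (Ns j) (Ms (j + e)) (d (j + e)) (x (j + e)) = Some (v (j + e))" for j
    using v(1)[of "j + e"] by simp
  have "a' j (y j) = Some (hadd (Ms j) (p j) (hzero (Ms j)))" for j
    unfolding y_def by (rule A.R.s(3)[OF u(2) B.r'_p'[OF v']])
  then have a'y: "a' j (y j) = Some (p j)" for j using pc by (simp add: M.M.add_zero)
  have "d (j + e) (y j) = Some (hadd (Ms (j + e)) (hzero (Ms (j + e))) (q (j + e)))" for j
    unfolding y_def by (rule B.R.t(3)[OF B.p_r[OF u(1)] v(2)])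
  then have dy: "d (j + e) (y j) = Some (q (j + e))" for j
    using pc by (simp add: M.M.add_commute[of "hzero (Ms (j + e))"] M.M.add_zero)
  have yc: "y \<in> hcarrier N.S" using A.R.s(1)[OF a'y] by (simp add: N.carrier_iff)
  have "D' y = Some (\<lambda>j. hadd (Ms j) (p j) (q (j - e + e)))"
    unfolding D'_iff using yc a'y dy by (intro conjI exI[of _ p] exI[of _ "\<lambda>j. q (j + e)"]) simp_all
  moreover have "(\<lambda>j. hadd (Ms j) (p j) (q (j - e + e))) = hsub M.S z x" by (simp add: M.operations pq)
  ultimately have "D' y = Some (hsub M.S z x)" by simp
  then show "\<exists>x y. x \<in> hcarrier M.S \<and> D x = Some y \<and> D' y = Some (hsub M.S z x)"
    using Dx D_components(5)[OF u(1) v(1)] by blast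
qed

lemma adjoint_D: "op_adjoint M.S N.S D = D'"
  and regular_D: "regular_operator M.S N.S D"
proof -
  interpret dual: dirac_family Ns Ms I a' "\<lambda>j. c (j + e)" "- e" by (rule dual)
  note regular = regular_of_resolvent_onto[OF M.S.hilbert_module_axioms N.S.hilbert_module_axioms
      module_operator_D dense_dom_D dual.module_operator_D[unfolded dual_D] dual.dense_dom_D[unfolded dual_D]
      _ onto_D dual.onto_D[unfolded dual_D dual_D']]
  show "op_adjoint M.S N.S D = D'" "regular_operator M.S N.S D"
    by (rule regular; use formal in blast)+
qed

text \<open>
  The two summands of each component of \<open>D x\<close> are orthogonal, so both vanish if the component does.
\<close>

lemma ker_D: "x \<in> op_ker N.S D \<longleftrightarrow> (\<forall>j. x j \<in> A.H j)"
proof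
  assume "x \<in> op_ker N.S D"
  then have "D x = Some (hzero N.S)" by (simp add: op_ker_def)
  then obtain u v where 1: "\<And>j. a j (x j) = Some (u j)" "\<And>j. c j (x j) = Some (v j)"
    "hzero N.S = (\<lambda>j. hadd (Ns j) (u j) (v (j + e)))" unfolding D_iff by blast
  note comp = D_components[OF 1(1,2)]
  have zero: "u j = hzero (Ns j) \<and> v (j + e) = hzero (Ns j)" for j
  proof -
    have v': "op_adjoint (Ns j) (Ms (j + e)) (d (j + e)) (x (j + e)) = Some (v (j + e))"
      using 1(2)[of "j + e"] by simp
    have "hinner (Ns j) (u j) (v (j + e)) = 0"
      using A.R.adjoint[OF 1(1) B.r'_p'[OF v']] comp(1)[of j] by simp
    note le = N.M.orthogonal_norm_le[OF comp(2) comp(4) this]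
    have "hadd (Ns j) (u j) (v (j + e)) = hzero (Ns j)"
      using fun_cong[OF 1(3), of j] by (simp add: N.operations)
    then have "hnorm (Ns j) (u j) \<le> 0" "hnorm (Ns j) (v (j + e)) \<le> 0" using le by simp_all
    then have "hnorm (Ns j) (u j) = 0" "hnorm (Ns j) (v (j + e)) = 0"
      using N.M.hnorm_nonneg[of j "u j"] N.M.hnorm_nonneg[of j "v (j + e)"] by simp_all
    then show ?thesis using N.M.hnorm_eq_zero_iff comp(2,4) by blast
  qed
  have "v j = hzero (Ns (j - e))" for j using zero[of "j - e"] by simp
  then show "\<forall>j. x j \<in> A.H j" unfolding A.in_H using 1(1,2) zero by simp
next
  assume "\<forall>j. x j \<in> A.H j"
  then have 1: "a j (x j) = Some (hzero (Ns j))" "c j (x j) = Some (hzero (Ns (j - e)))" for j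
    unfolding A.in_H by auto
  have "D x = Some (hzero N.S)" by (rule D_eq_Some[OF 1]) (simp add: N.operations N.M.add_zero)
  then show "x \<in> op_ker N.S D" by (simp add: op_ker_def)
qed

text \<open>
  A vector of one summand is decomposed in the direct sum; its component of degree \<open>j\<close> is used.
\<close>

lemma hodge_of_spans:
  assumes spans: "spans M.S (op_ker N.S D) (hclosure M.S (ran D'))"
  shows "A.hodge j"
  unfolding A.hodge_def
proof
  fix x assume x: "x \<in> hcarrier (Ms j)"
  let ?X = "\<lambda>i. if i = j then x else hzero (Ms i)"
  have "?X \<in> hcarrier M.S" using x by (simp add: M.carrier_iff)
  then obtain h w where hw: "h \<in> op_ker N.S D" "w \<in> hclosure M.S (ran D')" "?X = hadd M.S h w"
    using spans unfolding spans_def by blast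
  have h: "h j \<in> A.H j" using hw(1) ker_D by blast
  have w: "w \<in> hcarrier M.S" using hw(2) M.S.hclosure_subset by blast
  have ran: "ran D' \<subseteq> hcarrier M.S"
    using module_operatorD(2)[OF N.S.hilbert_module_axioms M.S.hilbert_module_axioms
        dirac_family.module_operator_D[OF dual, unfolded dual_D]] by (auto simp: ran_def)
  define T where "T = (\<lambda>w. w j) ` ran D'"
  have T: "T \<subseteq> {hadd (Ms j) y z |y z. y \<in> ran (a' j) \<and> z \<in> ran (d j)}"
  proof
    fix y assume "y \<in> T"
    then obtain z w where "D' z = Some w" "y = w j" by (auto simp: T_def ran_def)
    then obtain p q where "a' j (z j) = Some (p j)" "d (j - e + e) (z (j - e)) = Some (q (j - e))"
      "y = hadd (Ms j) (p j) (q (j - e))" unfolding D'_iff by metis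
    then show "y \<in> {hadd (Ms j) y z |y z. y \<in> ran (a' j) \<and> z \<in> ran (d j)}" by (auto intro: ranI)
  qed
  have Tc: "T \<subseteq> hcarrier (Ms j)" using ran M.component by (auto simp: T_def)
  have "w j \<in> hclosure (Ms j) T"
    unfolding M.M.hclosure_iff[OF Tc]
  proof (intro conjI allI impI M.component[OF w])
    fix \<epsilon> :: real assume "\<epsilon> > 0"
    then obtain y where y: "y \<in> ran D'" "hnorm M.S (hsub M.S w y) < \<epsilon>"
      using hw(2) unfolding M.S.hclosure_iff[OF ran] by blast
    have "hnorm (Ms j) (hsub M.S w y j) \<le> hnorm M.S (hsub M.S w y)"
      using y ran w by (intro M.hnorm_component M.sub_closed) auto
    then show "\<exists>z\<in>T. hnorm (Ms j) (hsub (Ms j) (w j) z) < \<epsilon>"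
      using y unfolding T_def by (intro bexI[of _ "y j"]) (auto simp: M.operations)
  qed
  from A.hodge_of_hclosure_sum[OF this T]
  obtain v w' where vw: "v \<in> A.V j" "w' \<in> A.W j" "w j = hadd (Ms j) v w'" by blast
  have "x = hadd (Ms j) (h j) (w j)" using fun_cong[OF hw(3), of j] by (simp add: M.operations)
  also have "\<dots> = hadd (Ms j) (hadd (Ms j) (h j) v) w'"
    unfolding vw(3) using M.M.hsubmoduleD(2)[OF A.submodules(1) h] A.V_closed[OF vw(1)] A.W_closed[OF vw(2)]
    by (rule M.M.add_assoc[symmetric])
  finally show "\<exists>h\<in>A.H j. \<exists>v\<in>A.V j. \<exists>w\<in>A.W j. x = hadd (Ms j) (hadd (Ms j) h v) w" using h vw by blast
qed

text \<open>
  An element of \<open>V\<close> in degree \<open>j\<close> is approximated by some \<open>a\<^sup>* y\<close>, where by the decomposition of \<open>N\<^sub>j\<close>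
  one may assume \<open>d y = 0\<close>, so that \<open>a\<^sup>* y\<close> is a value of \<open>D'\<close>. The same holds for \<open>W\<close>.
\<close>

lemma spans_of_hodge:
  assumes hM: "\<And>j. A.hodge j" and hN: "\<And>j. B.hodge j"
  shows "spans M.S (op_ker N.S D) (hclosure M.S (ran D'))"
  unfolding spans_def
proof
  fix x assume x: "x \<in> hcarrier M.S"
  have "\<exists>h v w. h \<in> A.H j \<and> v \<in> A.V j \<and> w \<in> A.W j \<and> x j = hadd (Ms j) (hadd (Ms j) h v) w" for j
    using hM[of j] M.component[OF x, of j] unfolding A.hodge_def by blast
  then obtain h v w where hvw: "\<And>j. h j \<in> A.H j" "\<And>j. v j \<in> A.V j" "\<And>j. w j \<in> A.W j"
    "\<And>j. x j = hadd (Ms j) (hadd (Ms j) (h j) (v j)) (w j)" by metis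
  have c: "h j \<in> hcarrier (Ms j)" "v j \<in> hcarrier (Ms j)" "w j \<in> hcarrier (Ms j)" for j
    using M.M.hsubmoduleD(2)[OF A.submodules(1) hvw(1)] A.V_closed[OF hvw(2)] A.W_closed[OF hvw(3)] by auto
  define r where "r j = hadd (Ms j) (v j) (w j)" for j
  have r: "r \<in> hcarrier M.S" using c by (simp add: M.carrier_iff r_def)
  have ran: "ran D' \<subseteq> hcarrier M.S"
    using module_operatorD(2)[OF N.S.hilbert_module_axioms M.S.hilbert_module_axioms
        dirac_family.module_operator_D[OF dual, unfolded dual_D]] by (auto simp: ran_def)
  have "r \<in> hclosure M.S (ran D')"
    unfolding M.S.hclosure_iff[OF ran]
  proof (intro conjI allI impI r)
    fix \<epsilon> :: real assume \<epsilon>: "\<epsilon> > 0"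
    obtain \<delta> where \<delta>: "\<delta> > 0" "\<And>y. y \<in> hcarrier M.S \<Longrightarrow> (\<And>i. hnorm (Ms i) (hsub (Ms i) (r i) (y i)) < \<delta>)
      \<Longrightarrow> hnorm M.S (hsub M.S r y) < \<epsilon>" using M.approximate_components[OF r \<epsilon>] by blast
    have "\<exists>y p. a' j y = Some p \<and> d (j + e) y = Some (hzero (Ms (j + e))) \<and>
        hnorm (Ms j) (hsub (Ms j) (v j) p) < \<delta> / 2" for j
    proof -
      obtain p where p: "p \<in> ran (a' j)" "hnorm (Ms j) (hsub (Ms j) (v j) p) < \<delta> / 2"
        using hvw(2)[of j] \<delta>(1) unfolding M.M.hclosure_iff[OF A.ran_subsets(1)] by (meson half_gt_zero)
      then obtain y where "a' j y = Some p" by (auto simp: ran_def)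
      then show ?thesis using B.hodge_component_W[OF hN] p(2) by metis
    qed
    then obtain y p where y: "\<And>j. a' j (y j) = Some (p j)" "\<And>j. d (j + e) (y j) = Some (hzero (Ms (j + e)))"
      "\<And>j. hnorm (Ms j) (hsub (Ms j) (v j) (p j)) < \<delta> / 2" by metis
    have "\<exists>y q. d (j + e) y = Some q \<and> a' j y = Some (hzero (Ms j)) \<and>
        hnorm (Ms (j + e)) (hsub (Ms (j + e)) (w (j + e)) q) < \<delta> / 2" for j
    proof -
      obtain q where q: "q \<in> ran (d (j + e))" "hnorm (Ms (j + e)) (hsub (Ms (j + e)) (w (j + e)) q) < \<delta> / 2"
        using hvw(3)[of "j + e"] \<delta>(1) unfolding M.M.hclosure_iff[OF A.ran_subsets(2)] by (meson half_gt_zero)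
      then obtain y where "d (j + e) y = Some q" by (auto simp: ran_def)
      then show ?thesis using B.hodge_component_V[OF hN] q(2) by metis
    qed
    then obtain y' q where y': "\<And>j. d (j + e) (y' j) = Some (q j)" "\<And>j. a' j (y' j) = Some (hzero (Ms j))"
      "\<And>j. hnorm (Ms (j + e)) (hsub (Ms (j + e)) (w (j + e)) (q j)) < \<delta> / 2" by metis
    have pq: "p j \<in> hcarrier (Ms j)" "q (j - e) \<in> hcarrier (Ms j)" for j
      using A.R.s(2)[OF y(1)] B.R.t(2)[OF y'(1)[of "j - e"]] by simp_all
    define z where "z j = hadd (Ms j) (p j) (q (j - e))" for j
    have z: "z \<in> hcarrier M.S" using pq by (simp add: M.carrier_iff z_def)
    let ?y = "\<lambda>j. hadd (Ns j) (y j) (y' j)"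
    have "a' j (?y j) = Some (hadd (Ms j) (p j) (hzero (Ms j)))" for j by (rule A.R.s(3)[OF y(1) y'(2)])
    then have 1: "a' j (?y j) = Some (p j)" for j using pq by (simp add: M.M.add_zero)
    have "d (j + e) (?y j) = Some (hadd (Ms (j + e)) (hzero (Ms (j + e))) (q j))" for j
      by (rule B.R.t(3)[OF y(2) y'(1)])
    moreover have "hadd (Ms (j + e)) (hzero (Ms (j + e))) (q j) = q j" for j
      using pq(2)[of "j + e"] by (simp add: M.M.add_commute[of "hzero (Ms (j + e))"] M.M.add_zero)
    ultimately have 2: "d (j + e) (?y j) = Some (q j)" for j by simp
    have "?y \<in> hcarrier N.S" using A.R.s(1)[OF 1] by (simp add: N.carrier_iff)
    then have D'y: "D' ?y = Some z"
      unfolding D'_iff using 1 2 by (intro conjI exI[of _ p] exI[of _ q]) (auto simp: z_def)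
    have "hnorm (Ms j) (hsub (Ms j) (r j) (z j)) < \<delta>" for j
    proof -
      have "hsub (Ms j) (r j) (z j) = hadd (Ms j) (hsub (Ms j) (v j) (p j)) (hsub (Ms j) (w j) (q (j - e)))"
        unfolding r_def z_def using c[of j] pq[of j] by (intro M.M.inner_ext[where i=j]) auto
      then have "hnorm (Ms j) (hsub (Ms j) (r j) (z j))
          \<le> hnorm (Ms j) (hsub (Ms j) (v j) (p j)) + hnorm (Ms j) (hsub (Ms j) (w j) (q (j - e)))"
        using c[of j] pq[of j] by (simp add: M.M.hnorm_triangle)
      then show ?thesis using y(3)[of j] y'(3)[of "j - e"] by simp
    qed
    then have "hnorm M.S (hsub M.S r z) < \<epsilon>" by (rule \<delta>(2)[OF z])
    then show "\<exists>z\<in>ran D'. hnorm M.S (hsub M.S r z) < \<epsilon>" using D'y by (blast intro: ranI)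
  qed
  moreover have "h \<in> op_ker N.S D" using hvw(1) ker_D by blast
  moreover have "x = hadd M.S h r"
  proof
    show "x j = hadd M.S h r j" for j
      unfolding M.operations r_def hvw(4) using c[of j] by (rule M.M.add_assoc)
  qed
  ultimately show "\<exists>u\<in>op_ker N.S D. \<exists>v\<in>hclosure M.S (ran D'). x = hadd M.S u v" by blast
qed

theorem polar_decomposable_D_iff:
  "polar_decomposable M.S N.S D \<longleftrightarrow> (\<forall>j. A.hodge j) \<and> (\<forall>j. B.hodge j)"
proof -
  interpret D: regular_op M.S N.S D by unfold_locales (rule regular_D)
  interpret dual: dirac_family Ns Ms I a' "\<lambda>j. c (j + e)" "- e" by (rule dual)
  have hodge_N: "dual.A.hodge j \<longleftrightarrow> B.hodge j" for j using B.dual_hodge[of j] by simp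
  have hodge_M: "dual.B.hodge j \<longleftrightarrow> A.hodge j" for j using A.dual_hodge[of j] by simp
  have "polar_decomposable M.S N.S D \<longleftrightarrow> spans M.S (op_ker N.S D) (hclosure M.S (ran D')) \<and>
      spans N.S (op_ker M.S D') (hclosure N.S (ran D))"
    unfolding D.polar_decomposable_iff adjoint_D by simp
  also have "\<dots> \<longleftrightarrow> (\<forall>j. A.hodge j) \<and> (\<forall>j. B.hodge j)"
    using hodge_of_spans spans_of_hodge dual.hodge_of_spans[unfolded dual_D dual_D' hodge_N]
      dual.spans_of_hodge[unfolded dual_D dual_D' hodge_N hodge_M] by blast
  finally show ?thesis .
qed

end


section \<open>The four conditions\<close>

text \<open>
  The equations for \<open>k\<close> and \<open>l\<close> leave open in which of several equal forms the indices are written.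
\<close>

lemma hilbert_complex_two_step:
  assumes "hilbert_complex E t" "i + 1 = k" "l = k + 1"
  shows "two_step (E i) (E k) (E l) (t i) (t k)"
proof -
  have regular: "regular_op (E j) (E (j + 1)) (t j)" for j
    using assms(1) unfolding hilbert_complex_def regular_op_def regular_op_axioms_def by blast
  have "ran (t i) \<subseteq> op_ker (E (i + 2)) (t (i + 1))" using assms(1) unfolding hilbert_complex_def by blast
  moreover have "i + 2 = l" using assms(2,3) by simp
  ultimately have "ran (t i) \<subseteq> op_ker (E l) (t k)" using assms(2) by simp
  then show ?thesis
    using regular[of i] regular[of k] assms(2,3) unfolding two_step_def two_step_axioms_def by simp
qed

lemma even_dirac_polar_decomposable_iff:
  assumes "hilbert_complex E t" "finite_length E"
  shows "polar_decomposable (even_module E) (odd_module E) (even_dirac E t) \<longleftrightarrow>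
    (\<forall>k. two_step.hodge (E (k - 1)) (E k) (E (k + 1)) (t (k - 1)) (t k))"
proof -
  let ?hodge = "\<lambda>k. two_step.hodge (E (k - 1)) (E k) (E (k + 1)) (t (k - 1)) (t k)"
  obtain n where n: "\<And>k. \<bar>k\<bar> > n \<Longrightarrow> hcarrier (E k) = {hzero (E k)}"
    using assms(2) unfolding finite_length_def by blast
  define I where "I = {- \<bar>n\<bar> - 1..\<bar>n\<bar> + 1}"
  have module: "hilbert_module (E k)" for k using assms(1) unfolding hilbert_complex_def by blast
  interpret dirac_family "\<lambda>k. E (2 * k)" "\<lambda>k. E (2 * k + 1)" I "\<lambda>k. t (2 * k)" "\<lambda>k. t (2 * k - 1)" 1
  proof (intro dirac_family.intro finite_family.intro dirac_family_axioms.intro module)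
    show "finite I" "finite I" by (simp_all add: I_def)
    fix j
    show "hcarrier (E (2 * j)) = {hzero (E (2 * j))}" "hcarrier (E (2 * j + 1)) = {hzero (E (2 * j + 1))}"
      if "j \<notin> I"
      using that unfolding I_def by (auto intro!: n)
    show "two_step (E (2 * (j - 1) + 1)) (E (2 * j)) (E (2 * j + 1)) (t (2 * j - 1)) (t (2 * j))"
      using hilbert_complex_two_step[OF assms(1), of "2 * j - 1" "2 * j" "2 * j + 1"] by (simp add: algebra_simps)
    show "two_step (E (2 * j)) (E (2 * j + 1)) (E (2 * (j + 1))) (t (2 * j)) (t (2 * (j + 1) - 1))"
      using hilbert_complex_two_step[OF assms(1), of "2 * j" "2 * j + 1" "2 * j + 2"] by (simp add: algebra_simps)
  qed
  have index: "2 * (j - 1) + 1 = 2 * j - 1" "2 * (j + 1) = 2 * j + 1 + 1" "2 * (j + 1) - 1 = 2 * j + 1"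
    "2 * j - 1 + 1 = 2 * j" "j + 1 - 1 = j" for j :: int
    by simp_all
  have "D = even_dirac E t"
    unfolding dirac_def even_dirac_def even_module_def by (simp only: index)
  moreover have "A.hodge j \<longleftrightarrow> ?hodge (2 * j)" "B.hodge j \<longleftrightarrow> ?hodge (2 * j + 1)" for j
    by (simp_all add: algebra_simps)
  ultimately have "polar_decomposable (even_module E) (odd_module E) (even_dirac E t) \<longleftrightarrow>
      (\<forall>j. ?hodge (2 * j)) \<and> (\<forall>j. ?hodge (2 * j + 1))"
    using polar_decomposable_D_iff unfolding even_module_def odd_module_def by simp
  also have "\<dots> \<longleftrightarrow> (\<forall>k. ?hodge k)" by (metis evenE oddE)
  finally show ?thesis .
qed

theorem theorem4p6:
  fixes E :: "int \<Rightarrow> ('a::cstar_algebra, 'e) hmodule"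
    and t :: "int \<Rightarrow> 'e \<rightharpoonup> 'e"
  assumes "hilbert_complex E t"
  shows "(weak_hodge_decomposition E t \<longleftrightarrow>
            (\<forall>k. polar_decomposable (E k) (E (k + 1)) (t k))) \<and>
         ((\<forall>k. polar_decomposable (E k) (E (k + 1)) (t k)) \<longleftrightarrow>
            (\<forall>k. polar_decomposable (E k) (E k) (laplacian E t k))) \<and>
         (finite_length E \<longrightarrow>
            (weak_hodge_decomposition E t \<longleftrightarrow>
              polar_decomposable (even_module E) (odd_module E) (even_dirac E t)))"
proof -
  interpret two_step "E (k - 1)" "E k" "E (k + 1)" "t (k - 1)" "t k" for k
    by (rule hilbert_complex_two_step[OF assms]) simp_all
  have adjoint: "differential_adjoint E t (k - 1) = p' k" for k by simp
  have i: "weak_hodge_decomposition E t \<longleftrightarrow> (\<forall>k. hodge k)"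
    unfolding weak_hodge_decomposition_def adjoint by (simp only: hodge_iff_orthogonal_sum3[symmetric])
  have "polar_decomposable (E k) (E (k + 1)) (t k) \<longleftrightarrow>
      spans (E k) (op_ker (E (k + 1)) (t k)) (V k) \<and> spans (E (k + 1)) (op_ker (E (k + 1 - 1)) (p' (k + 1))) (W (k + 1))" for k
    using R.polar_decomposable_iff[of k] by simp
  moreover have "(\<forall>k. spans (E (k + 1)) (op_ker (E (k + 1 - 1)) (p' (k + 1))) (W (k + 1))) \<longleftrightarrow>
      (\<forall>k. spans (E k) (op_ker (E (k - 1)) (p' k)) (W k))"
    by (metis diff_add_cancel)
  ultimately have ii: "(\<forall>k. polar_decomposable (E k) (E (k + 1)) (t k)) \<longleftrightarrow> (\<forall>k. hodge k)"
    unfolding hodge_iff_spans by blast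
  have "laplacian E t k = \<Delta> k" for k unfolding laplacian_def adjoint \<Delta>_def by simp
  then have iii: "(\<forall>k. polar_decomposable (E k) (E k) (laplacian E t k)) \<longleftrightarrow> (\<forall>k. hodge k)"
    by (simp add: polar_decomposable_\<Delta>_iff)
  show ?thesis unfolding i ii iii using even_dirac_polar_decomposable_iff[OF assms] by blast
qed

end
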